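(* Let $(G,o)$ be an ergodic unimodular random graph and $\mathcal{B}$ its associated Bernoulli graphing. Then $\rho(G,o)=\rho_R(\mathcal{B})$, where $\rho_R(\mathcal B)$ is the spectral radius of the restriction of the Markov operator $\mathcal{M}$ of $\mathcal{B}$ to the random subspace $R$.
   Context: All graphs have vertex degrees bounded by a fixed $D\in\mathbb{N}$ and no isolated vertices. $\mathbb{G}_\bullet$ is the standard Borel space of isomorphism classes of connected rooted graphs $(G,o)$; $\mathbb{G}_{\bullet\bullet}$ is the space of isomorphism classes of connected doubly rooted graphs $(G,o,o')$; $\mathbb{G}_\bullet^+$ is the space of isomorphism classes of connected rooted graphs $(G,\xi,o)$ with a vertex labelling $\xi: V(G)\to[0,1]$ (isomorphisms preserve roots and labels). A unimodular random graph is a random element $(G,o)$ of $\mathbb{G}_\bullet$, with law $\nu$, satisfying the Mass Transport Principle: for every Borel $f:\mathbb{G}_{\bullet\bullet}\to\mathbb{R}_{\ge 0}$, $\int \sum_{o'\in V(G)} f(G,o',o)\,d\nu(G,o) = \int \sum_{o'\in V(G)} f(G,o,o')\,d\nu(G,o)$. It is ergodic if every Borel $U\subseteq\mathbb{G}_\bullet$ that is rerooting invariant ($(G,o)\in U$ implies $(G,o')\in U$ for all $o'\in V(G)$) has $\nu(U)\in\{0,1\}$. For a connected graph $G$, $\ell^2(G,\deg)$ is the Hilbert space of functions on $V(G)$ with inner product $\langle f,g\rangle=\sum_u f(u)\overline{g(u)}\deg(u)$, and $M_G$ is the self-adjoint Markov operator $(M_Gf)(u)=\frac{1}{\deg(u)}\sum_{(u,v)\in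 E(G)}f(v)$. Put $\rho(G,o)=\sup\{|\lambda| : \lambda\in\sigma(M_G)\}$; this does not depend on the root, so it is almost surely constant when $(G,o)$ is ergodic. The Bernoulli graphing of $(G,o)$ is the triple $(\mathcal{B},\mathbb{G}_\bullet^+,\mu)$, where $\mathcal B$ is the Borel graph on $\mathbb{G}_\bullet^+$ with an edge between $(G,\xi,o)$ and $(H,\eta,p)$ iff there is a neighbour $o'$ of $o$ in $G$ with $(G,\xi,o')\cong(H,\eta,p)$, and $\mu$ is given by $\int f\,d\mu=\int_{\mathbb{G}_\bullet}\int_{[0,1]^{V(G)}} f(G,\xi,o)\,d\beta_G(\xi)\,d\nu(G,o)$ with $\beta_G=\mathrm{Leb}^{\otimes V(G)}$. The degree-biased measure $\mu^*$ is given by $\int f\,d\mu^*=\int f\deg\,d\mu/\int\deg\,d\mu$, and $\nu^*$ is defined from $\nu$ in the same way using $\deg_G(o)$. The Markov operator $\mathcal{M}$ of $\mathcal{B}$ is the self-adjoint operator on $L^2(\mathbb{G}_\bullet^+,\mu^* )$ with $(\mathcal{M}f)(x)=\frac{1}{\deg(x)}\sum_{(x,y)\in\mathcal{B}} f(y)$. Let $s:\mathbb{G}_\bullet^+\to\mathbb{G}_\bullet$, $s(G,\xi,o)=(G,o)$, and let $\iota:L^2(\mathbb{G}_\bullet,\nu^* )\to L^2(\mathbb{G}_\bullet^+,\mu^* )$ be the isometric embedding $\iota f=f\circ s$. The structured subspace is $S=\mathrm{Ran}(\iota)$ and the random subspace is $R=S^\perp$. Both are $\mathcal{M}$-invariant.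 *)

theory Defs
  imports "HOL-Probability.Probability"
begin

section \<open>Square-integrable functions and spectra\<close>

text \<open>
  The Hilbert space \<open>L\<^sup>2(M)\<close> is handled through representatives: its elements are functions
  in \<open>L2 M\<close>, and two of them are the same vector iff they agree almost everywhere.
\<close>

definition L2 :: "'a measure \<Rightarrow> ('a \<Rightarrow> complex) set" where
  "L2 M = {f \<in> borel_measurable M. integrable M (\<lambda>x. (cmod (f x))\<^sup>2)}"

definition L2_inner :: "'a measure \<Rightarrow> ('a \<Rightarrow> complex) \<Rightarrow> ('a \<Rightarrow> complex) \<Rightarrow> complex" where
  "L2_inner M f g = (\<integral>x. f x * cnj (g x) \<partial>M)"

definition L2_norm :: "'a measure \<Rightarrow> ('a \<Rightarrow> complex) \<Rightarrow> real" where
  "L2_norm M f = sqrt (\<integral>x. (cmod (f x))\<^sup>2 \<partial>M)"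

definition L2_orthogonal :: "'a measure \<Rightarrow> ('a \<Rightarrow> complex) set \<Rightarrow> ('a \<Rightarrow> complex) set" where
  "L2_orthogonal M H = {f \<in> L2 M. \<forall>g\<in>H. L2_inner M f g = 0}"

text \<open>
  In the next two definitions \<open>H \<subseteq> L2 M\<close> is a linear subspace that is closed in norm and under
  almost everywhere equality, that is, a closed subspace of \<open>L\<^sup>2(M)\<close>.
\<close>

definition bounded_operator_on ::
    "'a measure \<Rightarrow> ('a \<Rightarrow> complex) set \<Rightarrow> (('a \<Rightarrow> complex) \<Rightarrow> ('a \<Rightarrow> complex)) \<Rightarrow> bool" where
  "bounded_operator_on M H A \<longleftrightarrow>
     (\<forall>f\<in>H. A f \<in> H) \<and>
     (\<forall>f\<in>H. \<forall>g\<in>H. AE x in M. A (\<lambda>y. f y + g y) x = A f x + A g x) \<and>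
     (\<forall>c. \<forall>f\<in>H. AE x in M. A (\<lambda>y. c * f y) x = c * A f x) \<and>
     (\<exists>C. \<forall>f\<in>H. L2_norm M (A f) \<le> C * L2_norm M f)"

definition spectrum_on ::
    "'a measure \<Rightarrow> ('a \<Rightarrow> complex) set \<Rightarrow> (('a \<Rightarrow> complex) \<Rightarrow> ('a \<Rightarrow> complex)) \<Rightarrow> complex set" where
  "spectrum_on M H T = {z. \<not> (\<exists>A. bounded_operator_on M H A \<and>
     (\<forall>f\<in>H. (AE x in M. A (\<lambda>y. T f y - z * f y) x = f x) \<and>
            (AE x in M. T (A f) x - z * A f x = f x)))}"

definition spectral_radius_on ::
    "'a measure \<Rightarrow> ('a \<Rightarrow> complex) set \<Rightarrow> (('a \<Rightarrow> complex) \<Rightarrow> ('a \<Rightarrow> complex)) \<Rightarrow> real" where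
  "spectral_radius_on M H T = (SUP z \<in> spectrum_on M H T. cmod z)"


section \<open>Graphs and Markov operators\<close>

text \<open>
  A graph is given by its symmetric edge relation. As there are no isolated vertices, its vertex
  set is the field of that relation. A connected graph of bounded degree is countable, so up to
  isomorphism its vertices are natural numbers. Graphs are simple.
\<close>

definition degree :: "'a rel \<Rightarrow> 'a \<Rightarrow> nat" where
  "degree E v = card (E `` {v})"

definition markov :: "'a rel \<Rightarrow> ('a \<Rightarrow> complex) \<Rightarrow> 'a \<Rightarrow> complex" where
  "markov E f u = (\<Sum>v \<in> E `` {u}. f v) / of_nat (degree E u)"

definition graphs :: "nat \<Rightarrow> nat rel set" where
  "graphs D = {E. sym E \<and> irrefl E \<and>
     (\<forall>v \<in> Field E. finite (E `` {v}) \<and> degree E v \<le> D) \<and>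
     (\<forall>u \<in> Field E. \<forall>v \<in> Field E. (u, v) \<in> E\<^sup>*)}"

definition graph_iso :: "(nat \<Rightarrow> nat) \<Rightarrow> nat rel \<Rightarrow> nat rel \<Rightarrow> bool" where
  "graph_iso \<phi> E F \<longleftrightarrow> bij_betw \<phi> (Field E) (Field F) \<and>
     (\<forall>u \<in> Field E. \<forall>v \<in> Field E. (u, v) \<in> E \<longleftrightarrow> (\<phi> u, \<phi> v) \<in> F)"

definition gball :: "nat rel \<Rightarrow> nat \<Rightarrow> nat \<Rightarrow> nat set" where
  "gball E r v = {w. \<exists>k\<le>r. (v, w) \<in> E ^^ k}"

definition ball_iso :: "(nat \<Rightarrow> nat) \<Rightarrow> nat \<Rightarrow> nat rel \<Rightarrow> nat \<Rightarrow> nat rel \<Rightarrow> nat \<Rightarrow> bool" where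
  "ball_iso \<phi> r E u F v \<longleftrightarrow> bij_betw \<phi> (gball E r u) (gball F r v) \<and> \<phi> u = v \<and>
     (\<forall>a \<in> gball E r u. \<forall>b \<in> gball E r u. (a, b) \<in> E \<longleftrightarrow> (\<phi> a, \<phi> b) \<in> F)"

text \<open>The space \<open>\<ell>\<^sup>2(G, deg)\<close> is \<open>L2\<close> of the degree-weighted counting measure on the vertices.\<close>

definition deg_measure :: "nat rel \<Rightarrow> nat measure" where
  "deg_measure E = point_measure (Field E) (\<lambda>v. ennreal (real (degree E v)))"

definition graph_spectral_radius :: "nat rel \<Rightarrow> real" where
  "graph_spectral_radius E = spectral_radius_on (deg_measure E) (L2 (deg_measure E)) (markov E)"


section \<open>Spaces of isomorphism classes\<close>

type_synonym rooted = "nat rel \<times> nat"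
type_synonym birooted = "nat rel \<times> nat \<times> nat"
type_synonym labelled = "nat rel \<times> (nat \<Rightarrow> real) \<times> nat"

definition rooted_graphs :: "nat \<Rightarrow> rooted set" where
  "rooted_graphs D = {(E, u). E \<in> graphs D \<and> u \<in> Field E}"

definition birooted_graphs :: "nat \<Rightarrow> birooted set" where
  "birooted_graphs D = {(E, u, u'). E \<in> graphs D \<and> u \<in> Field E \<and> u' \<in> Field E}"

definition labelled_graphs :: "nat \<Rightarrow> labelled set" where
  "labelled_graphs D = {(E, \<xi>, u). E \<in> graphs D \<and> \<xi> ` Field E \<subseteq> {0..1} \<and> u \<in> Field E}"

definition rooted_iso :: "nat \<Rightarrow> rooted rel" where
  "rooted_iso D = {((E, u), (F, v)). (E, u) \<in> rooted_graphs D \<and> (F, v) \<in> rooted_graphs D \<and>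
     (\<exists>\<phi>. graph_iso \<phi> E F \<and> \<phi> u = v)}"

definition birooted_iso :: "nat \<Rightarrow> birooted rel" where
  "birooted_iso D = {((E, u, u'), (F, v, v')).
     (E, u, u') \<in> birooted_graphs D \<and> (F, v, v') \<in> birooted_graphs D \<and>
     (\<exists>\<phi>. graph_iso \<phi> E F \<and> \<phi> u = v \<and> \<phi> u' = v')}"

definition labelled_iso :: "nat \<Rightarrow> labelled rel" where
  "labelled_iso D = {((E, \<xi>, u), (F, \<eta>, v)).
     (E, \<xi>, u) \<in> labelled_graphs D \<and> (F, \<eta>, v) \<in> labelled_graphs D \<and>
     (\<exists>\<phi>. graph_iso \<phi> E F \<and> (\<forall>w \<in> Field E. \<eta> (\<phi> w) = \<xi> w) \<and> \<phi> u = v)}"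

abbreviation rooted_class :: "nat \<Rightarrow> nat rel \<Rightarrow> nat \<Rightarrow> rooted set" where
  "rooted_class D E u \<equiv> rooted_iso D `` {(E, u)}"

abbreviation birooted_class :: "nat \<Rightarrow> nat rel \<Rightarrow> nat \<Rightarrow> nat \<Rightarrow> birooted set" where
  "birooted_class D E u u' \<equiv> birooted_iso D `` {(E, u, u')}"

abbreviation labelled_class :: "nat \<Rightarrow> nat rel \<Rightarrow> (nat \<Rightarrow> real) \<Rightarrow> nat \<Rightarrow> labelled set" where
  "labelled_class D E \<xi> u \<equiv> labelled_iso D `` {(E, \<xi>, u)}"

text \<open>
  The Borel structures are those of the usual local topologies. Basic open sets prescribe, up to
  isomorphism, the ball of some radius around the (first) root, together with the position of the
  second root in it, respectively with open conditions on the labels in it. These topologies are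
  second countable, so their Borel sets are generated by the basic open sets.
\<close>

definition rooted_space :: "nat \<Rightarrow> rooted set measure" where
  "rooted_space D = sigma (rooted_graphs D // rooted_iso D)
     {{rooted_class D F v |F v. (F, v) \<in> rooted_graphs D \<and> (\<exists>\<phi>. ball_iso \<phi> r E u F v)}
      |E u r. (E, u) \<in> rooted_graphs D}"

definition birooted_space :: "nat \<Rightarrow> birooted set measure" where
  "birooted_space D = sigma (birooted_graphs D // birooted_iso D)
     {{birooted_class D F v v' |F v v'. (F, v, v') \<in> birooted_graphs D \<and>
         (\<exists>\<phi>. ball_iso \<phi> r E u F v \<and> \<phi> u' = v')}
      |E u u' r. (E, u, u') \<in> birooted_graphs D \<and> u' \<in> gball E r u}"

definition labelled_space :: "nat \<Rightarrow> labelled set measure" where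
  "labelled_space D = sigma (labelled_graphs D // labelled_iso D)
     {{labelled_class D F \<eta> v |F \<eta> v. (F, \<eta>, v) \<in> labelled_graphs D \<and>
         (\<exists>\<phi>. ball_iso \<phi> r E u F v \<and> (\<forall>w \<in> gball E r u. \<eta> (\<phi> w) \<in> U w))}
      |E u r U. (E, u) \<in> rooted_graphs D \<and> (\<forall>w. open (U w))}"

text \<open>
  Functions of an isomorphism class are computed from a chosen representative; everything below
  is invariant under isomorphism, so the choice is immaterial.
\<close>

definition rep :: "'a set \<Rightarrow> 'a" where
  "rep x = (SOME g. g \<in> x)"

definition root_degree :: "rooted set \<Rightarrow> nat" where
  "root_degree x = (case rep x of (E, u) \<Rightarrow> degree E u)"

definition rho :: "rooted set \<Rightarrow> real" where
  "rho x = (case rep x of (E, u) \<Rightarrow> graph_spectral_radius E)"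

definition forget_labels :: "nat \<Rightarrow> labelled set \<Rightarrow> rooted set" where
  "forget_labels D x = (case rep x of (E, \<xi>, u) \<Rightarrow> rooted_class D E u)"


section \<open>Unimodular random graphs and Bernoulli graphings\<close>

definition unimodular :: "nat \<Rightarrow> rooted set measure \<Rightarrow> bool" where
  "unimodular D \<nu> \<longleftrightarrow> prob_space \<nu> \<and> sets \<nu> = sets (rooted_space D) \<and>
     (\<forall>f :: birooted set \<Rightarrow> real. f \<in> borel_measurable (birooted_space D) \<longrightarrow> (\<forall>y. 0 \<le> f y) \<longrightarrow>
       (\<integral>\<^sup>+x. (case rep x of (E, u) \<Rightarrow>
          \<integral>\<^sup>+u'. ennreal (f (birooted_class D E u' u)) \<partial>count_space (Field E)) \<partial>\<nu>) =
       (\<integral>\<^sup>+x. (case rep x of (E, u) \<Rightarrow>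
          \<integral>\<^sup>+u'. ennreal (f (birooted_class D E u u')) \<partial>count_space (Field E)) \<partial>\<nu>))"

definition rerooting_invariant :: "nat \<Rightarrow> rooted set set \<Rightarrow> bool" where
  "rerooting_invariant D U \<longleftrightarrow> (\<forall>(E, u) \<in> rooted_graphs D. \<forall>u' \<in> Field E.
     rooted_class D E u \<in> U \<longrightarrow> rooted_class D E u' \<in> U)"

definition ergodic :: "nat \<Rightarrow> rooted set measure \<Rightarrow> bool" where
  "ergodic D \<nu> \<longleftrightarrow> (\<forall>U \<in> sets (rooted_space D). rerooting_invariant D U \<longrightarrow>
     emeasure \<nu> U = 0 \<or> emeasure \<nu> U = 1)"

definition bernoulli_graph :: "nat \<Rightarrow> labelled set rel" where
  "bernoulli_graph D = {(labelled_class D E \<xi> u, labelled_class D E \<xi> u') |E \<xi> u u'.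
     (E, \<xi>, u) \<in> labelled_graphs D \<and> (u, u') \<in> E}"

definition label_measure :: "nat rel \<Rightarrow> (nat \<Rightarrow> real) measure" where
  "label_measure E = PiM (Field E) (\<lambda>_. restrict_space lborel {0..1})"

definition bernoulli_measure :: "nat \<Rightarrow> rooted set measure \<Rightarrow> labelled set measure" where
  "bernoulli_measure D \<nu> = \<nu> \<bind> (\<lambda>x. case rep x of (E, u) \<Rightarrow>
     distr (label_measure E) (labelled_space D) (\<lambda>\<xi>. labelled_class D E \<xi> u))"

definition biased :: "('a \<Rightarrow> nat) \<Rightarrow> 'a measure \<Rightarrow> 'a measure" where
  "biased d M = density M (\<lambda>x. of_nat (d x) / (\<integral>\<^sup>+y. of_nat (d y) \<partial>M))"

abbreviation nu_star :: "rooted set measure \<Rightarrow> rooted set measure" where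
  "nu_star \<nu> \<equiv> biased root_degree \<nu>"

abbreviation mu_star :: "nat \<Rightarrow> rooted set measure \<Rightarrow> labelled set measure" where
  "mu_star D \<nu> \<equiv> biased (degree (bernoulli_graph D)) (bernoulli_measure D \<nu>)"

definition structured_subspace :: "nat \<Rightarrow> rooted set measure \<Rightarrow> (labelled set \<Rightarrow> complex) set" where
  "structured_subspace D \<nu> = {f \<in> L2 (mu_star D \<nu>).
     \<exists>g \<in> L2 (nu_star \<nu>). AE x in mu_star D \<nu>. f x = g (forget_labels D x)}"

definition random_subspace :: "nat \<Rightarrow> rooted set measure \<Rightarrow> (labelled set \<Rightarrow> complex) set" where
  "random_subspace D \<nu> = L2_orthogonal (mu_star D \<nu>) (structured_subspace D \<nu>)"

definition rho_R :: "nat \<Rightarrow> rooted set measure \<Rightarrow> real" where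
  "rho_R D \<nu> = spectral_radius_on (mu_star D \<nu>) (random_subspace D \<nu>) (markov (bernoulli_graph D))"

end

theory Submission
  imports Defs
begin

text \<open>
  The norm of a symmetric contraction \<open>T\<close> is its spectral radius, because one of the two numbers
  \<open>\<plusminus>\<parallel>T\<parallel>\<close> lies in the spectrum. It can be recovered from the powers of \<open>T\<close> on any dense set of
  vectors: the sequence \<open>\<parallel>T\<^sup>n f\<parallel>\<close> is log-convex, so if it is \<open>O(c\<^sup>n)\<close>, with a constant that may
  depend on \<open>f\<close>, then \<open>\<parallel>T f\<parallel> \<le> c \<parallel>f\<parallel>\<close> (\<open>bounded_by_of_dense_growth\<close>). The theorem compares the
  growth of powers of two such operators, the Markov operator of the graph and that of the
  graphing on the random subspace, and in both cases the growth is that of one quantity, the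
  energy \<open>e\<^sub>n(G, o) = \<Sum>v. p\<^sub>n(o, v)\<^sup>2\<close> of the \<open>n\<close>-step transition probabilities of the simple
  random walk.

  For the graph, finitely supported functions are dense and the powers of the Markov operator on
  them are given by transition probabilities. Hence \<open>\<rho>(G, o) \<le> c\<close> holds iff \<open>e\<^sub>n(G, o) = O(c\<^bsup>2n\<^esup>)\<close>
  (\<open>graph_spectral_radius_le_iff\<close>).

  For the graphing, almost surely all labels are distinct. The component of \<open>(G, \<xi>, o)\<close> in the
  graphing is then a copy of \<open>G\<close>, and the \<open>n\<close>-th power of the Markov operator takes \<open>f\<close> to
  \<open>\<Sum>v. p\<^sub>n(o, v) f(G, \<xi>, v)\<close>. Let \<open>f\<close> be bounded, depend only on the labels in a ball of
  bounded radius around the root, and have mean zero given the unlabelled graph. Such functions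
  belong to the random subspace and are dense in it (\<open>zero_mean_local_dense\<close>). The variables
  \<open>f(G, \<xi>, v)\<close> and \<open>f(G, \<xi>, w)\<close> are uncorrelated unless \<open>v\<close> and \<open>w\<close> are close to each other, so
  that, given \<open>(G, o)\<close>, the sum has second moment at most a constant times \<open>e\<^sub>n(G, o)\<close>
  (\<open>label_square_le\<close>). If \<open>f\<close> is a fair coin, obtained by rounding the label of the root, the
  second moment is equal to \<open>e\<^sub>n(G, o)\<close> (\<open>label_square_coin\<close>).

  The coin shows that the mean of \<open>e\<^sub>n\<close> is \<open>O(r\<^bsup>2n\<^esup>)\<close>, where \<open>r = \<rho>\<^sub>R\<close>. For \<open>c > r\<close> the sum of
  \<open>e\<^sub>n / c\<^bsup>2n\<^esup>\<close> over \<open>n\<close> therefore has finite mean and is finite almost surely, which gives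
  \<open>\<rho>(G, o) \<le> c\<close> (\<open>rho_le_rho_R\<close>). Conversely, if \<open>\<rho>(G, o) \<le> c\<close> almost surely, then the powers of
  the Markov operator grow at most like \<open>c\<^sup>n\<close> on a dense subset of the random subspace, and
  \<open>\<rho>\<^sub>R \<le> c\<close> (\<open>rho_R_le\<close>). The event \<open>\<rho>(G, o) \<le> c\<close> is measurable, since \<open>e\<^sub>n\<close> is, and does not depend
  on the root. By ergodicity it has probability zero or one, so for \<open>c < \<rho>\<^sub>R\<close> it has probability
  zero (\<open>rho_ge_rho_R\<close>).

  The Markov operator of the graphing is symmetric because of the mass transport principle: send
  from \<open>u\<close> to each neighbour \<open>v\<close> the probability that \<open>(G, \<xi>, u)\<close> and \<open>(G, \<xi>, v)\<close> lie in two given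
  events (\<open>reversible_open_local\<close>). Statements about the space of labelled graphs are reduced to
  events that look at a ball of fixed radius and are open in its labels. These are stable under
  intersection and generate the Borel structure (\<open>sets_labelled_space\<close>).
\<close>

section \<open>The space of square-integrable functions\<close>

lemma borel_measurable_cnj [measurable (raw)]:
  "f \<in> borel_measurable M \<Longrightarrow> (\<lambda>x. cnj (f x)) \<in> borel_measurable M"
  by (rule borel_measurable_continuous_on[of cnj]) (auto intro: continuous_intros)

lemma L2_measurable [measurable_dest]: "f \<in> L2 M \<Longrightarrow> f \<in> borel_measurable M"
  by (simp add: L2_def)

lemma L2_integrable: "f \<in> L2 M \<Longrightarrow> integrable M (\<lambda>x. (cmod (f x))\<^sup>2)"
  by (simp add: L2_def)

lemma L2I_nn:
  assumes [measurable]: "f \<in> borel_measurable M"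
    and "(\<integral>\<^sup>+x. ennreal ((cmod (f x))\<^sup>2) \<partial>M) < \<infinity>"
  shows "f \<in> L2 M"
  using assms(2) by (auto simp: L2_def integrable_iff_bounded)

lemma L2_norm_nonneg [simp]: "0 \<le> L2_norm M f"
  by (simp add: L2_norm_def)

lemma L2_norm_power2: "(L2_norm M f)\<^sup>2 = (\<integral>x. (cmod (f x))\<^sup>2 \<partial>M)"
  by (simp add: L2_norm_def)

lemma L2_norm_nn:
  "f \<in> L2 M \<Longrightarrow> (\<integral>\<^sup>+x. ennreal ((cmod (f x))\<^sup>2) \<partial>M) = ennreal ((L2_norm M f)\<^sup>2)"
  by (simp add: L2_norm_power2 nn_integral_eq_integral L2_integrable)

lemma L2_norm_le_nn:
  assumes "f \<in> L2 M" "0 \<le> c" "(\<integral>\<^sup>+x. ennreal ((cmod (f x))\<^sup>2) \<partial>M) \<le> ennreal (c\<^sup>2)"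
  shows "L2_norm M f \<le> c"
proof -
  have "ennreal ((L2_norm M f)\<^sup>2) \<le> ennreal (c\<^sup>2)"
    using assms(1,3) by (simp add: L2_norm_nn)
  then have "(L2_norm M f)\<^sup>2 \<le> c\<^sup>2" by simp
  then show ?thesis using assms(2) by (rule power2_le_imp_le)
qed

lemma L2_bounded_nn:
  assumes "f \<in> borel_measurable M" "0 \<le> c" "(\<integral>\<^sup>+x. ennreal ((cmod (f x))\<^sup>2) \<partial>M) \<le> ennreal (c\<^sup>2)"
  shows "f \<in> L2 M" "L2_norm M f \<le> c"
proof -
  show "f \<in> L2 M"
    using assms by (intro L2I_nn) (auto simp: le_less_trans)
  then show "L2_norm M f \<le> c"
    using assms L2_norm_le_nn by blast
qed

lemma L2_zero [simp]: "(\<lambda>x. 0) \<in> L2 M"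
  by (simp add: L2_def)

lemma L2_norm_zero [simp]: "L2_norm M (\<lambda>x. 0) = 0"
  by (simp add: L2_norm_def)

lemma L2_scale: "f \<in> L2 M \<Longrightarrow> (\<lambda>x. c * f x) \<in> L2 M"
  by (auto simp: L2_def norm_mult power_mult_distrib)

lemma L2_norm_scale: "L2_norm M (\<lambda>x. c * f x) = cmod c * L2_norm M f"
  by (simp add: L2_norm_def norm_mult power_mult_distrib real_sqrt_mult)

lemma integrable_norm_mult_L2:
  assumes f: "f \<in> L2 M" and g: "g \<in> L2 M"
  shows "integrable M (\<lambda>x. cmod (f x) * cmod (g x))"
proof (rule Bochner_Integration.integrable_bound)
  show "integrable M (\<lambda>x. (cmod (f x))\<^sup>2 + (cmod (g x))\<^sup>2)"
    using f g by (simp add: L2_integrable)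
  show "AE x in M. norm (cmod (f x) * cmod (g x)) \<le> norm ((cmod (f x))\<^sup>2 + (cmod (g x))\<^sup>2)"
  proof (rule AE_I2)
    fix x
    have "0 \<le> (cmod (f x) - cmod (g x))\<^sup>2" by simp
    moreover have "0 \<le> (cmod (f x))\<^sup>2 + (cmod (g x))\<^sup>2" by simp
    moreover have "0 \<le> cmod (f x) * cmod (g x)" by simp
    ultimately show "norm (cmod (f x) * cmod (g x)) \<le> norm ((cmod (f x))\<^sup>2 + (cmod (g x))\<^sup>2)"
      unfolding power2_diff real_norm_def by linarith
  qed
qed (use f g in measurable)

lemma L2_add:
  assumes f: "f \<in> L2 M" and g: "g \<in> L2 M"
  shows "(\<lambda>x. f x + g x) \<in> L2 M"
proof -
  have [measurable]: "f \<in> borel_measurable M" "g \<in> borel_measurable M"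
    using f g by (auto simp: L2_measurable)
  have "integrable M (\<lambda>x. (cmod (f x + g x))\<^sup>2)"
  proof (rule Bochner_Integration.integrable_bound)
    show "integrable M (\<lambda>x. (cmod (f x))\<^sup>2 + 2 * (cmod (f x) * cmod (g x)) + (cmod (g x))\<^sup>2)"
      using integrable_norm_mult_L2[OF f g] L2_integrable[OF f] L2_integrable[OF g] by auto
    have "(cmod (f x + g x))\<^sup>2 \<le> (cmod (f x))\<^sup>2 + 2 * (cmod (f x) * cmod (g x)) + (cmod (g x))\<^sup>2" for x
      using power_mono[OF norm_triangle_ineq[of "f x" "g x"], of 2] by (simp add: power2_sum algebra_simps)
    then show "AE x in M. norm ((cmod (f x + g x))\<^sup>2) \<le>
        norm ((cmod (f x))\<^sup>2 + 2 * (cmod (f x) * cmod (g x)) + (cmod (g x))\<^sup>2)"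
      by (auto intro!: AE_I2 order_trans[OF _ abs_ge_self])
  qed measurable
  then show ?thesis by (simp add: L2_def)
qed

lemma L2_diff: "f \<in> L2 M \<Longrightarrow> g \<in> L2 M \<Longrightarrow> (\<lambda>x. f x - g x) \<in> L2 M"
  using L2_add[of f M "\<lambda>x. (-1) * g x"] L2_scale[of g M "-1"] by simp

lemma L2_sum: "(\<And>i. i \<in> I \<Longrightarrow> f i \<in> L2 M) \<Longrightarrow> (\<lambda>x. \<Sum>i\<in>I. f i x) \<in> L2 M"
  by (induction I rule: infinite_finite_induct) (auto intro: L2_add)

text \<open>
  The quadratic form \<open>\<integral> (s \<bar>f\<bar> - t \<bar>g\<bar>)\<^sup>2\<close> in \<open>s\<close> and \<open>t\<close> is nonnegative, so its discriminant is
  not positive.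
\<close>

lemma L2_norm_mult_integral:
  assumes f: "f \<in> L2 M" and g: "g \<in> L2 M"
  shows "(\<integral>x. cmod (f x) * cmod (g x) \<partial>M) \<le> L2_norm M f * L2_norm M g"
proof -
  define A where "A = (\<integral>x. (cmod (f x))\<^sup>2 \<partial>M)"
  define B where "B = (\<integral>x. cmod (f x) * cmod (g x) \<partial>M)"
  define C where "C = (\<integral>x. (cmod (g x))\<^sup>2 \<partial>M)"
  have quad: "0 \<le> s\<^sup>2 * A - 2 * s * t * B + t\<^sup>2 * C" for s t
  proof -
    have "0 \<le> (\<integral>x. (s * cmod (f x) - t * cmod (g x))\<^sup>2 \<partial>M)" by simp
    also have "\<dots> = (\<integral>x. s\<^sup>2 * (cmod (f x))\<^sup>2 - 2 * s * t * (cmod (f x) * cmod (g x)) + t\<^sup>2 * (cmod (g x))\<^sup>2 \<partial>M)"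
      by (intro Bochner_Integration.integral_cong) (auto simp: power2_eq_square algebra_simps)
    also have "\<dots> = s\<^sup>2 * A - 2 * s * t * B + t\<^sup>2 * C"
      using integrable_norm_mult_L2[OF f g] L2_integrable[OF f] L2_integrable[OF g]
      by (simp add: A_def B_def C_def)
    finally show ?thesis .
  qed
  have nn: "A \<ge> 0" "B \<ge> 0" "C \<ge> 0" by (auto simp: A_def B_def C_def)
  have "B\<^sup>2 \<le> A * C"
  proof (cases "C = 0")
    case True
    \<comment> \<open>For \<open>C = 0\<close> the form is affine in \<open>t\<close>; if \<open>B\<close> were nonzero, a large \<open>t\<close> would make it negative.\<close>
    have "B = 0"
    proof (rule ccontr)
      assume "B \<noteq> 0"
      then show False using quad[of 1 "(A + 1) / (2 * B)"] True nn by (simp add: field_simps)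
    qed
    then show ?thesis using nn by simp
  next
    case False
    then have "C > 0" using nn by simp
    \<comment> \<open>Up to scaling, the form is smallest at \<open>s = C\<close> and \<open>t = B\<close>.\<close>
    moreover have "0 \<le> C * (A * C - B\<^sup>2)"
      using quad[of C B] by (simp add: power2_eq_square algebra_simps)
    ultimately show ?thesis by (simp add: zero_le_mult_iff)
  qed
  then have "B \<le> sqrt (A * C)" by (simp add: real_le_rsqrt)
  then show ?thesis by (simp add: A_def B_def C_def L2_norm_def real_sqrt_mult)
qed

lemma L2_norm_triangle:
  assumes f: "f \<in> L2 M" and g: "g \<in> L2 M"
  shows "L2_norm M (\<lambda>x. f x + g x) \<le> L2_norm M f + L2_norm M g"
proof (rule power2_le_imp_le)
  have "(L2_norm M (\<lambda>x. f x + g x))\<^sup>2 = (\<integral>x. (cmod (f x + g x))\<^sup>2 \<partial>M)"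
    by (simp add: L2_norm_power2)
  also have "\<dots> \<le> (\<integral>x. (cmod (f x))\<^sup>2 + 2 * (cmod (f x) * cmod (g x)) + (cmod (g x))\<^sup>2 \<partial>M)"
  proof (rule integral_mono)
    show "integrable M (\<lambda>x. (cmod (f x + g x))\<^sup>2)"
      using L2_add[OF f g] by (rule L2_integrable)
    show "integrable M (\<lambda>x. (cmod (f x))\<^sup>2 + 2 * (cmod (f x) * cmod (g x)) + (cmod (g x))\<^sup>2)"
      using integrable_norm_mult_L2[OF f g] L2_integrable[OF f] L2_integrable[OF g] by auto
    show "(cmod (f x + g x))\<^sup>2 \<le> (cmod (f x))\<^sup>2 + 2 * (cmod (f x) * cmod (g x)) + (cmod (g x))\<^sup>2" for x
      using power_mono[OF norm_triangle_ineq[of "f x" "g x"], of 2] by (simp add: power2_sum algebra_simps)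
  qed
  also have "\<dots> = (L2_norm M f)\<^sup>2 + 2 * (\<integral>x. cmod (f x) * cmod (g x) \<partial>M) + (L2_norm M g)\<^sup>2"
    using integrable_norm_mult_L2[OF f g] L2_integrable[OF f] L2_integrable[OF g]
    by (simp add: L2_norm_power2)
  also have "\<dots> \<le> (L2_norm M f + L2_norm M g)\<^sup>2"
    using L2_norm_mult_integral[OF f g] by (simp add: power2_sum)
  finally show "(L2_norm M (\<lambda>x. f x + g x))\<^sup>2 \<le> (L2_norm M f + L2_norm M g)\<^sup>2" .
qed simp

lemma L2_norm_minus_commute: "L2_norm M (\<lambda>x. f x - g x) = L2_norm M (\<lambda>x. g x - f x)"
  by (simp add: L2_norm_def norm_minus_commute)

lemma L2_norm_triangle_diff:
  assumes "f \<in> L2 M" "g \<in> L2 M"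
  shows "L2_norm M f \<le> L2_norm M g + L2_norm M (\<lambda>x. g x - f x)"
  using L2_norm_triangle[OF assms(2) L2_diff[OF assms]] L2_norm_minus_commute[of M f g] by simp

lemma L2_norm_sum:
  "(\<And>i. i \<in> I \<Longrightarrow> f i \<in> L2 M) \<Longrightarrow> L2_norm M (\<lambda>x. \<Sum>i\<in>I. f i x) \<le> (\<Sum>i\<in>I. L2_norm M (f i))"
proof (induction I rule: infinite_finite_induct)
  case (insert i I)
  then have "L2_norm M (\<lambda>x. f i x + (\<Sum>i\<in>I. f i x)) \<le> L2_norm M (f i) + L2_norm M (\<lambda>x. \<Sum>i\<in>I. f i x)"
    by (intro L2_norm_triangle L2_sum) auto
  also have "\<dots> \<le> L2_norm M (f i) + (\<Sum>i\<in>I. L2_norm M (f i))"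
    using insert by auto
  finally show ?case using insert by simp
qed auto

lemma L2_cong_AE:
  assumes "f \<in> L2 M" "g \<in> borel_measurable M" "AE x in M. f x = g x"
  shows "g \<in> L2 M"
proof -
  have [measurable]: "f \<in> borel_measurable M" "g \<in> borel_measurable M" using assms by (auto simp: L2_measurable)
  have "integrable M (\<lambda>x. (cmod (f x))\<^sup>2) = integrable M (\<lambda>x. (cmod (g x))\<^sup>2)"
    using assms(3) by (intro integrable_cong_AE) auto
  then show ?thesis using assms by (simp add: L2_def)
qed

lemma L2_norm_cong_AE:
  assumes [measurable]: "f \<in> borel_measurable M" "g \<in> borel_measurable M" and "AE x in M. f x = g x"
  shows "L2_norm M f = L2_norm M g"
proof -
  have "(\<integral>x. (cmod (f x))\<^sup>2 \<partial>M) = (\<integral>x. (cmod (g x))\<^sup>2 \<partial>M)"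
    using assms(3) by (intro integral_cong_AE) auto
  then show ?thesis by (simp add: L2_norm_def)
qed

lemma L2_norm_zero_AE:
  assumes "f \<in> L2 M" "L2_norm M f = 0"
  shows "AE x in M. f x = 0"
proof -
  have "(\<integral>x. (cmod (f x))\<^sup>2 \<partial>M) = 0" using assms by (simp add: L2_norm_def)
  then show ?thesis
    using assms(1) by (subst (asm) integral_nonneg_eq_0_iff_AE) (auto simp: L2_integrable)
qed

lemma integrable_L2_inner:
  assumes "f \<in> L2 M" "g \<in> L2 M"
  shows "integrable M (\<lambda>x. f x * cnj (g x))"
  by (rule Bochner_Integration.integrable_bound[OF integrable_norm_mult_L2[OF assms]])
     (use assms in \<open>auto simp: norm_mult L2_measurable\<close>)

lemma L2_inner_add_left:
  assumes "f \<in> L2 M" "g \<in> L2 M" "h \<in> L2 M"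
  shows "L2_inner M (\<lambda>x. f x + g x) h = L2_inner M f h + L2_inner M g h"
  using assms by (simp add: L2_inner_def ring_distribs integrable_L2_inner)

lemma L2_inner_scale_left: "L2_inner M (\<lambda>x. c * f x) h = c * L2_inner M f h"
  by (simp add: L2_inner_def mult.assoc)

lemma L2_inner_commute: "L2_inner M g f = cnj (L2_inner M f g)"
proof -
  have "cnj (L2_inner M f g) = (\<integral>x. cnj (f x * cnj (g x)) \<partial>M)"
    unfolding L2_inner_def by (rule Bochner_Integration.integral_cnj[symmetric])
  then show ?thesis by (simp add: L2_inner_def mult.commute)
qed

lemma L2_inner_self: "L2_inner M f f = of_real ((L2_norm M f)\<^sup>2)"
proof -
  have "L2_inner M f f = (\<integral>x. complex_of_real ((cmod (f x))\<^sup>2) \<partial>M)"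
    unfolding L2_inner_def
    by (intro Bochner_Integration.integral_cong) (simp_all only: complex_norm_square)
  also have "\<dots> = complex_of_real (\<integral>x. (cmod (f x))\<^sup>2 \<partial>M)" by (rule integral_complex_of_real)
  finally show ?thesis by (simp add: L2_norm_power2)
qed

lemma L2_inner_cong_AE:
  assumes [measurable]: "f \<in> borel_measurable M" "f' \<in> borel_measurable M"
      "g \<in> borel_measurable M" "g' \<in> borel_measurable M"
    and "AE x in M. f x = f' x" "AE x in M. g x = g' x"
  shows "L2_inner M f g = L2_inner M f' g'"
  unfolding L2_inner_def using assms(5,6) by (intro integral_cong_AE) auto

lemma L2_Cauchy_Schwarz:
  assumes f: "f \<in> L2 M" and g: "g \<in> L2 M"
  shows "cmod (L2_inner M f g) \<le> L2_norm M f * L2_norm M g"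
proof -
  have "cmod (L2_inner M f g) \<le> (\<integral>x. cmod (f x * cnj (g x)) \<partial>M)"
    unfolding L2_inner_def by (rule integral_norm_bound)
  also have "\<dots> \<le> L2_norm M f * L2_norm M g"
    using L2_norm_mult_integral[OF f g] by (simp add: norm_mult)
  finally show ?thesis .
qed

lemma L2_norm_diff_power2:
  assumes f: "f \<in> L2 M" and g: "g \<in> L2 M"
  shows "(L2_norm M (\<lambda>x. f x - g x))\<^sup>2 = (L2_norm M f)\<^sup>2 - 2 * Re (L2_inner M f g) + (L2_norm M g)\<^sup>2"
proof -
  have I: "integrable M (\<lambda>x. f x * cnj (g x))"
    using assms by (rule integrable_L2_inner)
  have "(cmod (f x - g x))\<^sup>2 = (cmod (f x))\<^sup>2 - 2 * Re (f x * cnj (g x)) + (cmod (g x))\<^sup>2" for x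
    unfolding cmod_power2 by (simp add: power2_eq_square algebra_simps)
  then have "(L2_norm M (\<lambda>x. f x - g x))\<^sup>2 =
      (\<integral>x. (cmod (f x))\<^sup>2 - 2 * Re (f x * cnj (g x)) + (cmod (g x))\<^sup>2 \<partial>M)"
    by (simp add: L2_norm_power2)
  also have "\<dots> = (L2_norm M f)\<^sup>2 - 2 * Re (L2_inner M f g) + (L2_norm M g)\<^sup>2"
    using I L2_integrable[OF f] L2_integrable[OF g] integrable_Re[OF I] integral_Re[OF I]
    by (simp add: L2_norm_power2 L2_inner_def del: times_complex.sel)
  finally show ?thesis .
qed

text \<open>
  Completeness of \<open>L\<^sup>2\<close>, for absolutely convergent series. The partial sums of \<open>\<bar>g n\<bar>\<close> increase and
  have bounded norms, so by monotone convergence their limit is square-integrable, hence finite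
  almost everywhere.
\<close>

lemma L2_absolutely_convergent:
  fixes g :: "nat \<Rightarrow> 'a \<Rightarrow> complex"
  assumes g: "\<And>n. g n \<in> L2 M" and sm: "summable (\<lambda>n. L2_norm M (g n))"
  defines "G \<equiv> (\<lambda>x. \<Sum>n. g n x)"
  shows "AE x in M. summable (\<lambda>n. cmod (g n x))" "G \<in> L2 M" "L2_norm M G \<le> (\<Sum>n. L2_norm M (g n))"
proof -
  have [measurable]: "g n \<in> borel_measurable M" for n using g by (simp add: L2_measurable)
  define C where "C = (\<Sum>n. L2_norm M (g n))"
  have C0: "C \<ge> 0" unfolding C_def by (intro suminf_nonneg sm) simp
  define h where "h k x = (\<Sum>n<k. cmod (g n x))" for k x
  have h0: "0 \<le> h k x" for k x by (simp add: h_def sum_nonneg)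
  have [measurable]: "h k \<in> borel_measurable M" for k unfolding h_def[abs_def] by measurable
  have hL2: "(\<lambda>x. complex_of_real (h k x)) \<in> L2 M" for k
    unfolding h_def of_real_sum
  proof (rule L2_sum)
    fix i show "(\<lambda>x. complex_of_real (cmod (g i x))) \<in> L2 M"
      using g[of i] by (auto simp: L2_def)
  qed
  have "L2_norm M (\<lambda>x. complex_of_real (h k x)) \<le> C" for k
  proof -
    have "L2_norm M (\<lambda>x. \<Sum>n<k. complex_of_real (cmod (g n x))) \<le>
        (\<Sum>n<k. L2_norm M (\<lambda>x. complex_of_real (cmod (g n x))))"
    proof (rule L2_norm_sum)
      fix i show "(\<lambda>x. complex_of_real (cmod (g i x))) \<in> L2 M"
        using g[of i] by (auto simp: L2_def)
    qed
    also have "\<dots> = (\<Sum>n<k. L2_norm M (g n))"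
      by (simp add: L2_norm_def)
    also have "\<dots> \<le> C" unfolding C_def by (intro sum_le_suminf sm) auto
    finally show ?thesis by (simp add: h_def)
  qed
  then have hC: "(\<integral>\<^sup>+x. ennreal ((h k x)\<^sup>2) \<partial>M) \<le> ennreal (C\<^sup>2)" for k
    using L2_norm_nn[OF hL2[of k]] C0 h0 by (auto intro!: ennreal_leI power_mono)
  define \<Phi> where "\<Phi> x = (SUP k. ennreal ((h k x)\<^sup>2))" for x
  have \<Phi>: "(\<integral>\<^sup>+x. \<Phi> x \<partial>M) \<le> ennreal (C\<^sup>2)"
  proof -
    have "(\<integral>\<^sup>+x. \<Phi> x \<partial>M) = (SUP k. \<integral>\<^sup>+x. ennreal ((h k x)\<^sup>2) \<partial>M)"
      unfolding \<Phi>_def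
    proof (rule nn_integral_monotone_convergence_SUP)
      show "incseq (\<lambda>k x. ennreal ((h k x)\<^sup>2))"
        using h0 by (auto simp: incseq_def le_fun_def h_def intro!: ennreal_leI power_mono sum_mono2 sum_nonneg)
    qed simp
    also have "\<dots> \<le> ennreal (C\<^sup>2)" by (rule SUP_least) (rule hC)
    finally show ?thesis .
  qed
  have [measurable]: "\<Phi> \<in> borel_measurable M" unfolding \<Phi>_def by simp
  have fin: "AE x in M. \<Phi> x \<noteq> \<infinity>"
  proof (rule nn_integral_PInf_AE)
    show "(\<integral>\<^sup>+x. \<Phi> x \<partial>M) \<noteq> \<infinity>"
      using \<Phi> by (auto simp: top_unique)
  qed simp
  have smx: "summable (\<lambda>n. cmod (g n x)) \<and> ennreal ((cmod (G x))\<^sup>2) \<le> \<Phi> x" if "\<Phi> x \<noteq> \<infinity>" for x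
  proof -
    from that obtain r where r: "r \<ge> 0" "\<Phi> x = ennreal r"
      by (cases "\<Phi> x") auto
    have "ennreal ((h k x)\<^sup>2) \<le> ennreal r" for k
      unfolding r(2)[symmetric] \<Phi>_def by (rule SUP_upper) simp
    then have hk: "h k x \<le> sqrt r" for k
      using h0[of k x] r(1) by (intro real_le_rsqrt) (simp)
    have s: "summable (\<lambda>n. cmod (g n x))"
      by (rule bounded_imp_summable[where B = "sqrt r"]) (use hk[of "Suc _"] in \<open>auto simp: h_def lessThan_Suc_atMost\<close>)
    have "cmod (G x) \<le> (\<Sum>n. cmod (g n x))"
      unfolding G_def by (rule summable_norm[OF s])
    also have "\<dots> \<le> sqrt r"
      by (rule suminf_le_const[OF s]) (use hk in \<open>simp add: h_def\<close>)
    finally have "(cmod (G x))\<^sup>2 \<le> (sqrt r)\<^sup>2" by (intro power_mono) auto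
    then show ?thesis using s r by (simp add: ennreal_leI)
  qed
  show "AE x in M. summable (\<lambda>n. cmod (g n x))"
    using fin by eventually_elim (use smx in auto)
  have [measurable]: "G \<in> borel_measurable M"
    unfolding G_def suminf_eq_lim by simp
  have "(\<integral>\<^sup>+x. ennreal ((cmod (G x))\<^sup>2) \<partial>M) \<le> (\<integral>\<^sup>+x. \<Phi> x \<partial>M)"
    by (rule nn_integral_mono_AE) (use fin in eventually_elim, use smx in auto)
  also note \<Phi>
  finally have *: "(\<integral>\<^sup>+x. ennreal ((cmod (G x))\<^sup>2) \<partial>M) \<le> ennreal (C\<^sup>2)" .
  show "G \<in> L2 M" by (rule L2_bounded_nn(1)[OF _ C0 *]) simp
  show "L2_norm M G \<le> (\<Sum>n. L2_norm M (g n))"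
    unfolding C_def[symmetric] by (rule L2_bounded_nn(2)[OF _ C0 *]) simp
qed

lemma L2_series_tendsto:
  fixes g :: "nat \<Rightarrow> 'a \<Rightarrow> complex"
  assumes g: "\<And>n. g n \<in> L2 M" and sm: "summable (\<lambda>n. L2_norm M (g n))"
  shows "(\<lambda>k. L2_norm M (\<lambda>x. (\<Sum>n<k. g n x) - (\<Sum>n. g n x))) \<longlonglongrightarrow> 0"
proof (rule Lim_null_comparison)
  have [measurable]: "g n \<in> borel_measurable M" for n using g by (simp add: L2_measurable)
  have "L2_norm M (\<lambda>x. (\<Sum>n<k. g n x) - (\<Sum>n. g n x)) \<le> (\<Sum>n. L2_norm M (g (n + k)))" for k
  proof -
    have sm': "summable (\<lambda>n. L2_norm M (g (n + k)))" using sm by (subst summable_iff_shift)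
    have "L2_norm M (\<lambda>x. (\<Sum>n. g n x) - (\<Sum>n<k. g n x)) = L2_norm M (\<lambda>x. \<Sum>n. g (n + k) x)"
    proof (rule L2_norm_cong_AE)
      show "AE x in M. (\<Sum>n. g n x) - (\<Sum>n<k. g n x) = (\<Sum>n. g (n + k) x)"
        using L2_absolutely_convergent(1)[OF g sm]
      proof eventually_elim
        case (elim x)
        then have "summable (\<lambda>n. g n x)" by (rule summable_norm_cancel)
        from suminf_split_initial_segment[OF this, of k] show ?case by simp
      qed
    qed (auto simp: suminf_eq_lim)
    also have "\<dots> \<le> (\<Sum>n. L2_norm M (g (n + k)))"
      by (rule L2_absolutely_convergent(3)[OF g sm'])
    finally show ?thesis by (simp add: L2_norm_minus_commute)
  qed
  then show "\<forall>\<^sub>F k in sequentially. norm (L2_norm M (\<lambda>x. (\<Sum>n<k. g n x) - (\<Sum>n. g n x))) \<le>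
      (\<Sum>n. L2_norm M (g (n + k)))" by simp
  show "(\<lambda>k. \<Sum>n. L2_norm M (g (n + k))) \<longlonglongrightarrow> 0"
    using suminf_exist_split2[OF sm] .
qed

section \<open>Spectral radius of a symmetric contraction\<close>

text \<open>
  Log-convexity says that the ratios \<open>b (n + 1) / b n\<close> do not decrease. If the first of them were
  some \<open>t > c\<close>, then \<open>b n\<close> would grow at least like \<open>t\<^sup>n\<close>.
\<close>

lemma log_convex_growth:
  fixes b :: "nat \<Rightarrow> real"
  assumes nn: "\<And>n. 0 \<le> b n" and conv: "\<And>n. (b (Suc n))\<^sup>2 \<le> b n * b (Suc (Suc n))"
    and bound: "\<And>n. b n \<le> K * c ^ n" and c: "0 \<le> c" and b1: "b 0 = 0 \<Longrightarrow> b 1 = 0"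
  shows "b 1 \<le> c * b 0"
proof (rule ccontr)
  assume "\<not> b 1 \<le> c * b 0"
  then have less: "c * b 0 < b 1" by simp
  have b0: "b 0 > 0"
    using nn[of 0] b1 less by (cases "b 0 = 0") auto
  define t where "t = b 1 / b 0"
  have t: "c < t" using less b0 by (simp add: t_def field_simps)
  then have t0: "t > 0" using c by simp
  have step: "b n > 0 \<and> t * b n \<le> b (Suc n)" for n
  proof (induction n)
    case 0
    then show ?case using b0 by (simp add: t_def)
  next
    case (Suc n)
    then have pos: "b (Suc n) > 0" by (meson less_le_trans mult_pos_pos t0)
    have "t * b n * b (Suc n) \<le> b (Suc n) * b (Suc n)"
      using Suc pos by (intro mult_right_mono) auto
    also have "\<dots> \<le> b n * b (Suc (Suc n))" using conv[of n] by (simp add: power2_eq_square)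
    finally have "b n * (t * b (Suc n)) \<le> b n * b (Suc (Suc n))" by (simp add: algebra_simps)
    then show ?case using Suc pos by simp
  qed
  have pow: "t ^ n * b 0 \<le> b n" for n
  proof (induction n)
    case (Suc n)
    have "t ^ Suc n * b 0 = t * (t ^ n * b 0)" by simp
    also have "\<dots> \<le> t * b n" using Suc t0 by (intro mult_left_mono) auto
    also have "\<dots> \<le> b (Suc n)" using step by simp
    finally show ?case .
  qed simp
  have "b 0 \<le> K * (c / t) ^ n" for n
    using order_trans[OF pow bound, of n] t0 by (simp add: power_divide field_simps)
  moreover have "(\<lambda>n. K * (c / t) ^ n) \<longlonglongrightarrow> K * 0"
    using c t t0 by (intro tendsto_intros LIMSEQ_power_zero) simp
  ultimately have "b 0 \<le> K * 0" by (intro LIMSEQ_le_const) auto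
  then show False using b0 by simp
qed

text \<open>
  The Markov operator of a graphing is understood only at points whose labels are distinct;
  elsewhere several neighbours of the root may be the same point of the graphing. These points
  form a conull set \<open>Good\<close> that is a union of components, so the operator commutes with
  restricting functions to it, and all analytic assumptions are about restricted functions. For a
  single graph, \<open>Good\<close> is everything.
\<close>

locale symmetric_contraction =
  fixes M :: "'a measure" and H :: "('a \<Rightarrow> complex) set"
    and T :: "('a \<Rightarrow> complex) \<Rightarrow> ('a \<Rightarrow> complex)" and Good :: "'a set"
  assumes H_L2: "H \<subseteq> L2 M"
    and H_add: "\<And>f g. f \<in> H \<Longrightarrow> g \<in> H \<Longrightarrow> (\<lambda>x. f x + g x) \<in> H"
    and H_scale: "\<And>c f. f \<in> H \<Longrightarrow> (\<lambda>x. c * f x) \<in> H"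
    and H_closed: "\<And>f g. (\<And>n :: nat. f n \<in> H) \<Longrightarrow> g \<in> L2 M \<Longrightarrow>
        (\<lambda>n. L2_norm M (\<lambda>x. f n x - g x)) \<longlonglongrightarrow> 0 \<Longrightarrow> g \<in> H"
    and H_nontrivial: "\<exists>f\<in>H. L2_norm M f > 0"
    and Good_AE: "AE x in M. x \<in> Good"
    and cut_H: "\<And>f. f \<in> H \<Longrightarrow> (\<lambda>x. if x \<in> Good then f x else 0) \<in> H"
    and T_add: "\<And>f g. T (\<lambda>x. f x + g x) = (\<lambda>x. T f x + T g x)"
    and T_scale: "\<And>c f. T (\<lambda>x. c * f x) = (\<lambda>x. c * T f x)"
    and T_cut: "\<And>f. T (\<lambda>x. if x \<in> Good then f x else 0) = (\<lambda>x. if x \<in> Good then T f x else 0)"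
    and T_H: "\<And>f. f \<in> H \<Longrightarrow> T (\<lambda>x. if x \<in> Good then f x else 0) \<in> H"
    and T_symmetric: "\<And>f g. f \<in> H \<Longrightarrow> g \<in> H \<Longrightarrow>
        L2_inner M (T (\<lambda>x. if x \<in> Good then f x else 0)) g =
        L2_inner M f (T (\<lambda>x. if x \<in> Good then g x else 0))"
    and T_contraction: "\<And>f. f \<in> H \<Longrightarrow>
        L2_norm M (T (\<lambda>x. if x \<in> Good then f x else 0)) \<le> L2_norm M f"
begin

definition cut :: "('a \<Rightarrow> complex) \<Rightarrow> ('a \<Rightarrow> complex)" where
  "cut f = (\<lambda>x. if x \<in> Good then f x else 0)"

definition S :: "('a \<Rightarrow> complex) \<Rightarrow> ('a \<Rightarrow> complex)" where
  "S f = T (cut f)"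

lemma HD: "f \<in> H \<Longrightarrow> f \<in> L2 M" "f \<in> H \<Longrightarrow> f \<in> borel_measurable M"
  using H_L2 by (auto simp: L2_measurable)

lemma cut_in_H [simp]: "f \<in> H \<Longrightarrow> cut f \<in> H"
  unfolding cut_def by (rule cut_H)

lemma cut_AE: "AE x in M. cut f x = f x"
  using Good_AE by eventually_elim (simp add: cut_def)

lemma cut_cut [simp]: "cut (cut f) = cut f"
  by (simp add: cut_def fun_eq_iff)

lemma S_H [simp]: "f \<in> H \<Longrightarrow> S f \<in> H"
  unfolding S_def cut_def by (rule T_H)

lemma S_eq_cut: "S f = cut (T f)"
  unfolding S_def cut_def by (rule T_cut)

lemma S_AE: "AE x in M. S f x = T f x"
  unfolding S_eq_cut by (rule cut_AE)

lemma S_cut [simp]: "S (cut f) = S f"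
  by (simp add: S_def)

lemma T_S_cut: "cut f = f \<Longrightarrow> T f = S f"
  by (metis S_def)

lemma cut_add: "cut (\<lambda>x. f x + g x) = (\<lambda>x. cut f x + cut g x)"
  by (auto simp: cut_def)

lemma cut_scale: "cut (\<lambda>x. c * f x) = (\<lambda>x. c * cut f x)"
  by (auto simp: cut_def)

lemma S_add: "S (\<lambda>x. f x + g x) = (\<lambda>x. S f x + S g x)"
  unfolding S_def cut_add by (rule T_add)

lemma S_scale: "S (\<lambda>x. c * f x) = (\<lambda>x. c * S f x)"
  unfolding S_def cut_scale by (rule T_scale)

lemma S_diff: "S (\<lambda>x. f x - g x) = (\<lambda>x. S f x - S g x)"
  using S_add[of f "\<lambda>x. (-1) * g x"] S_scale[of "-1" g] by simp

lemma H_diff: "f \<in> H \<Longrightarrow> g \<in> H \<Longrightarrow> (\<lambda>x. f x - g x) \<in> H"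
  using H_add[of f "\<lambda>x. (-1) * g x"] H_scale[of g "-1"] by simp

lemma H_zero: "(\<lambda>x. 0) \<in> H"
proof -
  obtain f where "f \<in> H" using H_nontrivial by blast
  from H_scale[OF this, of 0] show ?thesis by simp
qed

lemma H_sum: "(\<And>i. i \<in> I \<Longrightarrow> f i \<in> H) \<Longrightarrow> (\<lambda>x. \<Sum>i\<in>I. f i x) \<in> H"
  by (induction I rule: infinite_finite_induct) (auto intro: H_add H_zero)

lemma S_symmetric: "f \<in> H \<Longrightarrow> g \<in> H \<Longrightarrow> L2_inner M (S f) g = L2_inner M f (S g)"
  unfolding S_def cut_def by (rule T_symmetric)

lemma S_contraction: "f \<in> H \<Longrightarrow> L2_norm M (S f) \<le> L2_norm M f"
  unfolding S_def cut_def by (rule T_contraction)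

lemma S_pow_H [simp]: "f \<in> H \<Longrightarrow> (S ^^ n) f \<in> H"
  by (induction n) auto

lemma S_pow_add: "(S ^^ n) (\<lambda>x. f x + g x) = (\<lambda>x. (S ^^ n) f x + (S ^^ n) g x)"
  by (induction n) (auto simp: S_add)

lemma S_pow_scale: "(S ^^ n) (\<lambda>x. c * f x) = (\<lambda>x. c * (S ^^ n) f x)"
  by (induction n) (auto simp: S_scale)

lemma norm_cut [simp]: "f \<in> H \<Longrightarrow> L2_norm M (cut f) = L2_norm M f"
  by (rule L2_norm_cong_AE) (auto simp: HD cut_AE)

definition bounded_by :: "real \<Rightarrow> bool" where
  "bounded_by c \<longleftrightarrow> 0 \<le> c \<and> (\<forall>f\<in>H. L2_norm M (S f) \<le> c * L2_norm M f)"

lemma bounded_byD: "bounded_by c \<Longrightarrow> f \<in> H \<Longrightarrow> L2_norm M (S f) \<le> c * L2_norm M f"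
  by (simp add: bounded_by_def)

lemma S_pow_bound:
  assumes "bounded_by c" "f \<in> H"
  shows "L2_norm M ((S ^^ n) f) \<le> c ^ n * L2_norm M f"
proof (induction n)
  case (Suc n)
  have "L2_norm M ((S ^^ Suc n) f) \<le> c * L2_norm M ((S ^^ n) f)"
    using bounded_byD[OF assms(1), of "(S ^^ n) f"] assms(2) by simp
  also have "\<dots> \<le> c * (c ^ n * L2_norm M f)"
    using assms(1) Suc by (intro mult_left_mono) (auto simp: bounded_by_def)
  finally show ?case by simp
qed simp

text \<open>
  By symmetry the square of \<open>\<parallel>S\<^bsup>n+1\<^esup> f\<parallel>\<close> is the inner product of \<open>S\<^sup>n f\<close> and \<open>S\<^bsup>n+2\<^esup> f\<close>, so the
  Cauchy-Schwarz inequality makes the norms of the iterates log-convex.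
\<close>

lemma norm_le_of_growth:
  assumes f: "f \<in> H" and c: "0 \<le> c" and growth: "\<And>n. L2_norm M ((S ^^ n) f) \<le> K * c ^ n"
  shows "L2_norm M (S f) \<le> c * L2_norm M f"
proof -
  define b where "b n = L2_norm M ((S ^^ n) f)" for n
  have "b 1 \<le> c * b 0"
  proof (rule log_convex_growth[where K = K])
    fix n
    have "of_real ((b (Suc n))\<^sup>2) = L2_inner M (S ((S ^^ n) f)) ((S ^^ Suc n) f)"
      by (simp add: b_def L2_inner_self)
    also have "\<dots> = L2_inner M ((S ^^ n) f) (S ((S ^^ Suc n) f))"
      using f S_pow_H[OF f, of "Suc n"] by (intro S_symmetric) auto
    finally have "(b (Suc n))\<^sup>2 = cmod (L2_inner M ((S ^^ n) f) ((S ^^ Suc (Suc n)) f))"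
      by (metis abs_power2 funpow.simps(2) norm_of_real o_apply)
    also have "\<dots> \<le> b n * b (Suc (Suc n))"
      unfolding b_def using f by (intro L2_Cauchy_Schwarz HD) (rule S_pow_H, assumption)+
    finally show "(b (Suc n))\<^sup>2 \<le> b n * b (Suc (Suc n))" .
  next
    assume "b 0 = 0"
    then show "b 1 = 0" using S_contraction[OF f] by (simp add: b_def order_antisym)
  qed (auto simp: b_def growth c)
  then show ?thesis by (simp add: b_def)
qed

text \<open>
  The constants \<open>K\<close> need not be bounded on \<open>X\<close>: log-convexity removes them before the passage to
  the limit.
\<close>

lemma bounded_by_of_dense_growth:
  assumes X: "X \<subseteq> H" and c: "0 \<le> c"
    and growth: "\<And>f. f \<in> X \<Longrightarrow> \<exists>K. \<forall>n. L2_norm M ((S ^^ n) f) \<le> K * c ^ n"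
    and dense: "\<And>f e. f \<in> H \<Longrightarrow> 0 < e \<Longrightarrow> \<exists>g\<in>X. L2_norm M (\<lambda>x. f x - g x) < e"
  shows "bounded_by c"
  unfolding bounded_by_def
proof (intro conjI ballI c)
  fix f assume f: "f \<in> H"
  show "L2_norm M (S f) \<le> c * L2_norm M f"
  proof (rule field_le_epsilon)
    fix e :: real assume e: "0 < e"
    \<comment> \<open>An error \<open>d\<close> in \<open>f\<close> costs \<open>d\<close> on the left and \<open>c d\<close> on the right.\<close>
    define d where "d = e / (1 + c)"
    have d: "0 < d" using e c by (simp add: d_def)
    obtain g where g: "g \<in> X" "L2_norm M (\<lambda>x. f x - g x) < d"
      using dense[OF f d] by blast
    have gH: "g \<in> H" using g X by auto
    have fg: "(\<lambda>x. f x - g x) \<in> H" using f gH by (rule H_diff)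
    obtain K where K: "L2_norm M ((S ^^ n) g) \<le> K * c ^ n" for n
      using growth[OF g(1)] by blast
    have "L2_norm M (S f) \<le> L2_norm M (S g) + L2_norm M (\<lambda>x. S g x - S f x)"
      using f gH by (intro L2_norm_triangle_diff) (auto simp: HD)
    also have "L2_norm M (\<lambda>x. S g x - S f x) \<le> L2_norm M (\<lambda>x. f x - g x)"
      using S_contraction[OF fg] L2_norm_minus_commute[of M "S g" "S f"] by (simp add: S_diff)
    also have "L2_norm M (S g) \<le> c * L2_norm M g"
      by (rule norm_le_of_growth[OF gH c K])
    also have "L2_norm M g \<le> L2_norm M f + L2_norm M (\<lambda>x. f x - g x)"
      using f gH by (intro L2_norm_triangle_diff) (auto simp: HD)
    finally have "L2_norm M (S f) \<le> c * (L2_norm M f + d) + d"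
      using g c by (smt (verit) mult_left_mono)
    also have "\<dots> = c * L2_norm M f + (1 + c) * d" by (simp add: algebra_simps)
    also have "(1 + c) * d = e" using c by (simp add: d_def)
    finally show "L2_norm M (S f) \<le> c * L2_norm M f + e" .
  qed
qed

text \<open>
  Outside the disc of radius \<open>c\<close> the series \<open>- (\<Sum>n. S\<^sup>n / z\<^bsup>n+1\<^esup>)\<close> converges absolutely to an
  inverse of \<open>S - z\<close>, so the spectrum is contained in the disc.
\<close>

context
  fixes c z assumes c: "bounded_by c" and z: "c < cmod z"
begin

definition neumann :: "('a \<Rightarrow> complex) \<Rightarrow> nat \<Rightarrow> 'a \<Rightarrow> complex" where
  "neumann f n = (\<lambda>x. (- 1 / z ^ Suc n) * (S ^^ n) (cut f) x)"

definition resolvent :: "('a \<Rightarrow> complex) \<Rightarrow> 'a \<Rightarrow> complex" where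
  "resolvent f x = (\<Sum>n. neumann f n x)"

lemma c0: "0 \<le> c" and z0: "z \<noteq> 0" and cz: "0 < cmod z"
  using c z by (auto simp: bounded_by_def)

lemma neumann_H: "f \<in> H \<Longrightarrow> neumann f n \<in> H"
  unfolding neumann_def by (intro H_scale S_pow_H cut_in_H)

lemma neumann_norm: "f \<in> H \<Longrightarrow> L2_norm M (neumann f n) \<le> L2_norm M f / cmod z * (c / cmod z) ^ n"
  using S_pow_bound[OF c cut_in_H, of f n] cz unfolding neumann_def L2_norm_scale
  by (simp add: norm_divide norm_mult norm_power power_divide field_simps)

lemma ratio: "0 \<le> c / cmod z" "c / cmod z < 1"
  using c0 z cz by (simp_all add: field_simps)

lemma geo: "summable (\<lambda>n. L2_norm M f / cmod z * (c / cmod z) ^ n)"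
  using ratio by (intro summable_mult summable_geometric) simp

lemma neumann_summable: "f \<in> H \<Longrightarrow> summable (\<lambda>n. L2_norm M (neumann f n))"
  by (rule summable_comparison_test[OF _ geo]) (use neumann_norm in auto)

lemma resolvent_norm: "f \<in> H \<Longrightarrow> L2_norm M (resolvent f) \<le> 1 / (cmod z - c) * L2_norm M f"
proof -
  assume f: "f \<in> H"
  have "L2_norm M (resolvent f) \<le> (\<Sum>n. L2_norm M (neumann f n))"
    unfolding resolvent_def[abs_def] using f
    by (intro L2_absolutely_convergent(3) neumann_summable) (auto simp: HD neumann_H)
  also have "\<dots> \<le> (\<Sum>n. L2_norm M f / cmod z * (c / cmod z) ^ n)"
    by (intro suminf_le neumann_norm neumann_summable geo f)
  also have "\<dots> = L2_norm M f / cmod z * (1 / (1 - c / cmod z))"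
    using ratio by (subst suminf_mult) (auto simp: suminf_geometric intro!: summable_geometric)
  also have "\<dots> = 1 / (cmod z - c) * L2_norm M f"
    using z c0 cz by (simp add: field_simps)
  finally show ?thesis .
qed

lemma resolvent_tendsto:
  "f \<in> H \<Longrightarrow> (\<lambda>k. L2_norm M (\<lambda>x. (\<Sum>n<k. neumann f n x) - resolvent f x)) \<longlonglongrightarrow> 0"
  unfolding resolvent_def by (rule L2_series_tendsto) (auto simp: HD neumann_H neumann_summable)

lemma resolvent_H: "f \<in> H \<Longrightarrow> resolvent f \<in> H"
proof (rule H_closed[OF _ _ resolvent_tendsto])
  show "f \<in> H \<Longrightarrow> resolvent f \<in> L2 M"
    unfolding resolvent_def[abs_def] by (rule L2_absolutely_convergent(2)) (auto simp: HD neumann_H neumann_summable)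
qed (auto intro!: H_sum neumann_H)

lemma neumann_AE_summable: "f \<in> H \<Longrightarrow> AE x in M. summable (\<lambda>n. neumann f n x)"
proof -
  assume f: "f \<in> H"
  have "AE x in M. summable (\<lambda>n. cmod (neumann f n x))"
    using f by (intro L2_absolutely_convergent(1) neumann_summable) (auto simp: HD neumann_H)
  then show ?thesis by eventually_elim (rule summable_norm_cancel)
qed

lemma partial_sum_identity:
  "(\<lambda>x. S (\<lambda>x. \<Sum>n<k. neumann f n x) x - z * (\<Sum>n<k. neumann f n x)) =
    (\<lambda>x. cut f x + z * neumann f k x)"
proof (induction k)
  case 0
  have "S (\<lambda>x. 0) = (\<lambda>x. 0)" using S_scale[of 0 "\<lambda>x. 0"] by simp
  then show ?case using z0 by (simp add: neumann_def)
next
  case (Suc k)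
  have "S (neumann f k) = (\<lambda>x. z * neumann f (Suc k) x)"
    unfolding neumann_def S_scale using z0 by (simp add: fun_eq_iff field_simps)
  then show ?case
    using Suc by (auto simp: S_add fun_eq_iff algebra_simps)
qed

lemma resolvent_right:
  assumes f: "f \<in> H" shows "AE x in M. T (resolvent f) x - z * resolvent f x = f x"
proof -
  define R where "R = resolvent f"
  define P where "P k x = (\<Sum>n<k. neumann f n x)" for k x
  have PH: "P k \<in> H" for k unfolding P_def by (intro H_sum neumann_H f)
  have RH: "R \<in> H" unfolding R_def by (rule resolvent_H[OF f])
  have lim: "(\<lambda>k. L2_norm M (\<lambda>x. P k x - R x)) \<longlonglongrightarrow> 0"
    unfolding P_def R_def by (rule resolvent_tendsto[OF f])
  \<comment> \<open>The defect \<open>E\<close> is small because the partial sums satisfy the equation up to their next term.\<close>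
  define E where "E = (\<lambda>x. S R x - z * R x - cut f x)"
  have EH: "E \<in> H" unfolding E_def using RH f by (intro H_diff H_scale) auto
  have id: "S (P k) x - z * P k x = cut f x + z * neumann f k x" for k x
    using partial_sum_identity[of f k] by (simp add: P_def[abs_def] fun_eq_iff)
  have bound: "L2_norm M E \<le> (1 + cmod z) * L2_norm M (\<lambda>x. P k x - R x) + cmod z * L2_norm M (neumann f k)" for k
  proof -
    have d: "(\<lambda>x. P k x - R x) \<in> H" using PH RH by (rule H_diff)
    have Eeq: "E = (\<lambda>x. (z * neumann f k x + z * (P k x - R x)) + (-1) * S (\<lambda>x. P k x - R x) x)"
      unfolding E_def S_diff using id[of k] by (auto simp: fun_eq_iff algebra_simps)
    have "L2_norm M E \<le> L2_norm M (\<lambda>x. z * neumann f k x + z * (P k x - R x)) + L2_norm M (\<lambda>x. (-1) * S (\<lambda>x. P k x - R x) x)"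
      unfolding Eeq using d neumann_H[OF f]
      by (intro L2_norm_triangle HD(1) H_add H_scale S_H) auto
    also have "L2_norm M (\<lambda>x. (-1) * S (\<lambda>x. P k x - R x) x) \<le> L2_norm M (\<lambda>x. P k x - R x)"
      unfolding L2_norm_scale using S_contraction[OF d] by simp
    also have "L2_norm M (\<lambda>x. z * neumann f k x + z * (P k x - R x)) \<le>
        L2_norm M (\<lambda>x. z * neumann f k x) + L2_norm M (\<lambda>x. z * (P k x - R x))"
      using d neumann_H[OF f] by (intro L2_norm_triangle HD(1) H_scale) auto
    finally show ?thesis unfolding L2_norm_scale by (simp add: algebra_simps)
  qed
  have "(\<lambda>k. (1 + cmod z) * L2_norm M (\<lambda>x. P k x - R x) + cmod z * L2_norm M (neumann f k)) \<longlonglongrightarrow>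
      (1 + cmod z) * 0 + cmod z * 0"
    by (intro tendsto_intros lim summable_LIMSEQ_zero neumann_summable f)
  then have "L2_norm M E \<le> (1 + cmod z) * 0 + cmod z * 0"
    by (rule LIMSEQ_le_const) (use bound in auto)
  then have "L2_norm M E = 0" by (simp add: order_antisym)
  then have "AE x in M. E x = 0" by (intro L2_norm_zero_AE HD(1) EH)
  moreover have "AE x in M. S R x = T R x" by (rule S_AE)
  moreover have "AE x in M. cut f x = f x" by (rule cut_AE)
  ultimately show ?thesis
    unfolding R_def[symmetric] by eventually_elim (simp add: E_def)
qed

lemma resolvent_left:
  assumes f: "f \<in> H" shows "AE x in M. resolvent (\<lambda>y. T f y - z * f y) x = f x"
proof -
  have cutg: "cut (\<lambda>y. T f y - z * f y) = (\<lambda>x. S (cut f) x + (- z) * cut f x)"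
    using cut_add[of "T f" "\<lambda>y. (- z) * f y"] cut_scale[of "-z" f] S_eq_cut[of f] by simp
  have pow: "(S ^^ n) (cut (\<lambda>y. T f y - z * f y)) = (\<lambda>x. (S ^^ Suc n) (cut f) x + (- z) * (S ^^ n) (cut f) x)" for n
    unfolding cutg S_pow_add S_pow_scale by (simp only: funpow_Suc_right o_apply)
  have t: "neumann (\<lambda>y. T f y - z * f y) n x = z * neumann f (Suc n) x - z * neumann f n x" for n x
    unfolding neumann_def pow using z0 by (simp add: field_simps)
  show ?thesis
    using neumann_AE_summable[OF f] cut_AE[of f]
  proof eventually_elim
    case (elim x)
    have l: "(\<lambda>n. z * neumann f n x) \<longlonglongrightarrow> z * 0"
      by (intro tendsto_intros summable_LIMSEQ_zero elim)
    have "(\<lambda>n. z * neumann f (Suc n) x - z * neumann f n x) sums (z * 0 - z * neumann f 0 x)"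
      by (rule telescope_sums[OF l])
    then have "resolvent (\<lambda>y. T f y - z * f y) x = - z * neumann f 0 x"
      unfolding resolvent_def t by (simp add: sums_iff)
    then show ?case using z0 elim by (simp add: neumann_def)
  qed
qed

lemma not_in_spectrum: "z \<notin> spectrum_on M H T"
proof -
  have "bounded_operator_on M H resolvent"
    unfolding bounded_operator_on_def
  proof (intro conjI ballI allI)
    fix f g assume f: "f \<in> H" and g: "g \<in> H"
    have t: "neumann (\<lambda>y. f y + g y) n x = neumann f n x + neumann g n x" for n x
      by (simp add: neumann_def cut_add S_pow_add algebra_simps add_divide_distrib diff_divide_distrib)
    show "AE x in M. resolvent (\<lambda>y. f y + g y) x = resolvent f x + resolvent g x"
      using neumann_AE_summable[OF f] neumann_AE_summable[OF g]
      by eventually_elim (simp add: resolvent_def t suminf_add)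
  next
    fix a f assume f: "f \<in> H"
    have t: "neumann (\<lambda>y. a * f y) n x = a * neumann f n x" for n x
      by (simp add: neumann_def cut_scale S_pow_scale)
    show "AE x in M. resolvent (\<lambda>y. a * f y) x = a * resolvent f x"
      using neumann_AE_summable[OF f] by eventually_elim (simp add: resolvent_def t suminf_mult)
  next
    show "\<exists>C. \<forall>f\<in>H. L2_norm M (resolvent f) \<le> C * L2_norm M f"
      using resolvent_norm by blast
  qed (rule resolvent_H)
  then show ?thesis
    unfolding spectrum_on_def using resolvent_left resolvent_right by blast
qed

end

lemma spectrum_bound: "bounded_by c \<Longrightarrow> z \<in> spectrum_on M H T \<Longrightarrow> cmod z \<le> c"
  using not_in_spectrum[of c z] by force

text \<open>
  This uses that the resolvent is a bounded left inverse: \<open>f = A (T f - z f)\<close>.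
\<close>

lemma bounded_below_of_resolvent:
  assumes "z \<notin> spectrum_on M H T"
  obtains C where "C > 0" "\<And>f. f \<in> H \<Longrightarrow> L2_norm M f \<le> C * L2_norm M (\<lambda>x. S f x - z * f x)"
proof -
  obtain A where A: "bounded_operator_on M H A"
    and left: "\<And>f. f \<in> H \<Longrightarrow> AE x in M. A (\<lambda>y. T f y - z * f y) x = f x"
    using assms unfolding spectrum_on_def by blast
  obtain C where C: "\<And>f. f \<in> H \<Longrightarrow> L2_norm M (A f) \<le> C * L2_norm M f"
    using A unfolding bounded_operator_on_def by blast
  have "L2_norm M f \<le> (\<bar>C\<bar> + 1) * L2_norm M (\<lambda>x. S f x - z * f x)" if f: "f \<in> H" for f
  proof -
    define g where "g = cut f"
    have g: "g \<in> H" using f by (simp add: g_def)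
    define h where "h = (\<lambda>x. S g x - z * g x)"
    have h: "h \<in> H" unfolding h_def using g by (intro H_diff H_scale) auto
    have "AE x in M. A h x = g x"
      using left[OF g] unfolding h_def by (subst T_S_cut[symmetric]) (simp_all add: g_def)
    then have "L2_norm M g = L2_norm M (A h)"
      using g h A by (intro L2_norm_cong_AE) (auto simp: HD bounded_operator_on_def)
    also have "\<dots> \<le> C * L2_norm M h" by (rule C[OF h])
    also have "\<dots> \<le> (\<bar>C\<bar> + 1) * L2_norm M h" by (intro mult_right_mono) auto
    also have "L2_norm M h = L2_norm M (\<lambda>x. S f x - z * f x)"
    proof (rule L2_norm_cong_AE)
      show "AE x in M. h x = S f x - z * f x"
        using cut_AE[of f] by eventually_elim (simp add: h_def g_def)
    qed (use f h in \<open>auto simp: HD intro!: borel_measurable_diff borel_measurable_times\<close>)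
    finally show ?thesis using f by (simp add: g_def)
  qed
  then show ?thesis by (intro that[of "\<bar>C\<bar> + 1"]) auto
qed

definition op_norm :: real where
  "op_norm = Sup {L2_norm M (S f) |f. f \<in> H \<and> L2_norm M f = 1}"

lemma unit_vector: "\<exists>f\<in>H. L2_norm M f = 1"
proof -
  obtain f where f: "f \<in> H" "L2_norm M f > 0" using H_nontrivial by blast
  then have "(\<lambda>x. of_real (1 / L2_norm M f) * f x) \<in> H" by (intro H_scale)
  moreover have "L2_norm M (\<lambda>x. of_real (1 / L2_norm M f) * f x) = 1"
    using f by (subst L2_norm_scale) (simp add: norm_divide)
  ultimately show ?thesis by blast
qed

lemma op_norm_bdd: "bdd_above {L2_norm M (S f) |f. f \<in> H \<and> L2_norm M f = 1}"
  using S_contraction by (intro bdd_aboveI[where M = 1]) force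

lemma bounded_by_op_norm: "bounded_by op_norm"
proof -
  have *: "L2_norm M (S f) \<le> op_norm" if "f \<in> H" "L2_norm M f = 1" for f
    unfolding op_norm_def by (rule cSup_upper[OF _ op_norm_bdd]) (use that in blast)
  have "L2_norm M (S f) \<le> op_norm * L2_norm M f" if f: "f \<in> H" for f
  proof (cases "L2_norm M f = 0")
    case True
    then show ?thesis using S_contraction[OF f] by simp
  next
    case False
    then have pos: "L2_norm M f > 0" by (simp add: order_less_le)
    define a where "a = complex_of_real (1 / L2_norm M f)"
    have "(\<lambda>x. a * f x) \<in> H" using f by (intro H_scale)
    moreover have "L2_norm M (\<lambda>x. a * f x) = 1"
      using pos by (subst L2_norm_scale) (simp add: a_def norm_divide)
    ultimately have "L2_norm M (S (\<lambda>x. a * f x)) \<le> op_norm" by (rule *)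
    then show ?thesis using pos unfolding S_scale L2_norm_scale by (simp add: a_def norm_divide field_simps)
  qed
  moreover have "0 \<le> op_norm"
    using unit_vector * by (meson L2_norm_nonneg order_trans)
  ultimately show ?thesis by (simp add: bounded_by_def)
qed

text \<open>
  Let \<open>r\<close> be the norm of \<open>S\<close>. If \<open>r\<close> and \<open>-r\<close> were both outside the spectrum, then
  \<open>S\<^sup>2 - r\<^sup>2 = (S + r) (S - r)\<close> would be bounded below. But for a unit vector \<open>f\<close> symmetry gives
  \<open>\<parallel>S\<^sup>2 f - r\<^sup>2 f\<parallel>\<^sup>2 \<le> r\<^sup>2 (r\<^sup>2 - \<parallel>S f\<parallel>\<^sup>2)\<close>, and the right hand side comes arbitrarily close to zero.
\<close>

lemma op_norm_in_spectrum:
  "of_real op_norm \<in> spectrum_on M H T \<or> of_real (- op_norm) \<in> spectrum_on M H T"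
proof (rule ccontr)
  define r where "r = op_norm"
  have r0: "0 \<le> r" using bounded_by_op_norm by (simp add: bounded_by_def r_def)
  assume "\<not> ?thesis"
  then have "complex_of_real r \<notin> spectrum_on M H T" "complex_of_real (- r) \<notin> spectrum_on M H T"
    by (auto simp: r_def)
  note nin = this
  obtain C1 where C1: "C1 > 0"
      "\<And>f. f \<in> H \<Longrightarrow> L2_norm M f \<le> C1 * L2_norm M (\<lambda>x. S f x - of_real r * f x)"
    using bounded_below_of_resolvent[OF nin(1)] by blast
  obtain C2 where C2: "C2 > 0"
      "\<And>f. f \<in> H \<Longrightarrow> L2_norm M f \<le> C2 * L2_norm M (\<lambda>x. S f x - of_real (- r) * f x)"
    using bounded_below_of_resolvent[OF nin(2)] by blast
  note C = C1(1) C2(1)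
  have main: "1 \<le> (C1 * C2)\<^sup>2 * (r\<^sup>2 * (r\<^sup>2 - (L2_norm M (S f))\<^sup>2))" if f: "f \<in> H" "L2_norm M f = 1" for f
  proof -
    define g where "g = (\<lambda>x. S f x - of_real r * f x)"
    have g: "g \<in> H" unfolding g_def using f by (intro H_diff H_scale) auto
    define h where "h = (\<lambda>x. S (S f) x - of_real (r\<^sup>2) * f x)"
    have geq: "(\<lambda>x. S g x - of_real (- r) * g x) = h"
      unfolding g_def h_def S_diff S_scale by (auto simp: fun_eq_iff algebra_simps power2_eq_square)
    have "1 \<le> C1 * L2_norm M g" using C1(2)[OF f(1)] f by (simp add: g_def)
    also have "\<dots> \<le> C1 * (C2 * L2_norm M h)"
      using C2(2)[OF g] C unfolding geq by (intro mult_left_mono) auto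
    finally have 1: "1 \<le> (C1 * C2) * L2_norm M h" by (simp add: mult.assoc)
    have inner: "L2_inner M (S (S f)) (\<lambda>x. of_real (r\<^sup>2) * f x) = of_real (r\<^sup>2 * (L2_norm M (S f))\<^sup>2)"
    proof -
      have "L2_inner M (S (S f)) (\<lambda>x. of_real (r\<^sup>2) * f x) = cnj (of_real (r\<^sup>2) * L2_inner M f (S (S f)))"
        using L2_inner_commute[of M "S (S f)" "\<lambda>x. of_real (r\<^sup>2) * f x"]
        by (simp only: L2_inner_scale_left)
      also have "L2_inner M f (S (S f)) = L2_inner M (S f) (S f)"
        using f by (intro S_symmetric[symmetric]) auto
      finally show ?thesis by (simp add: L2_inner_self)
    qed
    have "(L2_norm M h)\<^sup>2 = (L2_norm M (S (S f)))\<^sup>2 - 2 * (r\<^sup>2 * (L2_norm M (S f))\<^sup>2) + (r\<^sup>2)\<^sup>2"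
      unfolding h_def using f inner
      by (subst L2_norm_diff_power2) (auto simp: HD H_scale L2_norm_scale norm_power simp del: of_real_power of_real_mult)
    also have "L2_norm M (S (S f)) \<le> r * L2_norm M (S f)"
      unfolding r_def by (rule bounded_byD[OF bounded_by_op_norm]) (use f in auto)
    then have "(L2_norm M (S (S f)))\<^sup>2 \<le> r\<^sup>2 * (L2_norm M (S f))\<^sup>2"
      by (metis L2_norm_nonneg power_mono power_mult_distrib)
    finally have 2: "(L2_norm M h)\<^sup>2 \<le> r\<^sup>2 * (r\<^sup>2 - (L2_norm M (S f))\<^sup>2)"
      by (simp add: algebra_simps power2_eq_square)
    have "1\<^sup>2 \<le> ((C1 * C2) * L2_norm M h)\<^sup>2" using 1 by (intro power_mono) auto
    also have "\<dots> = (C1 * C2)\<^sup>2 * (L2_norm M h)\<^sup>2" by (simp add: power_mult_distrib)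
    also have "\<dots> \<le> (C1 * C2)\<^sup>2 * (r\<^sup>2 * (r\<^sup>2 - (L2_norm M (S f))\<^sup>2))"
      using 2 by (intro mult_left_mono) auto
    finally show ?thesis by simp
  qed
  define \<delta> where "\<delta> = 1 / (C1 * C2)\<^sup>2"
  have \<delta>: "\<delta> > 0" using C by (simp add: \<delta>_def)
  have main': "\<delta> \<le> r\<^sup>2 * (r\<^sup>2 - (L2_norm M (S f))\<^sup>2)" if "f \<in> H" "L2_norm M f = 1" for f
    using main[OF that] C by (simp add: \<delta>_def field_simps)
  obtain f0 where f0: "f0 \<in> H" "L2_norm M f0 = 1" using unit_vector by blast
  have rpos: "r > 0" using main'[OF f0] \<delta> r0 by (cases "r = 0") auto
  have "L2_norm M (S f) \<le> sqrt (r\<^sup>2 - \<delta> / r\<^sup>2)" if "f \<in> H" "L2_norm M f = 1" for f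
    using main'[OF that] rpos by (intro real_le_rsqrt) (simp add: field_simps)
  then have "op_norm \<le> sqrt (r\<^sup>2 - \<delta> / r\<^sup>2)"
    unfolding op_norm_def using f0 by (intro cSup_least) auto
  also have "\<dots> < sqrt (r\<^sup>2)" using \<delta> rpos by (intro real_sqrt_less_mono) simp
  finally show False using rpos by (simp add: r_def)
qed

lemma op_norm_attained: "\<exists>z\<in>spectrum_on M H T. op_norm = cmod z"
proof -
  have "0 \<le> op_norm" using bounded_by_op_norm by (simp add: bounded_by_def)
  then have "op_norm = cmod (of_real op_norm)" "op_norm = cmod (of_real (- op_norm))" by simp_all
  then show ?thesis using op_norm_in_spectrum by blast
qed

lemma spectral_radius_eq_op_norm: "spectral_radius_on M H T = op_norm"
proof -
  obtain z where z: "z \<in> spectrum_on M H T" "op_norm = cmod z"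
    using op_norm_attained by blast
  have "(SUP z \<in> spectrum_on M H T. cmod z) = op_norm"
    using z spectrum_bound[OF bounded_by_op_norm] by (intro cSup_eq_maximum) (auto simp: image_iff)
  then show ?thesis by (simp add: spectral_radius_on_def)
qed

lemma spectral_radius_le_iff: "0 \<le> c \<Longrightarrow> spectral_radius_on M H T \<le> c \<longleftrightarrow> bounded_by c"
proof
  assume "bounded_by c"
  then show "spectral_radius_on M H T \<le> c"
    unfolding spectral_radius_eq_op_norm using op_norm_attained spectrum_bound by auto
next
  assume "0 \<le> c" "spectral_radius_on M H T \<le> c"
  then show "bounded_by c"
    unfolding spectral_radius_eq_op_norm using bounded_by_op_norm
    by (auto simp: bounded_by_def intro: order_trans[OF _ mult_right_mono])
qed

lemma bounded_by_spectral_radius: "bounded_by (spectral_radius_on M H T)"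
  unfolding spectral_radius_eq_op_norm by (rule bounded_by_op_norm)

end

section \<open>Reversible Markov kernels\<close>

text \<open>
  The Cauchy-Schwarz inequality against the constant function one.
\<close>

lemma (in prob_space) norm_expectation_power2_le:
  fixes f :: "'a \<Rightarrow> complex"
  assumes [measurable]: "f \<in> borel_measurable M"
  shows "ennreal ((cmod (\<integral>x. f x \<partial>M))\<^sup>2) \<le> (\<integral>\<^sup>+x. ennreal ((cmod (f x))\<^sup>2) \<partial>M)"
proof (cases "(\<integral>\<^sup>+x. ennreal ((cmod (f x))\<^sup>2) \<partial>M) < \<infinity>")
  case True
  then have f: "f \<in> L2 M" by (intro L2I_nn) auto
  have one: "(\<lambda>x. 1) \<in> L2 M" by (simp add: L2_def)
  have "cmod (L2_inner M f (\<lambda>x. 1)) \<le> L2_norm M f * L2_norm M (\<lambda>x. 1)"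
    by (rule L2_Cauchy_Schwarz[OF f one])
  then have "cmod (\<integral>x. f x \<partial>M) \<le> L2_norm M f"
    by (simp add: L2_inner_def L2_norm_def prob_space)
  then show ?thesis
    unfolding L2_norm_nn[OF f] by (intro ennreal_leI power_mono) auto
qed (auto simp: not_less top_unique)

text \<open>
  Reversibility is required for nonnegative functions, where no integrability has to be checked.
  It means that \<open>average\<close> is symmetric.
\<close>

locale reversible_kernel =
  fixes M :: "'a measure" and \<kappa> :: "'a \<Rightarrow> 'a measure"
  assumes kernel [measurable]: "\<kappa> \<in> M \<rightarrow>\<^sub>M prob_algebra M"
    and reversible: "\<And>f g. f \<in> borel_measurable M \<Longrightarrow> g \<in> borel_measurable M \<Longrightarrow>
      (\<integral>\<^sup>+x. f x * (\<integral>\<^sup>+y. g y \<partial>\<kappa> x) \<partial>M) = (\<integral>\<^sup>+x. g x * (\<integral>\<^sup>+y. f y \<partial>\<kappa> x) \<partial>M)"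
begin

definition average :: "('a \<Rightarrow> complex) \<Rightarrow> 'a \<Rightarrow> complex" where
  "average f x = (\<integral>y. f y \<partial>\<kappa> x)"

lemma kernel_sub [measurable]: "\<kappa> \<in> M \<rightarrow>\<^sub>M subprob_algebra M"
  by (rule measurable_prob_algebraD) (rule kernel)

lemma kernel_sets: "x \<in> space M \<Longrightarrow> sets (\<kappa> x) = sets M"
  and kernel_prob: "x \<in> space M \<Longrightarrow> prob_space (\<kappa> x)"
  using measurable_space[OF kernel] by (auto simp: space_prob_algebra)

lemma average_measurable [measurable]:
  assumes [measurable]: "f \<in> borel_measurable M"
  shows "average f \<in> borel_measurable M"
  unfolding average_def[abs_def]
  by (rule measurable_compose[OF kernel_sub integral_measurable_subprob_algebra]) simp

text \<open>
  Reversibility with one function equal to one says that \<open>M\<close> is invariant under the kernel; the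
  bound is Jensen's inequality for each \<open>\<kappa> x\<close>, integrated.
\<close>

lemma average_power2_le:
  assumes [measurable]: "f \<in> borel_measurable M"
  shows "(\<integral>\<^sup>+x. ennreal ((cmod (average f x))\<^sup>2) \<partial>M) \<le> (\<integral>\<^sup>+x. ennreal ((cmod (f x))\<^sup>2) \<partial>M)"
proof -
  have "(\<integral>\<^sup>+x. ennreal ((cmod (average f x))\<^sup>2) \<partial>M) \<le> (\<integral>\<^sup>+x. 1 * (\<integral>\<^sup>+y. ennreal ((cmod (f y))\<^sup>2) \<partial>\<kappa> x) \<partial>M)"
  proof (rule nn_integral_mono)
    fix x assume x: "x \<in> space M"
    have "f \<in> borel_measurable (\<kappa> x)"
      using assms by (simp add: measurable_cong_sets[OF kernel_sets[OF x] refl])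
    then show "ennreal ((cmod (average f x))\<^sup>2) \<le> 1 * (\<integral>\<^sup>+y. ennreal ((cmod (f y))\<^sup>2) \<partial>\<kappa> x)"
      unfolding average_def using prob_space.norm_expectation_power2_le[OF kernel_prob[OF x]] by simp
  qed
  also have "\<dots> = (\<integral>\<^sup>+x. ennreal ((cmod (f x))\<^sup>2) * (\<integral>\<^sup>+y. 1 \<partial>\<kappa> x) \<partial>M)"
    by (rule reversible) auto
  also have "\<dots> = (\<integral>\<^sup>+x. ennreal ((cmod (f x))\<^sup>2) \<partial>M)"
    by (intro nn_integral_cong) (simp add: prob_space.emeasure_space_1[OF kernel_prob])
  finally show ?thesis .
qed

lemma average_L2: "f \<in> L2 M \<Longrightarrow> average f \<in> L2 M"
  using average_power2_le[of f] L2_norm_nn[of f M]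
  by (intro L2I_nn) (auto simp: L2_measurable intro: le_less_trans)

lemma average_contraction: "f \<in> L2 M \<Longrightarrow> L2_norm M (average f) \<le> L2_norm M f"
  using average_power2_le[of f] by (intro L2_norm_le_nn) (auto simp: average_L2 L2_norm_nn L2_measurable)

lemma kernel_integrable_AE:
  assumes f: "f \<in> L2 M"
  shows "AE x in M. integrable (\<kappa> x) f"
proof -
  have [measurable]: "f \<in> borel_measurable M" using f by (rule L2_measurable)
  have "(\<integral>\<^sup>+x. 1 * (\<integral>\<^sup>+y. ennreal ((cmod (f y))\<^sup>2) \<partial>\<kappa> x) \<partial>M) =
      (\<integral>\<^sup>+x. ennreal ((cmod (f x))\<^sup>2) * (\<integral>\<^sup>+y. 1 \<partial>\<kappa> x) \<partial>M)"
    by (rule reversible) auto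
  also have "\<dots> = (\<integral>\<^sup>+x. ennreal ((cmod (f x))\<^sup>2) \<partial>M)"
    by (intro nn_integral_cong) (simp add: prob_space.emeasure_space_1[OF kernel_prob])
  finally have "(\<integral>\<^sup>+x. (\<integral>\<^sup>+y. ennreal ((cmod (f y))\<^sup>2) \<partial>\<kappa> x) \<partial>M) \<noteq> \<infinity>"
    using L2_norm_nn[OF f] by simp
  then have "AE x in M. (\<integral>\<^sup>+y. ennreal ((cmod (f y))\<^sup>2) \<partial>\<kappa> x) \<noteq> \<infinity>"
    by (rule nn_integral_PInf_AE[rotated]) measurable
  with AE_space show ?thesis
  proof eventually_elim
    case (elim x)
    interpret K: prob_space "\<kappa> x" using elim by (intro kernel_prob)
    have m: "f \<in> borel_measurable (\<kappa> x)"
      by (simp add: measurable_cong_sets[OF kernel_sets[OF elim(1)] refl])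
    have fK: "f \<in> L2 (\<kappa> x)" using elim m by (intro L2I_nn) (auto simp: less_top)
    have "integrable (\<kappa> x) (\<lambda>y. f y * cnj 1)"
      by (rule integrable_L2_inner[OF fK, of "\<lambda>x. 1"]) (simp add: L2_def)
    then show ?case by simp
  qed
qed

lemma L2_of_real_measurable: "(\<lambda>x. complex_of_real (f x)) \<in> L2 M \<Longrightarrow> f \<in> borel_measurable M"
  using measurable_compose[OF L2_measurable borel_measurable_Re, of "\<lambda>x. complex_of_real (f x)" M] by simp

text \<open>
  A square-integrable complex function is a linear combination of four nonnegative ones, so
  sesquilinear identities only need to be checked on nonnegative functions.
\<close>

lemma L2_nonneg_induct:
  assumes f: "f \<in> L2 M"
    and nonneg: "\<And>g :: 'a \<Rightarrow> real. (\<lambda>x. complex_of_real (g x)) \<in> L2 M \<Longrightarrow> (\<And>x. 0 \<le> g x) \<Longrightarrow> P (\<lambda>x. complex_of_real (g x))"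
    and add: "\<And>g h. g \<in> L2 M \<Longrightarrow> h \<in> L2 M \<Longrightarrow> P g \<Longrightarrow> P h \<Longrightarrow> P (\<lambda>x. g x + h x)"
    and scale: "\<And>c g. g \<in> L2 M \<Longrightarrow> P g \<Longrightarrow> P (\<lambda>x. c * g x)"
  shows "P f"
proof -
  have dominated: "(\<lambda>x. complex_of_real (g x)) \<in> L2 M"
    if "\<And>x. \<bar>g x\<bar> \<le> cmod (f x)" "g \<in> borel_measurable M" for g :: "'a \<Rightarrow> real"
  proof (rule L2I_nn)
    have "(\<integral>\<^sup>+x. ennreal ((cmod (complex_of_real (g x)))\<^sup>2) \<partial>M) \<le> (\<integral>\<^sup>+x. ennreal ((cmod (f x))\<^sup>2) \<partial>M)"
      using that by (intro nn_integral_mono ennreal_leI power_mono) auto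
    then show "(\<integral>\<^sup>+x. ennreal ((cmod (complex_of_real (g x)))\<^sup>2) \<partial>M) < \<infinity>"
      using L2_norm_nn[OF f] by (auto intro: le_less_trans)
  qed (use that in measurable)
  have real: "(\<lambda>x. complex_of_real (g x)) \<in> L2 M \<and> P (\<lambda>x. complex_of_real (g x))"
    if g: "\<And>x. \<bar>g x\<bar> \<le> cmod (f x)" and [measurable]: "g \<in> borel_measurable M" for g :: "'a \<Rightarrow> real"
  proof -
    have p: "(\<lambda>x. complex_of_real (max 0 (g x))) \<in> L2 M" "(\<lambda>x. complex_of_real (max 0 (- g x))) \<in> L2 M"
      using g by (intro dominated; simp; smt (verit))+
    have "P (\<lambda>x. complex_of_real (max 0 (g x)) + (-1) * complex_of_real (max 0 (- g x)))"
      using p by (intro add scale nonneg L2_scale) auto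
    also have "(\<lambda>x. complex_of_real (max 0 (g x)) + (-1) * complex_of_real (max 0 (- g x))) = (\<lambda>x. complex_of_real (g x))"
      by (auto simp: fun_eq_iff max_def)
    finally show ?thesis using dominated[OF g] by simp
  qed
  have [measurable]: "f \<in> borel_measurable M" using f by (rule L2_measurable)
  have "P (\<lambda>x. complex_of_real (Re (f x)) + \<i> * complex_of_real (Im (f x)))"
    using real[of "\<lambda>x. Re (f x)"] real[of "\<lambda>x. Im (f x)"]
    by (intro add scale L2_scale) (auto simp: abs_Re_le_cmod abs_Im_le_cmod)
  moreover have "(\<lambda>x. complex_of_real (Re (f x)) + \<i> * complex_of_real (Im (f x))) = f"
    by (simp add: fun_eq_iff complex_eq_iff)
  ultimately show ?thesis by simp
qed

lemma average_add_AE: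
  "f \<in> L2 M \<Longrightarrow> g \<in> L2 M \<Longrightarrow> AE x in M. average (\<lambda>y. f y + g y) x = average f x + average g x"
  using kernel_integrable_AE[of f] kernel_integrable_AE[of g]
  by (auto simp: average_def)

lemma average_scale: "average (\<lambda>y. c * f y) = (\<lambda>x. c * average f x)"
  by (simp add: average_def fun_eq_iff)

lemma average_symmetric_nonneg:
  fixes f g :: "'a \<Rightarrow> real"
  assumes f: "(\<lambda>x. complex_of_real (f x)) \<in> L2 M" "\<And>x. 0 \<le> f x"
    and g: "(\<lambda>x. complex_of_real (g x)) \<in> L2 M" "\<And>x. 0 \<le> g x"
  shows "L2_inner M (average (\<lambda>x. complex_of_real (f x))) (\<lambda>x. complex_of_real (g x)) =
    of_real (enn2real (\<integral>\<^sup>+x. ennreal (g x) * (\<integral>\<^sup>+y. ennreal (f y) \<partial>\<kappa> x) \<partial>M))"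
proof -
  let ?f = "\<lambda>x. complex_of_real (f x)" and ?g = "\<lambda>x. complex_of_real (g x)"
  have [measurable]: "f \<in> borel_measurable M" "g \<in> borel_measurable M"
    using f(1) g(1) by (auto intro: L2_of_real_measurable)
  define a where "a x = (\<integral>y. f y \<partial>\<kappa> x)" for x
  have a0: "0 \<le> a x" for x unfolding a_def using f by simp
  have av: "average ?f x = of_real (a x)" for x
    unfolding average_def a_def by (rule integral_complex_of_real)
  have [measurable]: "a \<in> borel_measurable M"
    unfolding a_def[abs_def]
    by (rule measurable_compose[OF kernel_sub integral_measurable_subprob_algebra]) simp
  have "L2_inner M (average ?f) ?g = (\<integral>x. of_real (a x * g x) \<partial>M)"
    by (simp add: L2_inner_def av)
  also have "\<dots> = of_real (\<integral>x. a x * g x \<partial>M)" by (rule integral_complex_of_real)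
  also have "(\<integral>x. a x * g x \<partial>M) = enn2real (\<integral>\<^sup>+x. ennreal (a x * g x) \<partial>M)"
    using a0 g by (intro integral_eq_nn_integral) auto
  also have "(\<integral>\<^sup>+x. ennreal (a x * g x) \<partial>M) = (\<integral>\<^sup>+x. ennreal (g x) * (\<integral>\<^sup>+y. ennreal (f y) \<partial>\<kappa> x) \<partial>M)"
  proof (rule nn_integral_cong_AE)
    show "AE x in M. ennreal (a x * g x) = ennreal (g x) * (\<integral>\<^sup>+y. ennreal (f y) \<partial>\<kappa> x)"
      using kernel_integrable_AE[OF f(1)]
    proof eventually_elim
      case (elim x)
      then have "integrable (\<kappa> x) f" using integrable_Re[OF elim] by simp
      then have "(\<integral>\<^sup>+y. ennreal (f y) \<partial>\<kappa> x) = ennreal (a x)"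
        unfolding a_def using f by (intro nn_integral_eq_integral) auto
      then show ?case using a0 g by (simp add: ennreal_mult mult.commute)
    qed
  qed
  finally show ?thesis .
qed

text \<open>
  Both sides are sesquilinear, and for nonnegative functions the claim is reversibility.
\<close>

lemma average_symmetric:
  assumes f: "f \<in> L2 M" and g: "g \<in> L2 M"
  shows "L2_inner M (average f) g = L2_inner M f (average g)"
proof -
  have lin: "L2_inner M (average (\<lambda>x. h x + h' x)) k = L2_inner M (average h) k + L2_inner M (average h') k"
    if "h \<in> L2 M" "h' \<in> L2 M" "k \<in> L2 M" for h h' k
  proof -
    have "L2_inner M (average (\<lambda>x. h x + h' x)) k = L2_inner M (\<lambda>x. average h x + average h' x) k"
      using that average_add_AE[OF that(1,2)]
      by (intro L2_inner_cong_AE) (auto intro!: average_measurable L2_measurable L2_add average_L2)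
    then show ?thesis using that by (simp add: L2_inner_add_left average_L2)
  qed
  have lin': "L2_inner M h (average (\<lambda>x. k x + k' x)) = L2_inner M h (average k) + L2_inner M h (average k')"
    if "h \<in> L2 M" "k \<in> L2 M" "k' \<in> L2 M" for h k k'
    using lin[OF that(2,3,1)] L2_inner_commute[of M h] by (metis complex_cnj_add)
  have add_right: "L2_inner M h (\<lambda>x. k x + k' x) = L2_inner M h k + L2_inner M h k'"
    if "h \<in> L2 M" "k \<in> L2 M" "k' \<in> L2 M" for h k k'
    using L2_inner_add_left[OF that(2,3,1)] L2_inner_commute[of M h] by (metis complex_cnj_add)
  have scale_right: "L2_inner M h (\<lambda>x. c * k x) = cnj c * L2_inner M h k" for h k c
    using L2_inner_scale_left[of M c k h] L2_inner_commute[of M h] by (metis complex_cnj_mult)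
  show ?thesis
    using f
  proof (rule L2_nonneg_induct)
    fix f :: "'a \<Rightarrow> real" assume f: "(\<lambda>x. complex_of_real (f x)) \<in> L2 M" "\<And>x. 0 \<le> f x"
    let ?f = "\<lambda>x. complex_of_real (f x)"
    show "L2_inner M (average ?f) g = L2_inner M ?f (average g)"
      using g
    proof (rule L2_nonneg_induct)
      fix g :: "'a \<Rightarrow> real" assume g: "(\<lambda>x. complex_of_real (g x)) \<in> L2 M" "\<And>x. 0 \<le> g x"
      let ?g = "\<lambda>x. complex_of_real (g x)"
      have [measurable]: "f \<in> borel_measurable M" "g \<in> borel_measurable M"
    using f(1) g(1) by (auto intro: L2_of_real_measurable)
      have "L2_inner M ?f (average ?g) = cnj (L2_inner M (average ?g) ?f)" by (rule L2_inner_commute)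
      also have "\<dots> = of_real (enn2real (\<integral>\<^sup>+x. ennreal (f x) * (\<integral>\<^sup>+y. ennreal (g y) \<partial>\<kappa> x) \<partial>M))"
        using average_symmetric_nonneg[OF g f] by simp
      also have "\<dots> = of_real (enn2real (\<integral>\<^sup>+x. ennreal (g x) * (\<integral>\<^sup>+y. ennreal (f y) \<partial>\<kappa> x) \<partial>M))"
        by (subst reversible) auto
      finally show "L2_inner M (average ?f) ?g = L2_inner M ?f (average ?g)"
        using average_symmetric_nonneg[OF f g] by simp
    qed (simp_all add: lin' add_right scale_right average_scale f(1) average_L2)
  qed (simp_all add: lin L2_inner_add_left L2_inner_scale_left average_scale g average_L2)
qed

end

text \<open>
  The two sides of the reversibility condition are integrals over the law \<open>\<Lambda>\<close> of a pair of
  consecutive points and over the law \<open>\<Lambda>'\<close> of the reversed pair. The two laws agree if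
  they agree on the rectangles with sides in a generator that is stable under intersection.
\<close>

lemma reversible_kernelI_generator:
  assumes M: "prob_space M" and km: "\<kappa> \<in> M \<rightarrow>\<^sub>M prob_algebra M"
    and setsG: "sets M = sigma_sets (space M) G\<^sub>0" and stable: "Int_stable G\<^sub>0"
    and sub: "G\<^sub>0 \<subseteq> Pow (space M)" and sp: "space M \<in> G\<^sub>0"
    and sym: "\<And>A B. A \<in> G\<^sub>0 \<Longrightarrow> B \<in> G\<^sub>0 \<Longrightarrow>
      (\<integral>\<^sup>+x. indicator A x * emeasure (\<kappa> x) B \<partial>M) = (\<integral>\<^sup>+x. indicator B x * emeasure (\<kappa> x) A \<partial>M)"
  shows "reversible_kernel M \<kappa>"
proof
  interpret P: prob_space M by (rule M)
  let ?LL = "M \<Otimes>\<^sub>M M"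
  define k where "k x = distr (\<kappa> x) ?LL (Pair x)" for x
  have k [measurable]: "k \<in> M \<rightarrow>\<^sub>M subprob_algebra ?LL"
    unfolding k_def[abs_def]
    by (rule measurable_distr2[OF _ measurable_prob_algebraD[OF km]]) simp
  define \<Lambda> where "\<Lambda> = M \<bind> k"
  have sets\<Lambda> [measurable_cong]: "sets \<Lambda> = sets ?LL"
    unfolding \<Lambda>_def by (rule sets_bind_measurable[OF k P.not_empty])
  have int\<Lambda>: "(\<integral>\<^sup>+z. F z \<partial>\<Lambda>) = (\<integral>\<^sup>+x. \<integral>\<^sup>+y. F (x, y) \<partial>\<kappa> x \<partial>M)" if F: "F \<in> borel_measurable ?LL" for F
  proof -
    have "(\<integral>\<^sup>+z. F z \<partial>\<Lambda>) = (\<integral>\<^sup>+x. \<integral>\<^sup>+z. F z \<partial>k x \<partial>M)" unfolding \<Lambda>_def by (rule nn_integral_bind[OF F k])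
    also have "\<dots> = (\<integral>\<^sup>+x. \<integral>\<^sup>+y. F (x, y) \<partial>\<kappa> x \<partial>M)"
    proof (rule nn_integral_cong)
      fix x assume x: "x \<in> space M"
      then have s: "sets (\<kappa> x) = sets M" using measurable_space[OF km x] by (auto simp: space_prob_algebra)
      have "Pair x \<in> \<kappa> x \<rightarrow>\<^sub>M ?LL"
        unfolding measurable_cong_sets[OF s refl] using x by (rule measurable_Pair1')
      then show "(\<integral>\<^sup>+z. F z \<partial>k x) = (\<integral>\<^sup>+y. F (x, y) \<partial>\<kappa> x)"
        unfolding k_def using F by (subst nn_integral_distr) auto
    qed
    finally show ?thesis .
  qed
  define \<Lambda>' where "\<Lambda>' = distr \<Lambda> ?LL (\<lambda>(x, y). (y, x))"
  have swap: "(\<lambda>(x, y). (y, x)) \<in> \<Lambda> \<rightarrow>\<^sub>M ?LL"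
    unfolding measurable_cong_sets[OF sets\<Lambda> refl] by (rule measurable_pair_swap')
  have rect: "emeasure \<Lambda> (A \<times> B) = (\<integral>\<^sup>+x. indicator A x * emeasure (\<kappa> x) B \<partial>M)"
    if A: "A \<in> sets M" and B: "B \<in> sets M" for A B
  proof -
    have "emeasure \<Lambda> (A \<times> B) = (\<integral>\<^sup>+z. indicator (A \<times> B) z \<partial>\<Lambda>)"
      using A B by (subst nn_integral_indicator) (auto simp: sets\<Lambda>)
    also have "\<dots> = (\<integral>\<^sup>+x. \<integral>\<^sup>+y. indicator (A \<times> B) (x, y) \<partial>\<kappa> x \<partial>M)"
      using A B by (intro int\<Lambda>) auto
    also have "\<dots> = (\<integral>\<^sup>+x. indicator A x * emeasure (\<kappa> x) B \<partial>M)"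
    proof (rule nn_integral_cong)
      fix x assume x: "x \<in> space M"
      then have s: "sets (\<kappa> x) = sets M" using measurable_space[OF km x] by (auto simp: space_prob_algebra)
      have "(\<integral>\<^sup>+y. indicator (A \<times> B) (x, y) \<partial>\<kappa> x) = (\<integral>\<^sup>+y. indicator A x * indicator B y \<partial>\<kappa> x)"
        by (intro nn_integral_cong) (auto simp: indicator_def)
      also have "\<dots> = indicator A x * emeasure (\<kappa> x) B"
        using B s by (subst nn_integral_cmult) auto
      finally show "(\<integral>\<^sup>+y. indicator (A \<times> B) (x, y) \<partial>\<kappa> x) = indicator A x * emeasure (\<kappa> x) B" .
    qed
    finally show ?thesis .
  qed
  define G where "G = {A \<times> B |A B. A \<in> G\<^sub>0 \<and> B \<in> G\<^sub>0}"
  have setsLL: "sets ?LL = sigma_sets (space M \<times> space M) G"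
  proof -
    have "sets ?LL = sets (sigma (space M \<times> space M) G)"
      unfolding G_def by (rule sets_pair_eq[OF sub setsG _ _ _ sub setsG, of "{space M}" "{space M}"]) (use sp in auto)
    also have "G \<subseteq> Pow (space M \<times> space M)" using sub unfolding G_def by blast
    then have "sets (sigma (space M \<times> space M) G) = sigma_sets (space M \<times> space M) G" by (rule sets_measure_of)
    finally show ?thesis .
  qed
  have os: "A \<in> sets M" if "A \<in> G\<^sub>0" for A
    unfolding setsG using that by (rule sigma_sets.Basic)
  have "\<Lambda> = \<Lambda>'"
  proof (rule measure_eqI_generator_eq[where E = G and \<Omega> = "space M \<times> space M" and A = "\<lambda>_. space M \<times> space M"])
    show "Int_stable G"
    proof (rule Int_stableI)
      fix a b assume "a \<in> G" "b \<in> G"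
      then obtain A B A' B' where "a = A \<times> B" "b = A' \<times> B'" "A \<in> G\<^sub>0" "B \<in> G\<^sub>0"
        "A' \<in> G\<^sub>0" "B' \<in> G\<^sub>0" unfolding G_def by blast
      then show "a \<inter> b \<in> G"
        unfolding G_def using Int_stableD[OF stable] by (auto simp: Times_Int_Times)
    qed
    show "G \<subseteq> Pow (space M \<times> space M)" using sub unfolding G_def by blast
    show "sets \<Lambda> = sigma_sets (space M \<times> space M) G" unfolding sets\<Lambda> by (rule setsLL)
    show "sets \<Lambda>' = sigma_sets (space M \<times> space M) G" unfolding \<Lambda>'_def sets_distr by (rule setsLL)
    show "range (\<lambda>_. space M \<times> space M) \<subseteq> G" using sp unfolding G_def by auto
    show "emeasure \<Lambda> (space M \<times> space M) \<noteq> \<infinity>" for i :: nat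
    proof -
      have "emeasure \<Lambda> (space M \<times> space M) = (\<integral>\<^sup>+x. indicator (space M) x * emeasure (\<kappa> x) (space M) \<partial>M)"
        by (rule rect) auto
      also have "\<dots> \<le> (\<integral>\<^sup>+x. 1 \<partial>M)"
      proof (rule nn_integral_mono)
        fix x assume x: "x \<in> space M"
        have "prob_space (\<kappa> x)" using measurable_space[OF km x] by (auto simp: space_prob_algebra)
        then show "indicator (space M) x * emeasure (\<kappa> x) (space M) \<le> 1"
          using prob_space.emeasure_le_1 by (auto simp: indicator_def)
      qed
      finally show ?thesis by (auto simp: P.emeasure_space_1 top_unique)
    qed
    fix X assume "X \<in> G"
    then obtain A B where X: "X = A \<times> B" "A \<in> G\<^sub>0" "B \<in> G\<^sub>0" unfolding G_def by blast
    have "emeasure \<Lambda>' X = emeasure \<Lambda> ((\<lambda>(x, y). (y, x)) -` X \<inter> space \<Lambda>)"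
      unfolding \<Lambda>'_def using X os by (intro emeasure_distr[OF swap]) auto
    also have "(\<lambda>(x, y). (y, x)) -` X \<inter> space \<Lambda> = B \<times> A"
      using X(1) sets_eq_imp_space_eq[OF sets\<Lambda>] sub X(2,3) by (auto simp: space_pair_measure)
    finally show "emeasure \<Lambda> X = emeasure \<Lambda>' X"
      using sym[OF X(2,3)] rect[OF os[OF X(2)] os[OF X(3)]] rect[OF os[OF X(3)] os[OF X(2)]] X(1) by simp
  qed auto
  then have swapint: "(\<integral>\<^sup>+z. F z \<partial>\<Lambda>) = (\<integral>\<^sup>+z. F (case z of (x, y) \<Rightarrow> (y, x)) \<partial>\<Lambda>)" if F: "F \<in> borel_measurable ?LL" for F
    using nn_integral_distr[OF swap, of F] F unfolding \<Lambda>'_def by simp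
  show "\<kappa> \<in> M \<rightarrow>\<^sub>M prob_algebra M" by (rule km)
  fix f g :: "'a \<Rightarrow> ennreal" assume f [measurable]: "f \<in> borel_measurable M" and g [measurable]: "g \<in> borel_measurable M"
  have prod: "(\<integral>\<^sup>+z. f (fst z) * g (snd z) \<partial>\<Lambda>) = (\<integral>\<^sup>+x. f x * (\<integral>\<^sup>+y. g y \<partial>\<kappa> x) \<partial>M)"
    if [measurable]: "f \<in> borel_measurable M" "g \<in> borel_measurable M" for f g
  proof -
    have "(\<integral>\<^sup>+z. f (fst z) * g (snd z) \<partial>\<Lambda>) = (\<integral>\<^sup>+x. \<integral>\<^sup>+y. f x * g y \<partial>\<kappa> x \<partial>M)"
      by (subst int\<Lambda>) auto
    also have "\<dots> = (\<integral>\<^sup>+x. f x * (\<integral>\<^sup>+y. g y \<partial>\<kappa> x) \<partial>M)"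
    proof (rule nn_integral_cong)
      fix x assume x: "x \<in> space M"
      have s: "sets (\<kappa> x) = sets M" using measurable_space[OF km x] by (auto simp: space_prob_algebra)
      show "(\<integral>\<^sup>+y. f x * g y \<partial>\<kappa> x) = f x * (\<integral>\<^sup>+y. g y \<partial>\<kappa> x)"
        by (rule nn_integral_cmult) (simp add: measurable_cong_sets[OF s refl] that(2))
    qed
    finally show ?thesis .
  qed
  have "(\<integral>\<^sup>+z. f (fst z) * g (snd z) \<partial>\<Lambda>) = (\<integral>\<^sup>+z. g (fst z) * f (snd z) \<partial>\<Lambda>)"
    by (subst swapint) (auto simp: case_prod_beta mult.commute)
  then show "(\<integral>\<^sup>+x. f x * (\<integral>\<^sup>+y. g y \<partial>\<kappa> x) \<partial>M) = (\<integral>\<^sup>+x. g x * (\<integral>\<^sup>+y. f y \<partial>\<kappa> x) \<partial>M)"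
    unfolding prod[OF f g] prod[OF g f] .
qed

section \<open>Balls and isomorphisms of graphs\<close>

lemma graphs_sym: "E \<in> graphs D \<Longrightarrow> (u, v) \<in> E \<longleftrightarrow> (v, u) \<in> E"
  by (auto simp: graphs_def sym_def)

lemma edge_Field: "(u, v) \<in> E \<Longrightarrow> u \<in> Field E" "(u, v) \<in> E \<Longrightarrow> v \<in> Field E"
  by (auto simp: Field_def)

lemma neighbours_empty: "u \<notin> Field E \<Longrightarrow> E `` {u} = {}"
  by (auto simp: Field_def)

lemma neighbours_finite: "E \<in> graphs D \<Longrightarrow> finite (E `` {u})"
  by (cases "u \<in> Field E") (auto simp: graphs_def neighbours_empty)

lemma neighbours_nonempty: "E \<in> graphs D \<Longrightarrow> u \<in> Field E \<Longrightarrow> E `` {u} \<noteq> {}"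
  using graphs_sym[of E D] by (auto simp: Field_def)

lemma degree_pos: "E \<in> graphs D \<Longrightarrow> u \<in> Field E \<Longrightarrow> 0 < degree E u"
  using neighbours_nonempty[of E D u] neighbours_finite[of E D u] by (simp add: degree_def card_gt_0_iff)

lemma degree_le: "E \<in> graphs D \<Longrightarrow> u \<in> Field E \<Longrightarrow> degree E u \<le> D"
  by (auto simp: graphs_def)

lemma connected_path: "E \<in> graphs D \<Longrightarrow> u \<in> Field E \<Longrightarrow> v \<in> Field E \<Longrightarrow> (u, v) \<in> E\<^sup>*"
  by (auto simp: graphs_def)

lemma gball_0 [simp]: "gball E 0 u = {u}"
  by (auto simp: gball_def)

lemma gball_self [simp]: "u \<in> gball E r u"
  by (auto simp: gball_def intro!: exI[of _ 0])

lemma gball_mono: "r \<le> s \<Longrightarrow> gball E r u \<subseteq> gball E s u"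
  unfolding gball_def by (auto intro: order_trans)

lemma relpow_gball: "(u, v) \<in> E ^^ k \<Longrightarrow> k \<le> r \<Longrightarrow> v \<in> gball E r u"
  by (auto simp: gball_def)

lemma gball_Suc: "gball E (Suc r) u = gball E r u \<union> E `` gball E r u"
proof (intro equalityI subsetI)
  fix w assume "w \<in> gball E (Suc r) u"
  then obtain k where k: "k \<le> Suc r" "(u, w) \<in> E ^^ k" by (auto simp: gball_def)
  show "w \<in> gball E r u \<union> E `` gball E r u"
  proof (cases k)
    case 0 then show ?thesis using k by auto
  next
    case (Suc j)
    then obtain x where "(u, x) \<in> E ^^ j" "(x, w) \<in> E" using k by auto
    then show ?thesis using relpow_gball[of u x j E r] k(1) Suc by blast
  qed
next
  fix w assume "w \<in> gball E r u \<union> E `` gball E r u"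
  then show "w \<in> gball E (Suc r) u"
  proof
    assume "w \<in> gball E r u" then show ?thesis using gball_mono[of r "Suc r" E u] le_SucI[OF order_refl] by blast
  next
    assume "w \<in> E `` gball E r u"
    then obtain x k where "k \<le> r" "(u, x) \<in> E ^^ k" "(x, w) \<in> E" by (auto simp: gball_def)
    then have "(u, w) \<in> E ^^ Suc k" "Suc k \<le> Suc r" by (auto intro: relpow_Suc_I)
    then show ?thesis by (rule relpow_gball)
  qed
qed

lemma gball_Field: "u \<in> Field E \<Longrightarrow> gball E r u \<subseteq> Field E"
  by (induction r) (auto simp: gball_Suc Field_def)

lemma gball_trans: "w \<in> gball E k u \<Longrightarrow> x \<in> gball E s w \<Longrightarrow> x \<in> gball E (k + s) u"
proof -
  assume "w \<in> gball E k u" "x \<in> gball E s w"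
  then obtain i j where "i \<le> k" "j \<le> s" "(u, w) \<in> E ^^ i" "(w, x) \<in> E ^^ j" by (auto simp: gball_def)
  then show ?thesis by (intro relpow_gball[of u x "i + j" E]) (auto simp: relpow_add)
qed

lemma relpow_sym: "E \<in> graphs D \<Longrightarrow> (u, v) \<in> E ^^ k \<Longrightarrow> (v, u) \<in> E ^^ k"
proof (induction k arbitrary: v)
  case (Suc k)
  then obtain w where "(u, w) \<in> E ^^ k" "(w, v) \<in> E" by auto
  then have "(w, u) \<in> E ^^ k" "(v, w) \<in> E" using Suc graphs_sym[of E D] by auto
  then show ?case by (rule relpow_Suc_I2[rotated])
qed auto

lemma gball_sym: "E \<in> graphs D \<Longrightarrow> v \<in> gball E k u \<Longrightarrow> u \<in> gball E k v"
  using relpow_sym[of E D u v] relpow_gball[of v u _ E k] by (auto simp: gball_def[of E k u])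

lemma finite_gball [simp]: "E \<in> graphs D \<Longrightarrow> finite (gball E r u)"
proof (induction r)
  case (Suc r)
  then show ?case
    unfolding gball_Suc Image_eq_UN[of E "gball E r u"] by (auto intro: neighbours_finite)
qed simp

lemma card_gball_le:
  assumes E: "E \<in> graphs D" shows "card (gball E r u) \<le> (1 + D) ^ r"
proof (induction r)
  case (Suc r)
  have nb: "card (E `` {w}) \<le> D" for w
    using degree_le[OF E, of w] by (cases "w \<in> Field E") (auto simp: degree_def neighbours_empty)
  have "card (gball E (Suc r) u) \<le> card (gball E r u) + card (\<Union>w\<in>gball E r u. E `` {w})"
    unfolding gball_Suc Image_eq_UN[of E "gball E r u"] by (rule card_Un_le)
  also have "card (\<Union>w\<in>gball E r u. E `` {w}) \<le> (\<Sum>w\<in>gball E r u. card (E `` {w}))"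
    by (rule card_UN_le) (simp add: finite_gball[OF E])
  also have "\<dots> \<le> (\<Sum>w\<in>gball E r u. D)" by (intro sum_mono nb)
  also have "card (gball E r u) + \<dots> = (1 + D) * card (gball E r u)" by simp
  also have "\<dots> \<le> (1 + D) * (1 + D) ^ r" by (rule mult_left_mono) (use Suc in auto)
  finally show ?case by simp
qed simp

lemma ball_isoD:
  assumes "ball_iso \<phi> r E u F v"
  shows "bij_betw \<phi> (gball E r u) (gball F r v)" "\<phi> u = v" "inj_on \<phi> (gball E r u)"
    "\<phi> ` gball E r u = gball F r v"
    "\<And>a b. a \<in> gball E r u \<Longrightarrow> b \<in> gball E r u \<Longrightarrow> (a, b) \<in> E \<longleftrightarrow> (\<phi> a, \<phi> b) \<in> F"
  using assms by (auto simp: ball_iso_def bij_betw_def)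

lemma ball_iso_id: "ball_iso (\<lambda>x. x) r E u E u"
  by (auto simp: ball_iso_def bij_betw_def)

lemma ball_iso_comp:
  assumes "ball_iso \<phi> r E u F v" "ball_iso \<psi> r F v G w"
  shows "ball_iso (\<lambda>x. \<psi> (\<phi> x)) r E u G w"
proof -
  have "\<phi> a \<in> gball F r v" if "a \<in> gball E r u" for a
    using that ball_isoD(4)[OF assms(1)] by auto
  then show ?thesis
    using bij_betw_trans[OF ball_isoD(1)[OF assms(1)] ball_isoD(1)[OF assms(2)]] ball_isoD(2)[OF assms(1)]
      ball_isoD(2)[OF assms(2)] ball_isoD(5)[OF assms(1)] ball_isoD(5)[OF assms(2)]
    by (simp add: ball_iso_def o_def)
qed

lemma ball_iso_inv:
  assumes "ball_iso \<phi> r E u F v"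
  shows "ball_iso (inv_into (gball E r u) \<phi>) r F v E u"
proof -
  let ?B = "gball E r u"
  note * = ball_isoD[OF assms]
  have b: "bij_betw (inv_into ?B \<phi>) (gball F r v) ?B" by (rule bij_betw_inv_into[OF *(1)])
  have f: "a \<in> gball F r v \<Longrightarrow> \<phi> (inv_into ?B \<phi> a) = a" for a
    using *(4) by (metis f_inv_into_f)
  have "inv_into ?B \<phi> v = u" using *(2,3) inv_into_f_f[of \<phi> ?B u] by simp
  moreover have "(a, b) \<in> F \<longleftrightarrow> (inv_into ?B \<phi> a, inv_into ?B \<phi> b) \<in> E"
    if "a \<in> gball F r v" "b \<in> gball F r v" for a b
    using *(5)[of "inv_into ?B \<phi> a" "inv_into ?B \<phi> b"] f that b by (auto simp: bij_betw_def)
  ultimately show ?thesis using b by (auto simp: ball_iso_def)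
qed

lemma ball_iso_walk:
  assumes iso: "ball_iso \<phi> r E u F v" and w: "w \<in> gball E k u" and x: "(w, x) \<in> E ^^ j" and "k + j \<le> r"
  shows "(\<phi> w, \<phi> x) \<in> F ^^ j"
  using x \<open>k + j \<le> r\<close>
proof (induction j arbitrary: x)
  case (Suc j)
  then obtain y where y: "(w, y) \<in> E ^^ j" "(y, x) \<in> E" by auto
  have "y \<in> gball E (k + j) u" "x \<in> gball E (k + Suc j) u"
    using gball_trans[OF w relpow_gball[OF y(1) order_refl]]
      gball_trans[OF w relpow_gball[OF Suc.prems(1) order_refl]] by auto
  then have "y \<in> gball E r u" "x \<in> gball E r u"
    using Suc.prems gball_mono[of "k + j" r E u] gball_mono[of "k + Suc j" r E u] by auto
  then have "(\<phi> y, \<phi> x) \<in> F" using ball_isoD(5)[OF iso] y by auto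
  then show ?case using Suc y by auto
qed simp

text \<open>
  A walk of length \<open>s\<close> from a vertex at distance at most \<open>k\<close> from the root stays in the ball of
  radius \<open>k + s\<close>, so an isomorphism of balls carries smaller balls around other centres along.
\<close>

lemma ball_iso_recentre:
  assumes iso: "ball_iso \<phi> r E u F v" and w: "w \<in> gball E k u" and ks: "k + s \<le> r"
  shows "ball_iso \<phi> s E w F (\<phi> w)"
proof -
  note * = ball_isoD[OF iso]
  have sub: "gball E s w \<subseteq> gball E r u"
    using gball_trans[OF w] gball_mono[OF ks, of E u] by blast
  obtain i where i: "i \<le> k" "(u, w) \<in> E ^^ i" using w by (auto simp: gball_def)
  have vw: "(v, \<phi> w) \<in> F ^^ i"
    using ball_iso_walk[OF iso gball_self[of u E 0] i(2)] i ks *(2) by simp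
  have pull: "\<exists>x. y = \<phi> x \<and> x \<in> gball E r u \<and> (w, x) \<in> E ^^ j" if "(\<phi> w, y) \<in> F ^^ j" "j \<le> s" for y j
    using that
  proof (induction j arbitrary: y)
    case 0
    then show ?case using sub by auto
  next
    case (Suc j)
    then obtain y' where y': "(\<phi> w, y') \<in> F ^^ j" "(y', y) \<in> F" by auto
    then obtain x' where x': "y' = \<phi> x'" "x' \<in> gball E r u" "(w, x') \<in> E ^^ j" using Suc by auto
    have "(v, y) \<in> F ^^ (i + Suc j)" unfolding relpow_add by (rule relcompI[OF vw Suc.prems(1)])
    then have "y \<in> gball F r v" by (rule relpow_gball) (use i ks Suc in auto)
    then obtain x where x: "x \<in> gball E r u" "y = \<phi> x" using *(4) by auto
    then have "(x', x) \<in> E" using *(5)[of x' x] x' y' by auto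
    then show ?case using x x' by auto
  qed
  have "\<phi> ` gball E s w = gball F s (\<phi> w)"
  proof (intro equalityI subsetI)
    fix y assume "y \<in> \<phi> ` gball E s w"
    then obtain x j where "y = \<phi> x" "j \<le> s" "(w, x) \<in> E ^^ j" by (auto simp: gball_def)
    then show "y \<in> gball F s (\<phi> w)"
      using ball_iso_walk[OF iso w, of x j] ks by (auto intro: relpow_gball)
  next
    fix y assume "y \<in> gball F s (\<phi> w)"
    then show "y \<in> \<phi> ` gball E s w" using pull by (fastforce simp: gball_def)
  qed
  moreover have "inj_on \<phi> (gball E s w)" using *(3) sub by (rule inj_on_subset)
  moreover have "\<forall>a\<in>gball E s w. \<forall>b\<in>gball E s w. (a, b) \<in> E \<longleftrightarrow> (\<phi> a, \<phi> b) \<in> F"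
    by (intro ballI *(5) subsetD[OF sub])
  ultimately show ?thesis unfolding ball_iso_def bij_betw_def by blast
qed

lemma ball_iso_mono: "ball_iso \<phi> r E u F v \<Longrightarrow> s \<le> r \<Longrightarrow> ball_iso \<phi> s E u F v"
  using ball_iso_recentre[of \<phi> r E u F v u 0 s] by (simp add: ball_isoD(2))

lemma ball_iso_neighbours:
  assumes "ball_iso \<phi> r E u F v" "0 < r"
  shows "bij_betw \<phi> (E `` {u}) (F `` {v})"
proof -
  have iso: "ball_iso \<phi> 1 E u F v" using assms ball_iso_mono[of \<phi> r E u F v 1] by simp
  note * = ball_isoD[OF iso]
  have sub: "E `` {u} \<subseteq> gball E 1 u" "F `` {v} \<subseteq> gball F 1 v" by (auto simp: gball_Suc)
  have "\<phi> ` (E `` {u}) = F `` {v}"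
  proof (intro equalityI subsetI)
    fix y assume "y \<in> \<phi> ` (E `` {u})" then show "y \<in> F `` {v}"
      using *(5)[of u] *(2) sub by auto
  next
    fix y assume y: "y \<in> F `` {v}"
    then obtain x where "x \<in> gball E 1 u" "y = \<phi> x" using *(4) sub by blast
    then show "y \<in> \<phi> ` (E `` {u})" using *(5)[of u x] *(2) y by auto
  qed
  moreover have "inj_on \<phi> (E `` {u})" using *(3) sub(1) by (rule inj_on_subset)
  ultimately show ?thesis by (simp add: bij_betw_def)
qed

lemma graph_isoD:
  assumes "graph_iso \<phi> E F"
  shows "bij_betw \<phi> (Field E) (Field F)" "inj_on \<phi> (Field E)" "\<phi> ` Field E = Field F"
    "\<And>a b. a \<in> Field E \<Longrightarrow> b \<in> Field E \<Longrightarrow> (a, b) \<in> E \<longleftrightarrow> (\<phi> a, \<phi> b) \<in> F"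
  using assms by (auto simp: graph_iso_def bij_betw_def)

lemma graph_iso_id: "graph_iso (\<lambda>x. x) E E"
  by (auto simp: graph_iso_def bij_betw_def)

lemma graph_iso_comp:
  assumes "graph_iso \<phi> E F" "graph_iso \<psi> F G"
  shows "graph_iso (\<lambda>x. \<psi> (\<phi> x)) E G"
proof -
  have "\<phi> a \<in> Field F" if "a \<in> Field E" for a
    using that graph_isoD(3)[OF assms(1)] by auto
  then show ?thesis
    using bij_betw_trans[OF graph_isoD(1)[OF assms(1)] graph_isoD(1)[OF assms(2)]]
      graph_isoD(4)[OF assms(1)] graph_isoD(4)[OF assms(2)]
    by (simp add: graph_iso_def o_def)
qed

lemma graph_iso_inv:
  assumes "graph_iso \<phi> E F"
  shows "graph_iso (inv_into (Field E) \<phi>) F E"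
proof -
  note * = graph_isoD[OF assms]
  have b: "bij_betw (inv_into (Field E) \<phi>) (Field F) (Field E)" by (rule bij_betw_inv_into[OF *(1)])
  have f: "a \<in> Field F \<Longrightarrow> \<phi> (inv_into (Field E) \<phi> a) = a" for a
    using *(3) by (metis f_inv_into_f)
  have "(a, c) \<in> F \<longleftrightarrow> (inv_into (Field E) \<phi> a, inv_into (Field E) \<phi> c) \<in> E"
    if "a \<in> Field F" "c \<in> Field F" for a c
    using *(4)[of "inv_into (Field E) \<phi> a" "inv_into (Field E) \<phi> c"] f that b by (auto simp: bij_betw_def)
  then show ?thesis using b by (auto simp: graph_iso_def)
qed

lemma graph_iso_walk:
  assumes iso: "graph_iso \<phi> E F" and u: "u \<in> Field E" and "(u, x) \<in> E ^^ j"
  shows "x \<in> Field E \<and> (\<phi> u, \<phi> x) \<in> F ^^ j"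
  using assms(3)
proof (induction j arbitrary: x)
  case (Suc j)
  then obtain y where y: "(u, y) \<in> E ^^ j" "(y, x) \<in> E" by auto
  have yx: "y \<in> Field E" "(\<phi> u, \<phi> y) \<in> F ^^ j" "x \<in> Field E"
    using Suc.IH[OF y(1)] edge_Field(2)[OF y(2)] by auto
  then have "(\<phi> y, \<phi> x) \<in> F" using graph_isoD(4)[OF iso yx(1,3)] y(2) by blast
  with yx show ?case by (auto intro: relpow_Suc_I)
qed (use u in auto)

lemma graph_iso_ball_iso:
  assumes iso: "graph_iso \<phi> E F" and u: "u \<in> Field E"
  shows "ball_iso \<phi> r E u F (\<phi> u)"
proof -
  note * = graph_isoD[OF iso]
  have fu: "\<phi> u \<in> Field F" using * u by auto
  have "\<phi> ` gball E r u = gball F r (\<phi> u)"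
  proof (intro equalityI subsetI)
    fix y assume "y \<in> \<phi> ` gball E r u"
    then obtain x j where "y = \<phi> x" "j \<le> r" "(u, x) \<in> E ^^ j" by (auto simp: gball_def)
    then show "y \<in> gball F r (\<phi> u)"
      using graph_iso_walk[OF iso u] by (auto intro: relpow_gball)
  next
    fix y assume y: "y \<in> gball F r (\<phi> u)"
    then obtain j where j: "j \<le> r" "(\<phi> u, y) \<in> F ^^ j" by (auto simp: gball_def)
    have "(inv_into (Field E) \<phi> (\<phi> u), inv_into (Field E) \<phi> y) \<in> E ^^ j"
      using graph_iso_walk[OF graph_iso_inv[OF iso] fu j(2)] by simp
    then have "inv_into (Field E) \<phi> y \<in> gball E r u"
      using inv_into_f_f[OF *(2) u] j(1) by (auto intro: relpow_gball)
    moreover have "y = \<phi> (inv_into (Field E) \<phi> y)"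
      using subsetD[OF gball_Field[OF fu] y] *(3) f_inv_into_f[of y \<phi> "Field E"] by simp
    ultimately show "y \<in> \<phi> ` gball E r u" by blast
  qed
  moreover have "inj_on \<phi> (gball E r u)" using *(2) gball_Field[OF u] by (rule inj_on_subset)
  moreover have "\<forall>a\<in>gball E r u. \<forall>b\<in>gball E r u. (a, b) \<in> E \<longleftrightarrow> (\<phi> a, \<phi> b) \<in> F"
    by (intro ballI *(4) subsetD[OF gball_Field[OF u, of r]])
  ultimately show ?thesis unfolding ball_iso_def bij_betw_def by blast
qed

section \<open>Isomorphism classes\<close>

lemma rep_mem: "equiv A r \<Longrightarrow> x \<in> A // r \<Longrightarrow> rep x \<in> x"
  unfolding rep_def by (rule someI_ex) (metis in_quotient_imp_non_empty equals0I)

lemma rep_in: "equiv A r \<Longrightarrow> x \<in> A // r \<Longrightarrow> rep x \<in> A"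
  using rep_mem in_quotient_imp_subset by blast

lemma class_rep: "equiv A r \<Longrightarrow> x \<in> A // r \<Longrightarrow> r `` {rep x} = x"
  by (metis rep_mem Image_singleton_iff quotientE equiv_class_eq_iff)

lemma equiv_rooted_iso: "equiv (rooted_graphs D) (rooted_iso D)"
proof (rule equivI)
  show "refl_on (rooted_graphs D) (rooted_iso D)"
    by (auto simp: refl_on_def rooted_iso_def intro!: exI[of _ "\<lambda>x. x"] graph_iso_id)
  show "sym (rooted_iso D)"
  proof (rule symI)
    fix a b assume "(a, b) \<in> rooted_iso D"
    then obtain E u F v \<phi> where *: "a = (E, u)" "b = (F, v)" "(E, u) \<in> rooted_graphs D" "(F, v) \<in> rooted_graphs D"
      "graph_iso \<phi> E F" "\<phi> u = v" by (auto simp: rooted_iso_def)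
    then have "inv_into (Field E) \<phi> v = u"
      using inv_into_f_f[OF graph_isoD(2)[OF *(5)], of u] by (auto simp: rooted_graphs_def)
    then show "(b, a) \<in> rooted_iso D" using * graph_iso_inv[OF *(5)] by (auto simp: rooted_iso_def)
  qed
  show "trans (rooted_iso D)"
    by (rule transI) (force simp: rooted_iso_def intro: graph_iso_comp)
qed (auto simp: rooted_iso_def)

lemma equiv_birooted_iso: "equiv (birooted_graphs D) (birooted_iso D)"
proof (rule equivI)
  show "refl_on (birooted_graphs D) (birooted_iso D)"
    by (auto simp: refl_on_def birooted_iso_def intro!: exI[of _ "\<lambda>x. x"] graph_iso_id)
  show "sym (birooted_iso D)"
  proof (rule symI)
    fix a b assume "(a, b) \<in> birooted_iso D"
    then obtain E u u' F v v' \<phi> where *: "a = (E, u, u')" "b = (F, v, v')"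
      "(E, u, u') \<in> birooted_graphs D" "(F, v, v') \<in> birooted_graphs D"
      "graph_iso \<phi> E F" "\<phi> u = v" "\<phi> u' = v'" by (auto simp: birooted_iso_def)
    then have "inv_into (Field E) \<phi> v = u" "inv_into (Field E) \<phi> v' = u'"
      using inv_into_f_f[OF graph_isoD(2)[OF *(5)], of u] inv_into_f_f[OF graph_isoD(2)[OF *(5)], of u']
      by (auto simp: birooted_graphs_def)
    then show "(b, a) \<in> birooted_iso D" using * graph_iso_inv[OF *(5)] by (auto simp: birooted_iso_def)
  qed
  show "trans (birooted_iso D)"
    by (rule transI) (force simp: birooted_iso_def intro: graph_iso_comp)
qed (auto simp: birooted_iso_def)

lemma equiv_labelled_iso: "equiv (labelled_graphs D) (labelled_iso D)"
proof (rule equivI)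
  show "refl_on (labelled_graphs D) (labelled_iso D)"
    by (auto simp: refl_on_def labelled_iso_def intro!: exI[of _ "\<lambda>x. x"] graph_iso_id)
  show "sym (labelled_iso D)"
  proof (rule symI)
    fix a b assume "(a, b) \<in> labelled_iso D"
    then obtain E \<xi> u F \<eta> v \<phi> where *: "a = (E, \<xi>, u)" "b = (F, \<eta>, v)"
      "(E, \<xi>, u) \<in> labelled_graphs D" "(F, \<eta>, v) \<in> labelled_graphs D"
      "graph_iso \<phi> E F" "\<phi> u = v" "\<And>w. w \<in> Field E \<Longrightarrow> \<eta> (\<phi> w) = \<xi> w" by (auto simp: labelled_iso_def)
    let ?\<psi> = "inv_into (Field E) \<phi>"
    have "?\<psi> v = u"
      using * inv_into_f_f[OF graph_isoD(2)[OF *(5)], of u] by (auto simp: labelled_graphs_def)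
    moreover have "\<xi> (?\<psi> w) = \<eta> w" if "w \<in> Field F" for w
      using *(7)[of "?\<psi> w"] graph_isoD(3)[OF *(5)] that by (metis f_inv_into_f inv_into_into)
    ultimately show "(b, a) \<in> labelled_iso D"
      using * graph_iso_inv[OF *(5)] by (auto simp: labelled_iso_def)
  qed
  show "trans (labelled_iso D)"
  proof (rule transI)
    fix a b c assume "(a, b) \<in> labelled_iso D" "(b, c) \<in> labelled_iso D"
    then obtain E \<xi> u F \<eta> v G \<zeta> w \<phi> \<psi> where *: "a = (E, \<xi>, u)" "b = (F, \<eta>, v)" "c = (G, \<zeta>, w)"
      "(E, \<xi>, u) \<in> labelled_graphs D" "(G, \<zeta>, w) \<in> labelled_graphs D"
      "graph_iso \<phi> E F" "\<phi> u = v" "\<And>w. w \<in> Field E \<Longrightarrow> \<eta> (\<phi> w) = \<xi> w"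
      "graph_iso \<psi> F G" "\<psi> v = w" "\<And>w. w \<in> Field F \<Longrightarrow> \<zeta> (\<psi> w) = \<eta> w"
      by (auto simp: labelled_iso_def)
    have "\<zeta> (\<psi> (\<phi> x)) = \<xi> x" if "x \<in> Field E" for x
    proof -
      have "\<phi> x \<in> Field F" using that graph_isoD(3)[OF *(6)] by blast
      then show ?thesis using *(8)[OF that] *(11) by simp
    qed
    then show "(a, c) \<in> labelled_iso D"
      using * graph_iso_comp[OF *(6,9)] by (auto simp: labelled_iso_def intro!: exI[of _ "\<lambda>x. \<psi> (\<phi> x)"])
  qed
qed (auto simp: labelled_iso_def)

lemma rooted_class_eqI:
  assumes "(E, u) \<in> rooted_graphs D" "(F, v) \<in> rooted_graphs D" "graph_iso \<phi> E F" "\<phi> u = v"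
  shows "rooted_class D E u = rooted_class D F v"
  by (rule equiv_class_eq[OF equiv_rooted_iso]) (use assms in \<open>auto simp: rooted_iso_def\<close>)

lemma labelled_class_eqI:
  assumes "(E, \<xi>, u) \<in> labelled_graphs D" "(F, \<eta>, v) \<in> labelled_graphs D" "graph_iso \<phi> E F" "\<phi> u = v"
    "\<And>w. w \<in> Field E \<Longrightarrow> \<eta> (\<phi> w) = \<xi> w"
  shows "labelled_class D E \<xi> u = labelled_class D F \<eta> v"
  by (rule equiv_class_eq[OF equiv_labelled_iso]) (use assms in \<open>auto simp: labelled_iso_def\<close>)

lemma rooted_class_eqE:
  assumes "(E, u) \<in> rooted_graphs D" "(F, v) \<in> rooted_graphs D" "rooted_class D E u = rooted_class D F v"
  obtains \<phi> where "graph_iso \<phi> E F" "\<phi> u = v"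
  using eq_equiv_class[OF assms(3) equiv_rooted_iso assms(2)] by (auto simp: rooted_iso_def)

lemma birooted_class_eqE:
  assumes "(E, u, u') \<in> birooted_graphs D" "(F, v, v') \<in> birooted_graphs D" "birooted_class D E u u' = birooted_class D F v v'"
  obtains \<phi> where "graph_iso \<phi> E F" "\<phi> u = v" "\<phi> u' = v'"
  using eq_equiv_class[OF assms(3) equiv_birooted_iso assms(2)] by (auto simp: birooted_iso_def)

lemma labelled_class_eqE:
  assumes "(E, \<xi>, u) \<in> labelled_graphs D" "(F, \<eta>, v) \<in> labelled_graphs D" "labelled_class D E \<xi> u = labelled_class D F \<eta> v"
  obtains \<phi> where "graph_iso \<phi> E F" "\<phi> u = v" "\<And>w. w \<in> Field E \<Longrightarrow> \<eta> (\<phi> w) = \<xi> w"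
  using eq_equiv_class[OF assms(3) equiv_labelled_iso assms(2)] by (auto simp: labelled_iso_def)

lemma labelled_rooted: "(E, \<xi>, u) \<in> labelled_graphs D \<Longrightarrow> (E, u) \<in> rooted_graphs D"
  by (auto simp: labelled_graphs_def rooted_graphs_def)

lemma labelled_move: "(E, \<xi>, u) \<in> labelled_graphs D \<Longrightarrow> v \<in> Field E \<Longrightarrow> (E, \<xi>, v) \<in> labelled_graphs D"
  by (auto simp: labelled_graphs_def)

lemma rooted_move: "(E, u) \<in> rooted_graphs D \<Longrightarrow> v \<in> Field E \<Longrightarrow> (E, v) \<in> rooted_graphs D"
  by (auto simp: rooted_graphs_def)

lemma rootedD: "(E, u) \<in> rooted_graphs D \<Longrightarrow> E \<in> graphs D" "(E, u) \<in> rooted_graphs D \<Longrightarrow> u \<in> Field E"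
  by (auto simp: rooted_graphs_def)

section \<open>Local events generate the Borel structures\<close>

definition rooted_cyl :: "nat \<Rightarrow> nat \<Rightarrow> nat rel \<Rightarrow> nat \<Rightarrow> rooted set set" where
  "rooted_cyl D r E u = {rooted_class D F v |F v. (F, v) \<in> rooted_graphs D \<and> (\<exists>\<phi>. ball_iso \<phi> r E u F v)}"

definition birooted_cyl :: "nat \<Rightarrow> nat \<Rightarrow> nat rel \<Rightarrow> nat \<Rightarrow> nat \<Rightarrow> birooted set set" where
  "birooted_cyl D r E u u' = {birooted_class D F v v' |F v v'. (F, v, v') \<in> birooted_graphs D \<and>
         (\<exists>\<phi>. ball_iso \<phi> r E u F v \<and> \<phi> u' = v')}"

definition labelled_cyl :: "nat \<Rightarrow> nat \<Rightarrow> nat rel \<Rightarrow> nat \<Rightarrow> (nat \<Rightarrow> real set) \<Rightarrow> labelled set set" where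
  "labelled_cyl D r E u U = {labelled_class D F \<eta> v |F \<eta> v. (F, \<eta>, v) \<in> labelled_graphs D \<and>
         (\<exists>\<phi>. ball_iso \<phi> r E u F v \<and> (\<forall>w \<in> gball E r u. \<eta> (\<phi> w) \<in> U w))}"

lemma rooted_space_eq:
  "space (rooted_space D) = rooted_graphs D // rooted_iso D"
  "sets (rooted_space D) = sigma_sets (rooted_graphs D // rooted_iso D) {rooted_cyl D r E u |E u r. (E, u) \<in> rooted_graphs D}"
proof -
  have "{rooted_cyl D r E u |E u r. (E, u) \<in> rooted_graphs D} \<subseteq> Pow (rooted_graphs D // rooted_iso D)"
    by (auto simp: rooted_cyl_def intro: quotientI)
  then show "space (rooted_space D) = rooted_graphs D // rooted_iso D"
    "sets (rooted_space D) = sigma_sets (rooted_graphs D // rooted_iso D) {rooted_cyl D r E u |E u r. (E, u) \<in> rooted_graphs D}"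
    unfolding rooted_space_def rooted_cyl_def by (simp_all add: space_measure_of sets_measure_of)
qed

lemma birooted_space_eq:
  "space (birooted_space D) = birooted_graphs D // birooted_iso D"
  "sets (birooted_space D) = sigma_sets (birooted_graphs D // birooted_iso D)
    {birooted_cyl D r E u u' |E u u' r. (E, u, u') \<in> birooted_graphs D \<and> u' \<in> gball E r u}"
proof -
  have "{birooted_cyl D r E u u' |E u u' r. (E, u, u') \<in> birooted_graphs D \<and> u' \<in> gball E r u} \<subseteq> Pow (birooted_graphs D // birooted_iso D)"
    by (auto simp: birooted_cyl_def intro: quotientI)
  then show "space (birooted_space D) = birooted_graphs D // birooted_iso D"
    "sets (birooted_space D) = sigma_sets (birooted_graphs D // birooted_iso D)
    {birooted_cyl D r E u u' |E u u' r. (E, u, u') \<in> birooted_graphs D \<and> u' \<in> gball E r u}"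
    unfolding birooted_space_def birooted_cyl_def by (simp_all add: space_measure_of sets_measure_of)
qed

lemma labelled_space_eq:
  "space (labelled_space D) = labelled_graphs D // labelled_iso D"
  "sets (labelled_space D) = sigma_sets (labelled_graphs D // labelled_iso D)
    {labelled_cyl D r E u U |E u r U. (E, u) \<in> rooted_graphs D \<and> (\<forall>w. open (U w))}"
proof -
  have "{labelled_cyl D r E u U |E u r U. (E, u) \<in> rooted_graphs D \<and> (\<forall>w. open (U w))} \<subseteq> Pow (labelled_graphs D // labelled_iso D)"
    by (auto simp: labelled_cyl_def intro: quotientI)
  then show "space (labelled_space D) = labelled_graphs D // labelled_iso D"
    "sets (labelled_space D) = sigma_sets (labelled_graphs D // labelled_iso D)
    {labelled_cyl D r E u U |E u r U. (E, u) \<in> rooted_graphs D \<and> (\<forall>w. open (U w))}"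
    unfolding labelled_space_def labelled_cyl_def by (simp_all add: space_measure_of sets_measure_of)
qed

lemma rooted_spaceE:
  assumes "x \<in> space (rooted_space D)"
  obtains E u where "rep x = (E, u)" "(E, u) \<in> rooted_graphs D" "x = rooted_class D E u"
  using rep_in[OF equiv_rooted_iso, of x D] class_rep[OF equiv_rooted_iso, of x D] assms
  by (cases "rep x") (auto simp: rooted_space_eq)

lemma birooted_spaceE:
  assumes "x \<in> space (birooted_space D)"
  obtains E u u' where "rep x = (E, u, u')" "(E, u, u') \<in> birooted_graphs D" "x = birooted_class D E u u'"
  using rep_in[OF equiv_birooted_iso, of x D] class_rep[OF equiv_birooted_iso, of x D] assms
  by (cases "rep x") (auto simp: birooted_space_eq)

lemma labelled_spaceE:
  assumes "x \<in> space (labelled_space D)"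
  obtains E \<xi> u where "rep x = (E, \<xi>, u)" "(E, \<xi>, u) \<in> labelled_graphs D" "x = labelled_class D E \<xi> u"
  using rep_in[OF equiv_labelled_iso, of x D] class_rep[OF equiv_labelled_iso, of x D] assms
  by (cases "rep x") (auto simp: labelled_space_eq)

lemma rooted_class_space: "(E, u) \<in> rooted_graphs D \<Longrightarrow> rooted_class D E u \<in> space (rooted_space D)"
  by (auto simp: rooted_space_eq intro: quotientI)

lemma birooted_class_space: "(E, u, u') \<in> birooted_graphs D \<Longrightarrow> birooted_class D E u u' \<in> space (birooted_space D)"
  by (auto simp: birooted_space_eq intro: quotientI)

lemma labelled_class_space: "(E, \<xi>, u) \<in> labelled_graphs D \<Longrightarrow> labelled_class D E \<xi> u \<in> space (labelled_space D)"
  by (auto simp: labelled_space_eq intro: quotientI)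

lemma rep_rooted_class:
  assumes "(E, u) \<in> rooted_graphs D"
  obtains F v \<phi> where "rep (rooted_class D E u) = (F, v)" "(F, v) \<in> rooted_graphs D"
    "graph_iso \<phi> E F" "\<phi> u = v" "rooted_class D F v = rooted_class D E u"
proof -
  from rooted_spaceE[OF rooted_class_space[OF assms]] obtain F v where
    F: "rep (rooted_class D E u) = (F, v)" "(F, v) \<in> rooted_graphs D" "rooted_class D E u = rooted_class D F v" .
  from rooted_class_eqE[OF assms F(2,3)] obtain \<phi> where "graph_iso \<phi> E F" "\<phi> u = v" .
  with F that show ?thesis by metis
qed

lemma rep_birooted_class:
  assumes "(E, u, u') \<in> birooted_graphs D"
  obtains F v v' \<phi> where "rep (birooted_class D E u u') = (F, v, v')" "(F, v, v') \<in> birooted_graphs D"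
    "graph_iso \<phi> E F" "\<phi> u = v" "\<phi> u' = v'" "birooted_class D F v v' = birooted_class D E u u'"
proof -
  from birooted_spaceE[OF birooted_class_space[OF assms]] obtain F v v' where
    F: "rep (birooted_class D E u u') = (F, v, v')" "(F, v, v') \<in> birooted_graphs D"
      "birooted_class D E u u' = birooted_class D F v v'" .
  from birooted_class_eqE[OF assms F(2,3)] obtain \<phi> where "graph_iso \<phi> E F" "\<phi> u = v" "\<phi> u' = v'" .
  with F that show ?thesis by metis
qed

lemma rep_labelled_class:
  assumes "(E, \<xi>, u) \<in> labelled_graphs D"
  obtains F \<eta> v \<phi> where "rep (labelled_class D E \<xi> u) = (F, \<eta>, v)" "(F, \<eta>, v) \<in> labelled_graphs D"
    "graph_iso \<phi> E F" "\<phi> u = v" "\<forall>w\<in>Field E. \<eta> (\<phi> w) = \<xi> w"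
    "labelled_class D F \<eta> v = labelled_class D E \<xi> u"
proof -
  from labelled_spaceE[OF labelled_class_space[OF assms]] obtain F \<eta> v where
    F: "rep (labelled_class D E \<xi> u) = (F, \<eta>, v)" "(F, \<eta>, v) \<in> labelled_graphs D"
      "labelled_class D E \<xi> u = labelled_class D F \<eta> v" .
  from labelled_class_eqE[OF assms F(2,3)] obtain \<phi>
    where \<phi>: "graph_iso \<phi> E F" "\<phi> u = v" "\<And>w. w \<in> Field E \<Longrightarrow> \<eta> (\<phi> w) = \<xi> w" by blast
  have "\<forall>w\<in>Field E. \<eta> (\<phi> w) = \<xi> w" using \<phi>(3) by (rule ballI)
  from that[OF F(1,2) \<phi>(1,2) this F(3)[symmetric]] show ?thesis .
qed

text \<open>
  A ball is determined by finitely many natural numbers, so there are only countably many cylinders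
  of a given radius, as far as the graph is concerned.
\<close>

definition ball_code :: "nat \<Rightarrow> nat rel \<Rightarrow> nat \<Rightarrow> nat set \<times> nat rel \<times> nat" where
  "ball_code r E u = (gball E r u, E \<inter> gball E r u \<times> gball E r u, u)"

lemma ball_iso_cong_code:
  assumes "ball_code r E u = ball_code r E' u'"
  shows "ball_iso \<phi> r E u F v \<longleftrightarrow> ball_iso \<phi> r E' u' F v"
proof -
  have "gball E r u = gball E' r u'" "u = u'"
    "\<And>a b. a \<in> gball E r u \<Longrightarrow> b \<in> gball E r u \<Longrightarrow> (a, b) \<in> E \<longleftrightarrow> (a, b) \<in> E'"
    using assms by (auto simp: ball_code_def)
  then show ?thesis by (auto simp: ball_iso_def)
qed

lemma rooted_cyl_cong_code:
  "ball_code r E u = ball_code r E' u' \<Longrightarrow> rooted_cyl D r E u = rooted_cyl D r E' u'"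
  unfolding rooted_cyl_def by (simp only: ball_iso_cong_code[of r E u E' u'])

lemma birooted_cyl_cong_code:
  "ball_code r E u = ball_code r E' u' \<Longrightarrow> birooted_cyl D r E u w = birooted_cyl D r E' u' w"
  unfolding birooted_cyl_def by (simp only: ball_iso_cong_code[of r E u E' u'])

lemma labelled_cyl_cong_code:
  assumes code: "ball_code r E u = ball_code r E' u'" and U: "\<And>w. w \<in> gball E' r u' \<Longrightarrow> U w = U' w"
  shows "labelled_cyl D r E u U = labelled_cyl D r E' u' U'"
proof -
  have gb: "gball E r u = gball E' r u'" using code unfolding ball_code_def by blast
  have "(\<forall>w\<in>gball E' r u'. \<eta> (\<phi> w) \<in> U w) \<longleftrightarrow> (\<forall>w\<in>gball E' r u'. \<eta> (\<phi> w) \<in> U' w)"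
    for \<eta> :: "nat \<Rightarrow> real" and \<phi> by (intro ball_cong) (simp_all add: U)
  then show ?thesis unfolding labelled_cyl_def ball_iso_cong_code[OF code] gb by simp
qed

lemma countable_ball_codes: "countable {ball_code r E u |E u. E \<in> graphs D}"
proof (rule countable_subset)
  show "{ball_code r E u |E u. E \<in> graphs D} \<subseteq> Collect finite \<times> Collect finite \<times> UNIV"
    by (auto simp: ball_code_def)
  show "countable (Collect finite \<times> Collect finite \<times> UNIV :: (nat set \<times> nat rel \<times> nat) set)"
    by (intro countable_SIGMA countable_Collect_finite) auto
qed

text \<open>
  The map \<open>h\<close> factors through \<open>c\<close>.
\<close>

lemma countable_image_factor:
  assumes "countable (c ` X)" and "\<And>a b. a \<in> X \<Longrightarrow> b \<in> X \<Longrightarrow> c a = c b \<Longrightarrow> h a = h b"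
  shows "countable (h ` X)"
proof -
  have "h ` X \<subseteq> (\<lambda>k. h (SOME a. a \<in> X \<and> c a = k)) ` (c ` X)"
  proof
    fix y assume "y \<in> h ` X"
    then obtain a where a: "a \<in> X" "y = h a" by auto
    have "(SOME b. b \<in> X \<and> c b = c a) \<in> X \<and> c (SOME b. b \<in> X \<and> c b = c a) = c a"
      by (rule someI[of _ a]) (use a in auto)
    then have "y = h (SOME b. b \<in> X \<and> c b = c a)" using a assms(2) by metis
    then show "y \<in> (\<lambda>k. h (SOME a. a \<in> X \<and> c a = k)) ` (c ` X)" using a by auto
  qed
  then show ?thesis by (rule countable_subset) (intro countable_image assms(1))
qed

text \<open>
  Such a set is the union of the cylinders around its points, and by the previous lemmas there are
  only countably many of these.
\<close>

lemma rooted_local_sets: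
  assumes A: "A \<subseteq> space (rooted_space D)"
    and loc: "\<And>E u F v \<phi>. (E, u) \<in> rooted_graphs D \<Longrightarrow> (F, v) \<in> rooted_graphs D \<Longrightarrow>
      rooted_class D E u \<in> A \<Longrightarrow> ball_iso \<phi> r E u F v \<Longrightarrow> rooted_class D F v \<in> A"
  shows "A \<in> sets (rooted_space D)"
proof -
  define X where "X = {(E, u). (E, u) \<in> rooted_graphs D \<and> rooted_class D E u \<in> A}"
  have "countable ((\<lambda>(E, u). rooted_cyl D r E u) ` X)"
  proof (rule countable_image_factor)
    show "countable ((\<lambda>(E, u). ball_code r E u) ` X)"
      by (rule countable_subset[OF _ countable_ball_codes[of r D]]) (auto simp: X_def rooted_graphs_def)
  qed (clarsimp, erule rooted_cyl_cong_code)
  moreover have "(\<lambda>(E, u). rooted_cyl D r E u) ` X \<subseteq> sets (rooted_space D)"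
    by (auto simp: X_def rooted_space_eq intro!: sigma_sets.Basic)
  ultimately have "\<Union> ((\<lambda>(E, u). rooted_cyl D r E u) ` X) \<in> sets (rooted_space D)"
    by (rule sets.countable_Union)
  also have "\<Union> ((\<lambda>(E, u). rooted_cyl D r E u) ` X) = A"
  proof (intro equalityI subsetI)
    fix x assume "x \<in> \<Union> ((\<lambda>(E, u). rooted_cyl D r E u) ` X)"
    then obtain E u where E: "(E, u) \<in> X" and "x \<in> rooted_cyl D r E u" by blast
    then obtain F v \<phi> where F: "x = rooted_class D F v" "(F, v) \<in> rooted_graphs D" "ball_iso \<phi> r E u F v"
      unfolding rooted_cyl_def by blast
    show "x \<in> A" unfolding F(1) by (rule loc[OF _ F(2) _ F(3)]) (use E in \<open>auto simp: X_def\<close>)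
  next
    fix x assume x: "x \<in> A"
    from rooted_spaceE[OF subsetD[OF A x]]
    obtain E u where E: "(E, u) \<in> rooted_graphs D" "x = rooted_class D E u" by metis
    then have "x \<in> rooted_cyl D r E u" using ball_iso_id unfolding rooted_cyl_def by blast
    moreover have "(E, u) \<in> X" using E x by (simp add: X_def)
    ultimately show "x \<in> \<Union> ((\<lambda>(E, u). rooted_cyl D r E u) ` X)" by blast
  qed
  finally show ?thesis .
qed

text \<open>
  An isomorphism of balls around the first root determines the position of the second root only if
  this lies in the ball; hence the bound on the distance of the roots.
\<close>

lemma birooted_local_sets:
  assumes A: "A \<subseteq> space (birooted_space D)"
    and dist: "\<And>E u u'. (E, u, u') \<in> birooted_graphs D \<Longrightarrow> birooted_class D E u u' \<in> A \<Longrightarrow> u' \<in> gball E r u"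
    and loc: "\<And>E u u' F v \<phi>. (E, u, u') \<in> birooted_graphs D \<Longrightarrow> (F, v, \<phi> u') \<in> birooted_graphs D \<Longrightarrow>
      birooted_class D E u u' \<in> A \<Longrightarrow> ball_iso \<phi> r E u F v \<Longrightarrow> birooted_class D F v (\<phi> u') \<in> A"
  shows "A \<in> sets (birooted_space D)"
proof -
  define X where "X = {(E, u, u'). (E, u, u') \<in> birooted_graphs D \<and> birooted_class D E u u' \<in> A}"
  have "countable ((\<lambda>(E, u, u'). birooted_cyl D r E u u') ` X)"
  proof (rule countable_image_factor)
    show "countable ((\<lambda>(E, u, u'). (ball_code r E u, u')) ` X)"
    proof (rule countable_subset)
      show "(\<lambda>(E, u, u'). (ball_code r E u, u')) ` X \<subseteq> {ball_code r E u |E u. E \<in> graphs D} \<times> UNIV"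
        by (auto simp: X_def birooted_graphs_def)
      show "countable ({ball_code r E u |E u. E \<in> graphs D} \<times> (UNIV :: nat set))"
        by (intro countable_SIGMA countable_ball_codes) auto
    qed
  next
    fix a b :: birooted assume "(case a of (E, u, u') \<Rightarrow> (ball_code r E u, u')) = (case b of (E, u, u') \<Rightarrow> (ball_code r E u, u'))"
    then show "(case a of (E, u, u') \<Rightarrow> birooted_cyl D r E u u') = (case b of (E, u, u') \<Rightarrow> birooted_cyl D r E u u')"
      by (cases a; cases b) (use birooted_cyl_cong_code[of r "fst a" "fst (snd a)" "fst b" "fst (snd b)" D] in auto)
  qed
  moreover have "(\<lambda>(E, u, u'). birooted_cyl D r E u u') ` X \<subseteq> sets (birooted_space D)"
  proof clarify
    fix E u u' assume E: "(E, u, u') \<in> X"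
    then have "u' \<in> gball E r u" by (intro dist) (auto simp: X_def)
    then show "birooted_cyl D r E u u' \<in> sets (birooted_space D)"
      using E unfolding birooted_space_eq by (intro sigma_sets.Basic) (auto simp: X_def)
  qed
  ultimately have "\<Union> ((\<lambda>(E, u, u'). birooted_cyl D r E u u') ` X) \<in> sets (birooted_space D)"
    by (rule sets.countable_Union)
  also have "\<Union> ((\<lambda>(E, u, u'). birooted_cyl D r E u u') ` X) = A"
  proof (intro equalityI subsetI)
    fix x assume "x \<in> \<Union> ((\<lambda>(E, u, u'). birooted_cyl D r E u u') ` X)"
    then obtain E u u' where E: "(E, u, u') \<in> X" and "x \<in> birooted_cyl D r E u u'" by blast
    then obtain F v \<phi> where F: "x = birooted_class D F v (\<phi> u')" "(F, v, \<phi> u') \<in> birooted_graphs D"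
        "ball_iso \<phi> r E u F v"
      unfolding birooted_cyl_def by blast
    show "x \<in> A" unfolding F(1) by (rule loc[OF _ F(2) _ F(3)]) (use E in \<open>auto simp: X_def\<close>)
  next
    fix x assume x: "x \<in> A"
    from birooted_spaceE[OF subsetD[OF A x]]
    obtain E u u' where E: "(E, u, u') \<in> birooted_graphs D" "x = birooted_class D E u u'" by metis
    then have "x \<in> birooted_cyl D r E u u'" using ball_iso_id[of r E u] unfolding birooted_cyl_def by blast
    moreover have "(E, u, u') \<in> X" using E x by (simp add: X_def)
    ultimately show "x \<in> \<Union> ((\<lambda>(E, u, u'). birooted_cyl D r E u u') ` X)" by blast
  qed
  finally show ?thesis .
qed

text \<open>
  The cylinders that define the Borel structure are not stable under intersection, since several
  isomorphisms may map one ball to another. The generator that is used instead consists of all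
  events that look only at a ball of a fixed radius and are open in the labels there.
\<close>

definition local_nbhd :: "nat \<Rightarrow> nat \<Rightarrow> labelled set set \<Rightarrow> nat rel \<Rightarrow> (nat \<Rightarrow> real) \<Rightarrow> nat \<Rightarrow> real \<Rightarrow> bool" where
  "local_nbhd D r A E \<xi> u \<epsilon> \<longleftrightarrow> (\<forall>F \<eta> v \<phi>. (F, \<eta>, v) \<in> labelled_graphs D \<longrightarrow> ball_iso \<phi> r E u F v \<longrightarrow>
        (\<forall>w\<in>gball E r u. \<bar>\<eta> (\<phi> w) - \<xi> w\<bar> < \<epsilon>) \<longrightarrow> labelled_class D F \<eta> v \<in> A)"

definition open_local :: "nat \<Rightarrow> nat \<Rightarrow> labelled set set \<Rightarrow> bool" where
  "open_local D r A \<longleftrightarrow> A \<subseteq> space (labelled_space D) \<and>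
    (\<forall>E \<xi> u. (E, \<xi>, u) \<in> labelled_graphs D \<longrightarrow> labelled_class D E \<xi> u \<in> A \<longrightarrow>
      (\<exists>\<epsilon>>0. local_nbhd D r A E \<xi> u \<epsilon>))"

lemma local_nbhdD:
  "local_nbhd D r A E \<xi> u \<epsilon> \<Longrightarrow> (F, \<eta>, v) \<in> labelled_graphs D \<Longrightarrow> ball_iso \<phi> r E u F v \<Longrightarrow>
    (\<And>w. w \<in> gball E r u \<Longrightarrow> \<bar>\<eta> (\<phi> w) - \<xi> w\<bar> < \<epsilon>) \<Longrightarrow> labelled_class D F \<eta> v \<in> A"
  unfolding local_nbhd_def by blast

lemma local_nbhdI:
  "(\<And>F \<eta> v \<phi>. (F, \<eta>, v) \<in> labelled_graphs D \<Longrightarrow> ball_iso \<phi> r E u F v \<Longrightarrow>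
    (\<And>w. w \<in> gball E r u \<Longrightarrow> \<bar>\<eta> (\<phi> w) - \<xi> w\<bar> < \<epsilon>) \<Longrightarrow> labelled_class D F \<eta> v \<in> A) \<Longrightarrow>
   local_nbhd D r A E \<xi> u \<epsilon>"
  unfolding local_nbhd_def by blast

lemma open_localE:
  assumes "open_local D r A" "(E, \<xi>, u) \<in> labelled_graphs D" "labelled_class D E \<xi> u \<in> A"
  obtains \<epsilon> where "\<epsilon> > 0" "local_nbhd D r A E \<xi> u \<epsilon>"
  using assms unfolding open_local_def by blast

lemma open_local_space: "open_local D r A \<Longrightarrow> A \<subseteq> space (labelled_space D)"
  by (simp add: open_local_def)

lemma open_localI:
  assumes "A \<subseteq> space (labelled_space D)"
    and "\<And>E \<xi> u. (E, \<xi>, u) \<in> labelled_graphs D \<Longrightarrow> labelled_class D E \<xi> u \<in> A \<Longrightarrow> \<exists>\<epsilon>>0. local_nbhd D r A E \<xi> u \<epsilon>"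
  shows "open_local D r A"
  using assms unfolding open_local_def by blast

text \<open>
  Equal labels are closer than any \<open>\<epsilon>\<close>.
\<close>

lemma open_local_iff:
  assumes A: "open_local D r A" and E: "(E, \<xi>, u) \<in> labelled_graphs D" and F: "(F, \<eta>, v) \<in> labelled_graphs D"
    and iso: "ball_iso \<phi> r E u F v" and eq: "\<And>w. w \<in> gball E r u \<Longrightarrow> \<eta> (\<phi> w) = \<xi> w"
  shows "labelled_class D E \<xi> u \<in> A \<longleftrightarrow> labelled_class D F \<eta> v \<in> A"
proof
  assume "labelled_class D E \<xi> u \<in> A"
  from open_localE[OF A E this] obtain \<epsilon> where \<epsilon>: "\<epsilon> > 0" "local_nbhd D r A E \<xi> u \<epsilon>" .
  show "labelled_class D F \<eta> v \<in> A" by (rule local_nbhdD[OF \<epsilon>(2) F iso]) (simp add: eq \<epsilon>(1))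
next
  assume "labelled_class D F \<eta> v \<in> A"
  from open_localE[OF A F this] obtain \<epsilon> where \<epsilon>: "\<epsilon> > 0" "local_nbhd D r A F \<eta> v \<epsilon>" .
  show "labelled_class D E \<xi> u \<in> A"
  proof (rule local_nbhdD[OF \<epsilon>(2) E ball_iso_inv[OF iso]])
    fix w assume "w \<in> gball F r v"
    then have "\<phi> (inv_into (gball E r u) \<phi> w) = w" "inv_into (gball E r u) \<phi> w \<in> gball E r u"
      using ball_isoD(4)[OF iso] by (metis f_inv_into_f, metis inv_into_into)
    then show "\<bar>\<xi> (inv_into (gball E r u) \<phi> w) - \<eta> w\<bar> < \<epsilon>"
      using eq[of "inv_into (gball E r u) \<phi> w"] \<epsilon>(1) by simp
  qed
qed

lemma open_local_mono:
  assumes A: "open_local D r A" and "r \<le> s" shows "open_local D s A"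
proof (rule open_localI)
  show "A \<subseteq> space (labelled_space D)" using A by (rule open_local_space)
  fix E \<xi> u assume E: "(E, \<xi>, u) \<in> labelled_graphs D" "labelled_class D E \<xi> u \<in> A"
  from open_localE[OF A E] obtain \<epsilon> where \<epsilon>: "\<epsilon> > 0" "local_nbhd D r A E \<xi> u \<epsilon>" .
  have "local_nbhd D s A E \<xi> u \<epsilon>"
  proof (rule local_nbhdI)
    fix F \<eta> v \<phi> assume F: "(F, \<eta>, v) \<in> labelled_graphs D" "ball_iso \<phi> s E u F v"
      and near: "\<And>w. w \<in> gball E s u \<Longrightarrow> \<bar>\<eta> (\<phi> w) - \<xi> w\<bar> < \<epsilon>"
    show "labelled_class D F \<eta> v \<in> A"
      by (rule local_nbhdD[OF \<epsilon>(2) F(1) ball_iso_mono[OF F(2) \<open>r \<le> s\<close>]])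
         (rule near[OF subsetD[OF gball_mono[OF \<open>r \<le> s\<close>]]])
  qed
  with \<epsilon>(1) show "\<exists>\<epsilon>>0. local_nbhd D s A E \<xi> u \<epsilon>" by blast
qed

lemma open_local_Int:
  assumes A: "open_local D r A" and B: "open_local D r B" shows "open_local D r (A \<inter> B)"
proof (rule open_localI)
  show "A \<inter> B \<subseteq> space (labelled_space D)" using open_local_space[OF A] by auto
  fix E \<xi> u assume E: "(E, \<xi>, u) \<in> labelled_graphs D" "labelled_class D E \<xi> u \<in> A \<inter> B"
  then have EA: "labelled_class D E \<xi> u \<in> A" and EB: "labelled_class D E \<xi> u \<in> B" by auto
  from open_localE[OF A E(1) EA] obtain a where a: "a > 0" "local_nbhd D r A E \<xi> u a" .
  from open_localE[OF B E(1) EB] obtain b where b: "b > 0" "local_nbhd D r B E \<xi> u b" .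
  have "local_nbhd D r (A \<inter> B) E \<xi> u (min a b)"
    using a(2) b(2) unfolding local_nbhd_def by fastforce
  then show "\<exists>\<epsilon>>0. local_nbhd D r (A \<inter> B) E \<xi> u \<epsilon>" using a(1) b(1) by (metis min_less_iff_conj)
qed

lemma labelled_cyl_iff:
  assumes F: "(F, \<eta>, v) \<in> labelled_graphs D"
  shows "labelled_class D F \<eta> v \<in> labelled_cyl D r E u U \<longleftrightarrow>
    (\<exists>\<phi>. ball_iso \<phi> r E u F v \<and> (\<forall>w \<in> gball E r u. \<eta> (\<phi> w) \<in> U w))" (is "?L \<longleftrightarrow> ?R")
proof
  assume ?L
  then obtain G \<zeta> x \<phi> where G: "labelled_class D F \<eta> v = labelled_class D G \<zeta> x" "(G, \<zeta>, x) \<in> labelled_graphs D"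
    "ball_iso \<phi> r E u G x" "\<forall>w \<in> gball E r u. \<zeta> (\<phi> w) \<in> U w"
    unfolding labelled_cyl_def by blast
  from labelled_class_eqE[OF G(2) F G(1)[symmetric]] obtain \<psi> where
    \<psi>: "graph_iso \<psi> G F" "\<psi> x = v" "\<And>w. w \<in> Field G \<Longrightarrow> \<eta> (\<psi> w) = \<zeta> w" by blast
  have x: "x \<in> Field G" using G by (auto simp: labelled_graphs_def)
  have "\<phi> w \<in> Field G" if "w \<in> gball E r u" for w
    using ball_isoD(4)[OF G(3)] gball_Field[OF x, of r] that by auto
  then show ?R
    using ball_iso_comp[OF G(3) graph_iso_ball_iso[OF \<psi>(1) x]] \<psi> G(4)
    by (intro exI[of _ "\<lambda>x. \<psi> (\<phi> x)"]) auto
qed (use F in \<open>auto simp: labelled_cyl_def\<close>)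

lemma labelled_cyl_open_local:
  assumes E: "(E, u) \<in> rooted_graphs D" and U: "\<And>w. open (U w)"
  shows "open_local D r (labelled_cyl D r E u U)"
proof (rule open_localI)
  show "labelled_cyl D r E u U \<subseteq> space (labelled_space D)"
    by (auto simp: labelled_cyl_def intro: labelled_class_space)
  fix F \<eta> v assume F: "(F, \<eta>, v) \<in> labelled_graphs D" "labelled_class D F \<eta> v \<in> labelled_cyl D r E u U"
  then obtain \<phi> where \<phi>: "ball_iso \<phi> r E u F v" "\<And>w. w \<in> gball E r u \<Longrightarrow> \<eta> (\<phi> w) \<in> U w"
    by (auto simp: labelled_cyl_iff)
  have "\<exists>e>0. \<forall>t. \<bar>t - \<eta> (\<phi> w)\<bar> < e \<longrightarrow> t \<in> U w" if "w \<in> gball E r u" for w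
    using U[of w] \<phi>(2)[OF that] by (auto simp: open_dist dist_real_def)
  then obtain e where e: "\<And>w. w \<in> gball E r u \<Longrightarrow> e w > 0"
    "\<And>w t. w \<in> gball E r u \<Longrightarrow> \<bar>t - \<eta> (\<phi> w)\<bar> < e w \<Longrightarrow> t \<in> U w" by metis
  define \<epsilon> where "\<epsilon> = Min (e ` gball E r u)"
  have fin: "finite (gball E r u)" using E by (auto simp: rooted_graphs_def)
  have "gball E r u \<noteq> {}" using gball_self[of u E r] by blast
  then have \<epsilon>0: "\<epsilon> > 0" unfolding \<epsilon>_def using fin e by (subst Min_gr_iff) auto
  have \<epsilon>: "\<epsilon> \<le> e w" if "w \<in> gball E r u" for w unfolding \<epsilon>_def using fin that by auto
  have "local_nbhd D r (labelled_cyl D r E u U) F \<eta> v \<epsilon>"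
  proof (rule local_nbhdI)
    fix G \<zeta> x \<psi> assume G: "(G, \<zeta>, x) \<in> labelled_graphs D" and \<psi>: "ball_iso \<psi> r F v G x"
      and near: "\<And>w. w \<in> gball F r v \<Longrightarrow> \<bar>\<zeta> (\<psi> w) - \<eta> w\<bar> < \<epsilon>"
    have "\<zeta> (\<psi> (\<phi> w)) \<in> U w" if w: "w \<in> gball E r u" for w
    proof (rule e(2)[OF w])
      have "\<phi> w \<in> gball F r v" using ball_isoD(4)[OF \<phi>(1)] w by auto
      then show "\<bar>\<zeta> (\<psi> (\<phi> w)) - \<eta> (\<phi> w)\<bar> < e w" using near \<epsilon>[OF w] by fastforce
    qed
    then show "labelled_class D G \<zeta> x \<in> labelled_cyl D r E u U"
      using ball_iso_comp[OF \<phi>(1) \<psi>] unfolding labelled_cyl_iff[OF G]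
      by (intro exI[of _ "\<lambda>x. \<psi> (\<phi> x)"]) auto
  qed
  with \<epsilon>0 show "\<exists>\<epsilon>>0. local_nbhd D r (labelled_cyl D r E u U) F \<eta> v \<epsilon>" by blast
qed

text \<open>
  The topology is second countable: each point of \<open>A\<close> lies in a cylinder contained in \<open>A\<close> that
  prescribes the labels up to \<open>1 / (n + 1)\<close> around rational numbers, and such a cylinder depends
  only on the code of a ball, finitely many rational numbers, and \<open>n\<close>.
\<close>

lemma open_local_sets:
  assumes A: "open_local D r A" shows "A \<in> sets (labelled_space D)"
proof -
  define C :: "(nat rel \<times> nat \<times> (nat \<Rightarrow> rat) \<times> nat) \<Rightarrow> labelled set set" where
    "C = (\<lambda>(E, u, q, n). labelled_cyl D r E u (\<lambda>w. ball (of_rat (q w)) (1 / Suc n)))"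
  define X where "X = {(E, u, q, n) |E u q n. (E, u) \<in> rooted_graphs D \<and> C (E, u, q, n) \<subseteq> A}"
  have "countable (C ` X)"
  proof (rule countable_image_factor)
    define c :: "(nat rel \<times> nat \<times> (nat \<Rightarrow> rat) \<times> nat) \<Rightarrow> _" where
      "c = (\<lambda>(E, u, q, n). (ball_code r E u, (\<lambda>w. (w, q w)) ` gball E r u, n))"
    show "countable (c ` X)"
    proof (rule countable_subset)
      show "c ` X \<subseteq> {ball_code r E u |E u. E \<in> graphs D} \<times> Collect finite \<times> UNIV"
        by (auto simp: X_def c_def rooted_graphs_def)
      show "countable ({ball_code r E u |E u. E \<in> graphs D} \<times> (Collect finite :: (nat \<times> rat) set set) \<times> (UNIV :: nat set))"
        by (intro countable_SIGMA countable_ball_codes countable_Collect_finite) auto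
    qed
    fix a b assume ab: "a \<in> X" "b \<in> X" "c a = c b"
    obtain E u q n where a: "a = (E, u, q, n)" by (cases a)
    obtain E' u' q' n' where b: "b = (E', u', q', n')" by (cases b)
    have code: "ball_code r E u = ball_code r E' u'" and n: "n = n'"
      and q: "(\<lambda>w. (w, q w)) ` gball E r u = (\<lambda>w. (w, q' w)) ` gball E' r u'"
      using ab by (auto simp: c_def a b)
    have gb: "gball E r u = gball E' r u'" using code unfolding ball_code_def by blast
    have "q w = q' w" if "w \<in> gball E' r u'" for w
      using q that unfolding gb by auto
    then show "C a = C b"
      unfolding C_def a b prod.case n by (intro labelled_cyl_cong_code[OF code]) simp
  qed
  moreover have "C ` X \<subseteq> sets (labelled_space D)"
  proof clarify
    fix E u q n assume "(E, u, q, n) \<in> X"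
    then have "(E, u) \<in> rooted_graphs D" by (auto simp: X_def)
    then show "C (E, u, q, n) \<in> sets (labelled_space D)"
      unfolding labelled_space_eq C_def prod.case
      by (intro sigma_sets.Basic CollectI exI[of _ E] exI[of _ u] exI[of _ r]
          exI[of _ "\<lambda>w. ball (of_rat (q w)) (1 / Suc n)"]) simp
  qed
  ultimately have "\<Union> (C ` X) \<in> sets (labelled_space D)"
    by (rule sets.countable_Union)
  also have "\<Union> (C ` X) = A"
  proof (intro equalityI subsetI)
    fix x assume "x \<in> \<Union> (C ` X)" then show "x \<in> A" by (auto simp: X_def)
  next
    fix x assume x: "x \<in> A"
    from labelled_spaceE[OF subsetD[OF open_local_space[OF A] x]]
    obtain E \<xi> u where E: "(E, \<xi>, u) \<in> labelled_graphs D" "x = labelled_class D E \<xi> u" by metis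
    have EA: "labelled_class D E \<xi> u \<in> A" using x E(2) by simp
    from open_localE[OF A E(1) EA] obtain \<epsilon> where \<epsilon>: "\<epsilon> > 0" "local_nbhd D r A E \<xi> u \<epsilon>" .
    obtain n where n: "1 / real (Suc n) < \<epsilon> / 2" using \<epsilon>(1) nat_approx_posE[of "\<epsilon> / 2"] by auto
    have "\<exists>q :: rat. \<bar>of_rat q - \<xi> w\<bar> < 1 / Suc n" for w
    proof -
      obtain q where "\<xi> w < of_rat q" "of_rat q < \<xi> w + 1 / Suc n"
        using of_rat_dense[of "\<xi> w" "\<xi> w + 1 / Suc n"] by auto
      then show ?thesis by (intro exI[of _ q]) auto
    qed
    then obtain q :: "nat \<Rightarrow> rat" where q: "\<And>w. \<bar>of_rat (q w) - \<xi> w\<bar> < 1 / Suc n" by metis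
    have "C (E, u, q, n) \<subseteq> A"
    proof
      fix y assume "y \<in> C (E, u, q, n)"
      then obtain F \<eta> v \<phi> where F: "y = labelled_class D F \<eta> v" "(F, \<eta>, v) \<in> labelled_graphs D"
        "ball_iso \<phi> r E u F v" "\<And>w. w \<in> gball E r u \<Longrightarrow> \<eta> (\<phi> w) \<in> ball (of_rat (q w)) (1 / Suc n)"
        unfolding C_def labelled_cyl_def by auto
      show "y \<in> A"
        unfolding F(1)
      proof (rule local_nbhdD[OF \<epsilon>(2) F(2,3)])
        fix w assume "w \<in> gball E r u"
        then show "\<bar>\<eta> (\<phi> w) - \<xi> w\<bar> < \<epsilon>"
          using F(4)[of w] q[of w] n by (simp add: dist_real_def)
      qed
    qed
    moreover have "x \<in> C (E, u, q, n)"
      unfolding C_def E(2) prod.case labelled_cyl_iff[OF E(1)]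
      using q by (intro exI[of _ "\<lambda>x. x"]) (auto simp: ball_iso_id dist_real_def)
    ultimately show "x \<in> \<Union> (C ` X)" using labelled_rooted[OF E(1)] by (auto simp: X_def)
  qed
  finally show ?thesis .
qed

definition open_locals :: "nat \<Rightarrow> labelled set set set" where
  "open_locals D = {A. \<exists>r. open_local D r A}"

lemma open_locals_Int_stable: "Int_stable (open_locals D)"
proof (rule Int_stableI)
  fix A B assume "A \<in> open_locals D" "B \<in> open_locals D"
  then obtain r s where "open_local D r A" "open_local D s B" by (auto simp: open_locals_def)
  then have "open_local D (max r s) (A \<inter> B)"
    by (intro open_local_Int) (auto intro: open_local_mono)
  then show "A \<inter> B \<in> open_locals D" by (auto simp: open_locals_def)
qed

lemma open_locals_subset: "open_locals D \<subseteq> Pow (space (labelled_space D))"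
  using open_local_space by (auto simp: open_locals_def)

lemma sets_labelled_space: "sets (labelled_space D) = sigma_sets (space (labelled_space D)) (open_locals D)"
proof (rule antisym)
  show "sets (labelled_space D) \<subseteq> sigma_sets (space (labelled_space D)) (open_locals D)"
    unfolding labelled_space_eq
    by (rule sigma_sets_mono') (auto simp: open_locals_def intro: labelled_cyl_open_local)
  show "sigma_sets (space (labelled_space D)) (open_locals D) \<subseteq> sets (labelled_space D)"
    by (rule sets.sigma_sets_subset) (auto simp: open_locals_def open_local_sets)
qed

lemma space_open_local: "open_local D r (space (labelled_space D))"
  unfolding open_local_def local_nbhd_def by (auto intro!: exI[of _ 1] labelled_class_space)

section \<open>Independent uniform labels\<close>

abbreviation unit_measure :: "real measure" where
  "unit_measure \<equiv> restrict_space lborel {0..1}"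

lemma prob_space_unit: "prob_space unit_measure"
  by (rule prob_spaceI) (simp add: space_restrict_space emeasure_restrict_space)

lemma space_unit [simp]: "space unit_measure = {0..1}"
  by (simp add: space_restrict_space)

lemma unit_singleton: "emeasure unit_measure {t} = 0"
proof (cases "t \<in> {0..1}")
  case True
  then show ?thesis by (simp add: emeasure_restrict_space)
next
  case False
  then show ?thesis by (intro emeasure_notin_sets) (auto simp: sets_restrict_space)
qed

lemma prob_space_label: "prob_space (label_measure E)"
  unfolding label_measure_def by (rule prob_space_PiM) (rule prob_space_unit)

lemma space_label: "space (label_measure E) = Field E \<rightarrow>\<^sub>E {0..1}"
  by (simp add: label_measure_def space_PiM)

lemma label_component_unit: "i \<in> Field E \<Longrightarrow> (\<lambda>\<xi>. \<xi> i) \<in> label_measure E \<rightarrow>\<^sub>M unit_measure"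
  unfolding label_measure_def by (rule measurable_component_singleton)

lemma label_component: "i \<in> Field E \<Longrightarrow> (\<lambda>\<xi>. \<xi> i) \<in> borel_measurable (label_measure E)"
  using label_component_unit[of i E] measurable_restrict_space2_iff[of "\<lambda>\<xi>. \<xi> i" "label_measure E" lborel "{0..1}"]
  by simp

lemma labelled_of_label: "(E, u) \<in> rooted_graphs D \<Longrightarrow> \<xi> \<in> space (label_measure E) \<Longrightarrow> (E, \<xi>, u) \<in> labelled_graphs D"
  by (auto simp: space_label rooted_graphs_def labelled_graphs_def PiE_def)

text \<open>
  The value zero at the other vertices is a legitimate label, so the extension of a partial
  labelling is a labelling.
\<close>

definition extend0 :: "nat set \<Rightarrow> nat set \<Rightarrow> (nat \<Rightarrow> real) \<Rightarrow> nat \<Rightarrow> real" where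
  "extend0 V I t = (\<lambda>i\<in>V. if i \<in> I then t i else 0)"

lemma extend0_measurable:
  assumes "I \<subseteq> Field E"
  shows "extend0 (Field E) I \<in> PiM I (\<lambda>_. unit_measure) \<rightarrow>\<^sub>M label_measure E"
  unfolding label_measure_def extend0_def[abs_def]
proof (rule measurable_restrict)
  fix i assume "i \<in> Field E"
  show "(\<lambda>t. if i \<in> I then t i else 0) \<in> PiM I (\<lambda>_. unit_measure) \<rightarrow>\<^sub>M unit_measure"
    by (cases "i \<in> I") (auto intro: measurable_component_singleton measurable_const)
qed

lemma label_restrict_distr:
  assumes "inj_on \<phi> I" "\<phi> ` I \<subseteq> Field F"
  shows "distr (label_measure F) (PiM I (\<lambda>_. unit_measure)) (\<lambda>\<eta>. \<lambda>i\<in>I. \<eta> (\<phi> i)) = PiM I (\<lambda>_. unit_measure)"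
  unfolding label_measure_def
  by (rule distr_PiM_reindex[OF prob_space_unit assms(1)]) (use assms(2) in auto)

lemma label_restrict_measurable:
  assumes "\<phi> ` I \<subseteq> Field F"
  shows "(\<lambda>\<eta>. \<lambda>i\<in>I. \<eta> (\<phi> i)) \<in> label_measure F \<rightarrow>\<^sub>M PiM I (\<lambda>_. unit_measure)"
  by (rule measurable_restrict) (use assms in \<open>auto intro!: label_component_unit\<close>)

text \<open>
  The distribution of the labels on a set of vertices does not depend on the ambient graph, so
  functions of these labels have the same integral in any two graphs that contain them.
\<close>

lemma label_integral_transfer:
  assumes I: "I \<subseteq> Field E" and \<phi>: "inj_on \<phi> I" "\<phi> ` I \<subseteq> Field F"
    and f: "f \<in> borel_measurable (label_measure E)"
    and fg: "\<And>\<xi> \<eta>. \<xi> \<in> space (label_measure E) \<Longrightarrow> \<eta> \<in> space (label_measure F) \<Longrightarrow>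
      (\<And>i. i \<in> I \<Longrightarrow> \<eta> (\<phi> i) = \<xi> i) \<Longrightarrow> f \<xi> = g \<eta>"
  shows "(\<integral>\<^sup>+\<xi>. f \<xi> \<partial>label_measure E) = (\<integral>\<^sup>+\<eta>. g \<eta> \<partial>label_measure F)"
proof -
  let ?P = "PiM I (\<lambda>_. unit_measure)" and ?ext = "extend0 (Field E) I"
  have [measurable]: "?ext \<in> ?P \<rightarrow>\<^sub>M label_measure E" using I by (rule extend0_measurable)
  note [measurable] = f
  have ext: "?ext t \<in> space (label_measure E)" if "t \<in> space ?P" for t
    using measurable_space[OF extend0_measurable[OF I] that] .
  have "(\<integral>\<^sup>+\<xi>. f \<xi> \<partial>label_measure E) = (\<integral>\<^sup>+\<xi>. f (?ext (\<lambda>i\<in>I. \<xi> i)) \<partial>label_measure E)"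
  proof (rule nn_integral_cong)
    fix \<xi> assume \<xi>: "\<xi> \<in> space (label_measure E)"
    define \<eta> where "\<eta> = (\<lambda>j\<in>Field F. if j \<in> \<phi> ` I then \<xi> (inv_into I \<phi> j) else 0)"
    have "\<xi> i \<in> {0..1}" if "i \<in> I" for i using \<xi> I that by (auto simp: space_label PiE_def)
    then have \<eta>: "\<eta> \<in> space (label_measure F)"
      using \<phi>(1) by (auto simp: \<eta>_def space_label PiE_def Pi_def)
    have \<eta>\<xi>: "\<eta> (\<phi> i) = \<xi> i" if "i \<in> I" for i
      using that \<phi> by (auto simp: \<eta>_def)
    have "restrict \<xi> I \<in> space ?P"
      using \<xi> I by (auto simp: space_PiM space_label PiE_def)
    then have "?ext (\<lambda>i\<in>I. \<xi> i) \<in> space (label_measure E)" by (rule ext)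
    moreover have "\<eta> (\<phi> i) = ?ext (\<lambda>i\<in>I. \<xi> i) i" if "i \<in> I" for i
      using \<eta>\<xi>[OF that] that I by (auto simp: extend0_def)
    ultimately have "f (?ext (\<lambda>i\<in>I. \<xi> i)) = g \<eta>" using \<eta> by (intro fg)
    moreover have "f \<xi> = g \<eta>" using \<xi> \<eta> \<eta>\<xi> by (rule fg)
    ultimately show "f \<xi> = f (?ext (\<lambda>i\<in>I. \<xi> i))" by simp
  qed
  also have "\<dots> = (\<integral>\<^sup>+t. f (?ext t) \<partial>distr (label_measure E) ?P (\<lambda>\<xi>. \<lambda>i\<in>I. \<xi> i))"
    using label_restrict_measurable[of "\<lambda>x. x" I E] I
    by (subst nn_integral_distr) auto
  also have "\<dots> = (\<integral>\<^sup>+t. f (?ext t) \<partial>?P)"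
    using label_restrict_distr[of "\<lambda>x. x" I E] I by simp
  also have "\<dots> = (\<integral>\<^sup>+t. f (?ext t) \<partial>distr (label_measure F) ?P (\<lambda>\<eta>. \<lambda>i\<in>I. \<eta> (\<phi> i)))"
    using label_restrict_distr[OF \<phi>] by simp
  also have "\<dots> = (\<integral>\<^sup>+\<eta>. f (?ext (\<lambda>i\<in>I. \<eta> (\<phi> i))) \<partial>label_measure F)"
    using label_restrict_measurable[OF \<phi>(2)] by (subst nn_integral_distr) auto
  also have "\<dots> = (\<integral>\<^sup>+\<eta>. g \<eta> \<partial>label_measure F)"
  proof (rule nn_integral_cong)
    fix \<eta> assume \<eta>: "\<eta> \<in> space (label_measure F)"
    then have "(\<lambda>i\<in>I. \<eta> (\<phi> i)) \<in> space ?P"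
      using \<phi>(2) by (auto simp: space_PiM space_label PiE_def)
    then have "?ext (\<lambda>i\<in>I. \<eta> (\<phi> i)) \<in> space (label_measure E)" by (rule ext)
    then show "f (?ext (\<lambda>i\<in>I. \<eta> (\<phi> i))) = g \<eta>"
      using \<eta> I by (intro fg) (auto simp: extend0_def)
  qed
  finally show ?thesis .
qed

lemma label_emeasure_transfer:
  assumes I: "I \<subseteq> Field E" and \<phi>: "inj_on \<phi> I" "\<phi> ` I \<subseteq> Field F"
    and P: "{\<xi> \<in> space (label_measure E). P \<xi>} \<in> sets (label_measure E)"
    and Q: "{\<eta> \<in> space (label_measure F). Q \<eta>} \<in> sets (label_measure F)"
    and PQ: "\<And>\<xi> \<eta>. \<xi> \<in> space (label_measure E) \<Longrightarrow> \<eta> \<in> space (label_measure F) \<Longrightarrow>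
      (\<And>i. i \<in> I \<Longrightarrow> \<eta> (\<phi> i) = \<xi> i) \<Longrightarrow> P \<xi> \<longleftrightarrow> Q \<eta>"
  shows "emeasure (label_measure E) {\<xi> \<in> space (label_measure E). P \<xi>} =
    emeasure (label_measure F) {\<eta> \<in> space (label_measure F). Q \<eta>}"
proof -
  have "(\<integral>\<^sup>+\<xi>. indicator {\<xi> \<in> space (label_measure E). P \<xi>} \<xi> \<partial>label_measure E) =
    (\<integral>\<^sup>+\<eta>. indicator {\<eta> \<in> space (label_measure F). Q \<eta>} \<eta> \<partial>label_measure F)"
  proof (rule label_integral_transfer[OF I \<phi>])
    show "indicator {\<xi> \<in> space (label_measure E). P \<xi>} \<in> borel_measurable (label_measure E)"
      using P by (rule borel_measurable_indicator)
    fix \<xi> \<eta> assume "\<xi> \<in> space (label_measure E)" "\<eta> \<in> space (label_measure F)" "\<And>i. i \<in> I \<Longrightarrow> \<eta> (\<phi> i) = \<xi> i"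
    then show "indicator {\<xi> \<in> space (label_measure E). P \<xi>} \<xi> = (indicator {\<eta> \<in> space (label_measure F). Q \<eta>} \<eta> :: ennreal)"
      using PQ[of \<xi> \<eta>] by (auto simp: indicator_def)
  qed
  then show ?thesis using P Q by simp
qed

text \<open>
  Both functions factor through the restriction of the labelling to a set of vertices, and
  restrictions to disjoint sets are independent.
\<close>

lemma label_indep_integral:
  fixes f g :: "(nat \<Rightarrow> real) \<Rightarrow> complex"
  assumes [measurable]: "f \<in> borel_measurable (label_measure E)" "g \<in> borel_measurable (label_measure E)"
    and bounded: "\<And>\<xi>. cmod (f \<xi>) \<le> C" "\<And>\<xi>. cmod (g \<xi>) \<le> C"
    and IJ: "I \<subseteq> Field E" "J \<subseteq> Field E" "I \<inter> J = {}" and ne: "Field E \<noteq> {}"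
    and f: "\<And>\<xi> \<eta>. \<xi> \<in> space (label_measure E) \<Longrightarrow> \<eta> \<in> space (label_measure E) \<Longrightarrow>
       (\<And>i. i \<in> I \<Longrightarrow> \<eta> i = \<xi> i) \<Longrightarrow> f \<xi> = f \<eta>"
    and g: "\<And>\<xi> \<eta>. \<xi> \<in> space (label_measure E) \<Longrightarrow> \<eta> \<in> space (label_measure E) \<Longrightarrow>
       (\<And>i. i \<in> J \<Longrightarrow> \<eta> i = \<xi> i) \<Longrightarrow> g \<xi> = g \<eta>"
  shows "(\<integral>\<xi>. f \<xi> * g \<xi> \<partial>label_measure E) = (\<integral>\<xi>. f \<xi> \<partial>label_measure E) * (\<integral>\<xi>. g \<xi> \<partial>label_measure E)"
proof -
  interpret L: prob_space "label_measure E" by (rule prob_space_label)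
  have "L.indep_vars (\<lambda>_. unit_measure) (\<lambda>i \<xi>. \<xi> i) (Field E)"
  proof (subst L.indep_vars_iff_distr_eq_PiM'[OF ne])
    have "distr (label_measure E) unit_measure (\<lambda>\<xi>. \<xi> i) = unit_measure" if "i \<in> Field E" for i
      unfolding label_measure_def
      by (rule distr_PiM_component[OF prob_space_unit that])
    then have "PiM (Field E) (\<lambda>i. distr (label_measure E) unit_measure (\<lambda>\<xi>. \<xi> i)) = PiM (Field E) (\<lambda>_. unit_measure)"
      by (intro PiM_cong) auto
    then show "distr (label_measure E) (PiM (Field E) (\<lambda>_. unit_measure)) (\<lambda>x. \<lambda>i\<in>Field E. x i) =
      PiM (Field E) (\<lambda>i. distr (label_measure E) unit_measure (\<lambda>\<xi>. \<xi> i))"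
      using label_restrict_distr[of "\<lambda>x. x" "Field E" E] by simp
  qed (rule label_component_unit)
  then have "L.indep_vars (\<lambda>b. PiM (if b then I else J) (\<lambda>_. unit_measure))
      (\<lambda>b \<xi>. restrict (\<lambda>i. \<xi> i) (if b then I else J)) (UNIV :: bool set)"
    by (rule L.indep_vars_restrict) (use IJ in \<open>auto simp: disjoint_family_on_def\<close>)
  then have "L.indep_var (PiM I (\<lambda>_. unit_measure)) (\<lambda>\<xi>. restrict \<xi> I) (PiM J (\<lambda>_. unit_measure)) (\<lambda>\<xi>. restrict \<xi> J)"
    unfolding L.indep_var_def
    by (rule L.indep_vars_cong[THEN iffD1, rotated -1]) (auto split: bool.split)
  then have "L.indep_var borel ((\<lambda>t. f (extend0 (Field E) I t)) \<circ> (\<lambda>\<xi>. restrict \<xi> I))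
      borel ((\<lambda>t. g (extend0 (Field E) J t)) \<circ> (\<lambda>\<xi>. restrict \<xi> J))"
    using measurable_compose[OF extend0_measurable[OF IJ(1)], of f borel]
      measurable_compose[OF extend0_measurable[OF IJ(2)], of g borel]
    by (intro L.indep_var_compose) auto
  then have ind: "L.indep_var borel (\<lambda>\<xi>. f (extend0 (Field E) I (restrict \<xi> I))) borel (\<lambda>\<xi>. g (extend0 (Field E) J (restrict \<xi> J)))"
    by (simp add: o_def)
  have ext: "extend0 (Field E) K (restrict \<xi> K) \<in> space (label_measure E)"
    if "K \<subseteq> Field E" "\<xi> \<in> space (label_measure E)" for K \<xi>
    using that by (auto simp: space_label extend0_def PiE_def)
  have ff: "f (extend0 (Field E) I (restrict \<xi> I)) = f \<xi>" if "\<xi> \<in> space (label_measure E)" for \<xi>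
    using that ext[OF IJ(1) that] IJ(1) by (intro f) (auto simp: extend0_def)
  have gg: "g (extend0 (Field E) J (restrict \<xi> J)) = g \<xi>" if "\<xi> \<in> space (label_measure E)" for \<xi>
    using that ext[OF IJ(2) that] IJ(2) by (intro g) (auto simp: extend0_def)
  have int: "integrable (label_measure E) f" "integrable (label_measure E) g"
    using bounded by (auto intro!: L.integrable_const_bound[where B = C])
  have "(\<integral>\<xi>. f (extend0 (Field E) I (restrict \<xi> I)) * g (extend0 (Field E) J (restrict \<xi> J)) \<partial>label_measure E) =
    (\<integral>\<xi>. f (extend0 (Field E) I (restrict \<xi> I)) \<partial>label_measure E) * (\<integral>\<xi>. g (extend0 (Field E) J (restrict \<xi> J)) \<partial>label_measure E)"
  proof (rule L.indep_var_lebesgue_integral[OF ind])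
    show "integrable (label_measure E) (\<lambda>\<xi>. f (extend0 (Field E) I (restrict \<xi> I)))"
      using int(1) ff by (subst Bochner_Integration.integrable_cong[OF refl, of _ _ f]) auto
    show "integrable (label_measure E) (\<lambda>\<xi>. g (extend0 (Field E) J (restrict \<xi> J)))"
      using int(2) gg by (subst Bochner_Integration.integrable_cong[OF refl, of _ _ g]) auto
  qed
  moreover have "(\<integral>\<xi>. f (extend0 (Field E) I (restrict \<xi> I)) * g (extend0 (Field E) J (restrict \<xi> J)) \<partial>label_measure E) =
      (\<integral>\<xi>. f \<xi> * g \<xi> \<partial>label_measure E)"
    by (intro Bochner_Integration.integral_cong) (auto simp: ff gg)
  moreover have "(\<integral>\<xi>. f (extend0 (Field E) I (restrict \<xi> I)) \<partial>label_measure E) = (\<integral>\<xi>. f \<xi> \<partial>label_measure E)"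
    by (intro Bochner_Integration.integral_cong) (auto simp: ff)
  moreover have "(\<integral>\<xi>. g (extend0 (Field E) J (restrict \<xi> J)) \<partial>label_measure E) = (\<integral>\<xi>. g \<xi> \<partial>label_measure E)"
    by (intro Bochner_Integration.integral_cong) (auto simp: gg)
  ultimately show ?thesis by simp
qed

text \<open>
  Given the label of \<open>j\<close>, the label of \<open>i\<close> avoids this single value almost surely.
\<close>

lemma label_distinct_pair:
  assumes ij: "i \<in> Field E" "j \<in> Field E" "i \<noteq> j"
  shows "AE \<xi> in label_measure E. \<xi> i \<noteq> \<xi> j"
proof -
  let ?P = "PiM {i, j} (\<lambda>_. unit_measure)"
  interpret product_sigma_finite "\<lambda>_. unit_measure"
    using prob_space_imp_sigma_finite[OF prob_space_unit] by (simp add: product_sigma_finite_def)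
  have comp: "(\<lambda>t. t k) \<in> borel_measurable ?P" if "k \<in> {i, j}" for k
    using measurable_component_singleton[OF that, of "\<lambda>_. unit_measure"]
      measurable_restrict_space2_iff[of "\<lambda>\<xi>. \<xi> k" ?P lborel "{0..1}"] by simp
  have [measurable]: "(\<lambda>t. t i) \<in> borel_measurable ?P" "(\<lambda>t. t j) \<in> borel_measurable ?P"
    by (auto intro: comp)
  have "(\<integral>\<^sup>+t. indicator {t. t i = t j} t \<partial>?P) =
      (\<integral>\<^sup>+x. (\<integral>\<^sup>+y. indicator {t. t i = t j} (x(i := y)) \<partial>unit_measure) \<partial>PiM {j} (\<lambda>_. unit_measure))"
  proof (rule product_nn_integral_insert)
    have "{t \<in> space ?P. t i = t j} \<in> sets ?P" by measurable
    then have "indicator {t \<in> space ?P. t i = t j} \<in> borel_measurable ?P" by (rule borel_measurable_indicator)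
    then show "indicator {t. t i = t j} \<in> borel_measurable ?P"
      by (rule measurable_cong[THEN iffD1, rotated]) (auto simp: indicator_def)
  qed (use ij in auto)
  also have "\<dots> = (\<integral>\<^sup>+x. 0 \<partial>PiM {j} (\<lambda>_. unit_measure))"
  proof (rule nn_integral_cong)
    fix x assume "x \<in> space (PiM {j} (\<lambda>_. unit_measure))"
    then have xj: "x j \<in> {0..1}" by (auto simp: space_PiM)
    have "(\<integral>\<^sup>+y. indicator {t. t i = t j} (x(i := y)) \<partial>unit_measure) = (\<integral>\<^sup>+y. indicator {x j} y \<partial>unit_measure)"
      using ij by (intro nn_integral_cong) (auto simp: indicator_def)
    also have "\<dots> = 0"
      using xj by (subst nn_integral_indicator) (auto simp: unit_singleton sets_restrict_space)
    finally show "(\<integral>\<^sup>+y. indicator {t. t i = t j} (x(i := y)) \<partial>unit_measure) = 0" .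
  qed
  finally have 0: "(\<integral>\<^sup>+t. indicator {t. t i = t j} t \<partial>?P) = (0 :: ennreal)" by simp
  have "AE t in ?P. t i \<noteq> t j"
  proof -
    have s: "{t \<in> space ?P. t i = t j} \<in> sets ?P" by measurable
    have "(\<integral>\<^sup>+t. indicator {t. t i = t j} t \<partial>?P) = (\<integral>\<^sup>+t. indicator {t \<in> space ?P. t i = t j} t \<partial>?P)"
      by (intro nn_integral_cong) (auto simp: indicator_def)
    then have "{t \<in> space ?P. t i = t j} \<in> null_sets ?P"
      using 0 s by (auto simp: null_sets_def)
    then show ?thesis by (rule AE_I') auto
  qed
  moreover have ne: "{t \<in> space ?P. t i \<noteq> t j} \<in> sets ?P"
    by (intro sets.sets_Collect_neg borel_measurable_eq[of "\<lambda>t. t i" ?P "\<lambda>t. t j"]) (auto intro: comp)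
  ultimately have "AE t in distr (label_measure E) ?P (\<lambda>\<xi>. \<lambda>k\<in>{i, j}. \<xi> k). t i \<noteq> t j"
    using label_restrict_distr[of "\<lambda>x. x" "{i, j}" E] ij by (subst label_restrict_distr) auto
  then have "AE \<xi> in label_measure E. (\<lambda>k\<in>{i, j}. \<xi> k) i \<noteq> (\<lambda>k\<in>{i, j}. \<xi> k) j"
    using label_restrict_measurable[of "\<lambda>x. x" "{i, j}" E] ij ne by (subst (asm) AE_distr_iff) auto
  then show ?thesis by simp
qed

lemma label_AE_inj: "AE \<xi> in label_measure E. inj_on \<xi> (Field E)"
proof -
  have "AE \<xi> in label_measure E. \<forall>i j. i \<in> Field E \<and> j \<in> Field E \<and> i \<noteq> j \<longrightarrow> \<xi> i \<noteq> \<xi> j"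
    unfolding AE_all_countable using label_distinct_pair[of _ E] by auto
  then show ?thesis by eventually_elim (auto simp: inj_on_def)
qed

definition coin :: "real \<Rightarrow> complex" where
  "coin t = (if t < 1 / 2 then -1 else 1)"

lemma coin_measurable [measurable]: "coin \<in> borel_measurable borel"
  unfolding coin_def[abs_def] by measurable

lemma coin_mean:
  assumes i: "i \<in> Field E"
  shows "(\<integral>\<xi>. coin (\<xi> i) \<partial>label_measure E) = 0"
proof -
  have [measurable]: "coin \<in> borel_measurable unit_measure" by (rule measurable_restrict_space1) simp
  have "(\<integral>\<xi>. coin (\<xi> i) \<partial>label_measure E) = (\<integral>t. coin t \<partial>distr (label_measure E) unit_measure (\<lambda>\<xi>. \<xi> i))"
    by (subst integral_distr) (auto intro: label_component_unit[OF i])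
  also have "distr (label_measure E) unit_measure (\<lambda>\<xi>. \<xi> i) = unit_measure"
    unfolding label_measure_def by (rule distr_PiM_component[OF prob_space_unit i])
  also have "(\<integral>t. coin t \<partial>unit_measure) = (\<integral>t. indicator {0..1} t *\<^sub>R coin t \<partial>lborel)"
    by (subst integral_restrict_space) (auto simp: set_lebesgue_integral_def)
  also have "\<dots> = (\<integral>t. complex_of_real (indicator {1/2..1::real} t - indicator {0..<1/2} t) \<partial>lborel)"
    by (intro Bochner_Integration.integral_cong) (auto simp: coin_def indicator_def)
  also have "\<dots> = complex_of_real (\<integral>t. (indicator {1/2..1::real} t - indicator {0..<1/2} t) \<partial>lborel)"
    by (rule integral_complex_of_real)
  also have "(\<integral>t. (indicator {1/2..1::real} t - indicator {0..<1/2} t) \<partial>lborel) = (0 :: real)"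
    by (subst Bochner_Integration.integral_diff) (auto intro!: integrable_real_indicator emeasure_bounded_finite simp del: emeasure_lborel_Icc_eq emeasure_lborel_Ico)
  finally show ?thesis by simp
qed

section \<open>The kernels of labels and of neighbours\<close>

text \<open>
  The labellings that put the class into a given cylinder form a finite union of boxes, one for
  each isomorphism between the two balls.
\<close>

lemma labelled_class_measurable:
  assumes E: "(E, u) \<in> rooted_graphs D"
  shows "(\<lambda>\<xi>. labelled_class D E \<xi> u) \<in> label_measure E \<rightarrow>\<^sub>M labelled_space D"
  unfolding labelled_space_def labelled_cyl_def[symmetric]
proof (rule measurable_measure_of)
  show "{labelled_cyl D r E u U |E u r U. (E, u) \<in> rooted_graphs D \<and> (\<forall>w. open (U w))} \<subseteq> Pow (labelled_graphs D // labelled_iso D)"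
    by (auto simp: labelled_cyl_def intro: quotientI)
  show "(\<lambda>\<xi>. labelled_class D E \<xi> u) \<in> space (label_measure E) \<rightarrow> labelled_graphs D // labelled_iso D"
    using labelled_of_label[OF E] by (auto intro: quotientI)
  fix A assume "A \<in> {labelled_cyl D r E u U |E u r U. (E, u) \<in> rooted_graphs D \<and> (\<forall>w. open (U w))}"
  then obtain F v r U where F: "A = labelled_cyl D r F v U" "(F, v) \<in> rooted_graphs D" "\<And>w. open (U w)" by blast
  define B where "B = gball F r v"
  have fin: "finite B" unfolding B_def using rootedD(1)[OF F(2)] by simp
  define \<Phi> where "\<Phi> = {\<phi> \<in> B \<rightarrow>\<^sub>E gball E r u. ball_iso \<phi> r F v E u}"
  have finE: "finite (gball E r u)" using rootedD(1)[OF E] by simp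
  have "finite (B \<rightarrow>\<^sub>E gball E r u)" using fin finE by (intro finite_PiE) auto
  then have fin\<Phi>: "finite \<Phi>" unfolding \<Phi>_def by (rule rev_finite_subset) auto
  have "(\<lambda>\<xi>. labelled_class D E \<xi> u) -` A \<inter> space (label_measure E) =
      (\<Union>\<phi>\<in>\<Phi>. {\<xi> \<in> space (label_measure E). \<forall>w\<in>B. \<xi> (\<phi> w) \<in> U w})" (is "?L = ?R")
  proof (intro equalityI subsetI)
    fix \<xi> assume "\<xi> \<in> ?L"
    then have \<xi>: "\<xi> \<in> space (label_measure E)" and c: "labelled_class D E \<xi> u \<in> labelled_cyl D r F v U"
      using F(1) by auto
    from c[unfolded labelled_cyl_iff[OF labelled_of_label[OF E \<xi>]]]
    obtain \<phi> where \<phi>: "ball_iso \<phi> r F v E u" "\<forall>w\<in>gball F r v. \<xi> (\<phi> w) \<in> U w" by blast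
    have "ball_iso (restrict \<phi> B) r F v E u"
      using \<phi>(1) unfolding ball_iso_def B_def by (simp add: bij_betw_restrict_eq)
    then have "restrict \<phi> B \<in> \<Phi>" using ball_isoD(4)[OF \<phi>(1)] unfolding \<Phi>_def B_def by auto
    moreover have "\<forall>w\<in>B. \<xi> (restrict \<phi> B w) \<in> U w" using \<phi>(2) by (simp add: B_def)
    ultimately show "\<xi> \<in> ?R" using \<xi> by blast
  next
    fix \<xi> assume "\<xi> \<in> ?R"
    then obtain \<phi> where \<phi>: "ball_iso \<phi> r F v E u" "\<forall>w\<in>B. \<xi> (\<phi> w) \<in> U w" and \<xi>: "\<xi> \<in> space (label_measure E)"
      by (auto simp: \<Phi>_def)
    have "labelled_class D E \<xi> u \<in> labelled_cyl D r F v U"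
      unfolding labelled_cyl_iff[OF labelled_of_label[OF E \<xi>]] using \<phi> unfolding B_def by blast
    then show "\<xi> \<in> ?L" using \<xi> F(1) by simp
  qed
  moreover have "{\<xi> \<in> space (label_measure E). \<forall>w\<in>B. \<xi> (\<phi> w) \<in> U w} \<in> sets (label_measure E)" if "\<phi> \<in> \<Phi>" for \<phi>
  proof (intro sets.sets_Collect_finite_All' fin)
    fix w assume "w \<in> B"
    then have "\<phi> w \<in> Field E"
      using that gball_Field[OF rootedD(2)[OF E], of r] by (auto simp: \<Phi>_def PiE_def Pi_def)
    from measurable_sets[OF label_component[OF this], of "U w"] F(3)
    show "{\<xi> \<in> space (label_measure E). \<xi> (\<phi> w) \<in> U w} \<in> sets (label_measure E)"
      by (simp add: vimage_def Int_def conj_commute)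
  next
    show "B \<noteq> {}" using gball_self[of v F r] unfolding B_def by blast
  qed
  ultimately show "(\<lambda>\<xi>. labelled_class D E \<xi> u) -` A \<inter> space (label_measure E) \<in> sets (label_measure E)"
    using fin\<Phi> by auto
qed

definition label_kernel :: "nat \<Rightarrow> nat rel \<Rightarrow> nat \<Rightarrow> labelled set measure" where
  "label_kernel D E u = distr (label_measure E) (labelled_space D) (\<lambda>\<xi>. labelled_class D E \<xi> u)"

text \<open>
  The conditional law of the labelled graph given the unlabelled one.
\<close>

definition fibre :: "nat \<Rightarrow> rooted set \<Rightarrow> labelled set measure" where
  "fibre D x = (case rep x of (E, u) \<Rightarrow> label_kernel D E u)"

lemma sets_label_kernel [simp]: "sets (label_kernel D E u) = sets (labelled_space D)"
  by (simp add: label_kernel_def)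

lemma space_label_kernel [simp]: "space (label_kernel D E u) = space (labelled_space D)"
  by (simp add: label_kernel_def)

lemma prob_label_kernel: "(E, u) \<in> rooted_graphs D \<Longrightarrow> prob_space (label_kernel D E u)"
  unfolding label_kernel_def
  by (intro prob_space.prob_space_distr prob_space_label labelled_class_measurable)

lemma emeasure_label_kernel:
  assumes "(E, u) \<in> rooted_graphs D" "A \<in> sets (labelled_space D)"
  shows "emeasure (label_kernel D E u) A =
    emeasure (label_measure E) {\<xi> \<in> space (label_measure E). labelled_class D E \<xi> u \<in> A}"
  unfolding label_kernel_def using assms
  by (subst emeasure_distr[OF labelled_class_measurable]) (auto intro!: arg_cong[where f = "emeasure _"])

lemma label_event_sets:
  assumes "(E, u) \<in> rooted_graphs D" "A \<in> sets (labelled_space D)"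
  shows "{\<xi> \<in> space (label_measure E). labelled_class D E \<xi> u \<in> A} \<in> sets (label_measure E)"
  using measurable_sets[OF labelled_class_measurable[OF assms(1)] assms(2)]
  by (simp add: vimage_def Int_def conj_commute)

text \<open>
  A local event concerns the labels in a ball, and the law of these depends only on the ball.
\<close>

lemma label_kernel_local:
  assumes E: "(E, u) \<in> rooted_graphs D" and F: "(F, v) \<in> rooted_graphs D"
    and iso: "ball_iso \<phi> r E u F v" and A: "open_local D r A"
  shows "emeasure (label_kernel D E u) A = emeasure (label_kernel D F v) A"
  unfolding emeasure_label_kernel[OF E open_local_sets[OF A]] emeasure_label_kernel[OF F open_local_sets[OF A]]
proof (rule label_emeasure_transfer[where I = "gball E r u" and \<phi> = \<phi>])
  show "gball E r u \<subseteq> Field E" by (rule gball_Field[OF rootedD(2)[OF E]])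
  show "inj_on \<phi> (gball E r u)" by (rule ball_isoD(3)[OF iso])
  show "\<phi> ` gball E r u \<subseteq> Field F"
    unfolding ball_isoD(4)[OF iso] by (rule gball_Field[OF rootedD(2)[OF F]])
  fix \<xi> \<eta> assume "\<xi> \<in> space (label_measure E)" "\<eta> \<in> space (label_measure F)" "\<And>i. i \<in> gball E r u \<Longrightarrow> \<eta> (\<phi> i) = \<xi> i"
  then show "labelled_class D E \<xi> u \<in> A \<longleftrightarrow> labelled_class D F \<eta> v \<in> A"
    by (intro open_local_iff[OF A _ _ iso] labelled_of_label E F)
qed (intro label_event_sets E F open_local_sets[OF A])+

text \<open>
  A measure is determined by its values on local events, and these are preserved by isomorphisms.
\<close>

lemma label_kernel_iso:
  assumes E: "(E, u) \<in> rooted_graphs D" and F: "(F, v) \<in> rooted_graphs D"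
    and iso: "graph_iso \<phi> E F" "\<phi> u = v"
  shows "label_kernel D E u = label_kernel D F v"
proof (rule measure_eqI_generator_eq[where E = "open_locals D" and \<Omega> = "space (labelled_space D)"
      and A = "\<lambda>_. space (labelled_space D)"])
  interpret K: prob_space "label_kernel D E u" by (rule prob_label_kernel[OF E])
  fix A assume "A \<in> open_locals D"
  then obtain r where A: "open_local D r A" by (auto simp: open_locals_def)
  show "emeasure (label_kernel D E u) A = emeasure (label_kernel D F v) A"
    using graph_iso_ball_iso[OF iso(1) rootedD(2)[OF E], of r] iso(2)
    by (intro label_kernel_local[OF E F _ A]) auto
next
  interpret K: prob_space "label_kernel D E u" by (rule prob_label_kernel[OF E])
  show "emeasure (label_kernel D E u) (space (labelled_space D)) \<noteq> \<infinity>" for i :: nat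
    using K.emeasure_space_1 by simp
next
  show "range (\<lambda>_. space (labelled_space D)) \<subseteq> open_locals D"
    using space_open_local[of D 0] unfolding open_locals_def by blast
qed (simp_all add: sets_labelled_space open_locals_Int_stable open_locals_subset)

lemma fibre_class:
  assumes E: "(E, u) \<in> rooted_graphs D"
  shows "fibre D (rooted_class D E u) = label_kernel D E u"
proof -
  from rep_rooted_class[OF E] obtain F v \<phi> where
    F: "rep (rooted_class D E u) = (F, v)" "(F, v) \<in> rooted_graphs D" "graph_iso \<phi> E F" "\<phi> u = v" .
  show ?thesis unfolding fibre_def F(1) using label_kernel_iso[OF E F(2-4)] by simp
qed

lemma rooted_local_measurable:
  assumes h: "\<And>E u F v \<phi>. (E, u) \<in> rooted_graphs D \<Longrightarrow> (F, v) \<in> rooted_graphs D \<Longrightarrow> ball_iso \<phi> r E u F v \<Longrightarrow>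
      h (rooted_class D E u) = h (rooted_class D F v)"
    and sp: "h \<in> space (rooted_space D) \<rightarrow> space N"
  shows "h \<in> rooted_space D \<rightarrow>\<^sub>M N"
proof (rule measurableI)
  fix B assume "B \<in> sets N"
  show "h -` B \<inter> space (rooted_space D) \<in> sets (rooted_space D)"
  proof (rule rooted_local_sets[where r = r])
    fix E u F v \<phi> assume *: "(E, u) \<in> rooted_graphs D" "(F, v) \<in> rooted_graphs D"
      "rooted_class D E u \<in> h -` B \<inter> space (rooted_space D)" "ball_iso \<phi> r E u F v"
    then show "rooted_class D F v \<in> h -` B \<inter> space (rooted_space D)"
      using h[OF *(1,2,4)] rooted_class_space[OF *(2)] by auto
  qed simp
qed (use sp in auto)

text \<open>
  It suffices to check the probabilities of local events, which are functions of a ball around the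
  root.
\<close>

lemma fibre_measurable: "fibre D \<in> rooted_space D \<rightarrow>\<^sub>M prob_algebra (labelled_space D)"
proof (rule measurable_prob_algebra_generated[OF sets_labelled_space open_locals_Int_stable open_locals_subset])
  fix x assume "x \<in> space (rooted_space D)"
  from rooted_spaceE[OF this] obtain E u where E: "(E, u) \<in> rooted_graphs D" "x = rooted_class D E u" by metis
  show "prob_space (fibre D x)" "sets (fibre D x) = sets (labelled_space D)"
    unfolding E(2) fibre_class[OF E(1)] using prob_label_kernel[OF E(1)] by auto
next
  fix A assume "A \<in> open_locals D"
  then obtain r where A: "open_local D r A" by (auto simp: open_locals_def)
  show "(\<lambda>x. emeasure (fibre D x) A) \<in> borel_measurable (rooted_space D)"
    by (rule rooted_local_measurable[where r = r]) (auto simp: fibre_class label_kernel_local[OF _ _ _ A])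
qed

definition neighbour_kernel :: "nat \<Rightarrow> labelled set \<Rightarrow> labelled set measure" where
  "neighbour_kernel D x = (case rep x of (E, \<xi>, u) \<Rightarrow>
     distr (uniform_count_measure (E `` {u})) (labelled_space D) (\<lambda>v. labelled_class D E \<xi> v))"

text \<open>
  Neighbours are counted as vertices of the graph, hence repeatedly if they are the same point of
  the graphing.
\<close>

definition neighbour_count :: "nat \<Rightarrow> labelled set set \<Rightarrow> labelled set \<Rightarrow> nat" where
  "neighbour_count D A x = (case rep x of (E, \<xi>, u) \<Rightarrow> card {v \<in> E `` {u}. labelled_class D E \<xi> v \<in> A})"

lemma neighbour_labelled: "(E, \<xi>, u) \<in> labelled_graphs D \<Longrightarrow> (u, v) \<in> E \<Longrightarrow> (E, \<xi>, v) \<in> labelled_graphs D"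
  by (auto simp: labelled_graphs_def Field_def)

lemma labelledD: "(E, \<xi>, u) \<in> labelled_graphs D \<Longrightarrow> E \<in> graphs D" "(E, \<xi>, u) \<in> labelled_graphs D \<Longrightarrow> u \<in> Field E"
  by (auto simp: labelled_graphs_def)

lemma iso_neighbour_classes:
  assumes E: "(E, \<xi>, u) \<in> labelled_graphs D" and F: "(F, \<eta>, v) \<in> labelled_graphs D"
    and iso: "graph_iso \<phi> E F" "\<phi> u = v" "\<forall>w\<in>Field E. \<eta> (\<phi> w) = \<xi> w"
  shows "bij_betw \<phi> (E `` {u}) (F `` {v})"
    "\<And>w. w \<in> Field E \<Longrightarrow> labelled_class D F \<eta> (\<phi> w) = labelled_class D E \<xi> w"
proof -
  have "ball_iso \<phi> 1 E u F v" using graph_iso_ball_iso[OF iso(1) labelledD(2)[OF E]] iso(2) by simp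
  then show "bij_betw \<phi> (E `` {u}) (F `` {v})" by (rule ball_iso_neighbours) simp
  fix w assume w: "w \<in> Field E"
  then have fw: "\<phi> w \<in> Field F" using graph_isoD(3)[OF iso(1)] by blast
  have "labelled_class D E \<xi> w = labelled_class D F \<eta> (\<phi> w)"
    by (rule labelled_class_eqI[OF labelled_move[OF E w] labelled_move[OF F fw] iso(1) refl]) (rule bspec[OF iso(3)])
  then show "labelled_class D F \<eta> (\<phi> w) = labelled_class D E \<xi> w" by (rule sym)
qed

lemma neighbour_count_class:
  assumes E: "(E, \<xi>, u) \<in> labelled_graphs D"
  shows "neighbour_count D A (labelled_class D E \<xi> u) = card {v \<in> E `` {u}. labelled_class D E \<xi> v \<in> A}"
proof -
  from rep_labelled_class[OF E] obtain F \<eta> v \<phi> where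
    F: "rep (labelled_class D E \<xi> u) = (F, \<eta>, v)" "(F, \<eta>, v) \<in> labelled_graphs D"
    "graph_iso \<phi> E F" "\<phi> u = v" "\<forall>w\<in>Field E. \<eta> (\<phi> w) = \<xi> w"
    "labelled_class D F \<eta> v = labelled_class D E \<xi> u" .
  note * = iso_neighbour_classes[OF E F(2-5)]
  have sub: "E `` {u} \<subseteq> Field E" by (auto simp: Field_def)
  have "bij_betw \<phi> {w \<in> E `` {u}. labelled_class D E \<xi> w \<in> A} {w \<in> F `` {v}. labelled_class D F \<eta> w \<in> A}"
    unfolding bij_betw_def
  proof
    show "inj_on \<phi> {w \<in> E `` {u}. labelled_class D E \<xi> w \<in> A}"
      by (rule inj_on_subset[OF bij_betw_imp_inj_on[OF *(1)] Collect_subset])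
    show "\<phi> ` {w \<in> E `` {u}. labelled_class D E \<xi> w \<in> A} = {w \<in> F `` {v}. labelled_class D F \<eta> w \<in> A}"
    proof (intro equalityI subsetI)
      fix y assume "y \<in> \<phi> ` {w \<in> E `` {u}. labelled_class D E \<xi> w \<in> A}"
      then obtain w where w: "w \<in> E `` {u}" "labelled_class D E \<xi> w \<in> A" "y = \<phi> w" by blast
      have "y \<in> F `` {v}" using bij_betwE[OF *(1)] w(1,3) by blast
      moreover have "labelled_class D F \<eta> y \<in> A" using *(2)[OF subsetD[OF sub w(1)]] w(2,3) by simp
      ultimately show "y \<in> {w \<in> F `` {v}. labelled_class D F \<eta> w \<in> A}" by simp
    next
      fix y assume y: "y \<in> {w \<in> F `` {v}. labelled_class D F \<eta> w \<in> A}"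
      then have "y \<in> \<phi> ` (E `` {u})" unfolding bij_betw_imp_surj_on[OF *(1)] by simp
      then obtain w where w: "w \<in> E `` {u}" "y = \<phi> w" by blast
      have "labelled_class D E \<xi> w \<in> A" using *(2)[OF subsetD[OF sub w(1)]] y w(2) by simp
      then show "y \<in> \<phi> ` {w \<in> E `` {u}. labelled_class D E \<xi> w \<in> A}" using w by blast
    qed
  qed
  from bij_betw_same_card[OF this] show ?thesis by (simp add: neighbour_count_def F(1))
qed

text \<open>
  A neighbour whose class lies in the open event \<open>A\<close> keeps this property under small changes of
  the labels, so the count cannot drop. The radius increases by one because the balls are centred
  at neighbours of the root.
\<close>

lemma neighbour_count_open:
  assumes A: "open_local D r A"
  shows "open_local D (Suc r) {x \<in> space (labelled_space D). k \<le> neighbour_count D A x}"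
proof (rule open_localI)
  fix E \<xi> u assume E: "(E, \<xi>, u) \<in> labelled_graphs D"
    and k: "labelled_class D E \<xi> u \<in> {x \<in> space (labelled_space D). k \<le> neighbour_count D A x}"
  define V where "V = {v \<in> E `` {u}. labelled_class D E \<xi> v \<in> A}"
  have finV: "finite V" unfolding V_def by (rule finite_subset[OF _ neighbours_finite[OF labelledD(1)[OF E], of u]]) auto
  have kV: "k \<le> card V" using k by (simp add: neighbour_count_class[OF E] V_def)
  have "\<exists>e>0. local_nbhd D r A E \<xi> v e" if "v \<in> V" for v
    using open_localE[OF A neighbour_labelled[OF E]] that unfolding V_def by blast
  then obtain e where e: "\<And>v. v \<in> V \<Longrightarrow> e v > 0" "\<And>v. v \<in> V \<Longrightarrow> local_nbhd D r A E \<xi> v (e v)" by metis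
  define \<epsilon> where "\<epsilon> = Min (insert 1 (e ` V))"
  have \<epsilon>0: "\<epsilon> > 0" unfolding \<epsilon>_def using finV e(1) by (subst Min_gr_iff) auto
  have \<epsilon>: "\<epsilon> \<le> e v" if "v \<in> V" for v unfolding \<epsilon>_def using finV that by (intro Min_le) auto
  have "local_nbhd D (Suc r) {x \<in> space (labelled_space D). k \<le> neighbour_count D A x} E \<xi> u \<epsilon>"
  proof (rule local_nbhdI)
    fix F \<eta> w \<phi> assume F: "(F, \<eta>, w) \<in> labelled_graphs D" and iso: "ball_iso \<phi> (Suc r) E u F w"
      and near: "\<And>v. v \<in> gball E (Suc r) u \<Longrightarrow> \<bar>\<eta> (\<phi> v) - \<xi> v\<bar> < \<epsilon>"
    have bij: "bij_betw \<phi> (E `` {u}) (F `` {w})" by (rule ball_iso_neighbours[OF iso]) simp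
    have "\<phi> ` V \<subseteq> {v \<in> F `` {w}. labelled_class D F \<eta> v \<in> A}"
    proof
      fix y assume "y \<in> \<phi> ` V"
      then obtain v where v: "v \<in> V" "y = \<phi> v" by auto
      then have uv: "(u, v) \<in> E" by (simp add: V_def)
      have v1: "v \<in> gball E 1 u" by (rule relpow_gball[of u v 1]) (use uv in auto)
      have y: "y \<in> F `` {w}" using bij v uv by (auto simp: bij_betw_def)
      have "labelled_class D F \<eta> y \<in> A"
        unfolding v(2)
      proof (rule local_nbhdD[OF e(2)[OF v(1)] _ ball_iso_recentre[OF iso v1]])
        show "(F, \<eta>, \<phi> v) \<in> labelled_graphs D" using neighbour_labelled[OF F] y v by auto
        fix z assume "z \<in> gball E r v"
        then have "z \<in> gball E (Suc r) u" using gball_trans[OF v1, of z r] by simp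
        then show "\<bar>\<eta> (\<phi> z) - \<xi> z\<bar> < e v" using near \<epsilon>[OF v(1)] by fastforce
      qed simp
      then show "y \<in> {v \<in> F `` {w}. labelled_class D F \<eta> v \<in> A}" using y by simp
    qed
    moreover have "finite {v \<in> F `` {w}. labelled_class D F \<eta> v \<in> A}"
      by (rule finite_subset[OF _ neighbours_finite[OF labelledD(1)[OF F], of w]]) auto
    ultimately have "card (\<phi> ` V) \<le> card {v \<in> F `` {w}. labelled_class D F \<eta> v \<in> A}" by (intro card_mono)
    moreover have "card (\<phi> ` V) = card V"
      by (rule card_image[OF inj_on_subset[OF bij_betw_imp_inj_on[OF bij]]]) (auto simp: V_def)
    ultimately show "labelled_class D F \<eta> w \<in> {x \<in> space (labelled_space D). k \<le> neighbour_count D A x}"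
      using kV labelled_class_space[OF F] by (simp add: neighbour_count_class[OF F])
  qed
  with \<epsilon>0 show "\<exists>\<epsilon>>0. local_nbhd D (Suc r) {x \<in> space (labelled_space D). k \<le> neighbour_count D A x} E \<xi> u \<epsilon>" by blast
qed auto

lemma neighbour_count_measurable:
  assumes A: "open_local D r A"
  shows "(\<lambda>x. real (neighbour_count D A x)) \<in> borel_measurable (labelled_space D)"
  unfolding borel_measurable_iff_ge
proof
  fix a
  have "{x \<in> space (labelled_space D). a \<le> real (neighbour_count D A x)} =
      {x \<in> space (labelled_space D). nat \<lceil>a\<rceil> \<le> neighbour_count D A x}"
    by (auto simp: nat_le_iff ceiling_le_iff)
  also have "\<dots> \<in> sets (labelled_space D)" by (rule open_local_sets[OF neighbour_count_open[OF A]])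
  finally show "{x \<in> space (labelled_space D). a \<le> real (neighbour_count D A x)} \<in> sets (labelled_space D)" .
qed

lemma neighbour_class_measurable:
  assumes E: "(E, \<xi>, u) \<in> labelled_graphs D"
  shows "(\<lambda>v. labelled_class D E \<xi> v) \<in> uniform_count_measure (E `` {u}) \<rightarrow>\<^sub>M labelled_space D"
  by (rule measurableI) (auto simp: space_uniform_count_measure sets_uniform_count_measure
      intro!: labelled_class_space neighbour_labelled[OF E])

lemma emeasure_neighbour_distr:
  assumes E: "(E, \<xi>, u) \<in> labelled_graphs D" and A: "A \<in> sets (labelled_space D)"
  shows "emeasure (distr (uniform_count_measure (E `` {u})) (labelled_space D) (\<lambda>v. labelled_class D E \<xi> v)) A =
    ennreal (real (neighbour_count D A (labelled_class D E \<xi> u)) / real (degree E u))"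
proof -
  have "(\<lambda>v. labelled_class D E \<xi> v) -` A \<inter> space (uniform_count_measure (E `` {u})) =
      {v \<in> E `` {u}. labelled_class D E \<xi> v \<in> A}"
    by (auto simp: space_uniform_count_measure)
  moreover have "emeasure (uniform_count_measure (E `` {u})) {v \<in> E `` {u}. labelled_class D E \<xi> v \<in> A} =
      ennreal (real (card {v \<in> E `` {u}. labelled_class D E \<xi> v \<in> A}) / real (card (E `` {u})))"
    by (rule emeasure_uniform_count_measure[OF neighbours_finite[OF labelledD(1)[OF E]]]) blast
  ultimately show ?thesis
    unfolding emeasure_distr[OF neighbour_class_measurable[OF E] A] neighbour_count_class[OF E] degree_def by simp
qed

lemma neighbour_count_space:
  assumes E: "(E, \<xi>, u) \<in> labelled_graphs D"
  shows "neighbour_count D (space (labelled_space D)) (labelled_class D E \<xi> u) = degree E u"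
proof -
  have "{v \<in> E `` {u}. labelled_class D E \<xi> v \<in> space (labelled_space D)} = E `` {u}"
    using labelled_class_space[OF neighbour_labelled[OF E]] by auto
  then show ?thesis by (simp add: neighbour_count_class[OF E] degree_def)
qed

lemma neighbour_kernel_class:
  assumes E: "(E, \<xi>, u) \<in> labelled_graphs D"
  shows "neighbour_kernel D (labelled_class D E \<xi> u) =
    distr (uniform_count_measure (E `` {u})) (labelled_space D) (\<lambda>v. labelled_class D E \<xi> v)"
proof -
  from rep_labelled_class[OF E] obtain F \<eta> v \<phi> where
    F: "rep (labelled_class D E \<xi> u) = (F, \<eta>, v)" "(F, \<eta>, v) \<in> labelled_graphs D"
    "labelled_class D F \<eta> v = labelled_class D E \<xi> u" by metis
  have "degree F v = degree E u" using neighbour_count_space[OF F(2)] neighbour_count_space[OF E] F(3) by simp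
  then show ?thesis
    unfolding neighbour_kernel_def F(1) prod.case
  proof (intro measure_eqI)
    fix A assume "A \<in> sets (distr (uniform_count_measure (F `` {v})) (labelled_space D) (\<lambda>v. labelled_class D F \<eta> v))"
    then have A: "A \<in> sets (labelled_space D)" by simp
    show "emeasure (distr (uniform_count_measure (F `` {v})) (labelled_space D) (\<lambda>v. labelled_class D F \<eta> v)) A =
      emeasure (distr (uniform_count_measure (E `` {u})) (labelled_space D) (\<lambda>v. labelled_class D E \<xi> v)) A"
      using \<open>degree F v = degree E u\<close> unfolding emeasure_neighbour_distr[OF F(2) A] emeasure_neighbour_distr[OF E A] F(3) by simp
  qed simp
qed

lemma emeasure_neighbour_kernel:
  assumes x: "x \<in> space (labelled_space D)" and A: "A \<in> sets (labelled_space D)"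
  shows "emeasure (neighbour_kernel D x) A =
    ennreal (real (neighbour_count D A x) / real (neighbour_count D (space (labelled_space D)) x))"
proof -
  from labelled_spaceE[OF x] obtain E \<xi> u where E: "(E, \<xi>, u) \<in> labelled_graphs D" "x = labelled_class D E \<xi> u" by metis
  show ?thesis
    unfolding E(2) neighbour_kernel_class[OF E(1)] emeasure_neighbour_distr[OF E(1) A] neighbour_count_space[OF E(1)] ..
qed

lemma neighbour_kernel_measurable: "neighbour_kernel D \<in> labelled_space D \<rightarrow>\<^sub>M prob_algebra (labelled_space D)"
proof (rule measurable_prob_algebra_generated[OF sets_labelled_space open_locals_Int_stable open_locals_subset])
  fix x assume x: "x \<in> space (labelled_space D)"
  from labelled_spaceE[OF this] obtain E \<xi> u where E: "(E, \<xi>, u) \<in> labelled_graphs D" "x = labelled_class D E \<xi> u" by metis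
  show "sets (neighbour_kernel D x) = sets (labelled_space D)"
    unfolding E(2) neighbour_kernel_class[OF E(1)] by simp
  have "degree E u > 0" using degree_pos labelledD[OF E(1)] by blast
  then have "emeasure (neighbour_kernel D x) (space (labelled_space D)) = 1"
    unfolding emeasure_neighbour_kernel[OF x sets.top] by (simp add: E(2) neighbour_count_space[OF E(1)])
  then show "prob_space (neighbour_kernel D x)"
    by (intro prob_spaceI) (simp add: E(2) neighbour_kernel_class[OF E(1)])
next
  fix A assume "A \<in> open_locals D"
  then obtain r where A: "open_local D r A" by (auto simp: open_locals_def)
  have [measurable]: "(\<lambda>x. real (neighbour_count D A x)) \<in> borel_measurable (labelled_space D)"
    "(\<lambda>x. real (neighbour_count D (space (labelled_space D)) x)) \<in> borel_measurable (labelled_space D)"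
    by (rule neighbour_count_measurable[OF A]) (rule neighbour_count_measurable[OF space_open_local[of _ 0]])
  have "(\<lambda>x. ennreal (real (neighbour_count D A x) / real (neighbour_count D (space (labelled_space D)) x)))
      \<in> borel_measurable (labelled_space D)" by measurable
  then show "(\<lambda>x. emeasure (neighbour_kernel D x) A) \<in> borel_measurable (labelled_space D)"
    by (rule measurable_cong[THEN iffD1, rotated]) (simp add: emeasure_neighbour_kernel open_local_sets[OF A])
qed

lemma integral_neighbour_kernel:
  fixes f :: "labelled set \<Rightarrow> complex"
  assumes E: "(E, \<xi>, u) \<in> labelled_graphs D" and f: "f \<in> borel_measurable (labelled_space D)"
  shows "(\<integral>y. f y \<partial>neighbour_kernel D (labelled_class D E \<xi> u)) = markov E (\<lambda>v. f (labelled_class D E \<xi> v)) u"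
proof -
  have fin: "finite (E `` {u})" by (rule neighbours_finite[OF labelledD(1)[OF E]])
  have "(\<integral>y. f y \<partial>neighbour_kernel D (labelled_class D E \<xi> u)) =
      (\<integral>v. f (labelled_class D E \<xi> v) \<partial>uniform_count_measure (E `` {u}))"
    unfolding neighbour_kernel_class[OF E] by (rule integral_distr[OF neighbour_class_measurable[OF E] f])
  also have "\<dots> = (\<Sum>v\<in>E `` {u}. (1 / real (card (E `` {u}))) *\<^sub>R f (labelled_class D E \<xi> v))"
    unfolding uniform_count_measure_def using fin
    by (subst lebesgue_integral_point_measure_finite) auto
  also have "\<dots> = markov E (\<lambda>v. f (labelled_class D E \<xi> v)) u"
    by (simp add: markov_def degree_def scaleR_conv_of_real sum_divide_distrib)
  finally show ?thesis .
qed

section \<open>Graphs with distinct labels\<close>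

definition distinct_labels :: "nat \<Rightarrow> labelled set set" where
  "distinct_labels D = {labelled_class D E \<xi> u |E \<xi> u. (E, \<xi>, u) \<in> labelled_graphs D \<and> inj_on \<xi> (Field E)}"

text \<open>
  Distinctness of all labels is not a local event, but it is the intersection of these local
  events.
\<close>

definition distinct_ball :: "nat \<Rightarrow> nat \<Rightarrow> labelled set set" where
  "distinct_ball D r = {labelled_class D E \<xi> u |E \<xi> u. (E, \<xi>, u) \<in> labelled_graphs D \<and> inj_on \<xi> (gball E r u)}"

lemma inj_on_image_cong:
  assumes "bij_betw \<phi> A B" "\<forall>w\<in>A. \<eta> (\<phi> w) = \<xi> w"
  shows "inj_on \<xi> A \<longleftrightarrow> inj_on \<eta> B"
proof -
  have "inj_on \<xi> A \<longleftrightarrow> inj_on (\<lambda>w. \<eta> (\<phi> w)) A"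
    by (rule inj_on_cong) (simp add: assms(2))
  also have "\<dots> \<longleftrightarrow> inj_on \<eta> (\<phi> ` A)"
    using comp_inj_on_iff[of \<phi> A \<eta>] assms(1) by (simp add: bij_betw_def o_def)
  finally show ?thesis using assms(1) by (simp add: bij_betw_def)
qed

lemma distinct_labels_iff:
  assumes E: "(E, \<xi>, u) \<in> labelled_graphs D"
  shows "labelled_class D E \<xi> u \<in> distinct_labels D \<longleftrightarrow> inj_on \<xi> (Field E)"
proof
  assume "labelled_class D E \<xi> u \<in> distinct_labels D"
  then obtain F \<eta> v where F: "labelled_class D E \<xi> u = labelled_class D F \<eta> v" "(F, \<eta>, v) \<in> labelled_graphs D"
    "inj_on \<eta> (Field F)" by (auto simp: distinct_labels_def)
  from labelled_class_eqE[OF E F(2,1)] obtain \<phi> where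
    \<phi>: "graph_iso \<phi> E F" "\<And>w. w \<in> Field E \<Longrightarrow> \<eta> (\<phi> w) = \<xi> w" by blast
  have "\<forall>w\<in>Field E. \<eta> (\<phi> w) = \<xi> w" using \<phi>(2) by (rule ballI)
  from inj_on_image_cong[OF graph_isoD(1)[OF \<phi>(1)] this] F(3) show "inj_on \<xi> (Field E)" by simp
qed (use E in \<open>auto simp: distinct_labels_def\<close>)

lemma distinct_ball_iff:
  assumes E: "(E, \<xi>, u) \<in> labelled_graphs D"
  shows "labelled_class D E \<xi> u \<in> distinct_ball D r \<longleftrightarrow> inj_on \<xi> (gball E r u)"
proof
  assume "labelled_class D E \<xi> u \<in> distinct_ball D r"
  then obtain F \<eta> v where F: "labelled_class D E \<xi> u = labelled_class D F \<eta> v" "(F, \<eta>, v) \<in> labelled_graphs D"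
    "inj_on \<eta> (gball F r v)" by (auto simp: distinct_ball_def)
  from labelled_class_eqE[OF E F(2,1)] obtain \<phi> where
    \<phi>: "graph_iso \<phi> E F" "\<phi> u = v" "\<And>w. w \<in> Field E \<Longrightarrow> \<eta> (\<phi> w) = \<xi> w" by blast
  have "bij_betw \<phi> (gball E r u) (gball F r v)"
    using ball_isoD(1)[OF graph_iso_ball_iso[OF \<phi>(1) labelledD(2)[OF E]]] \<phi>(2) by simp
  moreover have "\<forall>w\<in>gball E r u. \<eta> (\<phi> w) = \<xi> w"
    using \<phi>(3)[OF subsetD[OF gball_Field[OF labelledD(2)[OF E]]]] by (rule ballI)
  ultimately have "inj_on \<xi> (gball E r u) \<longleftrightarrow> inj_on \<eta> (gball F r v)" by (rule inj_on_image_cong)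
  with F(3) show "inj_on \<xi> (gball E r u)" by simp
qed (use E in \<open>auto simp: distinct_ball_def\<close>)

lemma distinct_ball_open: "open_local D r (distinct_ball D r)"
proof (rule open_localI)
  show "distinct_ball D r \<subseteq> space (labelled_space D)"
    by (auto simp: distinct_ball_def intro: labelled_class_space)
  fix E \<xi> u assume E: "(E, \<xi>, u) \<in> labelled_graphs D" "labelled_class D E \<xi> u \<in> distinct_ball D r"
  let ?B = "gball E r u"
  define Q where "Q = {(a, b). a \<in> ?B \<and> b \<in> ?B \<and> a \<noteq> b}"
  have inj: "inj_on \<xi> ?B" using E by (simp add: distinct_ball_iff)
  have "Q \<subseteq> ?B \<times> ?B" by (auto simp: Q_def)
  then have finQ: "finite Q" using labelledD(1)[OF E(1)] by (auto intro: finite_subset)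
  define \<epsilon> where "\<epsilon> = Min (insert 1 ((\<lambda>(a, b). \<bar>\<xi> a - \<xi> b\<bar> / 2) ` Q))"
  have \<epsilon>0: "\<epsilon> > 0" unfolding \<epsilon>_def using finQ inj
    by (subst Min_gr_iff) (auto simp: Q_def inj_on_def)
  have \<epsilon>: "\<epsilon> \<le> \<bar>\<xi> a - \<xi> b\<bar> / 2" if "a \<in> ?B" "b \<in> ?B" "a \<noteq> b" for a b
    unfolding \<epsilon>_def using finQ that by (intro Min_le) (auto simp: Q_def image_iff intro!: bexI[of _ "(a, b)"])
  have "local_nbhd D r (distinct_ball D r) E \<xi> u \<epsilon>"
  proof (rule local_nbhdI)
    fix F \<eta> v \<phi> assume F: "(F, \<eta>, v) \<in> labelled_graphs D" and iso: "ball_iso \<phi> r E u F v"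
      and near: "\<And>w. w \<in> ?B \<Longrightarrow> \<bar>\<eta> (\<phi> w) - \<xi> w\<bar> < \<epsilon>"
    have "inj_on (\<lambda>w. \<eta> (\<phi> w)) ?B"
    proof (rule inj_onI, rule ccontr)
      fix a b assume ab: "a \<in> ?B" "b \<in> ?B" "\<eta> (\<phi> a) = \<eta> (\<phi> b)" "a \<noteq> b"
      show False using near[OF ab(1)] near[OF ab(2)] \<epsilon>[OF ab(1,2,4)] ab(3) by (simp add: abs_if split: if_splits)
    qed
    then have "inj_on \<eta> (gball F r v)"
      using inj_on_image_cong[OF ball_isoD(1)[OF iso], of \<eta> "\<lambda>w. \<eta> (\<phi> w)"] by simp
    then show "labelled_class D F \<eta> v \<in> distinct_ball D r" by (simp add: distinct_ball_iff[OF F])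
  qed
  with \<epsilon>0 show "\<exists>\<epsilon>>0. local_nbhd D r (distinct_ball D r) E \<xi> u \<epsilon>" by blast
qed

lemma Field_gball:
  assumes E: "E \<in> graphs D" and u: "u \<in> Field E"
  shows "Field E = (\<Union>r. gball E r u)"
proof
  show "Field E \<subseteq> (\<Union>r. gball E r u)"
  proof
    fix v assume "v \<in> Field E"
    then obtain k where "(u, v) \<in> E ^^ k" using connected_path[OF E u] rtrancl_imp_relpow by metis
    then show "v \<in> (\<Union>r. gball E r u)" using relpow_gball[of u v k E k] by blast
  qed
qed (use gball_Field[OF u] in blast)

lemma distinct_labels_eq: "distinct_labels D = (\<Inter>r. distinct_ball D r)"
proof (intro equalityI subsetI)
  fix x assume "x \<in> distinct_labels D"
  then obtain E \<xi> u where E: "x = labelled_class D E \<xi> u" "(E, \<xi>, u) \<in> labelled_graphs D" "inj_on \<xi> (Field E)"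
    by (auto simp: distinct_labels_def)
  have "inj_on \<xi> (gball E r u)" for r
    using E(3) gball_Field[OF labelledD(2)[OF E(2)]] by (rule inj_on_subset)
  then show "x \<in> (\<Inter>r. distinct_ball D r)" using E by (simp add: distinct_ball_iff)
next
  fix x assume x: "x \<in> (\<Inter>r. distinct_ball D r)"
  then have "x \<in> space (labelled_space D)" using open_local_space[OF distinct_ball_open[of D 0]] by blast
  from labelled_spaceE[OF this] obtain E \<xi> u where E: "(E, \<xi>, u) \<in> labelled_graphs D" "x = labelled_class D E \<xi> u" by metis
  have inj: "inj_on \<xi> (gball E r u)" for r using x E by (auto simp: distinct_ball_iff)
  have "inj_on \<xi> (Field E)"
  proof (rule inj_onI)
    fix a b assume ab: "a \<in> Field E" "b \<in> Field E" "\<xi> a = \<xi> b"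
    then obtain r s where "a \<in> gball E r u" "b \<in> gball E s u"
      using Field_gball[OF labelledD[OF E(1)]] by blast
    then have "a \<in> gball E (max r s) u" "b \<in> gball E (max r s) u"
      using gball_mono[of r "max r s" E u] gball_mono[of s "max r s" E u] by auto
    then show "a = b" using inj ab(3) by (auto dest: inj_onD)
  qed
  then show "x \<in> distinct_labels D" using E by (simp add: distinct_labels_iff)
qed

lemma distinct_labels_sets [measurable]: "distinct_labels D \<in> sets (labelled_space D)"
  unfolding distinct_labels_eq
  by (rule sets.countable_INT) (use open_local_sets[OF distinct_ball_open] in auto)

lemma label_kernel_AE_distinct:
  assumes E: "(E, u) \<in> rooted_graphs D"
  shows "AE x in label_kernel D E u. x \<in> distinct_labels D"
  unfolding label_kernel_def
proof (subst AE_distr_iff[OF labelled_class_measurable[OF E]])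
  show "AE \<xi> in label_measure E. labelled_class D E \<xi> u \<in> distinct_labels D"
    using label_AE_inj[of E] AE_space
    by eventually_elim (simp add: distinct_labels_iff[OF labelled_of_label[OF E]])
  show "{x \<in> space (labelled_space D). x \<in> distinct_labels D} \<in> sets (labelled_space D)" by measurable
qed

lemma bernoulli_neighbours:
  assumes E: "(E, \<xi>, u) \<in> labelled_graphs D"
  shows "bernoulli_graph D `` {labelled_class D E \<xi> u} = (\<lambda>v. labelled_class D E \<xi> v) ` (E `` {u})"
proof (intro equalityI subsetI)
  fix y assume "y \<in> bernoulli_graph D `` {labelled_class D E \<xi> u}"
  then obtain F \<eta> v w where F: "labelled_class D E \<xi> u = labelled_class D F \<eta> v" "y = labelled_class D F \<eta> w"
    "(F, \<eta>, v) \<in> labelled_graphs D" "(v, w) \<in> F" by (auto simp: bernoulli_graph_def)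
  from labelled_class_eqE[OF F(3) E F(1)[symmetric]] obtain \<phi> where
    \<phi>: "graph_iso \<phi> F E" "\<phi> v = u" "\<And>w. w \<in> Field F \<Longrightarrow> \<xi> (\<phi> w) = \<eta> w" by blast
  have "\<forall>w\<in>Field F. \<xi> (\<phi> w) = \<eta> w" using \<phi>(3) by (rule ballI)
  note * = iso_neighbour_classes[OF F(3) E \<phi>(1,2) this]
  have "\<phi> w \<in> E `` {u}" using bij_betwE[OF *(1)] F(4) by auto
  moreover have "y = labelled_class D E \<xi> (\<phi> w)" using *(2)[of w] F by (auto simp: Field_def)
  ultimately show "y \<in> (\<lambda>v. labelled_class D E \<xi> v) ` (E `` {u})" by blast
next
  fix y assume "y \<in> (\<lambda>v. labelled_class D E \<xi> v) ` (E `` {u})"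
  then show "y \<in> bernoulli_graph D `` {labelled_class D E \<xi> u}"
    using E unfolding bernoulli_graph_def by blast
qed

text \<open>
  An isomorphism of labelled graphs preserves labels; if these are distinct, then different
  rootings of the same graph are different points of the Bernoulli graphing.
\<close>

lemma labelled_class_inj:
  assumes E: "(E, \<xi>, u) \<in> labelled_graphs D" and inj: "inj_on \<xi> (Field E)"
  shows "inj_on (\<lambda>v. labelled_class D E \<xi> v) (Field E)"
proof (rule inj_onI)
  fix v w assume v: "v \<in> Field E" and w: "w \<in> Field E" and eq: "labelled_class D E \<xi> v = labelled_class D E \<xi> w"
  from labelled_class_eqE[OF labelled_move[OF E v] labelled_move[OF E w] eq] obtain \<phi> where
    "\<phi> v = w" "\<And>x. x \<in> Field E \<Longrightarrow> \<xi> (\<phi> x) = \<xi> x" by blast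
  then have "\<xi> w = \<xi> v" using v by blast
  then show "v = w" using inj v w by (auto dest: inj_onD)
qed

lemma bernoulli_degree:
  assumes E: "(E, \<xi>, u) \<in> labelled_graphs D" and inj: "inj_on \<xi> (Field E)"
  shows "degree (bernoulli_graph D) (labelled_class D E \<xi> u) = degree E u"
proof -
  have "inj_on (\<lambda>v. labelled_class D E \<xi> v) (E `` {u})"
    using labelled_class_inj[OF E inj] by (rule inj_on_subset) (auto simp: Field_def)
  then show ?thesis unfolding degree_def bernoulli_neighbours[OF E] by (rule card_image)
qed

lemma bernoulli_markov:
  assumes E: "(E, \<xi>, u) \<in> labelled_graphs D" and inj: "inj_on \<xi> (Field E)"
  shows "markov (bernoulli_graph D) f (labelled_class D E \<xi> u) = markov E (\<lambda>v. f (labelled_class D E \<xi> v)) u"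
proof -
  have "inj_on (\<lambda>v. labelled_class D E \<xi> v) (E `` {u})"
    using labelled_class_inj[OF E inj] by (rule inj_on_subset) (auto simp: Field_def)
  then show ?thesis
    unfolding markov_def bernoulli_degree[OF E inj] bernoulli_neighbours[OF E] by (simp add: sum.reindex)
qed

section \<open>Spectral radius and return probabilities of a graph\<close>

lemma space_deg_measure [simp]: "space (deg_measure E) = Field E"
  and sets_deg_measure [simp]: "sets (deg_measure E) = Pow (Field E)"
  by (simp_all add: deg_measure_def space_point_measure sets_point_measure)

lemma deg_measure_measurable: "f \<in> Field E \<rightarrow> space N \<Longrightarrow> f \<in> deg_measure E \<rightarrow>\<^sub>M N"
  by (rule measurableI) auto

lemma deg_measure_borel [measurable]: "f \<in> borel_measurable (deg_measure E)"
  for f :: "nat \<Rightarrow> 'b :: topological_space"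
  by (rule deg_measure_measurable) auto

lemma nn_integral_deg_measure:
  "(\<integral>\<^sup>+v. f v \<partial>deg_measure E) = (\<integral>\<^sup>+v. ennreal (real (degree E v)) * f v \<partial>count_space (Field E))"
  unfolding deg_measure_def point_measure_def by (subst nn_integral_density) auto

definition graph_kernel :: "nat rel \<Rightarrow> nat \<Rightarrow> nat measure" where
  "graph_kernel E u = distr (uniform_count_measure (E `` {u})) (deg_measure E) (\<lambda>v. v)"

lemma graph_kernel_id_measurable: "(\<lambda>v. v) \<in> uniform_count_measure (E `` {u}) \<rightarrow>\<^sub>M deg_measure E"
  by (rule measurableI) (auto simp: space_uniform_count_measure sets_uniform_count_measure Field_def)

lemma nn_integral_graph_kernel:
  assumes E: "E \<in> graphs D" and u: "u \<in> Field E"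
  shows "ennreal (real (degree E u)) * (\<integral>\<^sup>+v. g v \<partial>graph_kernel E u) = (\<integral>\<^sup>+v. indicator E (u, v) * g v \<partial>count_space (Field E))"
proof -
  have fin: "finite (E `` {u})" by (rule neighbours_finite[OF E])
  have pos: "degree E u > 0" by (rule degree_pos[OF E u])
  have "(\<integral>\<^sup>+v. g v \<partial>graph_kernel E u) = (\<integral>\<^sup>+v. g v \<partial>uniform_count_measure (E `` {u}))"
    unfolding graph_kernel_def by (subst nn_integral_distr[OF graph_kernel_id_measurable]) auto
  also have "\<dots> = (\<Sum>v\<in>E `` {u}. ennreal (1 / real (degree E u)) * g v)"
    unfolding uniform_count_measure_def using fin
    by (subst nn_integral_point_measure_finite) (auto intro!: sum.cong simp: mult.commute degree_def)
  finally have "ennreal (real (degree E u)) * (\<integral>\<^sup>+v. g v \<partial>graph_kernel E u) =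
      ennreal (real (degree E u)) * (ennreal (1 / real (degree E u)) * (\<Sum>v\<in>E `` {u}. g v))"
    by (simp add: sum_distrib_left)
  also have "\<dots> = (ennreal (real (degree E u)) * ennreal (1 / real (degree E u))) * (\<Sum>v\<in>E `` {u}. g v)"
    by (simp only: mult.assoc)
  also have "ennreal (real (degree E u)) * ennreal (1 / real (degree E u)) = 1"
    using pos by (simp add: ennreal_mult[symmetric])
  also have "1 * (\<Sum>v\<in>E `` {u}. g v) = (\<Sum>v\<in>E `` {u}. indicator E (u, v) * g v)"
    by (auto intro!: sum.cong)
  also have "\<dots> = (\<integral>\<^sup>+v. indicator E (u, v) * g v \<partial>count_space (Field E))"
    by (rule nn_integral_count_space'[symmetric]) (use fin in \<open>auto simp: Field_def\<close>)
  finally show ?thesis .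
qed

text \<open>
  The degree of \<open>u\<close> times the probability of a step from \<open>u\<close> to \<open>v\<close> is the indicator of the edge,
  which is symmetric.
\<close>

lemma graph_kernel_reversible:
  assumes E: "E \<in> graphs D"
  shows "reversible_kernel (deg_measure E) (graph_kernel E)"
proof
  show "graph_kernel E \<in> deg_measure E \<rightarrow>\<^sub>M prob_algebra (deg_measure E)"
  proof (rule deg_measure_measurable, rule Pi_I)
    fix u assume u: "u \<in> Field E"
    have "prob_space (uniform_count_measure (E `` {u}))"
      by (rule prob_space_uniform_count_measure[OF neighbours_finite[OF E] neighbours_nonempty[OF E u]])
    then have "prob_space (graph_kernel E u)"
      unfolding graph_kernel_def by (rule prob_space.prob_space_distr[OF _ graph_kernel_id_measurable])
    then show "graph_kernel E u \<in> space (prob_algebra (deg_measure E))"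
      by (simp add: space_prob_algebra graph_kernel_def)
  qed
  fix f g :: "nat \<Rightarrow> ennreal"
  have cnt: "countable (Field E)" by simp
  interpret S: sigma_finite_measure "count_space (Field E)"
    by (rule sigma_finite_measure_count_space_countable[OF cnt])
  interpret P: pair_sigma_finite "count_space (Field E)" "count_space (Field E)" ..
  have m: "h \<in> borel_measurable (count_space (Field E) \<Otimes>\<^sub>M count_space (Field E))" for h :: "nat \<times> nat \<Rightarrow> ennreal"
    unfolding pair_measure_countable[OF cnt cnt] by simp
  have *: "(\<integral>\<^sup>+u. f u * (\<integral>\<^sup>+v. g v \<partial>graph_kernel E u) \<partial>deg_measure E) =
      (\<integral>\<^sup>+u. \<integral>\<^sup>+v. indicator E (u, v) * f u * g v \<partial>count_space (Field E) \<partial>count_space (Field E))" for f g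
    unfolding nn_integral_deg_measure
  proof (rule nn_integral_cong)
    fix u assume "u \<in> space (count_space (Field E))"
    then have u: "u \<in> Field E" by simp
    have "ennreal (real (degree E u)) * (f u * (\<integral>\<^sup>+v. g v \<partial>graph_kernel E u)) =
        f u * (ennreal (real (degree E u)) * (\<integral>\<^sup>+v. g v \<partial>graph_kernel E u))"
      by (rule mult.left_commute)
    also have "\<dots> = (\<integral>\<^sup>+v. f u * (indicator E (u, v) * g v) \<partial>count_space (Field E))"
      unfolding nn_integral_graph_kernel[OF E u] by (rule nn_integral_cmult[symmetric]) simp
    finally show "ennreal (real (degree E u)) * (f u * (\<integral>\<^sup>+v. g v \<partial>graph_kernel E u)) =
      (\<integral>\<^sup>+v. indicator E (u, v) * f u * g v \<partial>count_space (Field E))"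
      by (simp add: mult.left_commute mult.assoc)
  qed
  have "(\<integral>\<^sup>+u. \<integral>\<^sup>+v. indicator E (u, v) * f u * g v \<partial>count_space (Field E) \<partial>count_space (Field E)) =
    (\<integral>\<^sup>+v. \<integral>\<^sup>+u. indicator E (u, v) * f u * g v \<partial>count_space (Field E) \<partial>count_space (Field E))"
    using P.Fubini'[of "\<lambda>u v. indicator E (u, v) * f u * g v"] m by simp
  also have "\<dots> = (\<integral>\<^sup>+v. \<integral>\<^sup>+u. indicator E (v, u) * g v * f u \<partial>count_space (Field E) \<partial>count_space (Field E))"
    by (intro nn_integral_cong) (simp add: indicator_def mult.commute graphs_sym[OF E, of _ v for v])
  finally show "(\<integral>\<^sup>+u. f u * (\<integral>\<^sup>+v. g v \<partial>graph_kernel E u) \<partial>deg_measure E) =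
      (\<integral>\<^sup>+u. g u * (\<integral>\<^sup>+v. f v \<partial>graph_kernel E u) \<partial>deg_measure E)"
    unfolding * .
qed

lemma integral_graph_kernel:
  fixes f :: "nat \<Rightarrow> complex"
  assumes E: "E \<in> graphs D"
  shows "(\<integral>v. f v \<partial>graph_kernel E u) = markov E f u"
proof -
  have "(\<integral>v. f v \<partial>graph_kernel E u) = (\<integral>v. f v \<partial>uniform_count_measure (E `` {u}))"
    unfolding graph_kernel_def by (rule integral_distr[OF graph_kernel_id_measurable deg_measure_borel])
  also have "\<dots> = (\<Sum>v\<in>E `` {u}. (1 / real (card (E `` {u}))) *\<^sub>R f v)"
    unfolding uniform_count_measure_def using neighbours_finite[OF E]
    by (subst lebesgue_integral_point_measure_finite) auto
  also have "\<dots> = markov E f u"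
    by (simp add: markov_def degree_def scaleR_conv_of_real sum_divide_distrib)
  finally show ?thesis .
qed

lemma markov_cong: "(\<And>v. (u, v) \<in> E \<Longrightarrow> f v = g v) \<Longrightarrow> markov E f u = markov E g u"
  by (simp add: markov_def)

lemma markov_add: "markov E (\<lambda>x. f x + g x) = (\<lambda>x. markov E f x + markov E g x)"
  by (simp add: markov_def fun_eq_iff sum.distrib add_divide_distrib)

lemma markov_scale: "markov E (\<lambda>x. c * f x) = (\<lambda>x. c * markov E f x)"
  by (simp add: markov_def fun_eq_iff sum_distrib_left[symmetric])

definition delta :: "nat \<Rightarrow> nat \<Rightarrow> complex" where
  "delta w v = (if v = w then 1 else 0)"

lemma L2_finite_support:
  assumes S: "finite S" "S \<subseteq> Field E" and f: "\<And>v. v \<in> Field E \<Longrightarrow> v \<notin> S \<Longrightarrow> f v = 0"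
  shows "f \<in> L2 (deg_measure E)" "(L2_norm (deg_measure E) f)\<^sup>2 = (\<Sum>v\<in>S. real (degree E v) * (cmod (f v))\<^sup>2)"
proof -
  have "(\<integral>\<^sup>+v. ennreal ((cmod (f v))\<^sup>2) \<partial>deg_measure E) = (\<Sum>v\<in>S. ennreal (real (degree E v)) * ennreal ((cmod (f v))\<^sup>2))"
    unfolding nn_integral_deg_measure by (rule nn_integral_count_space') (use S f in auto)
  also have "\<dots> = ennreal (\<Sum>v\<in>S. real (degree E v) * (cmod (f v))\<^sup>2)"
    by (simp add: ennreal_mult[symmetric])
  finally have *: "(\<integral>\<^sup>+v. ennreal ((cmod (f v))\<^sup>2) \<partial>deg_measure E) = ennreal (\<Sum>v\<in>S. real (degree E v) * (cmod (f v))\<^sup>2)" .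
  show L2: "f \<in> L2 (deg_measure E)" by (rule L2I_nn) (simp_all add: *)
  show "(L2_norm (deg_measure E) f)\<^sup>2 = (\<Sum>v\<in>S. real (degree E v) * (cmod (f v))\<^sup>2)"
    using L2_norm_nn[OF L2] unfolding * by (simp add: sum_nonneg)
qed

lemma markov_symmetric_contraction:
  assumes E: "E \<in> graphs D" and u: "u \<in> Field E"
  shows "symmetric_contraction (deg_measure E) (L2 (deg_measure E)) (markov E) UNIV"
proof -
  interpret K: reversible_kernel "deg_measure E" "graph_kernel E" by (rule graph_kernel_reversible[OF E])
  have av: "markov E f = K.average f" for f
    by (simp add: fun_eq_iff K.average_def integral_graph_kernel[OF E])
  show ?thesis
  proof
    have "(L2_norm (deg_measure E) (delta u))\<^sup>2 = (\<Sum>v\<in>{u}. real (degree E v) * (cmod (delta u v))\<^sup>2)"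
      by (rule L2_finite_support(2)) (use u in \<open>auto simp: delta_def\<close>)
    then have "(L2_norm (deg_measure E) (delta u))\<^sup>2 > 0"
      using degree_pos[OF E u] by (simp add: delta_def)
    then have "L2_norm (deg_measure E) (delta u) > 0"
      by (metis L2_norm_nonneg less_eq_real_def order_less_irrefl zero_power2)
    moreover have "delta u \<in> L2 (deg_measure E)"
      by (rule L2_finite_support(1)[of "{u}"]) (use u in \<open>auto simp: delta_def\<close>)
    ultimately show "\<exists>f\<in>L2 (deg_measure E). 0 < L2_norm (deg_measure E) f" by blast
    show "L2_inner (deg_measure E) (markov E (\<lambda>x. if x \<in> UNIV then f x else 0)) g =
        L2_inner (deg_measure E) f (markov E (\<lambda>x. if x \<in> UNIV then g x else 0))"
      if "f \<in> L2 (deg_measure E)" "g \<in> L2 (deg_measure E)" for f g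
      using K.average_symmetric[OF that] by (simp add: av)
  qed (auto simp: markov_add markov_scale av intro: L2_add L2_scale K.average_L2 K.average_contraction)
qed

fun walk :: "nat rel \<Rightarrow> nat \<Rightarrow> nat \<Rightarrow> nat \<Rightarrow> real" where
  "walk E 0 u v = (if u = v then 1 else 0)"
| "walk E (Suc n) u v = (\<Sum>w\<in>E `` {u}. walk E n w v) / real (degree E u)"

text \<open>
  On a graph with degrees at most \<open>D\<close>, up to factors between \<open>1 / D\<close> and \<open>D\<close>, which come from
  reversibility, this is the probability that the walk is back at \<open>u\<close> after \<open>2 n\<close> steps.
\<close>

definition walk_energy :: "nat rel \<Rightarrow> nat \<Rightarrow> nat \<Rightarrow> real" where
  "walk_energy E n u = (\<Sum>v\<in>gball E n u. (walk E n u v)\<^sup>2)"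

lemma walk_nonneg: "0 \<le> walk E n u v"
  by (induction n arbitrary: u) (auto intro!: sum_nonneg divide_nonneg_nonneg)

lemma gball_neighbour: "(u, w) \<in> E \<Longrightarrow> gball E n w \<subseteq> gball E (Suc n) u"
  using gball_trans[of w E 1 u _ n] relpow_gball[of u w 1 E 1] by auto

lemma walk_support: "v \<notin> gball E n u \<Longrightarrow> walk E n u v = 0"
proof (induction n arbitrary: u)
  case (Suc n)
  have "walk E n w v = 0" if "w \<in> E `` {u}" for w
    using Suc.IH[of w] Suc.prems gball_neighbour[of u w E n] that by blast
  then show ?case by (simp del: Image_singleton_iff)
qed auto

lemma markov_power:
  assumes E: "E \<in> graphs D"
  shows "((markov E) ^^ n) f u = (\<Sum>v\<in>gball E n u. of_real (walk E n u v) * f v)"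
proof (induction n arbitrary: u)
  case (Suc n)
  have "((markov E) ^^ Suc n) f u = (\<Sum>w\<in>E `` {u}. ((markov E) ^^ n) f w) / of_nat (degree E u)"
    by (simp add: markov_def[of E "((markov E) ^^ n) f"])
  also have "(\<Sum>w\<in>E `` {u}. ((markov E) ^^ n) f w) = (\<Sum>w\<in>E `` {u}. \<Sum>v\<in>gball E (Suc n) u. of_real (walk E n w v) * f v)"
  proof (rule sum.cong[OF refl])
    fix w assume "w \<in> E `` {u}"
    then have sub: "gball E n w \<subseteq> gball E (Suc n) u" by (intro gball_neighbour) simp
    show "((markov E) ^^ n) f w = (\<Sum>v\<in>gball E (Suc n) u. of_real (walk E n w v) * f v)"
      unfolding Suc.IH by (rule sum.mono_neutral_left) (use sub E walk_support in auto)
  qed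
  also have "\<dots> = (\<Sum>v\<in>gball E (Suc n) u. \<Sum>w\<in>E `` {u}. of_real (walk E n w v) * f v)"
    by (rule sum.swap)
  also have "\<dots> / of_nat (degree E u) = (\<Sum>v\<in>gball E (Suc n) u. of_real (walk E (Suc n) u v) * f v)"
    unfolding sum_divide_distrib[of _ "gball E (Suc n) u"]
    by (rule sum.cong[OF refl]) (simp add: sum_distrib_right[symmetric])
  finally show ?case .
qed simp

lemma markov_power_delta:
  assumes E: "E \<in> graphs D"
  shows "((markov E) ^^ n) (delta w) u = of_real (walk E n u w)"
proof -
  have "((markov E) ^^ n) (delta w) u = (\<Sum>v\<in>gball E n u. if v = w then of_real (walk E n u v) else 0)"
    unfolding markov_power[OF E] by (intro sum.cong) (auto simp: delta_def)
  also have "\<dots> = of_real (walk E n u w)"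
    using finite_gball[OF E] walk_support[of w E n u] by (subst sum.delta) auto
  finally show ?thesis .
qed

text \<open>
  The recursion in the definition of \<open>walk\<close> is for the first step of the walk; this is the one for
  the last step.
\<close>

lemma walk_last_step:
  assumes E: "E \<in> graphs D"
  shows "walk E (Suc n) v u = (\<Sum>w\<in>E `` {u}. walk E n v w / real (degree E w))"
proof (induction n arbitrary: v)
  case 0
  have fin: "finite (E `` {x})" for x by (rule neighbours_finite[OF E])
  have "(\<Sum>w\<in>E `` {v}. if w = u then 1 else 0 :: real) = (if u \<in> E `` {v} then 1 else 0)"
    by (rule sum.delta[OF fin])
  moreover have "(\<Sum>w\<in>E `` {u}. (if v = w then 1 else 0) / real (degree E w)) =
      (\<Sum>w\<in>E `` {u}. if v = w then 1 / real (degree E w) else 0)"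
    by (intro sum.cong) auto
  moreover have "\<dots> = (if v \<in> E `` {u} then 1 / real (degree E v) else 0)"
    by (rule sum.delta'[OF fin])
  ultimately show ?case using graphs_sym[OF E, of u v] by simp
next
  case (Suc n)
  have "walk E (Suc (Suc n)) v u = (\<Sum>x\<in>E `` {v}. \<Sum>w\<in>E `` {u}. walk E n x w / real (degree E w)) / real (degree E v)"
    by (subst walk.simps(2)) (simp only: Suc.IH)
  also have "(\<Sum>x\<in>E `` {v}. \<Sum>w\<in>E `` {u}. walk E n x w / real (degree E w)) =
      (\<Sum>w\<in>E `` {u}. \<Sum>x\<in>E `` {v}. walk E n x w / real (degree E w))" by (rule sum.swap)
  also have "\<dots> / real (degree E v) = (\<Sum>w\<in>E `` {u}. walk E (Suc n) v w / real (degree E w))"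
    by (simp add: sum_divide_distrib[symmetric]) (simp add: sum_divide_distrib divide_divide_eq_left mult.commute)
  finally show ?case .
qed

lemma walk_reversible:
  assumes E: "E \<in> graphs D"
  shows "u \<in> Field E \<Longrightarrow> v \<in> Field E \<Longrightarrow> real (degree E u) * walk E n u v = real (degree E v) * walk E n v u"
proof (induction n arbitrary: u)
  case (Suc n)
  have pos: "degree E x > 0" if "x \<in> Field E" for x by (rule degree_pos[OF E that])
  have nb: "w \<in> Field E" if "w \<in> E `` {u}" for w using that by (auto simp: Field_def)
  have "real (degree E u) * walk E (Suc n) u v = (\<Sum>w\<in>E `` {u}. walk E n w v)"
    using pos[OF Suc.prems(1)] by simp
  also have "\<dots> = (\<Sum>w\<in>E `` {u}. real (degree E v) * (walk E n v w / real (degree E w)))"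
  proof (rule sum.cong[OF refl])
    fix w assume w: "w \<in> E `` {u}"
    show "walk E n w v = real (degree E v) * (walk E n v w / real (degree E w))"
      using Suc.IH[OF nb[OF w] Suc.prems(2)] pos[OF nb[OF w]] by (simp add: field_simps)
  qed
  also have "\<dots> = real (degree E v) * walk E (Suc n) v u"
    unfolding walk_last_step[OF E] by (rule sum_distrib_left[symmetric])
  finally show ?case .
qed auto

lemma walk_energy_superset:
  assumes "finite B" "gball E n u \<subseteq> B"
  shows "walk_energy E n u = (\<Sum>v\<in>B. (walk E n u v)\<^sup>2)"
  unfolding walk_energy_def by (rule sum.mono_neutral_left) (use assms walk_support in auto)

text \<open>
  With probability at least \<open>1 / D\<close> the walk from \<open>u\<close> first moves to \<open>w\<close>.
\<close>

lemma walk_energy_neighbour: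
  assumes E: "E \<in> graphs D" and uw: "(u, w) \<in> E"
  shows "walk_energy E n w \<le> (real D)\<^sup>2 * walk_energy E (Suc n) u"
proof -
  have u: "u \<in> Field E" using uw by (rule edge_Field)
  have "walk E n w v \<le> real D * walk E (Suc n) u v" for v
  proof -
    have "walk E n w v \<le> (\<Sum>w\<in>E `` {u}. walk E n w v)"
      by (rule member_le_sum) (use uw neighbours_finite[OF E] walk_nonneg in auto)
    also have "\<dots> = real (degree E u) * walk E (Suc n) u v" using degree_pos[OF E u] by simp
    also have "\<dots> \<le> real D * walk E (Suc n) u v"
      using degree_le[OF E u] walk_nonneg[of E "Suc n" u v] by (intro mult_right_mono) auto
    finally show ?thesis .
  qed
  then have "(walk E n w v)\<^sup>2 \<le> (real D * walk E (Suc n) u v)\<^sup>2" for v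
    by (intro power_mono walk_nonneg)
  then have "(\<Sum>v\<in>gball E (Suc n) u. (walk E n w v)\<^sup>2) \<le> (\<Sum>v\<in>gball E (Suc n) u. (real D)\<^sup>2 * (walk E (Suc n) u v)\<^sup>2)"
    by (intro sum_mono) (simp only: power_mult_distrib)
  then show ?thesis
    unfolding walk_energy_superset[OF finite_gball[OF E] gball_neighbour[OF uw]]
    by (simp only: walk_energy_def sum_distrib_left)
qed

definition walk_growth :: "nat rel \<Rightarrow> real \<Rightarrow> nat \<Rightarrow> bool" where
  "walk_growth E c u \<longleftrightarrow> (\<exists>K. \<forall>n. walk_energy E n u \<le> K * c ^ (2 * n))"

lemma walk_growth_connected:
  assumes E: "E \<in> graphs D" and u: "u \<in> Field E" and v: "v \<in> Field E" and g: "walk_growth E c u"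
  shows "walk_growth E c v"
  using connected_path[OF E u v]
proof (induction rule: rtrancl_induct)
  case (step y z)
  then obtain K where K: "\<And>n. walk_energy E n y \<le> K * c ^ (2 * n)" by (auto simp: walk_growth_def)
  have "walk_energy E n z \<le> ((real D)\<^sup>2 * K * c\<^sup>2) * c ^ (2 * n)" for n
  proof -
    have "walk_energy E n z \<le> (real D)\<^sup>2 * walk_energy E (Suc n) y"
      by (rule walk_energy_neighbour[OF E step(2)])
    also have "\<dots> \<le> (real D)\<^sup>2 * (K * c ^ (2 * Suc n))"
      by (intro mult_left_mono K) simp
    also have "\<dots> = ((real D)\<^sup>2 * K * c\<^sup>2) * c ^ (2 * n)"
      by (simp add: power_add power2_eq_square)
    finally show ?thesis .
  qed
  then show ?case unfolding walk_growth_def by blast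
qed (rule g)

text \<open>
  Let \<open>h\<close> be the vector \<open>p\<^sub>n(u, \<sqdot>)\<close> of transition probabilities. The value at \<open>u\<close> of the \<open>n\<close>-th
  power of the Markov operator, applied to \<open>h\<close>, is the energy, while \<open>\<parallel>h\<parallel>\<^sup>2\<close> is at most \<open>D\<close> times
  the energy. As evaluation at a vertex is bounded by the norm, the square of the energy is at
  most \<open>c\<^bsup>2n\<^esup> D\<close> times the energy.
\<close>

lemma graph_spectral_radius_walk_bound:
  assumes E: "E \<in> graphs D" and u: "u \<in> Field E" and c: "0 \<le> c" "graph_spectral_radius E \<le> c"
  shows "walk_energy E n u \<le> real D * c ^ (2 * n)"
proof -
  let ?M = "deg_measure E"
  interpret S: symmetric_contraction ?M "L2 ?M" "markov E" UNIV
    by (rule markov_symmetric_contraction[OF E u])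
  have SM: "S.S = markov E" by (simp add: S.S_def S.cut_def fun_eq_iff)
  have bnd: "S.bounded_by c" using c S.spectral_radius_le_iff by (simp add: graph_spectral_radius_def)
  let ?B = "gball E n u"
  have B: "finite ?B" "?B \<subseteq> Field E" using finite_gball[OF E] gball_Field[OF u] by auto
  define h where "h v = complex_of_real (walk E n u v)" for v
  have h: "h \<in> L2 ?M" "(L2_norm ?M h)\<^sup>2 = (\<Sum>v\<in>?B. real (degree E v) * (cmod (h v))\<^sup>2)"
    using L2_finite_support[OF B, of h] walk_support by (auto simp: h_def)
  have h2: "(L2_norm ?M h)\<^sup>2 \<le> real D * walk_energy E n u"
    unfolding h(2) walk_energy_def sum_distrib_left h_def norm_of_real power2_abs
    using B degree_le[OF E] by (intro sum_mono mult_right_mono) auto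
  have we: "((markov E) ^^ n) h u = of_real (walk_energy E n u)"
    by (simp add: markov_power[OF E] h_def walk_energy_def power2_eq_square)
  have nonneg: "0 \<le> walk_energy E n u" by (simp add: walk_energy_def sum_nonneg)
  have point: "(cmod (f u))\<^sup>2 \<le> (L2_norm ?M f)\<^sup>2" if "f \<in> L2 ?M" for f
  proof -
    have "ennreal ((cmod (f u))\<^sup>2) \<le> ennreal (real (degree E u)) * ennreal ((cmod (f u))\<^sup>2)"
      using degree_pos[OF E u] by (subst ennreal_mult[symmetric]) (auto intro!: ennreal_leI simp: mult_le_cancel_right1)
    also have "\<dots> = (\<integral>\<^sup>+v. ennreal (real (degree E v)) * ennreal ((cmod (f v))\<^sup>2) * indicator {u} v \<partial>count_space (Field E))"
      using u by (subst nn_integral_count_space'[of "{u}"]) auto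
    also have "\<dots> \<le> (\<integral>\<^sup>+v. ennreal (real (degree E v)) * ennreal ((cmod (f v))\<^sup>2) \<partial>count_space (Field E))"
      by (intro nn_integral_mono) (auto simp: indicator_def)
    also have "\<dots> = ennreal ((L2_norm ?M f)\<^sup>2)"
      using L2_norm_nn[OF that] unfolding nn_integral_deg_measure .
    finally show ?thesis by simp
  qed
  have "(walk_energy E n u)\<^sup>2 = (cmod (((markov E) ^^ n) h u))\<^sup>2" unfolding we by simp
  also have "\<dots> \<le> (L2_norm ?M ((S.S ^^ n) h))\<^sup>2" using point[OF S.S_pow_H[OF h(1), of n]] unfolding SM .
  also have "\<dots> \<le> (c ^ n * L2_norm ?M h)\<^sup>2" by (intro power_mono S.S_pow_bound[OF bnd h(1)]) simp
  also have "\<dots> = c ^ (2 * n) * (L2_norm ?M h)\<^sup>2" by (simp add: power_mult_distrib power_mult[symmetric] mult.commute)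
  also have "\<dots> \<le> c ^ (2 * n) * (real D * walk_energy E n u)" using h2 c by (intro mult_left_mono) auto
  also have "\<dots> = (real D * c ^ (2 * n)) * walk_energy E n u" by (simp only: mult_ac)
  finally have *: "walk_energy E n u * walk_energy E n u \<le> (real D * c ^ (2 * n)) * walk_energy E n u"
    unfolding power2_eq_square .
  show ?thesis
  proof (cases "walk_energy E n u = 0")
    case True
    then show ?thesis using c by simp
  next
    case False
    then have "walk_energy E n u > 0" using nonneg by simp
    with * show ?thesis by (rule mult_right_le_imp_le)
  qed
qed

text \<open>
  Finitely supported functions are dense, and by reversibility the norm of the \<open>n\<close>-th power of the
  Markov operator on the point mass at \<open>w\<close> is controlled by the energy at \<open>w\<close>.
\<close>

lemma graph_spectral_radius_le_of_growth:
  assumes E: "E \<in> graphs D" and u: "u \<in> Field E" and c: "0 \<le> c" and g: "walk_growth E c u"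
  shows "graph_spectral_radius E \<le> c"
proof -
  let ?M = "deg_measure E"
  interpret S: symmetric_contraction ?M "L2 ?M" "markov E" UNIV
    by (rule markov_symmetric_contraction[OF E u])
  have SM: "S.S = markov E" by (simp add: S.S_def S.cut_def fun_eq_iff)
  have pow_sum: "(S.S ^^ n) (\<lambda>v. \<Sum>w\<in>W. a w * delta w v) = (\<lambda>v. \<Sum>w\<in>W. a w * (S.S ^^ n) (delta w) v)"
    if "finite W" for n a W
    using that
  proof induction
    case empty
    have "(S.S ^^ n) (\<lambda>v. 0 * delta 0 v) = (\<lambda>v. 0 * (S.S ^^ n) (delta 0) v)" by (rule S.S_pow_scale)
    then show ?case by simp
  next
    case (insert x W)
    then show ?case by (simp add: S.S_pow_add S.S_pow_scale)
  qed
  have deltaL2: "delta w \<in> L2 ?M" if "w \<in> Field E" for w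
    by (rule L2_finite_support(1)[of "{w}"]) (use that in \<open>auto simp: delta_def\<close>)
  have delta_growth: "\<exists>K. \<forall>n. L2_norm ?M ((S.S ^^ n) (delta w)) \<le> K * c ^ n" if w: "w \<in> Field E" for w
  proof -
    obtain K where K: "\<And>n. walk_energy E n w \<le> K * c ^ (2 * n)"
      using walk_growth_connected[OF E u w g] by (auto simp: walk_growth_def)
    have "L2_norm ?M ((S.S ^^ n) (delta w)) \<le> (real D * sqrt \<bar>K\<bar>) * c ^ n" for n
    proof (rule power2_le_imp_le)
      have fx: "((markov E) ^^ n) (delta w) v = of_real (walk E n v w)" for v
        by (rule markov_power_delta[OF E])
      have B: "finite (gball E n w)" "gball E n w \<subseteq> Field E"
        using finite_gball[OF E] gball_Field[OF w] by auto
      have z: "((markov E) ^^ n) (delta w) v = 0" if "v \<notin> gball E n w" for v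
        unfolding fx using walk_support[of w E n v] gball_sym[OF E, of w n v] that by auto
      have "(L2_norm ?M ((S.S ^^ n) (delta w)))\<^sup>2 = (\<Sum>v\<in>gball E n w. real (degree E v) * (walk E n v w)\<^sup>2)"
        unfolding SM using L2_finite_support(2)[OF B, of "((markov E) ^^ n) (delta w)"] z by (simp add: fx)
      also have "\<dots> \<le> (\<Sum>v\<in>gball E n w. (real D)\<^sup>2 * (walk E n w v)\<^sup>2)"
      proof (rule sum_mono)
        fix v assume "v \<in> gball E n w"
        then have v: "v \<in> Field E" using B by auto
        have d1: "1 \<le> real (degree E v)" using degree_pos[OF E v] by simp
        have "real (degree E v) * (walk E n v w)\<^sup>2 \<le> (real (degree E v))\<^sup>2 * (walk E n v w)\<^sup>2"
          using d1 by (intro mult_right_mono) (auto simp: power2_eq_square)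
        also have "\<dots> = (real (degree E w) * walk E n w v)\<^sup>2"
          by (simp add: power_mult_distrib[symmetric] walk_reversible[OF E v w])
        also have "\<dots> \<le> (real D * walk E n w v)\<^sup>2"
          using degree_le[OF E w] walk_nonneg[of E n w v] by (intro power_mono mult_right_mono) auto
        finally show "real (degree E v) * (walk E n v w)\<^sup>2 \<le> (real D)\<^sup>2 * (walk E n w v)\<^sup>2"
          by (simp add: power_mult_distrib)
      qed
      also have "\<dots> = (real D)\<^sup>2 * walk_energy E n w" by (simp add: walk_energy_def sum_distrib_left)
      also have "\<dots> \<le> (real D)\<^sup>2 * (\<bar>K\<bar> * c ^ (2 * n))"
      proof (rule mult_left_mono)
        have "K * c ^ (2 * n) \<le> \<bar>K\<bar> * c ^ (2 * n)" using c by (intro mult_right_mono) auto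
        then show "walk_energy E n w \<le> \<bar>K\<bar> * c ^ (2 * n)" using K[of n] by linarith
      qed simp
      also have "\<dots> = ((real D * sqrt \<bar>K\<bar>) * c ^ n)\<^sup>2"
        by (simp add: power_mult_distrib power_mult[symmetric] mult.commute)
      finally show "(L2_norm ?M ((S.S ^^ n) (delta w)))\<^sup>2 \<le> ((real D * sqrt \<bar>K\<bar>) * c ^ n)\<^sup>2" .
      show "0 \<le> (real D * sqrt \<bar>K\<bar>) * c ^ n" using c by simp
    qed
    then show ?thesis by blast
  qed
  define X where "X = {(\<lambda>v. \<Sum>w\<in>W. a w * delta w v) |W a. finite W \<and> W \<subseteq> Field E}"
  have "S.bounded_by c"
  proof (rule S.bounded_by_of_dense_growth[OF _ c])
    show "X \<subseteq> L2 ?M" by (auto simp: X_def intro!: L2_sum L2_scale deltaL2)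
  next
    fix f assume "f \<in> X"
    then obtain W a where W: "finite W" "W \<subseteq> Field E" "f = (\<lambda>v. \<Sum>w\<in>W. a w * delta w v)" by (auto simp: X_def)
    have "\<forall>w\<in>W. \<exists>K. \<forall>n. L2_norm ?M ((S.S ^^ n) (delta w)) \<le> K * c ^ n" using delta_growth W(2) by blast
    then obtain K where K: "\<And>w n. w \<in> W \<Longrightarrow> L2_norm ?M ((S.S ^^ n) (delta w)) \<le> K w * c ^ n" by metis
    have "L2_norm ?M ((S.S ^^ n) f) \<le> (\<Sum>w\<in>W. cmod (a w) * K w) * c ^ n" for n
    proof -
      have "L2_norm ?M ((S.S ^^ n) f) \<le> (\<Sum>w\<in>W. L2_norm ?M (\<lambda>v. a w * (S.S ^^ n) (delta w) v))"
        unfolding W(3) pow_sum[OF W(1)] using W(2) by (intro L2_norm_sum L2_scale S.S_pow_H deltaL2) auto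
      also have "\<dots> \<le> (\<Sum>w\<in>W. cmod (a w) * (K w * c ^ n))"
        unfolding L2_norm_scale by (intro sum_mono mult_left_mono K) auto
      finally show ?thesis by (simp add: sum_distrib_right mult.assoc)
    qed
    then show "\<exists>K. \<forall>n. L2_norm ?M ((S.S ^^ n) f) \<le> K * c ^ n" by blast
  next
    fix f and e :: real assume f: "f \<in> L2 ?M" and e: "0 < e"
    define g where "g k = (\<lambda>v. \<Sum>w\<in>Field E \<inter> {..<k}. f w * delta w v)" for k :: nat
    have gX: "g k \<in> X" for k unfolding X_def g_def by (intro CollectI exI conjI refl) auto
    have gval: "g k v = (if v < k then f v else 0)" if "v \<in> Field E" for k v
    proof -
      have "g k v = (\<Sum>w\<in>Field E \<inter> {..<k}. if v = w then f w else 0)"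
        unfolding g_def by (intro sum.cong) (auto simp: delta_def)
      also have "\<dots> = (if v \<in> Field E \<inter> {..<k} then f v else 0)" by (rule sum.delta') simp
      finally show ?thesis using that by simp
    qed
    have "(\<lambda>k. \<integral>v. (cmod (f v - g k v))\<^sup>2 \<partial>?M) \<longlonglongrightarrow> (\<integral>v. 0 \<partial>?M)"
    proof (rule integral_dominated_convergence[where w = "\<lambda>v. (cmod (f v))\<^sup>2"])
      show "integrable ?M (\<lambda>v. (cmod (f v))\<^sup>2)" by (rule L2_integrable[OF f])
      show "AE v in ?M. (\<lambda>k. (cmod (f v - g k v))\<^sup>2) \<longlonglongrightarrow> 0"
      proof (rule AE_I2)
        fix v assume "v \<in> space ?M"
        then have v: "v \<in> Field E" by simp
        have "\<forall>\<^sub>F k in sequentially. (cmod (f v - g k v))\<^sup>2 = 0"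
          by (rule eventually_mono[OF eventually_gt_at_top[of v]]) (simp add: gval[OF v])
        then show "(\<lambda>k. (cmod (f v - g k v))\<^sup>2) \<longlonglongrightarrow> 0" by (rule tendsto_eventually)
      qed
      show "AE v in ?M. norm ((cmod (f v - g k v))\<^sup>2) \<le> (cmod (f v))\<^sup>2" for k
        by (rule AE_I2) (simp add: gval)
    qed auto
    then have "(\<lambda>k. sqrt (\<integral>v. (cmod (f v - g k v))\<^sup>2 \<partial>?M)) \<longlonglongrightarrow> sqrt 0"
      by (intro tendsto_real_sqrt) simp
    then have "(\<lambda>k. L2_norm ?M (\<lambda>v. f v - g k v)) \<longlonglongrightarrow> 0" by (simp add: L2_norm_def)
    then have "\<forall>\<^sub>F k in sequentially. L2_norm ?M (\<lambda>v. f v - g k v) < e" using e by (rule order_tendstoD(2))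
    then obtain k where "L2_norm ?M (\<lambda>v. f v - g k v) < e" by (auto simp: eventually_sequentially)
    then show "\<exists>g\<in>X. L2_norm ?M (\<lambda>v. f v - g v) < e" using gX by blast
  qed
  then show ?thesis using c by (simp add: graph_spectral_radius_def S.spectral_radius_le_iff)
qed

lemma graph_spectral_radius_le_iff:
  assumes E: "E \<in> graphs D" and u: "u \<in> Field E" and c: "0 \<le> c"
  shows "graph_spectral_radius E \<le> c \<longleftrightarrow> walk_growth E c u"
  using graph_spectral_radius_le_of_growth[OF E u c] graph_spectral_radius_walk_bound[OF E u c]
  unfolding walk_growth_def by blast

lemma graph_spectral_radius_nonneg:
  assumes E: "E \<in> graphs D" and u: "u \<in> Field E"
  shows "0 \<le> graph_spectral_radius E"
proof -
  interpret S: symmetric_contraction "deg_measure E" "L2 (deg_measure E)" "markov E" UNIV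
    by (rule markov_symmetric_contraction[OF E u])
  show ?thesis using S.bounded_by_spectral_radius by (simp add: graph_spectral_radius_def S.bounded_by_def)
qed

section \<open>The Bernoulli graphing as a reversible kernel\<close>

text \<open>
  A density enters only through integrals, which ignore null sets. No measurability is assumed
  since the degree in the graphing is under control only where the labels are distinct.
\<close>

lemma density_cong_AE_nonmeasurable:
  "(AE x in M. f x = g x) \<Longrightarrow> density M f = density M g"
  unfolding density_def by (auto intro!: measure_of_eq nn_integral_cong_AE sets.space_closed)

lemma root_degree_class:
  assumes E: "(E, u) \<in> rooted_graphs D"
  shows "root_degree (rooted_class D E u) = degree E u"
proof -
  from rep_rooted_class[OF E] obtain F v \<phi> where
    F: "rep (rooted_class D E u) = (F, v)" "graph_iso \<phi> E F" "\<phi> u = v" by metis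
  have "bij_betw \<phi> (E `` {u}) (F `` {v})"
    using ball_iso_neighbours[OF graph_iso_ball_iso[OF F(2) rootedD(2)[OF E], of 1]] F(3) by simp
  then show ?thesis using bij_betw_same_card by (fastforce simp: root_degree_def F(1) degree_def)
qed

lemma root_degree_measurable: "(\<lambda>x. of_nat (root_degree x) :: ennreal) \<in> borel_measurable (rooted_space D)"
proof (rule rooted_local_measurable[where r = 1])
  fix E u F v \<phi> assume E: "(E, u) \<in> rooted_graphs D" and F: "(F, v) \<in> rooted_graphs D" and iso: "ball_iso \<phi> 1 E u F v"
  have "card (E `` {u}) = card (F `` {v})"
    by (rule bij_betw_same_card[OF ball_iso_neighbours[OF iso]]) simp
  then show "(of_nat (root_degree (rooted_class D E u)) :: ennreal) = of_nat (root_degree (rooted_class D F v))"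
    unfolding root_degree_class[OF E] root_degree_class[OF F] degree_def by simp
qed simp

lemma forget_labels_class:
  assumes E: "(E, \<xi>, u) \<in> labelled_graphs D"
  shows "forget_labels D (labelled_class D E \<xi> u) = rooted_class D E u"
proof -
  from rep_labelled_class[OF E] obtain F \<eta> v \<phi> where
    F: "rep (labelled_class D E \<xi> u) = (F, \<eta>, v)" "(F, \<eta>, v) \<in> labelled_graphs D" "graph_iso \<phi> E F" "\<phi> u = v" by metis
  show ?thesis unfolding forget_labels_def F(1) prod.case
    by (rule rooted_class_eqI[symmetric, OF labelled_rooted[OF E] labelled_rooted[OF F(2)] F(3,4)])
qed

lemma forget_labels_measurable: "forget_labels D \<in> labelled_space D \<rightarrow>\<^sub>M rooted_space D"
  unfolding rooted_space_def rooted_cyl_def[symmetric]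
proof (rule measurable_measure_of)
  show "{rooted_cyl D r E u |E u r. (E, u) \<in> rooted_graphs D} \<subseteq> Pow (rooted_graphs D // rooted_iso D)"
    by (auto simp: rooted_cyl_def intro: quotientI)
  show "forget_labels D \<in> space (labelled_space D) \<rightarrow> rooted_graphs D // rooted_iso D"
  proof
    fix x assume "x \<in> space (labelled_space D)"
    from labelled_spaceE[OF this] obtain E \<xi> u where E: "(E, \<xi>, u) \<in> labelled_graphs D" "x = labelled_class D E \<xi> u" by metis
    show "forget_labels D x \<in> rooted_graphs D // rooted_iso D"
      unfolding E(2) forget_labels_class[OF E(1)] using labelled_rooted[OF E(1)] by (rule quotientI)
  qed
  fix A assume "A \<in> {rooted_cyl D r E u |E u r. (E, u) \<in> rooted_graphs D}"
  then obtain E u r where A: "A = rooted_cyl D r E u" "(E, u) \<in> rooted_graphs D" by blast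
  have "forget_labels D -` A \<inter> space (labelled_space D) = labelled_cyl D r E u (\<lambda>_. UNIV)"
  proof (intro equalityI subsetI)
    fix x assume x: "x \<in> forget_labels D -` A \<inter> space (labelled_space D)"
    then have "x \<in> space (labelled_space D)" by simp
    from labelled_spaceE[OF this] obtain F \<eta> v where F: "(F, \<eta>, v) \<in> labelled_graphs D" "x = labelled_class D F \<eta> v" by metis
    have "rooted_class D F v \<in> rooted_cyl D r E u" using x F A(1) by (simp add: forget_labels_class)
    then obtain G w \<phi> where G: "rooted_class D F v = rooted_class D G w" "(G, w) \<in> rooted_graphs D" "ball_iso \<phi> r E u G w"
      unfolding rooted_cyl_def by blast
    from rooted_class_eqE[OF G(2) labelled_rooted[OF F(1)] G(1)[symmetric]] obtain \<psi> where
      \<psi>: "graph_iso \<psi> G F" "\<psi> w = v" .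
    have "ball_iso (\<lambda>x. \<psi> (\<phi> x)) r E u F v"
      using ball_iso_comp[OF G(3) graph_iso_ball_iso[OF \<psi>(1) rootedD(2)[OF G(2)]]] \<psi>(2) by simp
    then show "x \<in> labelled_cyl D r E u (\<lambda>_. UNIV)" unfolding F(2) labelled_cyl_iff[OF F(1)] by auto
  next
    fix x assume "x \<in> labelled_cyl D r E u (\<lambda>_. UNIV)"
    then obtain F \<eta> v \<phi> where F: "x = labelled_class D F \<eta> v" "(F, \<eta>, v) \<in> labelled_graphs D" "ball_iso \<phi> r E u F v"
      unfolding labelled_cyl_def by blast
    have "rooted_class D F v \<in> rooted_cyl D r E u" unfolding rooted_cyl_def using labelled_rooted[OF F(2)] F(3) by blast
    then show "x \<in> forget_labels D -` A \<inter> space (labelled_space D)"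
      using F A(1) by (simp add: forget_labels_class labelled_class_space)
  qed
  also have "\<dots> \<in> sets (labelled_space D)"
    by (rule open_local_sets[OF labelled_cyl_open_local[OF A(2)]]) simp
  finally show "forget_labels D -` A \<inter> space (labelled_space D) \<in> sets (labelled_space D)" .
qed

text \<open>
  The mass that is sent along an edge: the probability that its ends lie in \<open>A\<close> and in \<open>B\<close>.
\<close>

definition edge_mass :: "nat \<Rightarrow> labelled set set \<Rightarrow> labelled set set \<Rightarrow> nat rel \<Rightarrow> nat \<Rightarrow> nat \<Rightarrow> real" where
  "edge_mass D A B E u v = (if (u, v) \<in> E then measure (label_measure E)
     {\<xi> \<in> space (label_measure E). labelled_class D E \<xi> u \<in> A \<and> labelled_class D E \<xi> v \<in> B} else 0)"

text \<open>
  The ball of radius \<open>r + 1\<close> around one end of an edge contains the balls of radius \<open>r\<close> around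
  both.
\<close>

lemma edge_mass_local:
  assumes A: "open_local D r A" and B: "open_local D r B"
    and E: "(E, u, v) \<in> birooted_graphs D" and F: "(F, u', \<phi> v) \<in> birooted_graphs D"
    and iso: "ball_iso \<phi> (Suc r) E u F u'" and uv: "(u, v) \<in> E"
  shows "(u', \<phi> v) \<in> F" "edge_mass D A B E u v = edge_mass D A B F u' (\<phi> v)"
proof -
  have Eu: "(E, u) \<in> rooted_graphs D" "(E, v) \<in> rooted_graphs D"
    and Fu: "(F, u') \<in> rooted_graphs D" "(F, \<phi> v) \<in> rooted_graphs D"
    using E F by (auto simp: birooted_graphs_def rooted_graphs_def)
  have v1: "v \<in> gball E 1 u" using uv by (intro relpow_gball[of u v 1]) auto
  have vr: "v \<in> gball E (Suc r) u" using gball_mono[of 1 "Suc r" E u] v1 by auto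
  show uv': "(u', \<phi> v) \<in> F"
    using ball_isoD(5)[OF iso gball_self vr] ball_isoD(2)[OF iso] uv by simp
  have iso1: "ball_iso \<phi> r E u F u'" by (rule ball_iso_mono[OF iso]) simp
  have iso2: "ball_iso \<phi> r E v F (\<phi> v)" by (rule ball_iso_recentre[OF iso v1]) simp
  have "emeasure (label_measure E) {\<xi> \<in> space (label_measure E). labelled_class D E \<xi> u \<in> A \<and> labelled_class D E \<xi> v \<in> B} =
    emeasure (label_measure F) {\<eta> \<in> space (label_measure F). labelled_class D F \<eta> u' \<in> A \<and> labelled_class D F \<eta> (\<phi> v) \<in> B}"
  proof (rule label_emeasure_transfer[where I = "gball E (Suc r) u" and \<phi> = \<phi>])
    show "gball E (Suc r) u \<subseteq> Field E" by (rule gball_Field[OF rootedD(2)[OF Eu(1)]])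
    show "inj_on \<phi> (gball E (Suc r) u)" by (rule ball_isoD(3)[OF iso])
    show "\<phi> ` gball E (Suc r) u \<subseteq> Field F"
      unfolding ball_isoD(4)[OF iso] by (rule gball_Field[OF rootedD(2)[OF Fu(1)]])
    show "{\<xi> \<in> space (label_measure E). labelled_class D E \<xi> u \<in> A \<and> labelled_class D E \<xi> v \<in> B} \<in> sets (label_measure E)"
      by (intro sets.sets_Collect_conj label_event_sets Eu open_local_sets[OF A] open_local_sets[OF B])
    show "{\<eta> \<in> space (label_measure F). labelled_class D F \<eta> u' \<in> A \<and> labelled_class D F \<eta> (\<phi> v) \<in> B} \<in> sets (label_measure F)"
      by (intro sets.sets_Collect_conj label_event_sets Fu open_local_sets[OF A] open_local_sets[OF B])
    fix \<xi> \<eta> assume \<xi>: "\<xi> \<in> space (label_measure E)" and \<eta>: "\<eta> \<in> space (label_measure F)"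
      and eq: "\<And>i. i \<in> gball E (Suc r) u \<Longrightarrow> \<eta> (\<phi> i) = \<xi> i"
    have "labelled_class D E \<xi> u \<in> A \<longleftrightarrow> labelled_class D F \<eta> u' \<in> A"
      by (rule open_local_iff[OF A labelled_of_label[OF Eu(1) \<xi>] labelled_of_label[OF Fu(1) \<eta>] iso1])
         (rule eq, use gball_mono[of r "Suc r" E u] in auto)
    moreover have "labelled_class D E \<xi> v \<in> B \<longleftrightarrow> labelled_class D F \<eta> (\<phi> v) \<in> B"
      by (rule open_local_iff[OF B labelled_of_label[OF Eu(2) \<xi>] labelled_of_label[OF Fu(2) \<eta>] iso2])
         (rule eq, use gball_trans[OF v1, of _ r] in auto)
    ultimately show "labelled_class D E \<xi> u \<in> A \<and> labelled_class D E \<xi> v \<in> B \<longleftrightarrow>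
      labelled_class D F \<eta> u' \<in> A \<and> labelled_class D F \<eta> (\<phi> v) \<in> B" by simp
  qed
  then show "edge_mass D A B E u v = edge_mass D A B F u' (\<phi> v)"
    using uv uv' by (simp add: edge_mass_def measure_def)
qed

definition edge_mass_class :: "nat \<Rightarrow> labelled set set \<Rightarrow> labelled set set \<Rightarrow> birooted set \<Rightarrow> real" where
  "edge_mass_class D A B y = (case rep y of (E, u, v) \<Rightarrow> edge_mass D A B E u v)"

lemma edge_mass_class:
  assumes A: "open_local D r A" and B: "open_local D r B" and E: "(E, u, v) \<in> birooted_graphs D"
  shows "edge_mass_class D A B (birooted_class D E u v) = edge_mass D A B E u v"
proof -
  from rep_birooted_class[OF E] obtain F u' v' \<phi> where
    F: "rep (birooted_class D E u v) = (F, u', v')" "(F, u', v') \<in> birooted_graphs D"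
    "graph_iso \<phi> E F" "\<phi> u = u'" "\<phi> v = v'" by metis
  have uE: "u \<in> Field E" "v \<in> Field E" using E by (auto simp: birooted_graphs_def)
  have iso: "ball_iso \<phi> (Suc r) E u F u'" using graph_iso_ball_iso[OF F(3) uE(1)] F(4) by simp
  show ?thesis
  proof (cases "(u, v) \<in> E")
    case True
    have "edge_mass D A B E u v = edge_mass D A B F u' (\<phi> v)"
      by (rule edge_mass_local(2)[OF A B E _ iso True]) (use F in simp)
    then show ?thesis by (simp add: edge_mass_class_def F)
  next
    case False
    then have "(u', v') \<notin> F" using graph_isoD(4)[OF F(3) uE] F(4,5) by simp
    then show ?thesis using False by (simp add: edge_mass_class_def F(1) edge_mass_def)
  qed
qed

text \<open>
  The mass vanishes if the roots are not adjacent. For adjacent roots it depends only on a ball,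
  so the sets \<open>N S\<close> of pairs of adjacent roots whose mass lies in \<open>S\<close> are local events.
\<close>

lemma edge_mass_class_measurable:
  assumes A: "open_local D r A" and B: "open_local D r B"
  shows "edge_mass_class D A B \<in> borel_measurable (birooted_space D)"
proof -
  define N where "N S = {birooted_class D E u v |E u v. (E, u, v) \<in> birooted_graphs D \<and> (u, v) \<in> E \<and> edge_mass D A B E u v \<in> S}" for S
  have N: "N S \<in> sets (birooted_space D)" for S
  proof (rule birooted_local_sets[where r = "Suc r"])
    show "N S \<subseteq> space (birooted_space D)" unfolding N_def by (auto intro: birooted_class_space)
    fix E u v assume E: "(E, u, v) \<in> birooted_graphs D" "birooted_class D E u v \<in> N S"
    then obtain F u' v' where F: "birooted_class D E u v = birooted_class D F u' v'" "(F, u', v') \<in> birooted_graphs D"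
      "(u', v') \<in> F" "edge_mass D A B F u' v' \<in> S" unfolding N_def by blast
    from birooted_class_eqE[OF E(1) F(2,1)] obtain \<psi> where \<psi>: "graph_iso \<psi> E F" "\<psi> u = u'" "\<psi> v = v'" .
    have uE: "u \<in> Field E" "v \<in> Field E" using E by (auto simp: birooted_graphs_def)
    have uv: "(u, v) \<in> E" using graph_isoD(4)[OF \<psi>(1) uE] \<psi>(2,3) F(3) by simp
    have em: "edge_mass D A B E u v \<in> S"
      using F(4) edge_mass_class[OF A B E(1)] edge_mass_class[OF A B F(2)] F(1) by simp
    have "v \<in> gball E 1 u" by (rule relpow_gball[of u v 1]) (use uv in auto)
    then show "v \<in> gball E (Suc r) u" using gball_mono[of 1 "Suc r" E u] by auto
    fix G w \<phi> assume G: "(G, w, \<phi> v) \<in> birooted_graphs D" "ball_iso \<phi> (Suc r) E u G w"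
    show "birooted_class D G w (\<phi> v) \<in> N S"
      unfolding N_def using edge_mass_local[OF A B E(1) G uv] em G(1) by auto
  qed
  show ?thesis
  proof (rule measurableI)
    fix S :: "real set" assume "S \<in> sets borel"
    have "edge_mass_class D A B -` S \<inter> space (birooted_space D) =
        N S \<union> (if 0 \<in> S then space (birooted_space D) - N UNIV else {})" (is "?L = ?R")
    proof (intro equalityI subsetI)
      fix y assume y: "y \<in> ?L"
      then have "y \<in> space (birooted_space D)" by simp
      from birooted_spaceE[OF this] obtain E u v where E: "(E, u, v) \<in> birooted_graphs D" "y = birooted_class D E u v" by metis
      have S: "edge_mass D A B E u v \<in> S" using y edge_mass_class[OF A B E(1)] E(2) by simp
      show "y \<in> ?R"
      proof (cases "(u, v) \<in> E")
        case True
        then have "y \<in> N S" using E S unfolding N_def by blast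
        then show ?thesis by simp
      next
        case False
        then have 0: "0 \<in> S" using S by (simp add: edge_mass_def)
        have "y \<notin> N UNIV"
        proof
          assume "y \<in> N UNIV"
          then obtain F u' v' where F: "birooted_class D E u v = birooted_class D F u' v'" "(F, u', v') \<in> birooted_graphs D"
            "(u', v') \<in> F" unfolding N_def E(2) by blast
          from birooted_class_eqE[OF E(1) F(2,1)] obtain \<psi> where \<psi>: "graph_iso \<psi> E F" "\<psi> u = u'" "\<psi> v = v'" .
          have "u \<in> Field E" "v \<in> Field E" using E by (auto simp: birooted_graphs_def)
          from graph_isoD(4)[OF \<psi>(1) this] False F(3) \<psi>(2,3) show False by simp
        qed
        then show ?thesis using 0 y by simp
      qed
    next
      fix y assume y: "y \<in> ?R"
      have ysp: "y \<in> space (birooted_space D)"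
        using y sets.sets_into_space[OF N[of S]] by (auto split: if_splits)
      from birooted_spaceE[OF this] obtain E u v where E: "(E, u, v) \<in> birooted_graphs D" "y = birooted_class D E u v" by metis
      have "edge_mass_class D A B y \<in> S"
      proof (cases "y \<in> N S")
        case True
        then show ?thesis unfolding N_def using edge_mass_class[OF A B] by auto
      next
        case False
        then have 0: "0 \<in> S" "y \<notin> N UNIV" using y by (auto split: if_splits)
        then have "(u, v) \<notin> E" using E unfolding N_def by blast
        then show ?thesis using 0 E edge_mass_class[OF A B E(1)] by (simp add: edge_mass_def)
      qed
      then show "y \<in> ?L" using ysp by simp
    qed
    then show "edge_mass_class D A B -` S \<inter> space (birooted_space D) \<in> sets (birooted_space D)"
      using N by auto
  qed auto
qed

locale unimodular_graph =
  fixes D :: nat and \<nu> :: "rooted set measure"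
  assumes unimodular: "unimodular D \<nu>"
begin

abbreviation L :: "labelled set measure" where "L \<equiv> labelled_space D"
abbreviation \<mu> :: "labelled set measure" where "\<mu> \<equiv> mu_star D \<nu>"

lemma prob_nu: "prob_space \<nu>" and sets_nu: "sets \<nu> = sets (rooted_space D)"
  using unimodular by (auto simp: unimodular_def)

lemma space_nu: "space \<nu> = space (rooted_space D)"
  using sets_nu by (rule sets_eq_imp_space_eq)

sublocale N: prob_space \<nu> by (rule prob_nu)

lemma nu_repE:
  assumes "x \<in> space \<nu>"
  obtains E u where "rep x = (E, u)" "(E, u) \<in> rooted_graphs D" "x = rooted_class D E u"
  using rooted_spaceE[of x D] assms unfolding space_nu by metis

lemma fibre_meas [measurable]: "fibre D \<in> \<nu> \<rightarrow>\<^sub>M prob_algebra L"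
  unfolding measurable_cong_sets[OF sets_nu refl] by (rule fibre_measurable)

lemma fibre_meas_sub [measurable]: "fibre D \<in> \<nu> \<rightarrow>\<^sub>M subprob_algebra L"
  by (rule measurable_prob_algebraD) (rule fibre_meas)

lemma rd_meas [measurable]: "(\<lambda>x. of_nat (root_degree x) :: ennreal) \<in> borel_measurable \<nu>"
  unfolding measurable_cong_sets[OF sets_nu refl] by (rule root_degree_measurable)

lemma root_degree_bounds: "x \<in> space \<nu> \<Longrightarrow> 1 \<le> root_degree x" "x \<in> space \<nu> \<Longrightarrow> root_degree x \<le> D"
proof -
  assume "x \<in> space \<nu>"
  from nu_repE[OF this] obtain E u where E: "(E, u) \<in> rooted_graphs D" "x = rooted_class D E u" by metis
  show "1 \<le> root_degree x" "root_degree x \<le> D"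
    unfolding E(2) root_degree_class[OF E(1)]
    using degree_pos[OF rootedD[OF E(1)]] degree_le[OF rootedD[OF E(1)]] by auto
qed

definition mean_degree :: ennreal where
  "mean_degree = (\<integral>\<^sup>+x. of_nat (root_degree x) \<partial>\<nu>)"

lemma mean_degree_bounds: "1 \<le> mean_degree" "mean_degree \<le> of_nat D"
proof -
  have "(\<integral>\<^sup>+x. 1 \<partial>\<nu>) \<le> mean_degree" unfolding mean_degree_def
  proof (rule nn_integral_mono)
    fix x assume "x \<in> space \<nu>"
    from of_nat_mono[OF root_degree_bounds(1)[OF this]] show "(1 :: ennreal) \<le> of_nat (root_degree x)" by simp
  qed
  then show "1 \<le> mean_degree" by (simp add: N.emeasure_space_1)
  have "mean_degree \<le> (\<integral>\<^sup>+x. of_nat D \<partial>\<nu>)" unfolding mean_degree_def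
    by (rule nn_integral_mono) (intro of_nat_mono root_degree_bounds)
  then show "mean_degree \<le> of_nat D" by (simp add: N.emeasure_space_1)
qed

lemma mean_degree_finite: "mean_degree \<noteq> 0" "mean_degree \<noteq> \<infinity>"
  using mean_degree_bounds by (auto simp: top_unique)

lemma bernoulli_eq: "bernoulli_measure D \<nu> = \<nu> \<bind> fibre D"
  unfolding bernoulli_measure_def fibre_def label_kernel_def ..

lemma sets_bernoulli: "sets (bernoulli_measure D \<nu>) = sets L"
  unfolding bernoulli_eq by (rule sets_bind_measurable[OF fibre_meas_sub N.not_empty])

lemma nn_integral_bernoulli:
  "f \<in> borel_measurable L \<Longrightarrow> (\<integral>\<^sup>+y. f y \<partial>bernoulli_measure D \<nu>) = (\<integral>\<^sup>+x. \<integral>\<^sup>+y. f y \<partial>fibre D x \<partial>\<nu>)"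
  unfolding bernoulli_eq by (rule nn_integral_bind) (auto intro: fibre_meas_sub)

lemma nn_integral_label_kernel:
  "(E, u) \<in> rooted_graphs D \<Longrightarrow> f \<in> borel_measurable L \<Longrightarrow>
    (\<integral>\<^sup>+y. f y \<partial>label_kernel D E u) = (\<integral>\<^sup>+\<xi>. f (labelled_class D E \<xi> u) \<partial>label_measure E)"
  unfolding label_kernel_def by (subst nn_integral_distr[OF labelled_class_measurable]) auto

text \<open>
  The degree of the root in its graph, as a measurable function of the labelled class. If the
  labels are distinct, it is the degree in the graphing.
\<close>

definition lab_degree :: "labelled set \<Rightarrow> ennreal" where
  "lab_degree y = of_nat (neighbour_count D (space L) y)"

lemma lab_degree_measurable [measurable]: "lab_degree \<in> borel_measurable L"
proof -
  have "(\<lambda>y. ennreal (real (neighbour_count D (space L) y))) \<in> borel_measurable L"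
    using neighbour_count_measurable[OF space_open_local[of D 0]] by measurable
  then show ?thesis by (simp add: lab_degree_def[abs_def] ennreal_of_nat_eq_real_of_nat)
qed

lemma lab_degree_class: "(E, \<xi>, u) \<in> labelled_graphs D \<Longrightarrow> lab_degree (labelled_class D E \<xi> u) = of_nat (degree E u)"
  by (simp add: lab_degree_def neighbour_count_space)

lemma AE_fibre_distinct: "x \<in> space \<nu> \<Longrightarrow> AE y in fibre D x. y \<in> distinct_labels D"
  using label_kernel_AE_distinct fibre_class by (metis nu_repE)

lemma AE_bernoulli_distinct: "AE y in bernoulli_measure D \<nu>. y \<in> distinct_labels D"
  unfolding bernoulli_eq
  by (subst AE_bind[OF fibre_meas_sub]) (auto simp: AE_fibre_distinct)

lemma AE_bernoulli_degree: "AE y in bernoulli_measure D \<nu>. of_nat (degree (bernoulli_graph D) y) = lab_degree y"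
  using AE_bernoulli_distinct
proof eventually_elim
  case (elim y)
  then obtain E \<xi> u where E: "y = labelled_class D E \<xi> u" "(E, \<xi>, u) \<in> labelled_graphs D" "inj_on \<xi> (Field E)"
    by (auto simp: distinct_labels_def)
  show ?case unfolding E(1) bernoulli_degree[OF E(2,3)] lab_degree_class[OF E(2)] ..
qed

lemma nn_integral_fibre_degree:
  assumes x: "x \<in> space \<nu>" and f: "f \<in> borel_measurable L"
  shows "(\<integral>\<^sup>+y. lab_degree y * f y \<partial>fibre D x) = of_nat (root_degree x) * (\<integral>\<^sup>+y. f y \<partial>fibre D x)"
proof -
  from nu_repE[OF x] obtain E u where E: "(E, u) \<in> rooted_graphs D" "x = rooted_class D E u" by metis
  have m: "(\<lambda>\<xi>. f (labelled_class D E \<xi> u)) \<in> borel_measurable (label_measure E)"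
    by (rule measurable_compose[OF labelled_class_measurable[OF E(1)] f])
  have "(\<integral>\<^sup>+y. lab_degree y * f y \<partial>fibre D x) =
      (\<integral>\<^sup>+\<xi>. lab_degree (labelled_class D E \<xi> u) * f (labelled_class D E \<xi> u) \<partial>label_measure E)"
    unfolding E(2) fibre_class[OF E(1)] using f by (subst nn_integral_label_kernel[OF E(1)]) auto
  also have "\<dots> = (\<integral>\<^sup>+\<xi>. of_nat (degree E u) * f (labelled_class D E \<xi> u) \<partial>label_measure E)"
    by (intro nn_integral_cong) (simp add: lab_degree_class[OF labelled_of_label[OF E(1)]])
  also have "\<dots> = of_nat (degree E u) * (\<integral>\<^sup>+\<xi>. f (labelled_class D E \<xi> u) \<partial>label_measure E)"
    by (rule nn_integral_cmult[OF m])
  finally show ?thesis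
    unfolding E(2) fibre_class[OF E(1)] root_degree_class[OF E(1)] using f by (simp add: nn_integral_label_kernel[OF E(1)])
qed

lemma mean_degree_bernoulli: "(\<integral>\<^sup>+y. of_nat (degree (bernoulli_graph D) y) \<partial>bernoulli_measure D \<nu>) = mean_degree"
proof -
  have "(\<integral>\<^sup>+y. of_nat (degree (bernoulli_graph D) y) \<partial>bernoulli_measure D \<nu>) = (\<integral>\<^sup>+y. lab_degree y * 1 \<partial>bernoulli_measure D \<nu>)"
    using AE_bernoulli_degree by (intro nn_integral_cong_AE) auto
  also have "\<dots> = (\<integral>\<^sup>+x. \<integral>\<^sup>+y. lab_degree y * 1 \<partial>fibre D x \<partial>\<nu>)"
    by (rule nn_integral_bernoulli) simp
  also have "\<dots> = (\<integral>\<^sup>+x. of_nat (root_degree x) * (\<integral>\<^sup>+y. 1 \<partial>fibre D x) \<partial>\<nu>)"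
    by (intro nn_integral_cong nn_integral_fibre_degree) auto
  also have "\<dots> = mean_degree" unfolding mean_degree_def
  proof (rule nn_integral_cong)
    fix x assume "x \<in> space \<nu>"
    then have "prob_space (fibre D x)" using measurable_space[OF fibre_meas] by (auto simp: space_prob_algebra)
    then show "of_nat (root_degree x) * (\<integral>\<^sup>+y. 1 \<partial>fibre D x) = (of_nat (root_degree x) :: ennreal)"
      by (simp add: prob_space.emeasure_space_1)
  qed
  finally show ?thesis .
qed

lemma mu_star_eq: "\<mu> = density (bernoulli_measure D \<nu>) (\<lambda>y. lab_degree y / mean_degree)"
  unfolding biased_def mean_degree_bernoulli
  by (rule density_cong_AE_nonmeasurable) (use AE_bernoulli_degree in auto)

lemma sets_mu [simp, measurable_cong]: "sets \<mu> = sets L"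
  unfolding mu_star_eq by (simp add: sets_bernoulli)

lemma space_mu [simp]: "space \<mu> = space L"
  using sets_mu by (rule sets_eq_imp_space_eq)

lemma borel_mu: "f \<in> borel_measurable \<mu> \<longleftrightarrow> f \<in> borel_measurable L"
  by (simp add: measurable_cong_sets[OF sets_mu refl])

text \<open>
  Since the degree does not depend on the labels, biasing by it commutes with sampling them.
\<close>

lemma nn_integral_mu:
  assumes f [measurable]: "f \<in> borel_measurable L"
  shows "(\<integral>\<^sup>+y. f y \<partial>\<mu>) = (\<integral>\<^sup>+x. (of_nat (root_degree x) / mean_degree) * (\<integral>\<^sup>+y. f y \<partial>fibre D x) \<partial>\<nu>)"
proof -
  have m: "g \<in> borel_measurable (bernoulli_measure D \<nu>)" if "g \<in> borel_measurable L" for g :: "labelled set \<Rightarrow> ennreal"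
    using that by (simp add: measurable_cong_sets[OF sets_bernoulli refl])
  have d: "(\<lambda>y. lab_degree y / mean_degree) \<in> borel_measurable L" by measurable
  have "(\<integral>\<^sup>+y. f y \<partial>\<mu>) = (\<integral>\<^sup>+y. lab_degree y / mean_degree * f y \<partial>bernoulli_measure D \<nu>)"
    unfolding mu_star_eq by (rule nn_integral_density[OF m[OF d] m[OF f]])
  also have "\<dots> = (\<integral>\<^sup>+x. \<integral>\<^sup>+y. lab_degree y / mean_degree * f y \<partial>fibre D x \<partial>\<nu>)"
    by (rule nn_integral_bernoulli) measurable
  also have "\<dots> = (\<integral>\<^sup>+x. (of_nat (root_degree x) / mean_degree) * (\<integral>\<^sup>+y. f y \<partial>fibre D x) \<partial>\<nu>)"
  proof (rule nn_integral_cong)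
    fix x assume x: "x \<in> space \<nu>"
    have mf: "(\<lambda>y. f y / mean_degree) \<in> borel_measurable L" by measurable
    have s: "sets (fibre D x) = sets L" using measurable_space[OF fibre_meas x] by (auto simp: space_prob_algebra)
    have "(\<integral>\<^sup>+y. lab_degree y / mean_degree * f y \<partial>fibre D x) = (\<integral>\<^sup>+y. lab_degree y * (f y / mean_degree) \<partial>fibre D x)"
      by (intro nn_integral_cong) (simp add: divide_ennreal_def mult_ac)
    also have "\<dots> = of_nat (root_degree x) * (\<integral>\<^sup>+y. f y / mean_degree \<partial>fibre D x)"
      by (rule nn_integral_fibre_degree[OF x mf])
    also have "(\<integral>\<^sup>+y. f y / mean_degree \<partial>fibre D x) = (\<integral>\<^sup>+y. f y \<partial>fibre D x) / mean_degree"
      by (rule nn_integral_divide) (simp add: measurable_cong_sets[OF s refl])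
    finally show "(\<integral>\<^sup>+y. lab_degree y / mean_degree * f y \<partial>fibre D x) =
        of_nat (root_degree x) / mean_degree * (\<integral>\<^sup>+y. f y \<partial>fibre D x)"
      by (simp add: divide_ennreal_def mult_ac)
  qed
  finally show ?thesis .
qed

lemma fibre_prob: "x \<in> space \<nu> \<Longrightarrow> prob_space (fibre D x)"
  and fibre_sets: "x \<in> space \<nu> \<Longrightarrow> sets (fibre D x) = sets L"
  using measurable_space[OF fibre_meas] by (auto simp: space_prob_algebra)

lemma fibre_borel: "x \<in> space \<nu> \<Longrightarrow> f \<in> borel_measurable L \<Longrightarrow> f \<in> borel_measurable (fibre D x)"
  by (simp add: measurable_cong_sets[OF fibre_sets refl])

lemma nn_integral_nu_star:
  "g \<in> borel_measurable \<nu> \<Longrightarrow> (\<integral>\<^sup>+x. g x \<partial>nu_star \<nu>) = (\<integral>\<^sup>+x. (of_nat (root_degree x) / mean_degree) * g x \<partial>\<nu>)"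
  unfolding biased_def mean_degree_def[symmetric] by (rule nn_integral_density) measurable

lemma prob_mu: "prob_space \<mu>"
proof (rule prob_spaceI)
  have "emeasure \<mu> (space \<mu>) = (\<integral>\<^sup>+y. 1 \<partial>\<mu>)" by simp
  also have "\<dots> = (\<integral>\<^sup>+x. (of_nat (root_degree x) / mean_degree) * (\<integral>\<^sup>+y. 1 \<partial>fibre D x) \<partial>\<nu>)"
    by (rule nn_integral_mu) simp
  also have "\<dots> = (\<integral>\<^sup>+x. of_nat (root_degree x) / mean_degree \<partial>\<nu>)"
    by (intro nn_integral_cong) (simp add: prob_space.emeasure_space_1[OF fibre_prob])
  also have "\<dots> = mean_degree / mean_degree"
    unfolding mean_degree_def by (rule nn_integral_divide) measurable
  also have "\<dots> = 1" using mean_degree_finite by (simp add: ennreal_divide_self less_top)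
  finally show "emeasure \<mu> (space \<mu>) = 1" .
qed

lemma AE_mu_distinct: "AE y in \<mu>. y \<in> distinct_labels D"
proof -
  have "(\<integral>\<^sup>+y. indicator (space L - distinct_labels D) y \<partial>\<mu>) =
      (\<integral>\<^sup>+x. (of_nat (root_degree x) / mean_degree) * (\<integral>\<^sup>+y. indicator (space L - distinct_labels D) y \<partial>fibre D x) \<partial>\<nu>)"
    by (rule nn_integral_mu) measurable
  also have "\<dots> = (\<integral>\<^sup>+x. 0 \<partial>\<nu>)"
  proof (rule nn_integral_cong)
    fix x assume x: "x \<in> space \<nu>"
    have "(\<integral>\<^sup>+y. indicator (space L - distinct_labels D) y \<partial>fibre D x) = (\<integral>\<^sup>+y. 0 \<partial>fibre D x)"
      by (rule nn_integral_cong_AE) (use AE_fibre_distinct[OF x] in eventually_elim, auto)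
    then show "(of_nat (root_degree x) / mean_degree) * (\<integral>\<^sup>+y. indicator (space L - distinct_labels D) y \<partial>fibre D x) = 0"
      by simp
  qed
  finally have "emeasure \<mu> (space L - distinct_labels D) = 0"
    by (subst (asm) nn_integral_indicator) auto
  then show ?thesis by (intro AE_I[where N = "space L - distinct_labels D"]) auto
qed

lemma nkernel_meas: "neighbour_kernel D \<in> \<mu> \<rightarrow>\<^sub>M prob_algebra \<mu>"
proof -
  have "neighbour_kernel D \<in> L \<rightarrow>\<^sub>M prob_algebra L" by (rule neighbour_kernel_measurable)
  then show ?thesis
    unfolding measurable_cong_sets[OF sets_mu refl] by (simp add: prob_algebra_def subprob_algebra_cong[OF sets_mu])
qed

text \<open>
  The degree cancels against the probability of choosing a given neighbour.
\<close>

lemma edge_mass_sum: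
  assumes E: "(E, u) \<in> rooted_graphs D" and A: "A \<in> sets L" and B: "B \<in> sets L"
  shows "of_nat (degree E u) * (\<integral>\<^sup>+y. indicator A y * emeasure (neighbour_kernel D y) B \<partial>label_kernel D E u) =
    (\<integral>\<^sup>+v. ennreal (edge_mass D A B E u v) \<partial>count_space (Field E))"
proof -
  interpret P: prob_space "label_measure E" by (rule prob_space_label)
  have fin: "finite (E `` {u})" by (rule neighbours_finite[OF rootedD(1)[OF E]])
  have pos: "degree E u > 0" by (rule degree_pos[OF rootedD[OF E]])
  have nk: "(\<lambda>y. emeasure (neighbour_kernel D y) B) \<in> borel_measurable L"
    by (rule measurable_compose[OF measurable_prob_algebraD[OF neighbour_kernel_measurable] measurable_emeasure_subprob_algebra[OF B]])
  have Eu: "(E, v) \<in> rooted_graphs D" if "v \<in> E `` {u}" for v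
    using E that by (auto simp: rooted_graphs_def Field_def)
  have ev: "{\<xi> \<in> space (label_measure E). labelled_class D E \<xi> u \<in> A \<and> labelled_class D E \<xi> v \<in> B} \<in> sets (label_measure E)"
    if "v \<in> E `` {u}" for v
    by (intro sets.sets_Collect_conj label_event_sets E Eu[OF that] A B)
  have "of_nat (degree E u) * (\<integral>\<^sup>+y. indicator A y * emeasure (neighbour_kernel D y) B \<partial>label_kernel D E u) =
      of_nat (degree E u) * (\<integral>\<^sup>+\<xi>. indicator A (labelled_class D E \<xi> u) * emeasure (neighbour_kernel D (labelled_class D E \<xi> u)) B \<partial>label_measure E)"
    using nk A by (subst nn_integral_label_kernel[OF E]) auto
  also have "\<dots> = (\<integral>\<^sup>+\<xi>. of_nat (degree E u) * (indicator A (labelled_class D E \<xi> u) * emeasure (neighbour_kernel D (labelled_class D E \<xi> u)) B) \<partial>label_measure E)"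
    using measurable_compose[OF labelled_class_measurable[OF E] nk]
      measurable_compose[OF labelled_class_measurable[OF E] borel_measurable_indicator[OF A]]
    by (intro nn_integral_cmult[symmetric] borel_measurable_times_ennreal)
  also have "\<dots> = (\<integral>\<^sup>+\<xi>. (\<Sum>v\<in>E `` {u}. indicator {\<xi> \<in> space (label_measure E). labelled_class D E \<xi> u \<in> A \<and> labelled_class D E \<xi> v \<in> B} \<xi>) \<partial>label_measure E)"
  proof (rule nn_integral_cong)
    fix \<xi> assume \<xi>: "\<xi> \<in> space (label_measure E)"
    have lE: "(E, \<xi>, u) \<in> labelled_graphs D" by (rule labelled_of_label[OF E \<xi>])
    have "emeasure (neighbour_kernel D (labelled_class D E \<xi> u)) B =
        ennreal (real (card {v \<in> E `` {u}. labelled_class D E \<xi> v \<in> B}) / real (degree E u))"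
      unfolding neighbour_kernel_class[OF lE] emeasure_neighbour_distr[OF lE B] neighbour_count_class[OF lE] ..
    then have "of_nat (degree E u) * emeasure (neighbour_kernel D (labelled_class D E \<xi> u)) B =
        ennreal (real (card {v \<in> E `` {u}. labelled_class D E \<xi> v \<in> B}))"
      using pos by (simp add: ennreal_of_nat_eq_real_of_nat ennreal_mult[symmetric])
    also have "\<dots> = (\<Sum>v\<in>E `` {u}. indicator {v. labelled_class D E \<xi> v \<in> B} v)"
    proof -
      have "(\<Sum>v\<in>E `` {u}. indicator {v. labelled_class D E \<xi> v \<in> B} v :: ennreal) =
          (\<Sum>v\<in>{v \<in> E `` {u}. labelled_class D E \<xi> v \<in> B}. 1)"
        by (rule sum.mono_neutral_cong_right[OF fin]) auto
      then show ?thesis by (simp add: ennreal_of_nat_eq_real_of_nat)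
    qed
    finally have *: "of_nat (degree E u) * emeasure (neighbour_kernel D (labelled_class D E \<xi> u)) B =
        (\<Sum>v\<in>E `` {u}. indicator {v. labelled_class D E \<xi> v \<in> B} v)" .
    have "of_nat (degree E u) * (indicator A (labelled_class D E \<xi> u) * emeasure (neighbour_kernel D (labelled_class D E \<xi> u)) B) =
        indicator A (labelled_class D E \<xi> u) * (\<Sum>v\<in>E `` {u}. indicator {v. labelled_class D E \<xi> v \<in> B} v)"
      unfolding *[symmetric] by (rule mult.left_commute)
    also have "\<dots> = (\<Sum>v\<in>E `` {u}. indicator {\<xi> \<in> space (label_measure E). labelled_class D E \<xi> u \<in> A \<and> labelled_class D E \<xi> v \<in> B} \<xi>)"
      unfolding sum_distrib_left using \<xi> by (intro sum.cong) (auto simp: indicator_def)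
    finally show "of_nat (degree E u) * (indicator A (labelled_class D E \<xi> u) * emeasure (neighbour_kernel D (labelled_class D E \<xi> u)) B) =
        (\<Sum>v\<in>E `` {u}. indicator {\<xi> \<in> space (label_measure E). labelled_class D E \<xi> u \<in> A \<and> labelled_class D E \<xi> v \<in> B} \<xi>)" .
  qed
  also have "\<dots> = (\<Sum>v\<in>E `` {u}. \<integral>\<^sup>+\<xi>. indicator {\<xi> \<in> space (label_measure E). labelled_class D E \<xi> u \<in> A \<and> labelled_class D E \<xi> v \<in> B} \<xi> \<partial>label_measure E)"
    using ev by (intro nn_integral_sum borel_measurable_indicator)
  also have "\<dots> = (\<Sum>v\<in>E `` {u}. ennreal (edge_mass D A B E u v))"
  proof (rule sum.cong[OF refl])
    fix v assume v: "v \<in> E `` {u}"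
    show "(\<integral>\<^sup>+\<xi>. indicator {\<xi> \<in> space (label_measure E). labelled_class D E \<xi> u \<in> A \<and> labelled_class D E \<xi> v \<in> B} \<xi> \<partial>label_measure E) =
        ennreal (edge_mass D A B E u v)"
      unfolding nn_integral_indicator[OF ev[OF v]] edge_mass_def using v by (simp add: P.emeasure_eq_measure)
  qed
  also have "\<dots> = (\<integral>\<^sup>+v. ennreal (edge_mass D A B E u v) \<partial>count_space (Field E))"
    by (rule nn_integral_count_space'[symmetric]) (use fin in \<open>auto simp: edge_mass_def Field_def\<close>)
  finally show ?thesis .
qed

lemma edge_mass_swap: "E \<in> graphs D \<Longrightarrow> edge_mass D A B E u v = edge_mass D B A E v u"
  using graphs_sym[of E D u v] by (auto simp: edge_mass_def conj_commute)

text \<open>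
  In the mass transport principle for the edge mass from \<open>A\<close> to \<open>B\<close>, the mass that leaves the root
  is the left hand side, up to the factor \<open>mean_degree\<close>. The mass that arrives at the root is the
  mass that leaves it when \<open>A\<close> and \<open>B\<close> are exchanged, because edges are symmetric.
\<close>

lemma reversible_open_local:
  assumes A: "open_local D r A" and B: "open_local D r B"
  shows "(\<integral>\<^sup>+y. indicator A y * emeasure (neighbour_kernel D y) B \<partial>\<mu>) =
    (\<integral>\<^sup>+y. indicator B y * emeasure (neighbour_kernel D y) A \<partial>\<mu>)"
proof -
  have nk: "(\<lambda>y. emeasure (neighbour_kernel D y) B) \<in> borel_measurable L" if "B \<in> sets L" for B
    by (rule measurable_compose[OF measurable_prob_algebraD[OF neighbour_kernel_measurable] measurable_emeasure_subprob_algebra[OF that]])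
  have As: "A \<in> sets L" and Bs: "B \<in> sets L" using A B by (auto intro: open_local_sets)
  have form: "(\<integral>\<^sup>+y. indicator A y * emeasure (neighbour_kernel D y) B \<partial>\<mu>) =
      (\<integral>\<^sup>+x. (case rep x of (E, u) \<Rightarrow> \<integral>\<^sup>+v. ennreal (edge_mass D A B E u v) \<partial>count_space (Field E)) / mean_degree \<partial>\<nu>)"
    if "A \<in> sets L" "B \<in> sets L" for A B
  proof -
    have "(\<integral>\<^sup>+y. indicator A y * emeasure (neighbour_kernel D y) B \<partial>\<mu>) =
        (\<integral>\<^sup>+x. (of_nat (root_degree x) / mean_degree) * (\<integral>\<^sup>+y. indicator A y * emeasure (neighbour_kernel D y) B \<partial>fibre D x) \<partial>\<nu>)"
      using nk[OF that(2)] that(1) by (intro nn_integral_mu) auto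
    also have "\<dots> = (\<integral>\<^sup>+x. (case rep x of (E, u) \<Rightarrow> \<integral>\<^sup>+v. ennreal (edge_mass D A B E u v) \<partial>count_space (Field E)) / mean_degree \<partial>\<nu>)"
    proof (rule nn_integral_cong)
      fix x assume "x \<in> space \<nu>"
      from nu_repE[OF this] obtain E u where E: "rep x = (E, u)" "(E, u) \<in> rooted_graphs D" "x = rooted_class D E u" .
      have "of_nat (root_degree x) * (\<integral>\<^sup>+y. indicator A y * emeasure (neighbour_kernel D y) B \<partial>fibre D x) =
          (\<integral>\<^sup>+v. ennreal (edge_mass D A B E u v) \<partial>count_space (Field E))"
        unfolding E(3) root_degree_class[OF E(2)] fibre_class[OF E(2)] by (rule edge_mass_sum[OF E(2) that])
      then show "(of_nat (root_degree x) / mean_degree) * (\<integral>\<^sup>+y. indicator A y * emeasure (neighbour_kernel D y) B \<partial>fibre D x) =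
          (case rep x of (E, u) \<Rightarrow> \<integral>\<^sup>+v. ennreal (edge_mass D A B E u v) \<partial>count_space (Field E)) / mean_degree"
        unfolding E(1) prod.case by (simp add: divide_ennreal_def mult_ac)
    qed
    finally show ?thesis .
  qed
  define Z where "Z x h = (case rep x of (E, u) \<Rightarrow> \<integral>\<^sup>+v. ennreal (h E u v) \<partial>count_space (Field E))"
    for x :: "rooted set" and h :: "nat rel \<Rightarrow> nat \<Rightarrow> nat \<Rightarrow> real"
  have mtp: "(\<integral>\<^sup>+x. Z x (\<lambda>E u v. edge_mass_class D A B (birooted_class D E v u)) \<partial>\<nu>) =
      (\<integral>\<^sup>+x. Z x (\<lambda>E u v. edge_mass_class D A B (birooted_class D E u v)) \<partial>\<nu>)"
    using unimodular edge_mass_class_measurable[OF A B]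
    unfolding unimodular_def Z_def by (auto simp: edge_mass_class_def edge_mass_def split: prod.split)
  have 1: "(\<integral>\<^sup>+x. Z x (\<lambda>E u v. edge_mass_class D A B (birooted_class D E u v)) \<partial>\<nu>) = (\<integral>\<^sup>+x. Z x (edge_mass D A B) \<partial>\<nu>)"
  proof (rule nn_integral_cong)
    fix x assume "x \<in> space \<nu>"
    from nu_repE[OF this] obtain E u where E: "rep x = (E, u)" "(E, u) \<in> rooted_graphs D" by metis
    show "Z x (\<lambda>E u v. edge_mass_class D A B (birooted_class D E u v)) = Z x (edge_mass D A B)"
      unfolding Z_def E(1) prod.case using E(2)
      by (intro nn_integral_cong arg_cong[where f = ennreal] edge_mass_class[OF A B]) (auto simp: birooted_graphs_def rooted_graphs_def)
  qed
  have 2: "(\<integral>\<^sup>+x. Z x (\<lambda>E u v. edge_mass_class D A B (birooted_class D E v u)) \<partial>\<nu>) = (\<integral>\<^sup>+x. Z x (edge_mass D B A) \<partial>\<nu>)"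
  proof (rule nn_integral_cong)
    fix x assume "x \<in> space \<nu>"
    from nu_repE[OF this] obtain E u where E: "rep x = (E, u)" "(E, u) \<in> rooted_graphs D" by metis
    have "edge_mass_class D A B (birooted_class D E v u) = edge_mass D B A E u v" if "v \<in> Field E" for v
      using edge_mass_class[OF A B, of E v u] edge_mass_swap[OF rootedD(1)[OF E(2)], of A B v u] E(2) that
      by (simp add: birooted_graphs_def rooted_graphs_def)
    then show "Z x (\<lambda>E u v. edge_mass_class D A B (birooted_class D E v u)) = Z x (edge_mass D B A)"
      unfolding Z_def E(1) prod.case by (intro nn_integral_cong) simp
  qed
  have div: "(\<integral>\<^sup>+x. Z x h / mean_degree \<partial>\<nu>) = (\<integral>\<^sup>+x. Z x h \<partial>\<nu>) / mean_degree" if "(\<lambda>x. Z x h) \<in> borel_measurable \<nu>" for h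
    using that by (rule nn_integral_divide)
  have meas: "(\<lambda>x. Z x (edge_mass D A B)) \<in> borel_measurable \<nu>" if "A \<in> sets L" "B \<in> sets L" for A B
  proof -
    have "(\<lambda>y. indicator A y * emeasure (neighbour_kernel D y) B) \<in> borel_measurable L"
      using nk[OF that(2)] that(1) by auto
    from measurable_compose[OF fibre_meas_sub nn_integral_measurable_subprob_algebra[OF this]]
    have "(\<lambda>x. of_nat (root_degree x) * (\<integral>\<^sup>+y. indicator A y * emeasure (neighbour_kernel D y) B \<partial>fibre D x)) \<in> borel_measurable \<nu>"
      by (intro borel_measurable_times_ennreal rd_meas)
    then show ?thesis
    proof (rule measurable_cong[THEN iffD1, rotated])
      fix x assume "x \<in> space \<nu>"
      from nu_repE[OF this] obtain E u where E: "rep x = (E, u)" "(E, u) \<in> rooted_graphs D" "x = rooted_class D E u" .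
      show "of_nat (root_degree x) * (\<integral>\<^sup>+y. indicator A y * emeasure (neighbour_kernel D y) B \<partial>fibre D x) = Z x (edge_mass D A B)"
        unfolding Z_def E(1) prod.case unfolding E(3) root_degree_class[OF E(2)] fibre_class[OF E(2)] by (rule edge_mass_sum[OF E(2) that])
    qed
  qed
  show ?thesis
    unfolding form[OF As Bs] form[OF Bs As] Z_def[symmetric] div[OF meas[OF As Bs]] div[OF meas[OF Bs As]]
    using mtp unfolding 1 2 by simp
qed

lemma neighbour_reversible: "reversible_kernel \<mu> (neighbour_kernel D)"
proof (rule reversible_kernelI_generator[OF prob_mu nkernel_meas])
  show "sets \<mu> = sigma_sets (space \<mu>) (open_locals D)" using sets_labelled_space[of D] by simp
  show "open_locals D \<subseteq> Pow (space \<mu>)" using open_locals_subset[of D] by simp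
  show "space \<mu> \<in> open_locals D" using space_open_local[of D 0] unfolding open_locals_def space_mu by blast
  fix A B assume "A \<in> open_locals D" "B \<in> open_locals D"
  then obtain r s where "open_local D r A" "open_local D s B" by (auto simp: open_locals_def)
  then have "open_local D (max r s) A" "open_local D (max r s) B" by (auto intro: open_local_mono)
  then show "(\<integral>\<^sup>+y. indicator A y * emeasure (neighbour_kernel D y) B \<partial>\<mu>) =
      (\<integral>\<^sup>+y. indicator B y * emeasure (neighbour_kernel D y) A \<partial>\<mu>)" by (rule reversible_open_local)
qed (rule open_locals_Int_stable)

end

section \<open>The random subspace\<close>

lemma L2_orthogonalD: "f \<in> L2_orthogonal M H \<Longrightarrow> f \<in> L2 M" "f \<in> L2_orthogonal M H \<Longrightarrow> g \<in> H \<Longrightarrow> L2_inner M f g = 0"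
  by (auto simp: L2_orthogonal_def)

lemma L2_orthogonal_add:
  assumes H: "H \<subseteq> L2 M" and f: "f \<in> L2_orthogonal M H" and g: "g \<in> L2_orthogonal M H"
  shows "(\<lambda>x. f x + g x) \<in> L2_orthogonal M H"
  using f g H unfolding L2_orthogonal_def by (auto simp: L2_add L2_inner_add_left subset_iff)

lemma L2_orthogonal_scale: "f \<in> L2_orthogonal M H \<Longrightarrow> (\<lambda>x. c * f x) \<in> L2_orthogonal M H"
  unfolding L2_orthogonal_def by (auto simp: L2_scale L2_inner_scale_left)

lemma L2_orthogonal_cong_AE:
  assumes H: "H \<subseteq> L2 M" and f: "f \<in> L2_orthogonal M H" and g: "g \<in> borel_measurable M" "AE x in M. f x = g x"
  shows "g \<in> L2_orthogonal M H"
proof -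
  have fL: "f \<in> L2 M" using f by (rule L2_orthogonalD)
  have "L2_inner M g h = 0" if h: "h \<in> H" for h
  proof -
    have "L2_inner M g h = L2_inner M f h"
      using g fL h H by (intro L2_inner_cong_AE) (auto simp: L2_measurable subset_iff)
    then show ?thesis using L2_orthogonalD(2)[OF f h] by simp
  qed
  then show ?thesis using L2_cong_AE[OF fL g] by (simp add: L2_orthogonal_def)
qed

lemma L2_orthogonal_closed:
  assumes H: "H \<subseteq> L2 M" and f: "\<And>n :: nat. f n \<in> L2_orthogonal M H" and g: "g \<in> L2 M"
    and lim: "(\<lambda>n. L2_norm M (\<lambda>x. f n x - g x)) \<longlonglongrightarrow> 0"
  shows "g \<in> L2_orthogonal M H"
proof -
  have "L2_inner M g h = 0" if h: "h \<in> H" for h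
  proof -
    have hL: "h \<in> L2 M" using H h by auto
    have bound: "cmod (L2_inner M g h) \<le> L2_norm M (\<lambda>x. f n x - g x) * L2_norm M h" for n
    proof -
      have fL: "f n \<in> L2 M" by (rule L2_orthogonalD(1)[OF f])
      have "L2_inner M (\<lambda>x. f n x + (-1) * g x) h = L2_inner M (f n) h + L2_inner M (\<lambda>x. (-1) * g x) h"
        by (rule L2_inner_add_left[OF fL L2_scale[OF g] hL])
      then have "L2_inner M (\<lambda>x. f n x - g x) h = - L2_inner M g h"
        using L2_orthogonalD(2)[OF f h, of n] L2_inner_scale_left[of M "-1" g h] by simp
      then show ?thesis using L2_Cauchy_Schwarz[OF L2_diff[OF fL g] hL] by simp
    qed
    have "(\<lambda>n. L2_norm M (\<lambda>x. f n x - g x) * L2_norm M h) \<longlonglongrightarrow> 0 * L2_norm M h"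
      by (intro tendsto_intros lim)
    then have "cmod (L2_inner M g h) \<le> 0 * L2_norm M h"
      by (rule LIMSEQ_le_const) (use bound in auto)
    then show ?thesis by simp
  qed
  then show ?thesis using g by (simp add: L2_orthogonal_def)
qed

text \<open>
  Adjacent points of the graphing carry the same labelling, so no edge leaves the set of graphs
  with distinct labels.
\<close>

lemma markov_distinct:
  "markov (bernoulli_graph D) (\<lambda>x. if x \<in> distinct_labels D then f x else 0) =
    (\<lambda>x. if x \<in> distinct_labels D then markov (bernoulli_graph D) f x else 0)"
proof
  fix x
  have edge: "x \<in> distinct_labels D \<longleftrightarrow> y \<in> distinct_labels D" if "(x, y) \<in> bernoulli_graph D" for y
  proof -
    obtain E \<xi> u v where E: "x = labelled_class D E \<xi> u" "y = labelled_class D E \<xi> v" "(E, \<xi>, u) \<in> labelled_graphs D" "(u, v) \<in> E"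
      using \<open>(x, y) \<in> bernoulli_graph D\<close> by (auto simp: bernoulli_graph_def)
    show ?thesis unfolding E(1,2) distinct_labels_iff[OF E(3)] distinct_labels_iff[OF neighbour_labelled[OF E(3,4)]] ..
  qed
  have "(\<Sum>v\<in>bernoulli_graph D `` {x}. if v \<in> distinct_labels D then f v else 0) =
      (\<Sum>v\<in>bernoulli_graph D `` {x}. if x \<in> distinct_labels D then f v else 0)"
    by (rule sum.cong[OF refl]) (use edge in auto)
  then show "markov (bernoulli_graph D) (\<lambda>x. if x \<in> distinct_labels D then f x else 0) x =
      (if x \<in> distinct_labels D then markov (bernoulli_graph D) f x else 0)"
    by (simp add: markov_def)
qed

definition label_local :: "nat \<Rightarrow> nat \<Rightarrow> (labelled set \<Rightarrow> complex) \<Rightarrow> bool" where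
  "label_local D k f \<longleftrightarrow> (\<forall>E \<xi> \<eta> u. (E, \<xi>, u) \<in> labelled_graphs D \<longrightarrow> (E, \<eta>, u) \<in> labelled_graphs D \<longrightarrow>
     (\<forall>w\<in>gball E k u. \<eta> w = \<xi> w) \<longrightarrow> f (labelled_class D E \<xi> u) = f (labelled_class D E \<eta> u))"

definition zero_mean :: "nat \<Rightarrow> (labelled set \<Rightarrow> complex) \<Rightarrow> bool" where
  "zero_mean D f \<longleftrightarrow> (\<forall>E u. (E, u) \<in> rooted_graphs D \<longrightarrow> (\<integral>\<xi>. f (labelled_class D E \<xi> u) \<partial>label_measure E) = 0)"

lemma label_localD:
  "label_local D k f \<Longrightarrow> (E, \<xi>, u) \<in> labelled_graphs D \<Longrightarrow> (E, \<eta>, u) \<in> labelled_graphs D \<Longrightarrow>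
    (\<And>w. w \<in> gball E k u \<Longrightarrow> \<eta> w = \<xi> w) \<Longrightarrow> f (labelled_class D E \<xi> u) = f (labelled_class D E \<eta> u)"
  unfolding label_local_def by blast

lemma label_local_mono: "label_local D k f \<Longrightarrow> k \<le> l \<Longrightarrow> label_local D l f"
  unfolding label_local_def using gball_mono[of k l] by (meson subsetD)

section \<open>Local functions of mean zero decorrelate\<close>

lemma label_square_expand:
  fixes f :: "labelled set \<Rightarrow> complex" and q :: "nat \<Rightarrow> real"
  assumes E: "E \<in> graphs D" and B: "finite B" "B \<subseteq> Field E" and f: "f \<in> borel_measurable (labelled_space D)"
    and bound: "\<And>x. cmod (f x) \<le> C"
  shows "complex_of_real (\<integral>\<xi>. (cmod (\<Sum>v\<in>B. of_real (q v) * f (labelled_class D E \<xi> v)))\<^sup>2 \<partial>label_measure E) =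
    (\<Sum>v\<in>B. \<Sum>w\<in>B. of_real (q v * q w) *
      (\<integral>\<xi>. f (labelled_class D E \<xi> v) * cnj (f (labelled_class D E \<xi> w)) \<partial>label_measure E))"
    and "(\<integral>\<^sup>+\<xi>. ennreal ((cmod (\<Sum>v\<in>B. of_real (q v) * f (labelled_class D E \<xi> v)))\<^sup>2) \<partial>label_measure E) =
      ennreal (\<integral>\<xi>. (cmod (\<Sum>v\<in>B. of_real (q v) * f (labelled_class D E \<xi> v)))\<^sup>2 \<partial>label_measure E)"
proof -
  interpret P: prob_space "label_measure E" by (rule prob_space_label)
  define g where "g v \<xi> = f (labelled_class D E \<xi> v)" for v \<xi>
  have gm: "g v \<in> borel_measurable (label_measure E)" if "v \<in> B" for v
    unfolding g_def using that B E
    by (intro measurable_compose[OF labelled_class_measurable f]) (auto simp: rooted_graphs_def)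
  have gb: "cmod (g v \<xi>) \<le> C" for v \<xi> by (simp add: g_def bound)
  have C0: "0 \<le> C" using gb[of undefined undefined] norm_ge_zero order_trans by blast
  define Z where "Z \<xi> = (\<Sum>v\<in>B. of_real (q v) * g v \<xi>)" for \<xi>
  have Zm: "Z \<in> borel_measurable (label_measure E)"
    unfolding Z_def[abs_def] using gm by (intro borel_measurable_sum borel_measurable_times borel_measurable_const)
  have Zb: "cmod (Z \<xi>) \<le> (\<Sum>v\<in>B. \<bar>q v\<bar> * C)" for \<xi>
    unfolding Z_def using gb by (intro sum_norm_le) (auto simp: norm_mult intro!: mult_left_mono)
  have Zi: "integrable (label_measure E) (\<lambda>\<xi>. (cmod (Z \<xi>))\<^sup>2)"
  proof (rule P.integrable_const_bound[where B = "(\<Sum>v\<in>B. \<bar>q v\<bar> * C)\<^sup>2"])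
    show "AE \<xi> in label_measure E. norm ((cmod (Z \<xi>))\<^sup>2) \<le> (\<Sum>v\<in>B. \<bar>q v\<bar> * C)\<^sup>2"
      using Zb by (intro AE_I2) (simp add: power_mono)
  qed (use Zm in measurable)
  have prodi: "integrable (label_measure E) (\<lambda>\<xi>. g v \<xi> * cnj (g w \<xi>))" if "v \<in> B" "w \<in> B" for v w
  proof (rule P.integrable_const_bound[where B = "C * C"])
    show "AE \<xi> in label_measure E. norm (g v \<xi> * cnj (g w \<xi>)) \<le> C * C"
      using gb C0 by (intro AE_I2) (auto simp: norm_mult intro!: mult_mono)
  qed (intro borel_measurable_times borel_measurable_cnj gm that)
  have "complex_of_real (\<integral>\<xi>. (cmod (Z \<xi>))\<^sup>2 \<partial>label_measure E) = (\<integral>\<xi>. complex_of_real ((cmod (Z \<xi>))\<^sup>2) \<partial>label_measure E)"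
    by (rule integral_complex_of_real[symmetric])
  also have "\<dots> = (\<integral>\<xi>. (\<Sum>v\<in>B. \<Sum>w\<in>B. of_real (q v * q w) * (g v \<xi> * cnj (g w \<xi>))) \<partial>label_measure E)"
  proof (rule Bochner_Integration.integral_cong[OF refl])
    fix \<xi>
    have "complex_of_real ((cmod (Z \<xi>))\<^sup>2) = Z \<xi> * cnj (Z \<xi>)" by (rule complex_norm_square)
    also have "\<dots> = (\<Sum>v\<in>B. \<Sum>w\<in>B. (of_real (q v) * g v \<xi>) * (of_real (q w) * cnj (g w \<xi>)))"
      by (simp add: Z_def sum_product)
    finally show "complex_of_real ((cmod (Z \<xi>))\<^sup>2) = (\<Sum>v\<in>B. \<Sum>w\<in>B. of_real (q v * q w) * (g v \<xi> * cnj (g w \<xi>)))"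
      by (simp add: mult_ac)
  qed
  also have "\<dots> = (\<Sum>v\<in>B. \<integral>\<xi>. (\<Sum>w\<in>B. of_real (q v * q w) * (g v \<xi> * cnj (g w \<xi>))) \<partial>label_measure E)"
    by (intro Bochner_Integration.integral_sum Bochner_Integration.integrable_sum integrable_mult_right prodi)
  also have "\<dots> = (\<Sum>v\<in>B. \<Sum>w\<in>B. \<integral>\<xi>. of_real (q v * q w) * (g v \<xi> * cnj (g w \<xi>)) \<partial>label_measure E)"
    by (intro sum.cong refl Bochner_Integration.integral_sum integrable_mult_right prodi)
  also have "\<dots> = (\<Sum>v\<in>B. \<Sum>w\<in>B. of_real (q v * q w) * (\<integral>\<xi>. g v \<xi> * cnj (g w \<xi>) \<partial>label_measure E))"
    by simp
  finally show "complex_of_real (\<integral>\<xi>. (cmod (\<Sum>v\<in>B. of_real (q v) * f (labelled_class D E \<xi> v)))\<^sup>2 \<partial>label_measure E) =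
    (\<Sum>v\<in>B. \<Sum>w\<in>B. of_real (q v * q w) *
      (\<integral>\<xi>. f (labelled_class D E \<xi> v) * cnj (f (labelled_class D E \<xi> w)) \<partial>label_measure E))"
    by (simp only: Z_def g_def)
  have "(\<integral>\<^sup>+\<xi>. ennreal ((cmod (Z \<xi>))\<^sup>2) \<partial>label_measure E) = ennreal (\<integral>\<xi>. (cmod (Z \<xi>))\<^sup>2 \<partial>label_measure E)"
    by (rule nn_integral_eq_integral[OF Zi]) simp
  then show "(\<integral>\<^sup>+\<xi>. ennreal ((cmod (\<Sum>v\<in>B. of_real (q v) * f (labelled_class D E \<xi> v)))\<^sup>2) \<partial>label_measure E) =
      ennreal (\<integral>\<xi>. (cmod (\<Sum>v\<in>B. of_real (q v) * f (labelled_class D E \<xi> v)))\<^sup>2 \<partial>label_measure E)"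
    by (simp only: Z_def g_def)
qed

text \<open>
  The two values depend on labels in disjoint balls and are therefore independent.
\<close>

lemma label_uncorrelated:
  assumes E: "E \<in> graphs D" and v: "v \<in> Field E" and w: "w \<in> Field E" and f: "f \<in> borel_measurable (labelled_space D)"
    and bound: "\<And>x. cmod (f x) \<le> C" and loc: "label_local D k f" and zero: "zero_mean D f"
    and disj: "gball E k v \<inter> gball E k w = {}"
  shows "(\<integral>\<xi>. f (labelled_class D E \<xi> v) * cnj (f (labelled_class D E \<xi> w)) \<partial>label_measure E) = 0"
proof -
  have Ev: "(E, v) \<in> rooted_graphs D" and Ew: "(E, w) \<in> rooted_graphs D" using E v w by (auto simp: rooted_graphs_def)
  have m: "(\<lambda>\<xi>. f (labelled_class D E \<xi> v)) \<in> borel_measurable (label_measure E)"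
    "(\<lambda>\<xi>. cnj (f (labelled_class D E \<xi> w))) \<in> borel_measurable (label_measure E)"
    using measurable_compose[OF labelled_class_measurable[OF Ev] f] measurable_compose[OF labelled_class_measurable[OF Ew] f]
    by (auto intro: borel_measurable_cnj)
  have "(\<integral>\<xi>. f (labelled_class D E \<xi> v) * cnj (f (labelled_class D E \<xi> w)) \<partial>label_measure E) =
      (\<integral>\<xi>. f (labelled_class D E \<xi> v) \<partial>label_measure E) * (\<integral>\<xi>. cnj (f (labelled_class D E \<xi> w)) \<partial>label_measure E)"
  proof (rule label_indep_integral[OF m, where C = C and I = "gball E k v" and J = "gball E k w"])
    show "gball E k v \<subseteq> Field E" "gball E k w \<subseteq> Field E" by (rule gball_Field[OF v], rule gball_Field[OF w])
    show "gball E k v \<inter> gball E k w = {}" by (rule disj)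
    show "Field E \<noteq> {}" using v by blast
    fix \<xi> \<eta> assume \<xi>: "\<xi> \<in> space (label_measure E)" and \<eta>: "\<eta> \<in> space (label_measure E)"
    show "f (labelled_class D E \<xi> v) = f (labelled_class D E \<eta> v)" if "\<And>i. i \<in> gball E k v \<Longrightarrow> \<eta> i = \<xi> i"
      by (rule label_localD[OF loc labelled_of_label[OF Ev \<xi>] labelled_of_label[OF Ev \<eta>] that])
    show "cnj (f (labelled_class D E \<xi> w)) = cnj (f (labelled_class D E \<eta> w))" if "\<And>i. i \<in> gball E k w \<Longrightarrow> \<eta> i = \<xi> i"
      by (rule arg_cong[where f = cnj], rule label_localD[OF loc labelled_of_label[OF Ew \<xi>] labelled_of_label[OF Ew \<eta>] that])
  qed (simp_all add: bound)
  also have "(\<integral>\<xi>. f (labelled_class D E \<xi> v) \<partial>label_measure E) = 0" using zero Ev by (simp add: zero_mean_def)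
  finally show ?thesis by simp
qed

text \<open>
  Values at \<open>v\<close> and \<open>w\<close> are correlated only if the balls of radius \<open>k\<close> around \<open>v\<close> and \<open>w\<close> meet.
  For each \<open>v\<close> this leaves at most \<open>(1 + D)\<^bsup>2k\<^esup>\<close> vertices \<open>w\<close>, so the estimate
  \<open>q v q w \<le> ((q v)\<^sup>2 + (q w)\<^sup>2) / 2\<close> bounds the double sum by a multiple of the diagonal.
\<close>

lemma label_square_le:
  fixes q :: "nat \<Rightarrow> real"
  assumes E: "E \<in> graphs D" and B: "finite B" "B \<subseteq> Field E" and f: "f \<in> borel_measurable (labelled_space D)"
    and bound: "\<And>x. cmod (f x) \<le> C" and loc: "label_local D k f" and zero: "zero_mean D f" and q: "\<And>v. 0 \<le> q v"
  shows "(\<integral>\<^sup>+\<xi>. ennreal ((cmod (\<Sum>v\<in>B. of_real (q v) * f (labelled_class D E \<xi> v)))\<^sup>2) \<partial>label_measure E) \<le>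
    ennreal (C\<^sup>2 * real ((1 + D) ^ (2 * k)) * (\<Sum>v\<in>B. (q v)\<^sup>2))"
proof -
  interpret P: prob_space "label_measure E" by (rule prob_space_label)
  define cov where "cov v w = (\<integral>\<xi>. f (labelled_class D E \<xi> v) * cnj (f (labelled_class D E \<xi> w)) \<partial>label_measure E)" for v w
  define near where "near v w \<longleftrightarrow> gball E k v \<inter> gball E k w \<noteq> {}" for v w
  define I where "I = (\<integral>\<xi>. (cmod (\<Sum>v\<in>B. of_real (q v) * f (labelled_class D E \<xi> v)))\<^sup>2 \<partial>label_measure E)"
  have C0: "0 \<le> C" using bound[of undefined] norm_ge_zero order_trans by blast
  have covb: "cmod (cov v w) \<le> C\<^sup>2" if "v \<in> B" "w \<in> B" for v w
  proof -
    have "cmod (cov v w) \<le> (\<integral>\<xi>. cmod (f (labelled_class D E \<xi> v) * cnj (f (labelled_class D E \<xi> w))) \<partial>label_measure E)"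
      unfolding cov_def by (rule integral_norm_bound)
    also have "\<dots> \<le> (\<integral>\<xi>. C\<^sup>2 \<partial>label_measure E)"
    proof (rule Bochner_Integration.integral_mono')
      show "cmod (f (labelled_class D E \<xi> v) * cnj (f (labelled_class D E \<xi> w))) \<le> C\<^sup>2" for \<xi>
        using bound C0 by (auto simp: norm_mult power2_eq_square intro!: mult_mono)
    qed (auto simp: P.prob_space)
    finally show ?thesis by (simp add: P.prob_space)
  qed
  have covz: "cov v w = 0" if "v \<in> B" "w \<in> B" "\<not> near v w" for v w
    unfolding cov_def using that B(2)
    by (intro label_uncorrelated[OF E _ _ f bound loc zero]) (auto simp: near_def)
  have nearsub: "{w \<in> B. near v w} \<subseteq> gball E (2 * k) v" for v
  proof
    fix w assume "w \<in> {w \<in> B. near v w}"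
    then obtain x where x: "x \<in> gball E k v" "x \<in> gball E k w" by (auto simp: near_def)
    from gball_trans[OF x(1) gball_sym[OF E x(2)]] show "w \<in> gball E (2 * k) v" by (simp add: mult_2)
  qed
  have ncard: "card {w \<in> B. near v w} \<le> (1 + D) ^ (2 * k)" for v
    using card_mono[OF finite_gball[OF E] nearsub] card_gball_le[OF E, of "2 * k" v] by (rule order_trans)
  have "complex_of_real I = (\<Sum>v\<in>B. \<Sum>w\<in>B. of_real (q v * q w) * cov v w)"
    unfolding I_def cov_def by (rule label_square_expand(1)[OF E B f bound])
  then have "\<bar>I\<bar> = cmod (\<Sum>v\<in>B. \<Sum>w\<in>B. of_real (q v * q w) * cov v w)"
    by (metis norm_of_real)
  also have "\<dots> \<le> (\<Sum>v\<in>B. \<Sum>w\<in>B. if near v w then C\<^sup>2 * (((q v)\<^sup>2 + (q w)\<^sup>2) / 2) else 0)"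
  proof (intro sum_norm_le)
    fix v w assume v: "v \<in> B" and w: "w \<in> B"
    have "q v * q w \<le> ((q v)\<^sup>2 + (q w)\<^sup>2) / 2"
      using sum_squares_bound[of "q v" "q w"] by simp
    then have "q v * q w * cmod (cov v w) \<le> ((q v)\<^sup>2 + (q w)\<^sup>2) / 2 * C\<^sup>2"
      using covb[OF v w] q by (intro mult_mono) auto
    then show "cmod (of_real (q v * q w) * cov v w) \<le> (if near v w then C\<^sup>2 * (((q v)\<^sup>2 + (q w)\<^sup>2) / 2) else 0)"
      using covz[OF v w] q by (auto simp: norm_mult abs_mult mult.commute)
  qed
  also have "\<dots> = (\<Sum>v\<in>B. \<Sum>w\<in>B. (if near v w then C\<^sup>2 * (q v)\<^sup>2 / 2 else 0)) +
      (\<Sum>v\<in>B. \<Sum>w\<in>B. (if near v w then C\<^sup>2 * (q w)\<^sup>2 / 2 else 0))"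
    unfolding sum.distrib[symmetric] by (intro sum.cong refl) (auto simp: algebra_simps add_divide_distrib)
  also have "(\<Sum>v\<in>B. \<Sum>w\<in>B. (if near v w then C\<^sup>2 * (q w)\<^sup>2 / 2 else 0)) =
      (\<Sum>v\<in>B. \<Sum>w\<in>B. (if near v w then C\<^sup>2 * (q v)\<^sup>2 / 2 else 0))"
    by (subst sum.swap) (intro sum.cong refl, auto simp: near_def)
  also have "(\<Sum>v\<in>B. \<Sum>w\<in>B. (if near v w then C\<^sup>2 * (q v)\<^sup>2 / 2 else 0)) +
      (\<Sum>v\<in>B. \<Sum>w\<in>B. (if near v w then C\<^sup>2 * (q v)\<^sup>2 / 2 else 0)) =
      (\<Sum>v\<in>B. (\<Sum>w\<in>B. (if near v w then C\<^sup>2 * (q v)\<^sup>2 / 2 else 0)) + (\<Sum>w\<in>B. (if near v w then C\<^sup>2 * (q v)\<^sup>2 / 2 else 0)))"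
    by (rule sum.distrib[symmetric])
  also have "\<dots> = (\<Sum>v\<in>B. C\<^sup>2 * (q v)\<^sup>2 * real (card {w \<in> B. near v w}))"
  proof (rule sum.cong[OF refl])
    fix v
    have "(\<Sum>w\<in>B. (if near v w then C\<^sup>2 * (q v)\<^sup>2 / 2 else 0)) = (\<Sum>w\<in>{w \<in> B. near v w}. C\<^sup>2 * (q v)\<^sup>2 / 2)"
      by (rule sum.inter_filter[symmetric, OF B(1)])
    then show "(\<Sum>w\<in>B. (if near v w then C\<^sup>2 * (q v)\<^sup>2 / 2 else 0)) + (\<Sum>w\<in>B. (if near v w then C\<^sup>2 * (q v)\<^sup>2 / 2 else 0)) =
        C\<^sup>2 * (q v)\<^sup>2 * real (card {w \<in> B. near v w})" by (simp add: mult_ac)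
  qed
  also have "\<dots> \<le> (\<Sum>v\<in>B. C\<^sup>2 * (q v)\<^sup>2 * real ((1 + D) ^ (2 * k)))"
    by (intro sum_mono mult_left_mono of_nat_mono ncard) auto
  also have "\<dots> = C\<^sup>2 * real ((1 + D) ^ (2 * k)) * (\<Sum>v\<in>B. (q v)\<^sup>2)"
    unfolding sum_distrib_left by (intro sum.cong refl) (simp only: mult_ac)
  finally have "I \<le> C\<^sup>2 * real ((1 + D) ^ (2 * k)) * (\<Sum>v\<in>B. (q v)\<^sup>2)" by linarith
  then show ?thesis
    unfolding label_square_expand(2)[OF E B f bound] I_def[symmetric] by (rule ennreal_leI)
qed

text \<open>
  Rounding the label of the root to a fair coin gives a local function of mean zero and modulus
  one.
\<close>

definition low_root :: "nat \<Rightarrow> labelled set set" where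
  "low_root D = {labelled_class D E \<xi> u |E \<xi> u. (E, \<xi>, u) \<in> labelled_graphs D \<and> \<xi> u < 1 / 2}"

definition root_coin :: "nat \<Rightarrow> labelled set \<Rightarrow> complex" where
  "root_coin D x = (if x \<in> low_root D then -1 else 1)"

lemma low_root_iff:
  assumes E: "(E, \<xi>, u) \<in> labelled_graphs D"
  shows "labelled_class D E \<xi> u \<in> low_root D \<longleftrightarrow> \<xi> u < 1 / 2"
proof
  assume "labelled_class D E \<xi> u \<in> low_root D"
  then obtain F \<eta> v where F: "labelled_class D E \<xi> u = labelled_class D F \<eta> v" "(F, \<eta>, v) \<in> labelled_graphs D"
    "\<eta> v < 1 / 2" by (auto simp: low_root_def)
  from labelled_class_eqE[OF E F(2,1)] obtain \<phi> where
    "\<phi> u = v" "\<And>w. w \<in> Field E \<Longrightarrow> \<eta> (\<phi> w) = \<xi> w" by blast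
  then have "\<eta> v = \<xi> u" using labelledD(2)[OF E] by blast
  then show "\<xi> u < 1 / 2" using F(3) by simp
qed (use E in \<open>auto simp: low_root_def\<close>)

lemma low_root_open: "open_local D 0 (low_root D)"
proof (rule open_localI)
  show "low_root D \<subseteq> space (labelled_space D)" unfolding low_root_def by (auto intro: labelled_class_space)
  fix E \<xi> u assume E: "(E, \<xi>, u) \<in> labelled_graphs D" "labelled_class D E \<xi> u \<in> low_root D"
  then have lt: "\<xi> u < 1 / 2" by (simp add: low_root_iff)
  have "local_nbhd D 0 (low_root D) E \<xi> u (1 / 2 - \<xi> u)"
  proof (rule local_nbhdI)
    fix F \<eta> v \<phi> assume F: "(F, \<eta>, v) \<in> labelled_graphs D" "ball_iso \<phi> 0 E u F v"
      and near: "\<And>w. w \<in> gball E 0 u \<Longrightarrow> \<bar>\<eta> (\<phi> w) - \<xi> w\<bar> < 1 / 2 - \<xi> u"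
    have "\<eta> v < 1 / 2" using near[of u] ball_isoD(2)[OF F(2)] by simp
    then show "labelled_class D F \<eta> v \<in> low_root D" by (simp add: low_root_iff[OF F(1)])
  qed
  then show "\<exists>\<epsilon>>0. local_nbhd D 0 (low_root D) E \<xi> u \<epsilon>" using lt by (intro exI[of _ "1 / 2 - \<xi> u"]) simp
qed

lemma root_coin_measurable [measurable]: "root_coin D \<in> borel_measurable (labelled_space D)"
proof -
  have [measurable]: "low_root D \<in> sets (labelled_space D)" by (rule open_local_sets[OF low_root_open])
  show ?thesis unfolding root_coin_def[abs_def] by measurable
qed

lemma root_coin_norm: "cmod (root_coin D x) = 1"
  by (simp add: root_coin_def)

lemma root_coin_class: "(E, \<xi>, u) \<in> labelled_graphs D \<Longrightarrow> root_coin D (labelled_class D E \<xi> u) = coin (\<xi> u)"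
  by (simp add: root_coin_def coin_def low_root_iff)

lemma root_coin_local: "label_local D 0 (root_coin D)"
  unfolding label_local_def by (auto simp: root_coin_class)

lemma root_coin_zero_mean: "zero_mean D (root_coin D)"
  unfolding zero_mean_def
proof (intro allI impI)
  fix E u assume E: "(E, u) \<in> rooted_graphs D"
  have "(\<integral>\<xi>. root_coin D (labelled_class D E \<xi> u) \<partial>label_measure E) = (\<integral>\<xi>. coin (\<xi> u) \<partial>label_measure E)"
    by (intro Bochner_Integration.integral_cong) (auto simp: root_coin_class[OF labelled_of_label[OF E]])
  then show "(\<integral>\<xi>. root_coin D (labelled_class D E \<xi> u) \<partial>label_measure E) = 0"
    using coin_mean[OF rootedD(2)[OF E]] by simp
qed

text \<open>
  The coins at different vertices are orthonormal.
\<close>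

lemma label_square_coin:
  fixes q :: "nat \<Rightarrow> real"
  assumes E: "E \<in> graphs D" and B: "finite B" "B \<subseteq> Field E"
  shows "(\<integral>\<^sup>+\<xi>. ennreal ((cmod (\<Sum>v\<in>B. of_real (q v) * root_coin D (labelled_class D E \<xi> v)))\<^sup>2) \<partial>label_measure E) =
    ennreal (\<Sum>v\<in>B. (q v)\<^sup>2)"
proof -
  interpret P: prob_space "label_measure E" by (rule prob_space_label)
  have bound: "cmod (root_coin D x) \<le> 1" for x by (simp add: root_coin_norm)
  have cov: "(\<integral>\<xi>. root_coin D (labelled_class D E \<xi> v) * cnj (root_coin D (labelled_class D E \<xi> w)) \<partial>label_measure E) =
      (if v = w then 1 else 0)" if "v \<in> B" "w \<in> B" for v w
  proof (cases "v = w")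
    case True
    have "root_coin D x * cnj (root_coin D x) = 1" for x by (simp add: root_coin_def)
    then show ?thesis using True by (simp add: P.prob_space)
  next
    case False
    then show ?thesis using that B(2)
      by (simp, intro label_uncorrelated[OF E _ _ root_coin_measurable bound root_coin_local root_coin_zero_mean]) auto
  qed
  have "complex_of_real (\<integral>\<xi>. (cmod (\<Sum>v\<in>B. of_real (q v) * root_coin D (labelled_class D E \<xi> v)))\<^sup>2 \<partial>label_measure E) =
      (\<Sum>v\<in>B. \<Sum>w\<in>B. of_real (q v * q w) * (if v = w then 1 else 0))"
    unfolding label_square_expand(1)[OF E B root_coin_measurable bound] by (intro sum.cong refl) (simp only: cov)
  also have "\<dots> = (\<Sum>v\<in>B. of_real ((q v)\<^sup>2))"
  proof (rule sum.cong[OF refl])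
    fix v assume v: "v \<in> B"
    have "(\<Sum>w\<in>B. of_real (q v * q w) * (if v = w then 1 else 0)) = (\<Sum>w\<in>B. if v = w then complex_of_real (q v * q w) else 0)"
      by (intro sum.cong) auto
    also have "\<dots> = of_real (q v * q v)" using B(1) v by (subst sum.delta') auto
    finally show "(\<Sum>w\<in>B. of_real (q v * q w) * (if v = w then 1 else 0)) = complex_of_real ((q v)\<^sup>2)"
      by (simp add: power2_eq_square)
  qed
  also have "\<dots> = complex_of_real (\<Sum>v\<in>B. (q v)\<^sup>2)" by simp
  finally have "(\<integral>\<xi>. (cmod (\<Sum>v\<in>B. of_real (q v) * root_coin D (labelled_class D E \<xi> v)))\<^sup>2 \<partial>label_measure E) = (\<Sum>v\<in>B. (q v)\<^sup>2)"
    by (simp only: of_real_eq_iff)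
  then show ?thesis unfolding label_square_expand(2)[OF E B root_coin_measurable bound] by simp
qed

section \<open>The Markov operator on the random subspace\<close>

context unimodular_graph
begin

sublocale K: reversible_kernel "mu_star D \<nu>" "neighbour_kernel D"
  by (rule neighbour_reversible)

sublocale PM: prob_space "mu_star D \<nu>"
  by (rule prob_mu)

abbreviation cut :: "(labelled set \<Rightarrow> complex) \<Rightarrow> labelled set \<Rightarrow> complex" where
  "cut f \<equiv> (\<lambda>x. if x \<in> distinct_labels D then f x else 0)"

lemma structured_subset: "structured_subspace D \<nu> \<subseteq> L2 \<mu>"
  by (auto simp: structured_subspace_def)

lemma random_L2: "f \<in> random_subspace D \<nu> \<Longrightarrow> f \<in> L2 \<mu>"
  unfolding random_subspace_def by (rule L2_orthogonalD)

lemma cut_measurable: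
  assumes "f \<in> borel_measurable \<mu>" shows "cut f \<in> borel_measurable \<mu>"
proof -
  have [measurable]: "f \<in> borel_measurable L" using assms by (simp add: borel_mu)
  show ?thesis unfolding borel_mu by measurable
qed

lemma cut_AE_eq: "AE x in \<mu>. f x = cut f x"
  using AE_mu_distinct by eventually_elim simp

lemma cut_L2: "f \<in> L2 \<mu> \<Longrightarrow> cut f \<in> L2 \<mu>"
  by (rule L2_cong_AE[OF _ cut_measurable cut_AE_eq]) (auto simp: L2_measurable)

lemma cut_random: "f \<in> random_subspace D \<nu> \<Longrightarrow> cut f \<in> random_subspace D \<nu>"
  unfolding random_subspace_def
  by (rule L2_orthogonal_cong_AE[OF structured_subset _ cut_measurable cut_AE_eq]) (auto dest: L2_orthogonalD simp: L2_measurable)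

lemma average_class:
  "(E, \<xi>, u) \<in> labelled_graphs D \<Longrightarrow> f \<in> borel_measurable L \<Longrightarrow>
    K.average f (labelled_class D E \<xi> u) = markov E (\<lambda>v. f (labelled_class D E \<xi> v)) u"
  unfolding K.average_def by (rule integral_neighbour_kernel)

lemma bernoulli_markov_average:
  assumes f: "f \<in> borel_measurable L"
  shows "markov (bernoulli_graph D) (cut f) = cut (K.average f)"
proof
  fix x
  have "markov (bernoulli_graph D) f x = K.average f x" if x: "x \<in> distinct_labels D"
  proof -
    from x obtain E \<xi> u where E: "x = labelled_class D E \<xi> u" "(E, \<xi>, u) \<in> labelled_graphs D" "inj_on \<xi> (Field E)"
      by (auto simp: distinct_labels_def)
    show ?thesis unfolding E(1) bernoulli_markov[OF E(2,3)] average_class[OF E(2) f] ..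
  qed
  then show "markov (bernoulli_graph D) (cut f) x = cut (K.average f) x"
    unfolding markov_distinct by simp
qed

lemma nn_integral_fibre_forget:
  assumes x: "x \<in> space \<nu>" and F: "F \<in> borel_measurable \<nu>"
  shows "(\<integral>\<^sup>+y. F (forget_labels D y) \<partial>fibre D x) = F x"
proof -
  from nu_repE[OF x] obtain E u where E: "(E, u) \<in> rooted_graphs D" "x = rooted_class D E u" by metis
  have F': "F \<in> borel_measurable (rooted_space D)" using F by (simp add: measurable_cong_sets[OF sets_nu refl])
  interpret P: prob_space "label_measure E" by (rule prob_space_label)
  have "(\<integral>\<^sup>+y. F (forget_labels D y) \<partial>fibre D x) = (\<integral>\<^sup>+\<xi>. F (forget_labels D (labelled_class D E \<xi> u)) \<partial>label_measure E)"
    unfolding E(2) fibre_class[OF E(1)]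
    by (rule nn_integral_label_kernel[OF E(1) measurable_compose[OF forget_labels_measurable F']])
  also have "\<dots> = (\<integral>\<^sup>+\<xi>. F x \<partial>label_measure E)"
    by (intro nn_integral_cong) (simp add: forget_labels_class[OF labelled_of_label[OF E(1)]] E(2))
  finally show ?thesis by (simp add: P.emeasure_space_1)
qed

lemma nn_integral_mu_forget:
  assumes F: "F \<in> borel_measurable \<nu>"
  shows "(\<integral>\<^sup>+y. F (forget_labels D y) \<partial>\<mu>) = (\<integral>\<^sup>+x. F x \<partial>nu_star \<nu>)"
proof -
  have F': "F \<in> borel_measurable (rooted_space D)" using F by (simp add: measurable_cong_sets[OF sets_nu refl])
  show ?thesis
    unfolding nn_integral_mu[OF measurable_compose[OF forget_labels_measurable F']] nn_integral_nu_star[OF F]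
    by (intro nn_integral_cong) (simp add: nn_integral_fibre_forget[OF _ F])
qed

lemma borel_nu_star: "g \<in> borel_measurable (nu_star \<nu>) \<longleftrightarrow> g \<in> borel_measurable \<nu>"
  by (simp add: biased_def)

lemma forget_measurable_nu: "g \<in> borel_measurable \<nu> \<Longrightarrow> (\<lambda>y. g (forget_labels D y)) \<in> borel_measurable L"
  by (rule measurable_compose[OF forget_labels_measurable]) (simp add: measurable_cong_sets[OF sets_nu refl])

lemma forget_L2:
  fixes g :: "rooted set \<Rightarrow> complex"
  assumes g: "g \<in> borel_measurable \<nu>"
  shows "(\<lambda>y. g (forget_labels D y)) \<in> L2 \<mu> \<longleftrightarrow> g \<in> L2 (nu_star \<nu>)"
proof -
  have m: "(\<lambda>x. ennreal ((cmod (g x))\<^sup>2)) \<in> borel_measurable \<nu>" using g by measurable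
  have eq: "(\<integral>\<^sup>+y. ennreal ((cmod (g (forget_labels D y)))\<^sup>2) \<partial>\<mu>) = (\<integral>\<^sup>+x. ennreal ((cmod (g x))\<^sup>2) \<partial>nu_star \<nu>)"
    by (rule nn_integral_mu_forget[OF m])
  show ?thesis
  proof
    assume "(\<lambda>y. g (forget_labels D y)) \<in> L2 \<mu>"
    from L2_norm_nn[OF this] show "g \<in> L2 (nu_star \<nu>)"
      using eq g by (intro L2I_nn) (auto simp: borel_nu_star)
  next
    assume "g \<in> L2 (nu_star \<nu>)"
    from L2_norm_nn[OF this] show "(\<lambda>y. g (forget_labels D y)) \<in> L2 \<mu>"
      using eq forget_measurable_nu[OF g] by (intro L2I_nn) (auto simp: borel_mu)
  qed
qed

lemma forget_structured:
  "g \<in> L2 (nu_star \<nu>) \<Longrightarrow> (\<lambda>y. g (forget_labels D y)) \<in> structured_subspace D \<nu>"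
  using forget_L2[of g] borel_nu_star[of g] by (auto simp: structured_subspace_def L2_measurable)

lemma fibre_integral_class:
  fixes f :: "labelled set \<Rightarrow> complex"
  assumes E: "(E, u) \<in> rooted_graphs D" and f: "f \<in> borel_measurable L"
  shows "(\<integral>y. f y \<partial>fibre D (rooted_class D E u)) = (\<integral>\<xi>. f (labelled_class D E \<xi> u) \<partial>label_measure E)"
  unfolding fibre_class[OF E] label_kernel_def by (rule integral_distr[OF labelled_class_measurable[OF E] f])

lemma fibre_integral_measurable:
  fixes f :: "labelled set \<Rightarrow> complex"
  assumes "f \<in> borel_measurable L"
  shows "(\<lambda>x. \<integral>y. f y \<partial>fibre D x) \<in> borel_measurable \<nu>"
  by (rule measurable_compose[OF fibre_meas_sub integral_measurable_subprob_algebra[OF assms]])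

text \<open>
  The graphs seen from the neighbours of the root do not depend on the labels, so averaging a
  function of the graph gives a function of the graph. Integrating it over the fibre shows that it
  is a measurable one.
\<close>

lemma average_forget_structured:
  assumes g: "g \<in> L2 (nu_star \<nu>)"
  shows "K.average (\<lambda>y. g (forget_labels D y)) \<in> structured_subspace D \<nu>"
proof -
  define h where "h = (\<lambda>y. g (forget_labels D y))"
  have hL: "h \<in> L2 \<mu>" unfolding h_def using forget_structured[OF g] structured_subset by auto
  have hm: "h \<in> borel_measurable L" using hL L2_measurable borel_mu by blast
  have aL: "K.average h \<in> L2 \<mu>" by (rule K.average_L2[OF hL])
  have am: "K.average h \<in> borel_measurable L" using aL L2_measurable borel_mu by blast
  define g' where "g' x = (\<integral>y. K.average h y \<partial>fibre D x)" for x
  have g'm: "g' \<in> borel_measurable \<nu>" unfolding g'_def[abs_def] by (rule fibre_integral_measurable[OF am])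
  have eq: "K.average h y = g' (forget_labels D y)" if y: "y \<in> space L" for y
  proof -
    from labelled_spaceE[OF y] obtain E \<xi> u where E: "(E, \<xi>, u) \<in> labelled_graphs D" "y = labelled_class D E \<xi> u" by metis
    have rE: "(E, u) \<in> rooted_graphs D" by (rule labelled_rooted[OF E(1)])
    interpret P: prob_space "label_measure E" by (rule prob_space_label)
    have val: "K.average h (labelled_class D E \<eta> u) = markov E (\<lambda>v. g (rooted_class D E v)) u"
      if \<eta>: "(E, \<eta>, u) \<in> labelled_graphs D" for \<eta>
    proof -
      have "h (labelled_class D E \<eta> v) = g (rooted_class D E v)" if "v \<in> E `` {u}" for v
        unfolding h_def using forget_labels_class[OF neighbour_labelled[OF \<eta>]] that by simp
      then show ?thesis unfolding average_class[OF \<eta> hm] markov_def by simp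
    qed
    have "g' (rooted_class D E u) = (\<integral>\<eta>. markov E (\<lambda>v. g (rooted_class D E v)) u \<partial>label_measure E)"
      unfolding g'_def fibre_integral_class[OF rE am]
      by (intro Bochner_Integration.integral_cong) (auto simp: val labelled_of_label[OF rE])
    then show ?thesis unfolding E(2) forget_labels_class[OF E(1)] val[OF E(1)] by (simp add: P.prob_space)
  qed
  have AEeq: "AE y in \<mu>. K.average h y = g' (forget_labels D y)" by (rule AE_I2) (simp add: eq)
  have "(\<lambda>y. g' (forget_labels D y)) \<in> L2 \<mu>"
    by (rule L2_cong_AE[OF aL _ AEeq]) (simp add: borel_mu forget_measurable_nu[OF g'm])
  then have "g' \<in> L2 (nu_star \<nu>)" by (simp add: forget_L2[OF g'm])
  then show ?thesis using aL AEeq unfolding structured_subspace_def h_def by blast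
qed

text \<open>
  A symmetric operator that preserves a subspace preserves its orthogonal complement.
\<close>

lemma average_random:
  assumes f: "f \<in> random_subspace D \<nu>"
  shows "K.average f \<in> random_subspace D \<nu>"
  unfolding random_subspace_def L2_orthogonal_def
proof (intro CollectI conjI ballI)
  show aL: "K.average f \<in> L2 \<mu>" by (rule K.average_L2[OF random_L2[OF f]])
  fix h assume h: "h \<in> structured_subspace D \<nu>"
  then obtain g where g: "g \<in> L2 (nu_star \<nu>)" "AE x in \<mu>. h x = g (forget_labels D x)" by (auto simp: structured_subspace_def)
  define h' where "h' = (\<lambda>x. g (forget_labels D x))"
  have h': "h' \<in> L2 \<mu>" unfolding h'_def using forget_structured[OF g(1)] structured_subset by auto
  have "L2_inner \<mu> (K.average f) h = L2_inner \<mu> (K.average f) h'"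
    using g(2) h structured_subset h' aL unfolding h'_def
    by (intro L2_inner_cong_AE) (auto simp: L2_measurable)
  also have "\<dots> = L2_inner \<mu> f (K.average h')" by (rule K.average_symmetric[OF random_L2[OF f] h'])
  also have "\<dots> = 0"
    using f average_forget_structured[OF g(1)] unfolding random_subspace_def h'_def by (intro L2_orthogonalD(2))
  finally show "L2_inner \<mu> (K.average f) h = 0" .
qed

lemma integral_mu_zero_real:
  fixes F :: "labelled set \<Rightarrow> real"
  assumes F: "integrable \<mu> F" and fib: "\<And>x. x \<in> space \<nu> \<Longrightarrow> integrable (fibre D x) F" "\<And>x. x \<in> space \<nu> \<Longrightarrow> (\<integral>y. F y \<partial>fibre D x) = 0"
  shows "(\<integral>y. F y \<partial>\<mu>) = 0"
proof -
  have Fm: "F \<in> borel_measurable L" using borel_measurable_integrable[OF F] borel_mu by simp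
  have m: "(\<lambda>y. ennreal (F y)) \<in> borel_measurable L" "(\<lambda>y. ennreal (- F y)) \<in> borel_measurable L" using Fm by measurable
  have "(\<integral>\<^sup>+y. ennreal (F y) \<partial>\<mu>) = (\<integral>\<^sup>+y. ennreal (- F y) \<partial>\<mu>)"
    unfolding nn_integral_mu[OF m(1)] nn_integral_mu[OF m(2)]
  proof (rule nn_integral_cong)
    fix x assume x: "x \<in> space \<nu>"
    have "(\<integral>\<^sup>+y. ennreal (F y) \<partial>fibre D x) < \<infinity>" "(\<integral>\<^sup>+y. ennreal (- F y) \<partial>fibre D x) < \<infinity>"
      using fib(1)[OF x] by (auto simp: real_integrable_def less_top)
    moreover have "enn2real (\<integral>\<^sup>+y. ennreal (F y) \<partial>fibre D x) - enn2real (\<integral>\<^sup>+y. ennreal (- F y) \<partial>fibre D x) = 0"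
      using fib(2)[OF x] real_lebesgue_integral_def[OF fib(1)[OF x]] by simp
    ultimately have "(\<integral>\<^sup>+y. ennreal (F y) \<partial>fibre D x) = (\<integral>\<^sup>+y. ennreal (- F y) \<partial>fibre D x)"
      by (metis eq_iff_diff_eq_0 ennreal_enn2real infinity_ennreal_def)
    then show "of_nat (root_degree x) / mean_degree * (\<integral>\<^sup>+y. ennreal (F y) \<partial>fibre D x) =
        of_nat (root_degree x) / mean_degree * (\<integral>\<^sup>+y. ennreal (- F y) \<partial>fibre D x)" by simp
  qed
  then show ?thesis using real_lebesgue_integral_def[OF F] by simp
qed

lemma integral_mu_zero:
  fixes F :: "labelled set \<Rightarrow> complex"
  assumes F: "integrable \<mu> F" and fib: "\<And>x. x \<in> space \<nu> \<Longrightarrow> integrable (fibre D x) F" "\<And>x. x \<in> space \<nu> \<Longrightarrow> (\<integral>y. F y \<partial>fibre D x) = 0"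
  shows "(\<integral>y. F y \<partial>\<mu>) = 0"
proof -
  have "(\<integral>y. Re (F y) \<partial>\<mu>) = 0"
    using F fib by (intro integral_mu_zero_real) auto
  moreover have "(\<integral>y. Im (F y) \<partial>\<mu>) = 0"
    using F fib by (intro integral_mu_zero_real) auto
  ultimately show ?thesis using F by (simp add: complex_eq_iff)
qed

lemma bounded_L2:
  assumes f: "f \<in> borel_measurable L" and C: "\<And>x. cmod (f x) \<le> C"
  shows "f \<in> L2 \<mu>"
proof -
  have "integrable \<mu> (\<lambda>x. (cmod (f x))\<^sup>2)"
  proof (rule PM.integrable_const_bound[where B = "C\<^sup>2"])
    show "AE x in \<mu>. norm ((cmod (f x))\<^sup>2) \<le> C\<^sup>2" using C by (intro AE_I2) (simp add: power_mono)
    have "f \<in> borel_measurable \<mu>" using f by (simp add: borel_mu)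
    then show "(\<lambda>x. (cmod (f x))\<^sup>2) \<in> borel_measurable \<mu>" by measurable
  qed
  then show ?thesis using f by (simp add: L2_def borel_mu)
qed

text \<open>
  On each fibre a function of the graph is constant, so its product with a function of mean zero
  has integral zero.
\<close>

lemma zero_mean_random:
  assumes f: "f \<in> borel_measurable L" and C: "\<And>x. cmod (f x) \<le> C" and zero: "zero_mean D f"
  shows "f \<in> random_subspace D \<nu>"
  unfolding random_subspace_def L2_orthogonal_def
proof (intro CollectI conjI ballI)
  show fL: "f \<in> L2 \<mu>" by (rule bounded_L2[OF f C])
  fix h assume h: "h \<in> structured_subspace D \<nu>"
  then obtain g where g: "g \<in> L2 (nu_star \<nu>)" "AE x in \<mu>. h x = g (forget_labels D x)" by (auto simp: structured_subspace_def)
  define h' where "h' = (\<lambda>x. g (forget_labels D x))"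
  have h': "h' \<in> L2 \<mu>" unfolding h'_def using forget_structured[OF g(1)] structured_subset by auto
  have h'm: "h' \<in> borel_measurable L" using h' L2_measurable borel_mu by blast
  have "L2_inner \<mu> f h = L2_inner \<mu> f h'"
    using g(2) h structured_subset h' fL unfolding h'_def
    by (intro L2_inner_cong_AE) (auto simp: L2_measurable)
  also have "\<dots> = 0"
    unfolding L2_inner_def
  proof (rule integral_mu_zero)
    show "integrable \<mu> (\<lambda>x. f x * cnj (h' x))" by (rule integrable_L2_inner[OF fL h'])
    fix x assume x: "x \<in> space \<nu>"
    interpret P: prob_space "fibre D x" by (rule fibre_prob[OF x])
    from nu_repE[OF x] obtain E u where E: "(E, u) \<in> rooted_graphs D" "x = rooted_class D E u" by metis
    have eq: "AE y in fibre D x. f y * cnj (h' y) = f y * cnj (g x)"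
    proof -
      have ae: "AE \<xi> in label_measure E. h' (labelled_class D E \<xi> u) = g x"
      proof (rule AE_I2)
        fix \<xi> assume "\<xi> \<in> space (label_measure E)"
        from forget_labels_class[OF labelled_of_label[OF E(1) this]] show "h' (labelled_class D E \<xi> u) = g x"
          by (simp only: h'_def E(2))
      qed
      have st: "{y \<in> space L. h' y = g x} \<in> sets L"
        using measurable_sets[OF h'm, of "{g x}"] by (simp add: vimage_def Int_def conj_commute)
      have "AE y in label_kernel D E u. h' y = g x"
        unfolding label_kernel_def AE_distr_iff[OF labelled_class_measurable[OF E(1)] st] by (rule ae)
      moreover have "fibre D x = label_kernel D E u" by (simp only: E(2) fibre_class[OF E(1)])
      ultimately have "AE y in fibre D x. h' y = g x" by (simp only:)
      then show ?thesis by eventually_elim simp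
    qed
    have fi: "integrable (fibre D x) f"
      by (rule P.integrable_const_bound[where B = C]) (auto simp: C fibre_borel[OF x f])
    have fhm: "(\<lambda>y. f y * cnj (h' y)) \<in> borel_measurable (fibre D x)"
      by (intro borel_measurable_times borel_measurable_cnj fibre_borel[OF x] f h'm)
    have fcm: "(\<lambda>y. f y * cnj (g x)) \<in> borel_measurable (fibre D x)"
      by (intro borel_measurable_times borel_measurable_const fibre_borel[OF x] f)
    show "integrable (fibre D x) (\<lambda>y. f y * cnj (h' y))"
      using fi integrable_cong_AE[OF fhm fcm eq] by auto
    have "(\<integral>y. f y * cnj (h' y) \<partial>fibre D x) = (\<integral>y. f y * cnj (g x) \<partial>fibre D x)"
      by (rule integral_cong_AE[OF fhm fcm eq])
    also have "\<dots> = (\<integral>y. f y \<partial>fibre D x) * cnj (g x)" by simp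
    also have "(\<integral>y. f y \<partial>fibre D x) = 0"
      unfolding E(2) fibre_integral_class[OF E(1) f] using zero E(1) by (simp add: zero_mean_def)
    finally show "(\<integral>y. f y * cnj (h' y) \<partial>fibre D x) = 0" by simp
  qed
  finally show "L2_inner \<mu> f h = 0" .
qed

lemma coin_random: "root_coin D \<in> random_subspace D \<nu>"
  by (rule zero_mean_random[where C = 1]) (auto simp: root_coin_norm root_coin_zero_mean)

lemma coin_L2_norm: "L2_norm \<mu> (root_coin D) = 1"
  using PM.prob_space by (simp add: L2_norm_def root_coin_norm)

lemma L2_mu_borel: "f \<in> L2 \<mu> \<Longrightarrow> f \<in> borel_measurable L"
  using L2_measurable borel_mu by blast

lemma markov_cut_cut:
  assumes f: "f \<in> L2 \<mu>"
  shows "markov (bernoulli_graph D) (cut f) = cut (K.average f)"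
  by (rule bernoulli_markov_average[OF L2_mu_borel[OF f]])

lemma random_symmetric_contraction:
  "symmetric_contraction (mu_star D \<nu>) (random_subspace D \<nu>) (markov (bernoulli_graph D)) (distinct_labels D)"
proof
  show "random_subspace D \<nu> \<subseteq> L2 \<mu>" using random_L2 by auto
  show "\<And>f g. f \<in> random_subspace D \<nu> \<Longrightarrow> g \<in> random_subspace D \<nu> \<Longrightarrow> (\<lambda>x. f x + g x) \<in> random_subspace D \<nu>"
    unfolding random_subspace_def by (rule L2_orthogonal_add[OF structured_subset])
  show "\<And>c f. f \<in> random_subspace D \<nu> \<Longrightarrow> (\<lambda>x. c * f x) \<in> random_subspace D \<nu>"
    unfolding random_subspace_def by (rule L2_orthogonal_scale)
  show "\<And>f g. (\<And>n :: nat. f n \<in> random_subspace D \<nu>) \<Longrightarrow> g \<in> L2 \<mu> \<Longrightarrow>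
        (\<lambda>n. L2_norm \<mu> (\<lambda>x. f n x - g x)) \<longlonglongrightarrow> 0 \<Longrightarrow> g \<in> random_subspace D \<nu>"
    unfolding random_subspace_def by (rule L2_orthogonal_closed[OF structured_subset])
  show "\<exists>f\<in>random_subspace D \<nu>. 0 < L2_norm \<mu> f"
    using coin_random coin_L2_norm by (intro bexI[of _ "root_coin D"]) auto
  show "AE x in \<mu>. x \<in> distinct_labels D" by (rule AE_mu_distinct)
  show "\<And>f. f \<in> random_subspace D \<nu> \<Longrightarrow> cut f \<in> random_subspace D \<nu>" by (rule cut_random)
  show "\<And>f g. markov (bernoulli_graph D) (\<lambda>x. f x + g x) = (\<lambda>x. markov (bernoulli_graph D) f x + markov (bernoulli_graph D) g x)"
    by (rule markov_add)
  show "\<And>c f. markov (bernoulli_graph D) (\<lambda>x. c * f x) = (\<lambda>x. c * markov (bernoulli_graph D) f x)"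
    by (rule markov_scale)
  show "\<And>f. markov (bernoulli_graph D) (cut f) = cut (markov (bernoulli_graph D) f)" by (rule markov_distinct)
  fix f assume f: "f \<in> random_subspace D \<nu>"
  have fL: "f \<in> L2 \<mu>" by (rule random_L2[OF f])
  show "markov (bernoulli_graph D) (cut f) \<in> random_subspace D \<nu>"
    unfolding markov_cut_cut[OF fL] by (intro cut_random average_random f)
  have AEf: "AE x in \<mu>. cut (K.average f) x = K.average f x" if "f \<in> L2 \<mu>" for f
    using cut_AE_eq[of "K.average f"] by eventually_elim simp
  show "L2_norm \<mu> (markov (bernoulli_graph D) (cut f)) \<le> L2_norm \<mu> f"
  proof -
    have "L2_norm \<mu> (cut (K.average f)) = L2_norm \<mu> (K.average f)"
      using K.average_L2[OF fL] cut_L2[OF K.average_L2[OF fL]]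
      by (intro L2_norm_cong_AE AEf fL) (auto simp: L2_measurable)
    then show ?thesis unfolding markov_cut_cut[OF fL] using K.average_contraction[OF fL] by simp
  qed
  fix g assume g: "g \<in> random_subspace D \<nu>"
  have gL: "g \<in> L2 \<mu>" by (rule random_L2[OF g])
  note meas = L2_measurable[OF fL] L2_measurable[OF gL] L2_measurable[OF K.average_L2[OF fL]]
    L2_measurable[OF K.average_L2[OF gL]] L2_measurable[OF cut_L2[OF K.average_L2[OF fL]]]
    L2_measurable[OF cut_L2[OF K.average_L2[OF gL]]]
  have "L2_inner \<mu> (cut (K.average f)) g = L2_inner \<mu> (K.average f) g"
    by (intro L2_inner_cong_AE AEf fL meas) simp
  also have "\<dots> = L2_inner \<mu> f (K.average g)" by (rule K.average_symmetric[OF fL gL])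
  also have "\<dots> = L2_inner \<mu> f (cut (K.average g))"
    by (intro L2_inner_cong_AE cut_AE_eq meas) simp
  finally show "L2_inner \<mu> (markov (bernoulli_graph D) (cut f)) g = L2_inner \<mu> f (markov (bernoulli_graph D) (cut g))"
    unfolding markov_cut_cut[OF fL] markov_cut_cut[OF gL] .
qed

sublocale R: symmetric_contraction "mu_star D \<nu>" "random_subspace D \<nu>" "markov (bernoulli_graph D)" "distinct_labels D"
  by (rule random_symmetric_contraction)

lemma rho_R_eq: "rho_R D \<nu> = spectral_radius_on \<mu> (random_subspace D \<nu>) (markov (bernoulli_graph D))"
  by (simp add: rho_R_def)

text \<open>
  If the labels are distinct, moving along the graphing is moving the root along the graph.
\<close>

lemma S_power_class:
  assumes "(E, \<xi>, u) \<in> labelled_graphs D" "inj_on \<xi> (Field E)"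
  shows "(R.S ^^ n) f (labelled_class D E \<xi> u) = ((markov E) ^^ n) (\<lambda>v. f (labelled_class D E \<xi> v)) u"
  using assms
proof (induction n arbitrary: u)
  case (Suc n)
  have "(R.S ^^ Suc n) f (labelled_class D E \<xi> u) = markov E (\<lambda>v. (R.S ^^ n) f (labelled_class D E \<xi> v)) u"
    using bernoulli_markov[OF Suc.prems, of "(R.S ^^ n) f"] distinct_labels_iff[OF Suc.prems(1)] Suc.prems(2)
    by (simp add: R.S_eq_cut R.cut_def)
  also have "\<dots> = markov E (\<lambda>v. ((markov E) ^^ n) (\<lambda>v. f (labelled_class D E \<xi> v)) v) u"
  proof (rule markov_cong)
    fix v assume "(u, v) \<in> E"
    then show "(R.S ^^ n) f (labelled_class D E \<xi> v) = ((markov E) ^^ n) (\<lambda>v. f (labelled_class D E \<xi> v)) v"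
      by (intro Suc.IH neighbour_labelled[OF Suc.prems(1)] Suc.prems(2))
  qed
  finally show ?case by simp
qed simp

lemma nn_integral_fibre_power:
  assumes E: "(E, u) \<in> rooted_graphs D" and f: "f \<in> random_subspace D \<nu>"
  shows "(\<integral>\<^sup>+y. ennreal ((cmod ((R.S ^^ n) f y))\<^sup>2) \<partial>fibre D (rooted_class D E u)) =
    (\<integral>\<^sup>+\<xi>. ennreal ((cmod (\<Sum>v\<in>gball E n u. of_real (walk E n u v) * f (labelled_class D E \<xi> v)))\<^sup>2) \<partial>label_measure E)"
proof -
  have m: "(R.S ^^ n) f \<in> borel_measurable L" by (intro L2_mu_borel random_L2 R.S_pow_H f)
  have m2: "(\<lambda>y. ennreal ((cmod ((R.S ^^ n) f y))\<^sup>2)) \<in> borel_measurable L" using m by measurable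
  have "(\<integral>\<^sup>+y. ennreal ((cmod ((R.S ^^ n) f y))\<^sup>2) \<partial>fibre D (rooted_class D E u)) =
      (\<integral>\<^sup>+\<xi>. ennreal ((cmod ((R.S ^^ n) f (labelled_class D E \<xi> u)))\<^sup>2) \<partial>label_measure E)"
    unfolding fibre_class[OF E] by (rule nn_integral_label_kernel[OF E m2])
  also have "\<dots> = (\<integral>\<^sup>+\<xi>. ennreal ((cmod (\<Sum>v\<in>gball E n u. of_real (walk E n u v) * f (labelled_class D E \<xi> v)))\<^sup>2) \<partial>label_measure E)"
  proof (rule nn_integral_cong_AE)
    show "AE \<xi> in label_measure E. ennreal ((cmod ((R.S ^^ n) f (labelled_class D E \<xi> u)))\<^sup>2) =
        ennreal ((cmod (\<Sum>v\<in>gball E n u. of_real (walk E n u v) * f (labelled_class D E \<xi> v)))\<^sup>2)"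
      using label_AE_inj[of E] AE_space
    proof eventually_elim
      case (elim \<xi>)
      show ?case
        unfolding S_power_class[OF labelled_of_label[OF E elim(2)] elim(1)] markov_power[OF rootedD(1)[OF E]] ..
    qed
  qed
  finally show ?thesis .
qed

text \<open>
  The conditional second moment of the iterated coin, given the graph. It is measurable by
  construction, and it agrees with \<open>walk_energy\<close>.
\<close>

definition energy :: "nat \<Rightarrow> rooted set \<Rightarrow> ennreal" where
  "energy n x = (\<integral>\<^sup>+y. ennreal ((cmod ((R.S ^^ n) (root_coin D) y))\<^sup>2) \<partial>fibre D x)"

lemma energy_class:
  assumes E: "(E, u) \<in> rooted_graphs D"
  shows "energy n (rooted_class D E u) = ennreal (walk_energy E n u)"
  unfolding energy_def nn_integral_fibre_power[OF E coin_random] walk_energy_def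
  by (rule label_square_coin[OF rootedD(1)[OF E] finite_gball[OF rootedD(1)[OF E]] gball_Field[OF rootedD(2)[OF E]]])

lemma energy_measurable [measurable]: "energy n \<in> borel_measurable \<nu>"
proof -
  have "(R.S ^^ n) (root_coin D) \<in> borel_measurable L" by (intro L2_mu_borel random_L2 R.S_pow_H coin_random)
  then have "(\<lambda>y. ennreal ((cmod ((R.S ^^ n) (root_coin D) y))\<^sup>2)) \<in> borel_measurable L" by measurable
  from measurable_compose[OF fibre_meas_sub nn_integral_measurable_subprob_algebra[OF this]]
  show ?thesis unfolding energy_def[abs_def] .
qed

text \<open>
  An integer constant \<open>K\<close> leaves only countably many conditions, so that the set of graphs that
  satisfy them is visibly measurable.
\<close>

lemma walk_growth_energy:
  assumes E: "(E, u) \<in> rooted_graphs D" and c: "0 \<le> c"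
  shows "walk_growth E c u \<longleftrightarrow> (\<exists>K::nat. \<forall>n. energy n (rooted_class D E u) \<le> ennreal (real K * c ^ (2 * n)))"
proof -
  have iff: "energy n (rooted_class D E u) \<le> ennreal (real K * c ^ (2 * n)) \<longleftrightarrow> walk_energy E n u \<le> real K * c ^ (2 * n)" for n K
    unfolding energy_class[OF E] using c by (intro ennreal_le_iff) simp
  show ?thesis
    unfolding iff walk_growth_def
  proof
    assume "\<exists>K. \<forall>n. walk_energy E n u \<le> K * c ^ (2 * n)"
    then obtain K where K: "\<And>n. walk_energy E n u \<le> K * c ^ (2 * n)" by blast
    obtain k :: nat where k: "K \<le> real k" using real_arch_simple by blast
    have "walk_energy E n u \<le> real k * c ^ (2 * n)" for n
      using K[of n] mult_right_mono[OF k, of "c ^ (2 * n)"] c by simp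
    then show "\<exists>K::nat. \<forall>n. walk_energy E n u \<le> real K * c ^ (2 * n)" by blast
  qed blast
qed

lemma rho_class_le_iff:
  assumes E: "(E, u) \<in> rooted_graphs D" and c: "0 \<le> c"
  shows "rho (rooted_class D E u) \<le> c \<longleftrightarrow> walk_growth E c u"
proof -
  from rep_rooted_class[OF E] obtain F v where
    F: "rep (rooted_class D E u) = (F, v)" "(F, v) \<in> rooted_graphs D" "rooted_class D F v = rooted_class D E u" by metis
  have "rho (rooted_class D E u) \<le> c \<longleftrightarrow> walk_growth F c v"
    unfolding rho_def F(1) prod.case by (rule graph_spectral_radius_le_iff[OF rootedD[OF F(2)] c])
  also have "\<dots> \<longleftrightarrow> walk_growth E c u"
    unfolding walk_growth_energy[OF F(2) c] walk_growth_energy[OF E c] F(3) ..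
  finally show ?thesis .
qed

lemma rho_nonneg: "x \<in> space \<nu> \<Longrightarrow> 0 \<le> rho x"
proof -
  assume "x \<in> space \<nu>"
  from nu_repE[OF this] obtain E u where E: "rep x = (E, u)" "(E, u) \<in> rooted_graphs D" by metis
  show "0 \<le> rho x" unfolding rho_def E(1) prod.case by (rule graph_spectral_radius_nonneg[OF rootedD[OF E(2)]])
qed

definition sublevel :: "real \<Rightarrow> rooted set set" where
  "sublevel c = {x \<in> space \<nu>. rho x \<le> c}"

lemma sublevel_eq:
  assumes c: "0 \<le> c"
  shows "sublevel c = {x \<in> space \<nu>. \<exists>K::nat. \<forall>n. energy n x \<le> ennreal (real K * c ^ (2 * n))}"
proof -
  have "rho x \<le> c \<longleftrightarrow> (\<exists>K::nat. \<forall>n. energy n x \<le> ennreal (real K * c ^ (2 * n)))" if x: "x \<in> space \<nu>" for x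
  proof -
    from nu_repE[OF x] obtain E u where E: "(E, u) \<in> rooted_graphs D" "x = rooted_class D E u" by metis
    show ?thesis unfolding E(2) rho_class_le_iff[OF E(1) c] walk_growth_energy[OF E(1) c] ..
  qed
  then show ?thesis unfolding sublevel_def by blast
qed

lemma sublevel_sets [measurable]: "sublevel c \<in> sets \<nu>"
proof (cases "0 \<le> c")
  case True
  show ?thesis unfolding sublevel_eq[OF True] by measurable
next
  case False
  then have "sublevel c = {}" using rho_nonneg unfolding sublevel_def by fastforce
  then show ?thesis by simp
qed

lemma sublevel_rerooting: "0 \<le> c \<Longrightarrow> rerooting_invariant D (sublevel c)"
  unfolding rerooting_invariant_def
proof clarify
  fix E u u' assume c: "0 \<le> c" and E: "(E, u) \<in> rooted_graphs D" and u': "u' \<in> Field E" and in_c: "rooted_class D E u \<in> sublevel c"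
  have E': "(E, u') \<in> rooted_graphs D" by (rule rooted_move[OF E u'])
  have "walk_growth E c u" using in_c rho_class_le_iff[OF E c] by (simp add: sublevel_def)
  then have "walk_growth E c u'" by (rule walk_growth_connected[OF rootedD[OF E] u'])
  then show "rooted_class D E u' \<in> sublevel c"
    using rho_class_le_iff[OF E' c] rooted_class_space[OF E'] by (simp add: sublevel_def space_nu)
qed

section \<open>The spectral radius of the graph is at most that of the random subspace\<close>

lemma rho_R_bounded: "R.bounded_by (rho_R D \<nu>)"
  unfolding rho_R_eq by (rule R.bounded_by_spectral_radius)

lemma rho_R_nonneg: "0 \<le> rho_R D \<nu>"
  using rho_R_bounded by (simp add: R.bounded_by_def)

text \<open>
  Degrees are at least one, so \<open>\<nu>\<close> is at most \<open>mean_degree\<close> times \<open>\<nu>\<^sup>*\<close>, and integrating the energy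
  against \<open>\<nu>\<^sup>*\<close> gives the squared norm of the iterated coin.
\<close>

lemma energy_integral: "(\<integral>\<^sup>+x. energy n x \<partial>\<nu>) \<le> ennreal (real D * rho_R D \<nu> ^ (2 * n))"
proof -
  let ?f = "(R.S ^^ n) (root_coin D)"
  have fR: "?f \<in> random_subspace D \<nu>" by (intro R.S_pow_H coin_random)
  have fm: "(\<lambda>y. ennreal ((cmod (?f y))\<^sup>2)) \<in> borel_measurable L"
    using L2_mu_borel[OF random_L2[OF fR]] by measurable
  have "(\<integral>\<^sup>+x. energy n x \<partial>\<nu>) \<le> (\<integral>\<^sup>+x. mean_degree * ((of_nat (root_degree x) / mean_degree) * energy n x) \<partial>\<nu>)"
  proof (rule nn_integral_mono)
    fix x assume x: "x \<in> space \<nu>"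
    have "energy n x = 1 * energy n x" by simp
    also have "\<dots> \<le> of_nat (root_degree x) * energy n x"
    proof (rule mult_right_mono)
      from of_nat_mono[OF root_degree_bounds(1)[OF x]] show "(1 :: ennreal) \<le> of_nat (root_degree x)" by simp
    qed simp
    also have "of_nat (root_degree x) = mean_degree * (of_nat (root_degree x) / mean_degree)"
      using mean_degree_finite by (metis ennreal_divide_times ennreal_times_divide mult.commute mult_divide_eq_ennreal infinity_ennreal_def)
    finally show "energy n x \<le> mean_degree * ((of_nat (root_degree x) / mean_degree) * energy n x)" by (simp add: mult.assoc)
  qed
  also have "\<dots> = mean_degree * (\<integral>\<^sup>+x. (of_nat (root_degree x) / mean_degree) * energy n x \<partial>\<nu>)"
    by (rule nn_integral_cmult) measurable
  also have "(\<integral>\<^sup>+x. (of_nat (root_degree x) / mean_degree) * energy n x \<partial>\<nu>) = ennreal ((L2_norm \<mu> ?f)\<^sup>2)"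
    unfolding energy_def nn_integral_mu[OF fm, symmetric] by (rule L2_norm_nn[OF random_L2[OF fR]])
  also have "\<dots> \<le> ennreal (rho_R D \<nu> ^ (2 * n))"
  proof (rule ennreal_leI)
    have "L2_norm \<mu> ?f \<le> rho_R D \<nu> ^ n * L2_norm \<mu> (root_coin D)"
      by (rule R.S_pow_bound[OF rho_R_bounded coin_random])
    then have "(L2_norm \<mu> ?f)\<^sup>2 \<le> (rho_R D \<nu> ^ n)\<^sup>2" unfolding coin_L2_norm by (intro power_mono) auto
    then show "(L2_norm \<mu> ?f)\<^sup>2 \<le> rho_R D \<nu> ^ (2 * n)" by (simp add: power_mult[symmetric] mult.commute)
  qed
  finally have "(\<integral>\<^sup>+x. energy n x \<partial>\<nu>) \<le> mean_degree * ennreal (rho_R D \<nu> ^ (2 * n))"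
    by (simp add: mult_left_mono)
  also have "\<dots> \<le> of_nat D * ennreal (rho_R D \<nu> ^ (2 * n))" by (intro mult_right_mono mean_degree_bounds) simp
  also have "\<dots> = ennreal (real D * rho_R D \<nu> ^ (2 * n))"
    using rho_R_nonneg by (simp add: ennreal_of_nat_eq_real_of_nat ennreal_mult)
  finally show ?thesis .
qed

text \<open>
  The series \<open>\<Sum>n. energy n / c\<^bsup>2n\<^esup>\<close> is dominated in mean by a convergent geometric series, so
  it is almost surely finite. Its value then bounds each of its terms.
\<close>

lemma rho_le_of_gt:
  assumes c: "rho_R D \<nu> < c"
  shows "AE x in \<nu>. rho x \<le> c"
proof -
  have c0: "0 < c" using c rho_R_nonneg by simp
  define r where "r = (rho_R D \<nu> / c)\<^sup>2"
  have r: "0 \<le> r" "r < 1" using c c0 rho_R_nonneg power_strict_mono[of "rho_R D \<nu>" c 2] by (auto simp: r_def power_divide)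
  have "(\<integral>\<^sup>+x. (\<Sum>n. energy n x * ennreal (1 / c ^ (2 * n))) \<partial>\<nu>) = (\<Sum>n. \<integral>\<^sup>+x. energy n x * ennreal (1 / c ^ (2 * n)) \<partial>\<nu>)"
    by (rule nn_integral_suminf) measurable
  also have "\<dots> \<le> (\<Sum>n. ennreal (real D * r ^ n))"
  proof (rule suminf_le)
    fix n
    have "(\<integral>\<^sup>+x. energy n x * ennreal (1 / c ^ (2 * n)) \<partial>\<nu>) = (\<integral>\<^sup>+x. energy n x \<partial>\<nu>) * ennreal (1 / c ^ (2 * n))"
      by (rule nn_integral_multc) measurable
    also have "\<dots> \<le> ennreal (real D * rho_R D \<nu> ^ (2 * n)) * ennreal (1 / c ^ (2 * n))"
      by (intro mult_right_mono energy_integral) simp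
    also have "\<dots> = ennreal (real D * r ^ n)"
      using c0 rho_R_nonneg by (simp add: ennreal_mult[symmetric] r_def power_divide power_mult)
    finally show "(\<integral>\<^sup>+x. energy n x * ennreal (1 / c ^ (2 * n)) \<partial>\<nu>) \<le> ennreal (real D * r ^ n)" .
  qed auto
  also have "\<dots> = ennreal (\<Sum>n. real D * r ^ n)"
    using r by (intro suminf_ennreal2 summable_mult summable_geometric) auto
  finally have "(\<integral>\<^sup>+x. (\<Sum>n. energy n x * ennreal (1 / c ^ (2 * n))) \<partial>\<nu>) \<noteq> \<infinity>" by (auto simp: top_unique)
  then have "AE x in \<nu>. (\<Sum>n. energy n x * ennreal (1 / c ^ (2 * n))) \<noteq> \<infinity>"
    by (rule nn_integral_PInf_AE[rotated]) measurable
  with AE_space show ?thesis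
  proof eventually_elim
    case (elim x)
    then obtain M where M: "0 \<le> M" "(\<Sum>n. energy n x * ennreal (1 / c ^ (2 * n))) = ennreal M"
      by (cases "(\<Sum>n. energy n x * ennreal (1 / c ^ (2 * n)))") auto
    obtain k :: nat where k: "M \<le> real k" using real_arch_simple by blast
    have "energy n x \<le> ennreal (real k * c ^ (2 * n))" for n
    proof -
      have "energy n x * ennreal (1 / c ^ (2 * n)) \<le> (\<Sum>n. energy n x * ennreal (1 / c ^ (2 * n)))"
        using sum_le_suminf[of "\<lambda>n. energy n x * ennreal (1 / c ^ (2 * n))" "{n}"] by simp
      also have "\<dots> \<le> ennreal (real k)" unfolding M(2) using k by (rule ennreal_leI)
      finally have "energy n x * ennreal (1 / c ^ (2 * n)) * ennreal (c ^ (2 * n)) \<le> ennreal (real k) * ennreal (c ^ (2 * n))"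
        by (rule mult_right_mono) simp
      moreover have "ennreal (1 / c ^ (2 * n)) * ennreal (c ^ (2 * n)) = 1"
        using c0 by (simp add: ennreal_mult[symmetric])
      ultimately show ?thesis using c0 by (simp add: mult.assoc ennreal_mult)
    qed
    then have "x \<in> sublevel c" using elim c0 by (auto simp: sublevel_eq)
    then show ?case by (simp add: sublevel_def)
  qed
qed

lemma rho_le_rho_R: "AE x in \<nu>. rho x \<le> rho_R D \<nu>"
proof -
  have "AE x in \<nu>. \<forall>m::nat. rho x \<le> rho_R D \<nu> + 1 / real (Suc m)"
    unfolding AE_all_countable by (intro allI rho_le_of_gt) simp
  then show ?thesis
  proof eventually_elim
    case (elim x)
    show ?case
    proof (rule field_le_epsilon)
      fix e :: real assume "0 < e"
      then obtain m where "1 / real (Suc m) < e" using nat_approx_posE by blast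
      then show "rho x \<le> rho_R D \<nu> + e" using elim[rule_format, of m] by linarith
    qed
  qed
qed

section \<open>Local functions are dense\<close>

definition bounded_local :: "(labelled set \<Rightarrow> complex) set" where
  "bounded_local = {f \<in> borel_measurable L. (\<exists>C. \<forall>x. cmod (f x) \<le> C) \<and> (\<exists>k. label_local D k f)}"

definition approximable :: "(labelled set \<Rightarrow> complex) set" where
  "approximable = {f \<in> L2 \<mu>. \<forall>e>0. \<exists>g\<in>bounded_local. L2_norm \<mu> (\<lambda>x. f x - g x) < e}"

lemma bounded_local_L2: "f \<in> bounded_local \<Longrightarrow> f \<in> L2 \<mu>"
  using bounded_L2 by (auto simp: bounded_local_def)

lemma bounded_local_add:
  assumes "f \<in> bounded_local" "g \<in> bounded_local"
  shows "(\<lambda>x. f x + g x) \<in> bounded_local"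
proof -
  obtain C k where f: "f \<in> borel_measurable L" "\<And>x. cmod (f x) \<le> C" "label_local D k f"
    using assms(1) by (auto simp: bounded_local_def)
  obtain C' l where g: "g \<in> borel_measurable L" "\<And>x. cmod (g x) \<le> C'" "label_local D l g"
    using assms(2) by (auto simp: bounded_local_def)
  have "label_local D (max k l) f" "label_local D (max k l) g"
    using label_local_mono[OF f(3), of "max k l"] label_local_mono[OF g(3), of "max k l"] by simp_all
  then have "label_local D (max k l) (\<lambda>x. f x + g x)"
    unfolding label_local_def by (intro allI impI arg_cong2[where f = "(+)"]; blast)
  moreover have "cmod (f x + g x) \<le> C + C'" for x using f(2)[of x] g(2)[of x] by norm
  ultimately show ?thesis using f(1) g(1) unfolding bounded_local_def by auto
qed

lemma bounded_local_scale: "f \<in> bounded_local \<Longrightarrow> (\<lambda>x. c * f x) \<in> bounded_local"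
proof -
  assume "f \<in> bounded_local"
  then obtain C k where f: "f \<in> borel_measurable L" "\<And>x. cmod (f x) \<le> C" "label_local D k f"
    by (auto simp: bounded_local_def)
  have "cmod (c * f x) \<le> cmod c * C" for x using f(2)[of x] by (simp add: norm_mult mult_left_mono)
  moreover have "label_local D k (\<lambda>x. c * f x)"
    using f(3) unfolding label_local_def by (intro allI impI arg_cong2[where f = "(*)"] refl; blast)
  ultimately show ?thesis using f(1) unfolding bounded_local_def by auto
qed

lemma bounded_local_approximable: "f \<in> bounded_local \<Longrightarrow> f \<in> approximable"
  using bounded_local_L2 unfolding approximable_def by (auto intro!: bexI[of _ f])

lemma approximable_add:
  assumes f: "f \<in> approximable" and g: "g \<in> approximable"
  shows "(\<lambda>x. f x + g x) \<in> approximable"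
  unfolding approximable_def
proof (intro CollectI conjI allI impI)
  have L: "f \<in> L2 \<mu>" "g \<in> L2 \<mu>" using f g by (auto simp: approximable_def)
  then show "(\<lambda>x. f x + g x) \<in> L2 \<mu>" by (rule L2_add)
  fix e :: real assume "0 < e"
  then have e2: "0 < e / 2" by simp
  obtain f' where f': "f' \<in> bounded_local" "L2_norm \<mu> (\<lambda>x. f x - f' x) < e / 2"
    using f e2 unfolding approximable_def by blast
  obtain g' where g': "g' \<in> bounded_local" "L2_norm \<mu> (\<lambda>x. g x - g' x) < e / 2"
    using g e2 unfolding approximable_def by blast
  have "L2_norm \<mu> (\<lambda>x. (f x - f' x) + (g x - g' x)) \<le> L2_norm \<mu> (\<lambda>x. f x - f' x) + L2_norm \<mu> (\<lambda>x. g x - g' x)"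
    by (intro L2_norm_triangle L2_diff L bounded_local_L2 f' g')
  also have "\<dots> < e" using f' g' by simp
  finally have "L2_norm \<mu> (\<lambda>x. (f x + g x) - (f' x + g' x)) < e" by (simp add: algebra_simps)
  then show "\<exists>h\<in>bounded_local. L2_norm \<mu> (\<lambda>x. (f x + g x) - h x) < e"
    using bounded_local_add[OF f'(1) g'(1)] by (rule bexI)
qed

lemma approximable_scale:
  assumes f: "f \<in> approximable"
  shows "(\<lambda>x. c * f x) \<in> approximable"
  unfolding approximable_def
proof (intro CollectI conjI allI impI)
  show "(\<lambda>x. c * f x) \<in> L2 \<mu>" using f by (auto simp: approximable_def intro: L2_scale)
  fix e :: real assume e: "0 < e"
  then have "0 < e / (cmod c + 1)" by (simp add: add_nonneg_pos)
  then obtain g where g: "g \<in> bounded_local" "L2_norm \<mu> (\<lambda>x. f x - g x) < e / (cmod c + 1)"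
    using f unfolding approximable_def by blast
  have "L2_norm \<mu> (\<lambda>x. c * f x - c * g x) = cmod c * L2_norm \<mu> (\<lambda>x. f x - g x)"
    using L2_norm_scale[of \<mu> c "\<lambda>x. f x - g x"] by (simp add: right_diff_distrib)
  also have "\<dots> \<le> (cmod c + 1) * L2_norm \<mu> (\<lambda>x. f x - g x)" by (intro mult_right_mono) auto
  also have "\<dots> < (cmod c + 1) * (e / (cmod c + 1))" using g by (intro mult_strict_left_mono) (auto simp: add_nonneg_pos)
  also have "\<dots> = e"
  proof -
    have "cmod c + 1 \<noteq> 0" using norm_ge_zero[of c] by linarith
    then show ?thesis by simp
  qed
  finally show "\<exists>h\<in>bounded_local. L2_norm \<mu> (\<lambda>x. c * f x - h x) < e" using bounded_local_scale[OF g(1)] by (rule bexI)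
qed

lemma approximable_limit:
  assumes f: "\<And>n :: nat. f n \<in> approximable" and g: "g \<in> L2 \<mu>" and lim: "(\<lambda>n. L2_norm \<mu> (\<lambda>x. g x - f n x)) \<longlonglongrightarrow> 0"
  shows "g \<in> approximable"
  unfolding approximable_def
proof (intro CollectI conjI allI impI g)
  fix e :: real assume "0 < e"
  then have e2: "0 < e / 2" by simp
  from order_tendstoD(2)[OF lim e2] obtain n where n: "L2_norm \<mu> (\<lambda>x. g x - f n x) < e / 2"
    by (auto simp: eventually_sequentially)
  obtain h where h: "h \<in> bounded_local" "L2_norm \<mu> (\<lambda>x. f n x - h x) < e / 2"
    using f[of n] e2 unfolding approximable_def by blast
  have fL: "f n \<in> L2 \<mu>" using f[of n] by (simp add: approximable_def)
  have "L2_norm \<mu> (\<lambda>x. (g x - f n x) + (f n x - h x)) \<le> L2_norm \<mu> (\<lambda>x. g x - f n x) + L2_norm \<mu> (\<lambda>x. f n x - h x)"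
    by (intro L2_norm_triangle L2_diff g fL bounded_local_L2 h)
  then have "L2_norm \<mu> (\<lambda>x. g x - h x) < e" using n h by simp
  then show "\<exists>h\<in>bounded_local. L2_norm \<mu> (\<lambda>x. g x - h x) < e" using h(1) by (rule bexI)
qed

lemma approximable_cong:
  assumes f: "f \<in> approximable" and g: "g \<in> borel_measurable L" and eq: "\<And>x. x \<in> space L \<Longrightarrow> f x = g x"
  shows "g \<in> approximable"
proof (rule approximable_limit[OF f])
  have fL: "f \<in> L2 \<mu>" using f by (simp add: approximable_def)
  have AE: "AE x in \<mu>. f x = g x" by (rule AE_I2) (simp add: eq)
  show "g \<in> L2 \<mu>" by (rule L2_cong_AE[OF fL _ AE]) (simp add: borel_mu g)
  have "L2_norm \<mu> (\<lambda>x. g x - f x) = L2_norm \<mu> (\<lambda>x. 0)"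
    using AE by (intro L2_norm_cong_AE) (auto simp: borel_mu intro!: borel_measurable_diff g L2_mu_borel[OF fL])
  then show "(\<lambda>n :: nat. L2_norm \<mu> (\<lambda>x. g x - f x)) \<longlonglongrightarrow> 0" by simp
qed

lemma approximable_sum: "finite I \<Longrightarrow> (\<And>i. i \<in> I \<Longrightarrow> f i \<in> approximable) \<Longrightarrow> (\<lambda>x. \<Sum>i\<in>I. f i x) \<in> approximable"
proof (induction I rule: finite_induct)
  case empty
  have "(\<lambda>x. 0) \<in> bounded_local" unfolding bounded_local_def label_local_def by auto
  then show ?case by (simp add: bounded_local_approximable)
next
  case (insert i I)
  then show ?case by (simp add: approximable_add)
qed

lemma open_local_approximable:
  assumes A: "open_local D r A"
  shows "indicator A \<in> approximable"
proof (rule bounded_local_approximable)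
  have "label_local D r (indicator A)"
    unfolding label_local_def
  proof (intro allI impI)
    fix E \<xi> \<eta> u assume E: "(E, \<xi>, u) \<in> labelled_graphs D" "(E, \<eta>, u) \<in> labelled_graphs D" and eq: "\<forall>w\<in>gball E r u. \<eta> w = \<xi> w"
    have "labelled_class D E \<xi> u \<in> A \<longleftrightarrow> labelled_class D E \<eta> u \<in> A"
      by (rule open_local_iff[OF A E ball_iso_id]) (use eq in auto)
    then show "indicator A (labelled_class D E \<xi> u) = (indicator A (labelled_class D E \<eta> u) :: complex)"
      by (simp add: indicator_def)
  qed
  moreover have "indicator A \<in> borel_measurable L" by (rule borel_measurable_indicator[OF open_local_sets[OF A]])
  moreover have "cmod (indicator A x) \<le> 1" for x by (simp add: indicator_def)
  ultimately show "indicator A \<in> bounded_local" unfolding bounded_local_def by blast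
qed

lemma indicator_bounded_L2: "A \<in> sets L \<Longrightarrow> indicator A \<in> L2 \<mu>"
  by (rule bounded_L2[where C = 1]) (auto simp: indicator_def)

text \<open>
  The approximable events form a Dynkin system that contains the local events.
\<close>

lemma indicator_approximable:
  assumes "A \<in> sets L"
  shows "indicator A \<in> approximable"
  using open_locals_Int_stable open_locals_subset assms[unfolded sets_labelled_space]
proof (induction rule: sigma_sets_induct_disjoint)
  case (basic A)
  then show ?case using open_local_approximable by (auto simp: open_locals_def)
next
  case empty
  show ?case using approximable_sum[of "{}"] by (simp add: indicator_def)
next
  case (compl A)
  then have A: "A \<in> sets L" by (simp add: sets_labelled_space)
  have sp: "indicator (space L) \<in> approximable" by (rule open_local_approximable[OF space_open_local[of _ 0]])
  have "(\<lambda>x. indicator (space L) x + (-1) * indicator A x) \<in> approximable"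
    by (intro approximable_add approximable_scale sp compl)
  then show ?case
    by (rule approximable_cong) (use A in \<open>auto simp: indicator_def\<close>)
next
  case (union A)
  have A: "A i \<in> sets L" for i using union.hyps(2) by (auto simp: sets_labelled_space)
  have fin: "(\<lambda>x. \<Sum>i<n. indicator (A i) x) \<in> approximable" for n
    by (intro approximable_sum union.IH) simp
  have sum: "(\<Sum>i<n. indicator (A i) x) = (indicator (\<Union>i<n. A i) x :: complex)" for n x
    by (rule indicator_UN_disjoint[symmetric]) (use union.hyps(1) in \<open>auto simp: disjoint_family_on_def\<close>)
  show ?case
  proof (rule approximable_limit[OF fin])
    show "indicator (\<Union>i. A i) \<in> L2 \<mu>" using A by (intro indicator_bounded_L2) auto
    have "(\<lambda>n. \<integral>x. (cmod (indicator (\<Union>i. A i) x - indicator (\<Union>i<n. A i) x))\<^sup>2 \<partial>\<mu>) \<longlonglongrightarrow> (\<integral>x. 0 \<partial>\<mu>)"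
    proof (rule integral_dominated_convergence[where w = "\<lambda>_. 1"])
      show "AE x in \<mu>. (\<lambda>n. (cmod (indicator (\<Union>i. A i) x - indicator (\<Union>i<n. A i) x))\<^sup>2) \<longlonglongrightarrow> 0"
      proof (rule AE_I2)
        fix x
        show "(\<lambda>n. (cmod (indicator (\<Union>i. A i) x - indicator (\<Union>i<n. A i) x))\<^sup>2) \<longlonglongrightarrow> 0"
        proof (cases "x \<in> (\<Union>i. A i)")
          case True
          then obtain i where "x \<in> A i" by blast
          then have "\<forall>\<^sub>F n in sequentially. (cmod (indicator (\<Union>i. A i) x - indicator (\<Union>i<n. A i) x))\<^sup>2 = 0"
            by (intro eventually_mono[OF eventually_gt_at_top[of i]]) (auto simp: indicator_def)
          then show ?thesis by (rule tendsto_eventually)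
        next
          case False
          then have "(cmod (indicator (\<Union>i. A i) x - indicator (\<Union>i<n. A i) x))\<^sup>2 = 0" for n
            by (auto simp: indicator_def)
          then show ?thesis by simp
        qed
      qed
      show "AE x in \<mu>. norm ((cmod (indicator (\<Union>i. A i) x - indicator (\<Union>i<n. A i) x))\<^sup>2) \<le> 1" for n
        by (rule AE_I2) (auto simp: indicator_def)
      show "(\<lambda>x. (cmod (indicator (\<Union>i. A i) x - indicator (\<Union>i<n. A i) x))\<^sup>2) \<in> borel_measurable \<mu>" for n
        unfolding borel_mu using A by measurable
    qed (auto simp: PM.prob_space)
    then have "(\<lambda>n. sqrt (\<integral>x. (cmod (indicator (\<Union>i. A i) x - indicator (\<Union>i<n. A i) x))\<^sup>2 \<partial>\<mu>)) \<longlonglongrightarrow> sqrt 0"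
      by (intro tendsto_real_sqrt) simp
    then show "(\<lambda>n. L2_norm \<mu> (\<lambda>x. indicator (\<Union>i. A i) x - (\<Sum>i<n. indicator (A i) x))) \<longlonglongrightarrow> 0"
      unfolding sum L2_norm_def by simp
  qed
qed

lemma L2_approximable:
  assumes f: "f \<in> L2 \<mu>"
  shows "f \<in> approximable"
proof -
  have fm: "f \<in> borel_measurable \<mu>" using f by (rule L2_measurable)
  from borel_measurable_implies_sequence_metric[OF fm, of 0] obtain s where
    s: "\<And>i. simple_function \<mu> (s i)" "\<And>x. x \<in> space \<mu> \<Longrightarrow> (\<lambda>i. s i x) \<longlonglongrightarrow> f x"
    and bnd: "\<And>i x. x \<in> space \<mu> \<Longrightarrow> cmod (s i x) \<le> 2 * cmod (f x)"
    by simp metis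
  have sm [measurable]: "s i \<in> borel_measurable \<mu>" for i using s(1) by (rule borel_measurable_simple_function)
  have sapp: "s i \<in> approximable" for i
  proof (rule approximable_cong)
    have fin: "finite (s i ` space \<mu>)" using s(1)[of i] by (simp add: simple_function_def)
    have "s i -` {y} \<inter> space \<mu> \<in> sets L" for y using measurable_sets[OF sm[of i], of "{y}"] by simp
    then show "(\<lambda>x. \<Sum>y\<in>s i ` space \<mu>. y * indicator (s i -` {y} \<inter> space \<mu>) x) \<in> approximable"
      by (intro approximable_sum fin approximable_scale indicator_approximable)
    show "s i \<in> borel_measurable L" using sm[of i] by (simp add: borel_mu)
    fix x assume x: "x \<in> space L"
    have "s i x = (\<Sum>y\<in>s i ` space \<mu>. indicator (s i -` {y} \<inter> space \<mu>) x *\<^sub>R y)"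
      by (rule simple_function_indicator_representation_banach[OF s(1)]) (use x in simp)
    also have "\<dots> = (\<Sum>y\<in>s i ` space \<mu>. y * indicator (s i -` {y} \<inter> space \<mu>) x)"
      by (rule sum.cong[OF refl]) (simp add: indicator_def)
    finally show "(\<Sum>y\<in>s i ` space \<mu>. y * indicator (s i -` {y} \<inter> space \<mu>) x) = s i x" by (rule sym)
  qed
  show ?thesis
  proof (rule approximable_limit[OF sapp f])
    have "(\<lambda>i. \<integral>x. (cmod (f x - s i x))\<^sup>2 \<partial>\<mu>) \<longlonglongrightarrow> (\<integral>x. 0 \<partial>\<mu>)"
    proof (rule integral_dominated_convergence[where w = "\<lambda>x. 9 * (cmod (f x))\<^sup>2"])
      show "integrable \<mu> (\<lambda>x. 9 * (cmod (f x))\<^sup>2)" using L2_integrable[OF f] by simp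
      show "AE x in \<mu>. (\<lambda>i. (cmod (f x - s i x))\<^sup>2) \<longlonglongrightarrow> 0"
      proof (rule AE_I2)
        fix x assume "x \<in> space \<mu>"
        then have "(\<lambda>i. (cmod (f x - s i x))\<^sup>2) \<longlonglongrightarrow> (cmod (f x - f x))\<^sup>2"
          by (intro tendsto_intros s(2))
        then show "(\<lambda>i. (cmod (f x - s i x))\<^sup>2) \<longlonglongrightarrow> 0" by simp
      qed
      show "AE x in \<mu>. norm ((cmod (f x - s i x))\<^sup>2) \<le> 9 * (cmod (f x))\<^sup>2" for i
      proof (rule AE_I2)
        fix x assume "x \<in> space \<mu>"
        then have "cmod (f x - s i x) \<le> 3 * cmod (f x)" using bnd[of x i] norm_triangle_ineq4[of "f x" "s i x"] by simp
        then have "(cmod (f x - s i x))\<^sup>2 \<le> (3 * cmod (f x))\<^sup>2" by (intro power_mono) auto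
        then show "norm ((cmod (f x - s i x))\<^sup>2) \<le> 9 * (cmod (f x))\<^sup>2" by (simp add: power_mult_distrib)
      qed
    qed (use fm in measurable)
    then have "(\<lambda>i. sqrt (\<integral>x. (cmod (f x - s i x))\<^sup>2 \<partial>\<mu>)) \<longlonglongrightarrow> sqrt 0"
      by (intro tendsto_real_sqrt) simp
    then show "(\<lambda>i. L2_norm \<mu> (\<lambda>x. f x - s i x)) \<longlonglongrightarrow> 0" by (simp add: L2_norm_def)
  qed
qed

definition zero_mean_local :: "(labelled set \<Rightarrow> complex) set" where
  "zero_mean_local = {f \<in> bounded_local. zero_mean D f}"

lemma zero_mean_local_random: "f \<in> zero_mean_local \<Longrightarrow> f \<in> random_subspace D \<nu>"
  unfolding zero_mean_local_def bounded_local_def using zero_mean_random by blast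

text \<open>
  Subtracting the conditional mean given the graph is an orthogonal projection, so it only
  improves the approximation of elements of the random subspace.
\<close>

lemma zero_mean_local_dense:
  assumes f: "f \<in> random_subspace D \<nu>" and e: "0 < e"
  shows "\<exists>g\<in>zero_mean_local. L2_norm \<mu> (\<lambda>x. f x - g x) < e"
proof -
  have fL: "f \<in> L2 \<mu>" by (rule random_L2[OF f])
  obtain g where gb: "g \<in> bounded_local" and ge: "L2_norm \<mu> (\<lambda>x. f x - g x) < e"
    using L2_approximable[OF fL] e unfolding approximable_def by blast
  obtain C k where g: "g \<in> borel_measurable L" "\<And>x. cmod (g x) \<le> C" "label_local D k g"
    using gb by (auto simp: bounded_local_def)
  have C0: "0 \<le> C" using g(2)[of undefined] norm_ge_zero order_trans by blast
  \<comment> \<open>The conditional mean of \<open>g\<close>; the value zero outside of the space makes it bounded everywhere.\<close>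
  define m where "m x = (if x \<in> space \<nu> then \<integral>y. g y \<partial>fibre D x else 0)" for x
  have mm: "m \<in> borel_measurable \<nu>"
    using fibre_integral_measurable[OF g(1)] by (rule measurable_cong[THEN iffD1, rotated]) (simp add: m_def)
  have mb: "cmod (m x) \<le> C" for x
  proof (cases "x \<in> space \<nu>")
    case True
    interpret P: prob_space "fibre D x" by (rule fibre_prob[OF True])
    have "cmod (m x) \<le> (\<integral>y. cmod (g y) \<partial>fibre D x)" using True by (simp add: m_def integral_norm_bound)
    also have "\<dots> \<le> (\<integral>y. C \<partial>fibre D x)" by (rule Bochner_Integration.integral_mono') (auto simp: g(2) C0)
    finally show ?thesis by (simp add: P.prob_space)
  qed (simp add: m_def C0)
  define p where "p y = m (forget_labels D y)" for y
  have pm: "p \<in> borel_measurable L" unfolding p_def[abs_def] by (rule forget_measurable_nu[OF mm])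
  have pb: "cmod (p y) \<le> C" for y by (simp add: p_def mb)
  have pL: "p \<in> L2 \<mu>" by (rule bounded_L2[OF pm pb])
  have pS: "p \<in> structured_subspace D \<nu>"
    using forget_structured[of m] forget_L2[OF mm] pL unfolding p_def[abs_def] by simp
  have pclass: "p (labelled_class D E \<xi> u) = m (rooted_class D E u)" if "(E, \<xi>, u) \<in> labelled_graphs D" for E \<xi> u
    unfolding p_def forget_labels_class[OF that] ..
  define h where "h = (\<lambda>y. g y - p y)"
  have hm: "h \<in> borel_measurable L" unfolding h_def using g(1) pm by measurable
  have hb: "cmod (h y) \<le> 2 * C" for y
    unfolding h_def using norm_triangle_ineq4[of "g y" "p y"] g(2)[of y] pb[of y] by simp
  have hloc: "label_local D k h"
    unfolding label_local_def h_def
  proof (intro allI impI arg_cong2[where f = "(-)"])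
    fix E \<xi> \<eta> u assume E: "(E, \<xi>, u) \<in> labelled_graphs D" "(E, \<eta>, u) \<in> labelled_graphs D" and eq: "\<forall>w\<in>gball E k u. \<eta> w = \<xi> w"
    show "g (labelled_class D E \<xi> u) = g (labelled_class D E \<eta> u)" by (rule label_localD[OF g(3) E]) (use eq in auto)
    show "p (labelled_class D E \<xi> u) = p (labelled_class D E \<eta> u)" unfolding pclass[OF E(1)] pclass[OF E(2)] ..
  qed
  have hz: "zero_mean D h"
    unfolding zero_mean_def
  proof (intro allI impI)
    fix E u assume E: "(E, u) \<in> rooted_graphs D"
    interpret P: prob_space "label_measure E" by (rule prob_space_label)
    have gm': "(\<lambda>\<xi>. g (labelled_class D E \<xi> u)) \<in> borel_measurable (label_measure E)"
      by (rule measurable_compose[OF labelled_class_measurable[OF E] g(1)])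
    have gi: "integrable (label_measure E) (\<lambda>\<xi>. g (labelled_class D E \<xi> u))"
      by (rule P.integrable_const_bound[where B = C]) (auto simp: g(2) gm')
    have mval: "m (rooted_class D E u) = (\<integral>\<xi>. g (labelled_class D E \<xi> u) \<partial>label_measure E)"
      using fibre_integral_class[OF E g(1)] rooted_class_space[OF E] by (simp add: m_def space_nu)
    have "(\<integral>\<xi>. h (labelled_class D E \<xi> u) \<partial>label_measure E) = (\<integral>\<xi>. g (labelled_class D E \<xi> u) - m (rooted_class D E u) \<partial>label_measure E)"
      unfolding h_def by (intro Bochner_Integration.integral_cong) (auto simp: pclass[OF labelled_of_label[OF E]])
    also have "\<dots> = (\<integral>\<xi>. g (labelled_class D E \<xi> u) \<partial>label_measure E) - m (rooted_class D E u)"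
      using gi by (simp add: P.prob_space)
    finally show "(\<integral>\<xi>. h (labelled_class D E \<xi> u) \<partial>label_measure E) = 0" by (simp add: mval)
  qed
  have hX: "h \<in> zero_mean_local"
    unfolding zero_mean_local_def bounded_local_def using hm hb hloc hz by blast
  have hL: "h \<in> L2 \<mu>" by (rule random_L2[OF zero_mean_local_random[OF hX]])
  have fh: "(\<lambda>x. f x - h x) \<in> random_subspace D \<nu>" by (rule R.H_diff[OF f zero_mean_local_random[OF hX]])
  have "L2_inner \<mu> (\<lambda>x. f x - h x) p = 0"
    using fh pS unfolding random_subspace_def by (rule L2_orthogonalD(2))
  then have "(L2_norm \<mu> (\<lambda>x. (f x - h x) - p x))\<^sup>2 = (L2_norm \<mu> (\<lambda>x. f x - h x))\<^sup>2 + (L2_norm \<mu> p)\<^sup>2"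
    using L2_norm_diff_power2[OF L2_diff[OF fL hL] pL] by simp
  moreover have "(\<lambda>x. (f x - h x) - p x) = (\<lambda>x. f x - g x)" by (auto simp: h_def)
  ultimately have "(L2_norm \<mu> (\<lambda>x. f x - h x))\<^sup>2 \<le> (L2_norm \<mu> (\<lambda>x. f x - g x))\<^sup>2" by simp
  then have "L2_norm \<mu> (\<lambda>x. f x - h x) \<le> L2_norm \<mu> (\<lambda>x. f x - g x)" by (rule power2_le_imp_le) simp
  then show ?thesis using ge hX by (intro bexI[of _ h]) auto
qed

section \<open>The spectral radius of the random subspace is at most that of the graph\<close>

text \<open>
  For a local function of mean zero, the conditional second moment of its iterates given the graph
  is at most a multiple of the walk energy, hence of \<open>c\<^bsup>2n\<^esup>\<close> almost surely.
\<close>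

lemma rho_R_le:
  assumes c: "0 \<le> c" and rho: "AE x in \<nu>. rho x \<le> c"
  shows "rho_R D \<nu> \<le> c"
proof -
  have "R.bounded_by c"
  proof (rule R.bounded_by_of_dense_growth[OF _ c])
    show "zero_mean_local \<subseteq> random_subspace D \<nu>" using zero_mean_local_random by blast
    show "\<exists>g\<in>zero_mean_local. L2_norm \<mu> (\<lambda>x. f x - g x) < e" if "f \<in> random_subspace D \<nu>" "0 < e" for f e
      by (rule zero_mean_local_dense[OF that])
    fix f assume fX: "f \<in> zero_mean_local"
    then obtain C k where f: "f \<in> borel_measurable L" "\<And>x. cmod (f x) \<le> C" "label_local D k f" "zero_mean D f"
      by (auto simp: zero_mean_local_def bounded_local_def)
    have fR: "f \<in> random_subspace D \<nu>" by (rule zero_mean_local_random[OF fX])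
    define M where "M = C\<^sup>2 * real ((1 + D) ^ (2 * k)) * real D"
    have M0: "0 \<le> M" by (simp add: M_def)
    have "L2_norm \<mu> ((R.S ^^ n) f) \<le> sqrt M * c ^ n" for n
    proof (rule L2_norm_le_nn)
      have SR: "(R.S ^^ n) f \<in> random_subspace D \<nu>" by (rule R.S_pow_H[OF fR])
      then show "(R.S ^^ n) f \<in> L2 \<mu>" by (rule random_L2)
      show "0 \<le> sqrt M * c ^ n" using M0 c by simp
      have m: "(\<lambda>y. ennreal ((cmod ((R.S ^^ n) f y))\<^sup>2)) \<in> borel_measurable L"
        using L2_mu_borel[OF random_L2[OF SR]] by measurable
      have fib: "AE x in \<nu>. (\<integral>\<^sup>+y. ennreal ((cmod ((R.S ^^ n) f y))\<^sup>2) \<partial>fibre D x) \<le> ennreal (M * c ^ (2 * n))"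
        using rho AE_space
      proof eventually_elim
        case (elim x)
        from nu_repE[OF elim(2)] obtain E u where E: "rep x = (E, u)" "(E, u) \<in> rooted_graphs D" "x = rooted_class D E u" .
        note G = rootedD[OF E(2)]
        have "graph_spectral_radius E \<le> c" using elim(1) by (simp add: rho_def E(1))
        then have we: "walk_energy E n u \<le> real D * c ^ (2 * n)" by (rule graph_spectral_radius_walk_bound[OF G c])
        have "(\<integral>\<^sup>+y. ennreal ((cmod ((R.S ^^ n) f y))\<^sup>2) \<partial>fibre D x) \<le>
            ennreal (C\<^sup>2 * real ((1 + D) ^ (2 * k)) * walk_energy E n u)"
          unfolding E(3) nn_integral_fibre_power[OF E(2) fR] walk_energy_def
          by (rule label_square_le[OF G(1) finite_gball[OF G(1)] gball_Field[OF G(2)] f walk_nonneg])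
        also have "\<dots> \<le> ennreal (C\<^sup>2 * real ((1 + D) ^ (2 * k)) * (real D * c ^ (2 * n)))"
          by (intro ennreal_leI mult_left_mono we) simp
        also have "\<dots> = ennreal (M * c ^ (2 * n))" by (simp add: M_def mult_ac)
        finally show ?case .
      qed
      have "(\<integral>\<^sup>+y. ennreal ((cmod ((R.S ^^ n) f y))\<^sup>2) \<partial>\<mu>) \<le>
          (\<integral>\<^sup>+x. (of_nat (root_degree x) / mean_degree) * ennreal (M * c ^ (2 * n)) \<partial>\<nu>)"
        unfolding nn_integral_mu[OF m]
        by (rule nn_integral_mono_AE) (use fib in eventually_elim, intro mult_left_mono, auto)
      also have "\<dots> = (\<integral>\<^sup>+x. of_nat (root_degree x) / mean_degree \<partial>\<nu>) * ennreal (M * c ^ (2 * n))"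
        by (rule nn_integral_multc) measurable
      also have "(\<integral>\<^sup>+x. of_nat (root_degree x) / mean_degree \<partial>\<nu>) = mean_degree / mean_degree"
        unfolding mean_degree_def by (rule nn_integral_divide) measurable
      also have "\<dots> = 1" using mean_degree_finite by (simp add: ennreal_divide_self less_top)
      also have "1 * ennreal (M * c ^ (2 * n)) = ennreal ((sqrt M * c ^ n)\<^sup>2)"
        using M0 by (simp add: power_mult_distrib power_mult[symmetric] mult.commute)
      finally show "(\<integral>\<^sup>+y. ennreal ((cmod ((R.S ^^ n) f y))\<^sup>2) \<partial>\<mu>) \<le> ennreal ((sqrt M * c ^ n)\<^sup>2)" .
    qed
    then show "\<exists>K. \<forall>n. L2_norm \<mu> ((R.S ^^ n) f) \<le> K * c ^ n" by blast
  qed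
  then show ?thesis unfolding rho_R_eq using c by (simp add: R.spectral_radius_le_iff)
qed

text \<open>
  For \<open>c < \<rho>\<^sub>R\<close> the event \<open>\<rho>(G, o) \<le> c\<close> has probability zero or one by ergodicity, and probability
  one would give \<open>\<rho>\<^sub>R \<le> c\<close>.
\<close>

lemma rho_ge_rho_R:
  assumes erg: "ergodic D \<nu>"
  shows "AE x in \<nu>. rho_R D \<nu> \<le> rho x"
proof -
  have null: "AE x in \<nu>. \<not> rho x \<le> c" if c: "c < rho_R D \<nu>" for c
  proof (cases "0 \<le> c")
    case True
    have "emeasure \<nu> (sublevel c) = 0 \<or> emeasure \<nu> (sublevel c) = 1"
      using erg sublevel_sets[of c] sublevel_rerooting[OF True] unfolding ergodic_def sets_nu by blast
    then show ?thesis
    proof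
      assume "emeasure \<nu> (sublevel c) = 0"
      then have "AE x in \<nu>. x \<notin> sublevel c" using sublevel_sets[of c] by (intro AE_not_in) (simp add: null_sets_def)
      with AE_space show ?thesis by eventually_elim (simp add: sublevel_def)
    next
      assume "emeasure \<nu> (sublevel c) = 1"
      then have "AE x in \<nu>. x \<in> sublevel c"
        using N.AE_in_set_eq_1[OF sublevel_sets[of c]] by (simp add: N.emeasure_eq_measure)
      then have "AE x in \<nu>. rho x \<le> c" by eventually_elim (simp add: sublevel_def)
      from rho_R_le[OF True this] c show ?thesis by simp
    qed
  next
    case False
    show ?thesis using AE_space by eventually_elim (use rho_nonneg False in fastforce)
  qed
  have "AE x in \<nu>. \<forall>m::nat. \<not> rho x \<le> rho_R D \<nu> - 1 / real (Suc m)"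
    unfolding AE_all_countable by (intro allI null) simp
  then show ?thesis
  proof eventually_elim
    case (elim x)
    show ?case
    proof (rule field_le_epsilon)
      fix e :: real assume "0 < e"
      then obtain m where "1 / real (Suc m) < e" using nat_approx_posE by blast
      then show "rho_R D \<nu> \<le> rho x + e" using elim[rule_format, of m] by linarith
    qed
  qed
qed

end

theorem theorem1p4:
  fixes D :: nat and \<nu> :: "rooted set measure"
  assumes "unimodular D \<nu>"
    and "ergodic D \<nu>"
  shows "AE x in \<nu>. rho x = rho_R D \<nu>"
proof -
  interpret unimodular_graph D \<nu> by unfold_locales (rule assms(1))
  show ?thesis
    using rho_le_rho_R rho_ge_rho_R[OF assms(2)] by eventually_elim simp
qed

end
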